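(* Assume $\|F\|<\frac{c_1}{2\sqrt{c_2c_3}}$ and let $\varepsilon\in(0,\varepsilon_0]$. Then the restriction $S(t):\mathbb D_\varepsilon\to\mathbb D_\varepsilon$ possesses the global attractor $\mathcal A_\varepsilon\subset\mathbb D_\varepsilon$. Moreover, there exists a set $\mathcal K_\varepsilon$ which is compact in $\mathbf H$ and bounded in $\mathbf H^1$ such that $\mathcal A_\varepsilon\subset\mathcal K_\varepsilon$.
   Context: Let $\mathfrak I=(a,b)\subset\mathbb R$ be a bounded interval, $\mathcal H=L^2(\mathfrak I)$ with inner product $\langle\cdot,\cdot\rangle$ and norm $\|\cdot\|$. Let $A=-\partial_{xx}$ with domain $H^2(\mathfrak I)\cap H^1_0(\mathfrak I)$, $\lambda_1>0$ its first eigenvalue, $\mathcal H^r=D(A^{r/2})$, $\|u\|_r=\|A^{r/2}u\|$, $B=I+A$, and on $\mathcal H^r$ the inner product $(u,v)_r=\langle A^{(r-1)/2}B^{1/2}u,A^{(r-1)/2}B^{1/2}v\rangle$ with norm $|||u|||_r^2=\|u\|_{r-1}^2+\|u\|_r^2$. Set $\omega=\sqrt{(1+\lambda_1)/\lambda_1}$. Let $\mu:(0,\infty)\to[0,\infty)$, $\mu\not\equiv0$, nonincreasing, absolutely continuous, with $\kappa:=\int_0^\infty\mu(s)\,ds\in(0,\infty)$, $\int_0^\infty s\mu(s)\,ds=1$, $\lim_{s\to0^+}\mu(s)<\infty$, and $\mu'+\delta\mu\le0$ a.e. for some $\delta>0$. $\mathcal M^r=L^2_\mu(\mathbb R^+;\mathcal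 H^{r+1})$ with norm $\|\eta\|_{\mathcal M^r}^2=\int_0^\infty\mu(s)\|\eta(s)\|_{r+1}^2ds$, $\mathcal M=\mathcal M^0$; $\mathbf H^r=\mathcal H^{r+1}\times\mathcal M^r$ with norm $\|(u,\eta)\|_{\mathbf H^r}^2=|||u|||_{r+1}^2+\|\eta\|_{\mathcal M^r}^2$, $\mathbf H=\mathbf H^0$. $T\eta=-\partial_s\eta$ with domain $\{\eta\in\mathcal M:\partial_s\eta\in\mathcal M,\ \lim_{s\to0}\|\eta(s)\|_1=0\}$. For $f\in L^2(\mathfrak I)$, $S(t)$ is the strongly continuous semigroup on $\mathbf H$ generated by $Bu_t+u_x+\int_0^\infty\mu(s)A\eta(s)\,ds+uu_x=f$, $\eta_t=T\eta+u$ (Dirichlet conditions on $u$), $S(t)z=(u(t),\eta^t)$. Let $F(x)=\int_a^xf(y)\,dy$ and for $\varepsilon>0$, $z=(u,\eta)\in\mathbf H$, $$\Lambda_\varepsilon(z)=\|z\|_{\mathbf H}^2+\frac2\kappa\int_0^\infty\mu(s)\langle F,\eta_x(s)\rangle\,ds+\frac2\kappa\|F\|^2-\frac{\varepsilon}{\sqrt\kappa}\int_0^\infty\mu(s)(u,\eta(s))_1\,ds.$$ Let $c_1,c_2,c_3>0$ and $\varepsilon_0\in(0,\frac1{2\omega})$ be constants depending only on $\mathfrak I,\mu$ such that for every $z\in\mathbf H$ and $\varepsilon\in(0,\varepsilon_0]$, $\mathcal L_\varepsilon(t)=\Lambda_\varepsilon(S(t)z)$ satisfies $\mathcal L_\varepsilon'+\varepsilon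 c_1\mathcal L_\varepsilon\le c_2\|F\|^2+c_3\varepsilon^2\mathcal L_\varepsilon^2$ for all $t\ge0$. Set $c_*=\sqrt{c_2/c_3}\,\big(\frac{c_1}{\sqrt{c_2c_3}}-\|F\|\big)$ and $\mathbb D_\varepsilon=\{z\in\mathbf H:\Lambda_\varepsilon(z)\le c_*/\varepsilon\}$, a closed subset of $\mathbf H$ (complete metric space with the metric of $\mathbf H$) which is invariant under $S(t)$. The global attractor of the restriction of $S(t)$ to $\mathbb D_\varepsilon$ is the unique compact set $\mathcal A_\varepsilon\subset\mathbb D_\varepsilon$ with $S(t)\mathcal A_\varepsilon=\mathcal A_\varepsilon$ for all $t\ge0$ and $\sup_{z\in\mathcal B}\inf_{y\in\mathcal A_\varepsilon}\|S(t)z-y\|_{\mathbf H}\to0$ as $t\to\infty$ for every bounded $\mathcal B\subset\mathbb D_\varepsilon$. *)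

theory Defs
  imports "HOL-Analysis.Analysis"
begin

text \<open>Elements of L2 are represented by real functions on the reals (only their values
on [a,b] matter, and only up to null sets; all quantities below are invariant under
a.e. modification).  A = -d^2/dx^2 with Dirichlet conditions has the orthonormal
eigenbasis ek k (k >= 1) with eigenvalues lam k.\<close>

definition ek :: "real \<Rightarrow> real \<Rightarrow> nat \<Rightarrow> real \<Rightarrow> real" where
  "ek a b k x = sqrt (2 / (b - a)) * sin (real k * pi * (x - a) / (b - a))"

definition dek :: "real \<Rightarrow> real \<Rightarrow> nat \<Rightarrow> real \<Rightarrow> real" where
  "dek a b k x = sqrt (2 / (b - a)) * (real k * pi / (b - a)) * cos (real k * pi * (x - a) / (b - a))"

definition lam :: "real \<Rightarrow> real \<Rightarrow> nat \<Rightarrow> real" where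
  "lam a b k = (real k * pi / (b - a))\<^sup>2"

definition innerL2 :: "real \<Rightarrow> real \<Rightarrow> (real \<Rightarrow> real) \<Rightarrow> (real \<Rightarrow> real) \<Rightarrow> real" where
  "innerL2 a b u v = (LINT x:{a..b}|lborel. u x * v x)"

definition coef :: "real \<Rightarrow> real \<Rightarrow> (real \<Rightarrow> real) \<Rightarrow> nat \<Rightarrow> real" where
  "coef a b u k = innerL2 a b u (ek a b k)"

definition L2 :: "real \<Rightarrow> real \<Rightarrow> (real \<Rightarrow> real) set" where
  "L2 a b = {u. set_borel_measurable lborel {a..b} u \<and> set_integrable lborel {a..b} (\<lambda>x. (u x)\<^sup>2)}"

text \<open>H^r = D(A^(r/2)) and the squared norm ||u||_r^2 = ||A^(r/2) u||^2\<close>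
definition Hs :: "real \<Rightarrow> real \<Rightarrow> nat \<Rightarrow> (real \<Rightarrow> real) set" where
  "Hs a b r = {u \<in> L2 a b. summable (\<lambda>n. lam a b (Suc n) ^ r * (coef a b u (Suc n))\<^sup>2)}"

definition hnorm2 :: "real \<Rightarrow> real \<Rightarrow> nat \<Rightarrow> (real \<Rightarrow> real) \<Rightarrow> real" where
  "hnorm2 a b r u = (\<Sum>n. lam a b (Suc n) ^ r * (coef a b u (Suc n))\<^sup>2)"

text \<open>(u,v)_1 = < B^(1/2) u, B^(1/2) v >\<close>
definition inner1 :: "real \<Rightarrow> real \<Rightarrow> (real \<Rightarrow> real) \<Rightarrow> (real \<Rightarrow> real) \<Rightarrow> real" where
  "inner1 a b u v = (\<Sum>n. (1 + lam a b (Suc n)) * coef a b u (Suc n) * coef a b v (Suc n))"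

type_synonym state = "(real \<Rightarrow> real) \<times> (real \<Rightarrow> real \<Rightarrow> real)"

text \<open>M^r = L^2_mu(R+; H^(r+1)); eta s is the value at memory variable s > 0\<close>
definition Mem :: "real \<Rightarrow> real \<Rightarrow> (real \<Rightarrow> real) \<Rightarrow> nat \<Rightarrow> (real \<Rightarrow> real \<Rightarrow> real) set" where
  "Mem a b \<mu> r = {\<eta>. (\<forall>s>0. \<eta> s \<in> Hs a b (Suc r))
      \<and> (\<forall>k. (\<lambda>s. coef a b (\<eta> s) k) \<in> borel_measurable (restrict_space lborel {0<..}))
      \<and> set_integrable lborel {0<..} (\<lambda>s. \<mu> s * hnorm2 a b (Suc r) (\<eta> s))}"

definition Mnorm2 :: "real \<Rightarrow> real \<Rightarrow> (real \<Rightarrow> real) \<Rightarrow> nat \<Rightarrow> (real \<Rightarrow> real \<Rightarrow> real) \<Rightarrow> real" where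
  "Mnorm2 a b \<mu> r \<eta> = (LINT s:{0<..}|lborel. \<mu> s * hnorm2 a b (Suc r) (\<eta> s))"

definition Hsp :: "real \<Rightarrow> real \<Rightarrow> (real \<Rightarrow> real) \<Rightarrow> nat \<Rightarrow> state set" where
  "Hsp a b \<mu> r = {(u, \<eta>). u \<in> Hs a b (Suc r) \<and> \<eta> \<in> Mem a b \<mu> r}"

definition Hnorm2 :: "real \<Rightarrow> real \<Rightarrow> (real \<Rightarrow> real) \<Rightarrow> nat \<Rightarrow> state \<Rightarrow> real" where
  "Hnorm2 a b \<mu> r z = hnorm2 a b r (fst z) + hnorm2 a b (Suc r) (fst z) + Mnorm2 a b \<mu> r (snd z)"

definition Hdist :: "real \<Rightarrow> real \<Rightarrow> (real \<Rightarrow> real) \<Rightarrow> state \<Rightarrow> state \<Rightarrow> real" where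
  "Hdist a b \<mu> z w = sqrt (Hnorm2 a b \<mu> 0 (\<lambda>x. fst z x - fst w x, \<lambda>s x. snd z s x - snd w s x))"

definition abs_cont_on :: "real set \<Rightarrow> (real \<Rightarrow> real) \<Rightarrow> bool" where
  "abs_cont_on I g \<longleftrightarrow> (\<forall>e>0. \<exists>d>0. \<forall>(n::nat) l r.
      (\<forall>i<n. l i \<le> r i \<and> {l i..r i} \<subseteq> I) \<and>
      (\<forall>i<n. \<forall>j<n. i \<noteq> j \<longrightarrow> r i \<le> l j \<or> r j \<le> l i) \<and>
      (\<Sum>i<n. r i - l i) < d \<longrightarrow> (\<Sum>i<n. \<bar>g (r i) - g (l i)\<bar>) < e)"

definition kappa :: "(real \<Rightarrow> real) \<Rightarrow> real" where
  "kappa \<mu> = (LINT s:{0<..}|lborel. \<mu> s)"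

definition kernel_ok :: "(real \<Rightarrow> real) \<Rightarrow> bool" where
  "kernel_ok \<mu> \<longleftrightarrow>
     (\<forall>s>0. \<mu> s \<ge> 0) \<and> (\<exists>s>0. \<mu> s \<noteq> 0) \<and>
     (\<forall>s t. 0 < s \<longrightarrow> s \<le> t \<longrightarrow> \<mu> t \<le> \<mu> s) \<and>
     abs_cont_on {0<..} \<mu> \<and>
     set_integrable lborel {0<..} \<mu> \<and> 0 < kappa \<mu> \<and>
     set_integrable lborel {0<..} (\<lambda>s. s * \<mu> s) \<and> (LINT s:{0<..}|lborel. s * \<mu> s) = 1 \<and>
     (\<exists>L. (\<mu> \<longlongrightarrow> L) (at_right 0)) \<and>
     (\<exists>\<delta>>0. AE s in lborel. s > 0 \<longrightarrow> (\<mu> differentiable (at s) \<and> deriv \<mu> s + \<delta> * \<mu> s \<le> 0))"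

text \<open>Weak (mild) solution with initial datum z = (u0, eta0): u(t) in H^1, eta^t in M,
continuous in bold H; eta^t given by the explicit solution of eta_t = T eta + u;
the u-equation B u_t + u_x + int mu A eta + u u_x = f tested against each eigenfunction
(in time-integrated form; u_x and u u_x = (u^2/2)_x are integrated by parts).\<close>
definition is_sol :: "real \<Rightarrow> real \<Rightarrow> (real \<Rightarrow> real) \<Rightarrow> (real \<Rightarrow> real) \<Rightarrow> state \<Rightarrow> (real \<Rightarrow> state) \<Rightarrow> bool" where
  "is_sol a b \<mu> f z U \<longleftrightarrow>
     (\<forall>t\<ge>0. U t \<in> Hsp a b \<mu> 0) \<and>
     (\<forall>t\<ge>0. \<forall>e>0. \<exists>d>0. \<forall>t'\<ge>0. \<bar>t' - t\<bar> < d \<longrightarrow> Hdist a b \<mu> (U t') (U t) < e) \<and>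
     (\<forall>t\<ge>0. \<forall>s>0. \<forall>k\<ge>1. coef a b (snd (U t) s) k =
        (if s \<le> t then (LINT r:{0..s}|lborel. coef a b (fst (U (t - r))) k)
         else coef a b (snd z (s - t)) k + (LINT r:{0..t}|lborel. coef a b (fst (U (t - r))) k))) \<and>
     (\<forall>t\<ge>0. \<forall>k\<ge>1.
        set_integrable lborel {0..t} (\<lambda>\<tau>. innerL2 a b (fst (U \<tau>)) (dek a b k)
            - lam a b k * (LINT s:{0<..}|lborel. \<mu> s * coef a b (snd (U \<tau>) s) k)
            + innerL2 a b (\<lambda>x. (fst (U \<tau>) x)\<^sup>2) (dek a b k) / 2 + coef a b f k) \<and>
        (1 + lam a b k) * (coef a b (fst (U t)) k - coef a b (fst z) k) =
        (LINT \<tau>:{0..t}|lborel. innerL2 a b (fst (U \<tau>)) (dek a b k)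
            - lam a b k * (LINT s:{0<..}|lborel. \<mu> s * coef a b (snd (U \<tau>) s) k)
            + innerL2 a b (\<lambda>x. (fst (U \<tau>) x)\<^sup>2) (dek a b k) / 2 + coef a b f k))"

definition Fprim :: "real \<Rightarrow> (real \<Rightarrow> real) \<Rightarrow> real \<Rightarrow> real" where
  "Fprim a f x = (LINT y:{a..x}|lborel. f y)"

definition normF :: "real \<Rightarrow> real \<Rightarrow> (real \<Rightarrow> real) \<Rightarrow> real" where
  "normF a b f = sqrt (LINT x:{a..b}|lborel. (Fprim a f x)\<^sup>2)"

text \<open><F, eta_x(s)> = - <f, eta(s)> (integration by parts, F(a) = 0 and eta(s) in H^1_0)\<close>
definition Lam :: "real \<Rightarrow> real \<Rightarrow> (real \<Rightarrow> real) \<Rightarrow> (real \<Rightarrow> real) \<Rightarrow> real \<Rightarrow> state \<Rightarrow> real" where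
  "Lam a b \<mu> f \<epsilon> z =
     Hnorm2 a b \<mu> 0 z
     + 2 / kappa \<mu> * (LINT s:{0<..}|lborel. \<mu> s * (- innerL2 a b f (snd z s)))
     + 2 / kappa \<mu> * (normF a b f)\<^sup>2
     - \<epsilon> / sqrt (kappa \<mu>) * (LINT s:{0<..}|lborel. \<mu> s * inner1 a b (fst z) (snd z s))"

section \<open>Attractor notions (modulo equality in bold H)\<close>

definition Hbounded :: "real \<Rightarrow> real \<Rightarrow> (real \<Rightarrow> real) \<Rightarrow> nat \<Rightarrow> state set \<Rightarrow> bool" where
  "Hbounded a b \<mu> r B \<longleftrightarrow> B \<subseteq> Hsp a b \<mu> r \<and> (\<exists>R. \<forall>z\<in>B. Hnorm2 a b \<mu> r z \<le> R)"

definition Hcompact :: "real \<Rightarrow> real \<Rightarrow> (real \<Rightarrow> real) \<Rightarrow> state set \<Rightarrow> bool" where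
  "Hcompact a b \<mu> K \<longleftrightarrow> K \<subseteq> Hsp a b \<mu> 0 \<and>
     (\<forall>x::nat \<Rightarrow> state. (\<forall>n. x n \<in> K) \<longrightarrow> (\<exists>g y. strict_mono g \<and> y \<in> K \<and>
        (\<lambda>n. Hdist a b \<mu> (x (g n)) y) \<longlonglongrightarrow> 0))"

definition global_attractor ::
  "real \<Rightarrow> real \<Rightarrow> (real \<Rightarrow> real) \<Rightarrow> (real \<Rightarrow> state \<Rightarrow> state) \<Rightarrow> state set \<Rightarrow> state set \<Rightarrow> bool" where
  "global_attractor a b \<mu> S D A \<longleftrightarrow>
     A \<subseteq> D \<and> Hcompact a b \<mu> A \<and>
     (\<forall>t\<ge>0. (\<forall>y\<in>A. \<exists>w\<in>A. Hdist a b \<mu> (S t y) w = 0) \<and>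
             (\<forall>w\<in>A. \<exists>y\<in>A. Hdist a b \<mu> (S t y) w = 0)) \<and>
     (\<forall>B. B \<subseteq> D \<and> Hbounded a b \<mu> 0 B \<longrightarrow>
        (\<forall>e>0. \<exists>T. \<forall>t\<ge>T. \<forall>z\<in>B. \<exists>y\<in>A. Hdist a b \<mu> (S t z) y < e))"

end

theory Submission
  imports Defs
begin

text \<open>Since \<open>B\<inverse>A = I - B\<inverse>\<close>, each Fourier coefficient of \<open>u\<close> solves the same scalar equation
\<open>v' = - \<integral> \<mu> \<eta> + g\<close>, \<open>\<eta>\<^sub>t = - \<eta>\<^sub>s + v\<close>, where the forcing \<open>g\<close> collects \<open>B\<inverse>(\<integral> \<mu> \<eta> - u\<^sub>x - u u\<^sub>x + f)\<close> and
thus gains one derivative. The scalar equation is exponentially stable: a Lyapunov functional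
\<open>v\<^sup>2 + \<integral> \<mu> \<eta>\<^sup>2 - \<theta> v \<integral> \<mu> \<eta>\<close> decays, which only uses \<open>(1 + \<delta> h) \<mu>(s + h) \<le> \<mu>(s)\<close>. Summing the modes with
different weights gives continuous dependence on the data, uniform smallness of the high modes for
large times, and a bound in the smoother space for every limit of \<open>S(t\<^sub>n) z\<^sub>n\<close> with \<open>t\<^sub>n\<close> tending to
infinity. The sublevel set is bounded and positively invariant by comparison with the constant
barrier, so its omega-limit set is the attractor, and it is itself bounded in the smoother space.\<close>

section \<open>Differential and integral inequalities\<close>

text \<open>The obstacle is the memory space: a bound in the smoother norm gives no compactness
  there, because it says nothing about the dependence on \<open>s\<close>. Compactness in
  \<open>s\<close> comes from the equation: memory created since time zero is an integral of
  \<open>u\<close> over a window of length at most \<open>s\<close>, hence Lipschitz in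
  \<open>s\<close> with a constant independent of the time, while the inherited memory is damped by
  the kernel. The second moment of the kernel, finite by the same decay, dominates the passage to
  the limit. Solutions are given only through Fourier coefficients in integrated form, and states
  are representatives, so identities between states hold up to distance zero. In particular the
  semigroup law is derived, from the estimate for the difference of two trajectories. The constants
  of the scalar stability estimate are the same for every mode; this is what permits weighted sums
  over the modes, with weight 1 + lambda for distances and its square for the smoother
  space.\<close>

lemma eventually_le_of_right_derivative:
  fixes p :: "real \<Rightarrow> real"
  assumes "(p has_real_derivative d) (at t within {t..})" "d < e"
  shows "\<forall>\<^sub>F h in at_right 0. p (t + h) \<le> p t + e * h"
proof -
  have "((\<lambda>y. (p y - p t) / (y - t)) \<longlongrightarrow> d) (at_right t)"
    using assms(1) by (auto simp: has_field_derivative_iff intro: tendsto_within_subset)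
  hence "\<forall>\<^sub>F y in at_right t. (p y - p t) / (y - t) < e"
    using assms(2) by (simp add: order_tendstoD(2))
  hence "\<forall>\<^sub>F h in at_right 0. (p (h + t) - p t) / (h + t - t) < e"
    by (subst (asm) eventually_at_right_to_0) simp
  moreover have "\<forall>\<^sub>F h::real in at_right 0. 0 < h"
    by (simp add: eventually_at_right_less)
  ultimately show ?thesis
  proof eventually_elim
    case (elim h)
    hence "p (h + t) - p t < e * h" by (simp add: pos_divide_less_eq)
    thus ?case by (simp add: add.commute)
  qed
qed

text \<open>The set of times at which the tilted function \<open>p t - e * t\<close> is at most
  \<open>p 0\<close> is closed and contains 0, and the increment hypothesis would push its supremum
  further to the right if it were below \<open>T\<close>. Only upper bounds on right increments
  enter, because the Lyapunov functional is controlled by finite increments and never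
  differentiated.\<close>

lemma nonincreasing_of_right_increments:
  fixes p :: "real \<Rightarrow> real"
  assumes T: "0 \<le> T" and cont: "continuous_on {0..T} p"
    and inc: "\<And>t e. 0 \<le> t \<Longrightarrow> t < T \<Longrightarrow> 0 < e \<Longrightarrow> \<forall>\<^sub>F h in at_right 0. p (t + h) \<le> p t + e * h"
  shows "p T \<le> p 0"
proof (rule field_le_epsilon)
  fix e' :: real assume e': "0 < e'"
  \<comment> \<open>Dividing by \<open>T + 1\<close> keeps the quotient meaningful when
    \<open>T = 0\<close>.\<close>
  define e where "e = e' / (T + 1)"
  have e: "0 < e" "e * T \<le> e'" using e' T by (auto simp: e_def field_simps)
  define X where "X = {t \<in> {0..T}. p t - e * t \<le> p 0}"
  have clX: "closed X"
    unfolding X_def by (intro continuous_on_closed_Collect_le continuous_intros cont closed_atLeastAtMost)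
  have X0: "0 \<in> X" using T by (auto simp: X_def)
  have bdd: "bdd_above X" by (auto simp: X_def intro!: bdd_aboveI[of _ T])
  define t where "t = Sup X"
  have tX: "t \<in> X" unfolding t_def using closed_contains_Sup clX X0 bdd by blast
  have "t = T"
  proof (rule ccontr)
    assume "t \<noteq> T"
    hence tT: "0 \<le> t" "t < T" using tX by (auto simp: X_def)
    have "\<forall>\<^sub>F h in at_right 0. p (t + h) \<le> p t + e * h" using inc tT e by blast
    moreover have "\<forall>\<^sub>F h in at_right 0. h < T - t" using tT by (auto intro!: eventually_at_right_less order_tendstoD tendsto_intros)
    moreover have "\<forall>\<^sub>F h::real in at_right 0. 0 < h" by (simp add: eventually_at_right_less)
    ultimately have "\<forall>\<^sub>F h in at_right 0. 0 < h \<and> h < T - t \<and> p (t + h) \<le> p t + e * h"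
      by eventually_elim auto
    then obtain h where h: "0 < h" "h < T - t" "p (t + h) \<le> p t + e * h"
      using eventually_happens'[OF trivial_limit_at_right_real] by blast
    have "t + h \<in> X" using h tT tX by (auto simp: X_def algebra_simps)
    hence "t + h \<le> t" unfolding t_def using bdd cSup_upper by blast
    thus False using h by simp
  qed
  thus "p T \<le> p 0 + e'" using tX e by (auto simp: X_def)
qed

lemma integral_has_right_derivative:
  fixes G :: "real \<Rightarrow> real"
  assumes "continuous_on {0..} G" "0 \<le> t"
  shows "((\<lambda>r. integral {0..r} G) has_real_derivative G t) (at t within {0..})"
proof -
  have "continuous_on {0..t+1} G" by (rule continuous_on_subset[OF assms(1)]) auto
  hence "((\<lambda>r. integral {0..r} G) has_real_derivative G t) (at t within {0..t+1})"
    using assms by (intro integral_has_real_derivative) auto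
  moreover have "at t within {0..t+1} = at t within {0..}"
    by (rule at_within_nhd[of t "{..<t+1}"]) auto
  ultimately show ?thesis by simp
qed

text \<open>Integrating factor: \<open>exp (\<nu> * t) * p t\<close> minus the integral of the
  weighted forcing is nonincreasing by the increment criterion. The rate may have either sign; a
  negative one gives the usual growth estimate.\<close>

lemma exponential_gronwall:
  fixes p G :: "real \<Rightarrow> real"
  assumes cp: "continuous_on {0..} p" and cG: "continuous_on {0..} G"
    and inc: "\<And>t e. 0 \<le> t \<Longrightarrow> 0 < e \<Longrightarrow> \<forall>\<^sub>F h in at_right 0. p (t + h) \<le> p t + h * (- \<nu> * p t + G t + e)"
    and T: "0 \<le> T"
  shows "p T \<le> exp (- \<nu> * T) * p 0 + integral {0..T} (\<lambda>r. exp (- \<nu> * (T - r)) * G r)"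
proof -
  define H where "H r = exp (\<nu> * r) * G r" for r
  have cH: "continuous_on {0..} H" unfolding H_def by (intro continuous_intros cG)
  define q where "q t = exp (\<nu> * t) * p t - integral {0..t} H" for t
  have dH: "((\<lambda>r. integral {0..r} H) has_real_derivative H t) (at t within {0..})" if "0 \<le> t" for t
    using integral_has_right_derivative[OF cH that] .
  have cI: "continuous_on {0..} (\<lambda>r. integral {0..r} H)"
    unfolding continuous_on_eq_continuous_within
    using DERIV_continuous[OF dH] by auto
  have "q T \<le> q 0"
  proof (rule nonincreasing_of_right_increments[OF T])
    have "continuous_on {0..} q" unfolding q_def by (intro continuous_intros cp cI)
    thus "continuous_on {0..T} q" by (rule continuous_on_subset) auto
  next
    fix t e :: real assume t: "0 \<le> t" "t < T" and e: "0 < e"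
    define e' where "e' = e / (2 * exp (\<nu> * t))"
    have e': "0 < e'" "exp (\<nu> * t) * e' < e" using e by (auto simp: e'_def)
    define c where "c = - \<nu> * p t + G t + e'"
    \<comment> \<open>In \<open>b\<close> the function \<open>p\<close> is replaced by its affine
      upper bound at \<open>t\<close>. The result is differentiable at \<open>t\<close>, agrees with
      \<open>q\<close> there and dominates it to the right; its slope
      \<open>exp (\<nu> * t) * e'\<close> is below \<open>e\<close> by the choice of
      \<open>e'\<close>.\<close>
    define b where "b y = exp (\<nu> * y) * (p t + (y - t) * c) - integral {0..y} H" for y
    have "(b has_real_derivative exp (\<nu> * t) * e') (at t within {0..})"
      unfolding b_def
      by (rule derivative_eq_intros dH[OF t(1)] refl | simp add: c_def H_def algebra_simps)+
    hence "(b has_real_derivative exp (\<nu> * t) * e') (at t within {t..})"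
      by (rule DERIV_subset) (use t in auto)
    hence "\<forall>\<^sub>F h in at_right 0. b (t + h) \<le> b t + e * h"
      by (rule eventually_le_of_right_derivative) (rule e')
    moreover have "\<forall>\<^sub>F h in at_right 0. p (t + h) \<le> p t + h * c"
      unfolding c_def using inc[OF t(1) e'(1)] .
    ultimately show "\<forall>\<^sub>F h in at_right 0. q (t + h) \<le> q t + e * h"
    proof eventually_elim
      case (elim h)
      have "q (t + h) \<le> b (t + h)" unfolding q_def b_def
        using elim(2) by (auto intro!: mult_left_mono)
      also have "\<dots> \<le> b t + e * h" by (rule elim)
      also have "b t = q t" by (simp add: b_def q_def)
      finally show ?case .
    qed
  qed
  hence "exp (\<nu> * T) * p T \<le> p 0 + integral {0..T} H" by (simp add: q_def)
  hence "exp (- \<nu> * T) * (exp (\<nu> * T) * p T) \<le> exp (- \<nu> * T) * (p 0 + integral {0..T} H)"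
    by (intro mult_left_mono) auto
  moreover have "exp (- \<nu> * T) * (exp (\<nu> * T) * p T) = p T"
    by (simp add: mult.assoc[symmetric] exp_add[symmetric])
  moreover have "exp (- \<nu> * T) * integral {0..T} H = integral {0..T} (\<lambda>r. exp (- \<nu> * (T - r)) * G r)"
  proof -
    have "exp (- \<nu> * (T - r)) = exp (- \<nu> * T) * exp (\<nu> * r)" for r
      unfolding exp_add[symmetric] by (simp add: algebra_simps)
    thus ?thesis unfolding integral_mult_right[symmetric]
      by (intro integral_cong) (simp add: H_def)
  qed
  ultimately show ?thesis by (simp only: distrib_left)
qed

text \<open>The right-hand side, as a function of time, is differentiable and satisfies
  \<open>Y' \<le> c * Y\<close>, so the exponential inequality applies with rate \<open>- c\<close>
  and zero forcing.\<close>

lemma integral_gronwall: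
  fixes X :: "real \<Rightarrow> real"
  assumes cX: "continuous_on {0..} X" and c: "0 < c" "0 \<le> K"
    and le: "\<And>t. 0 \<le> t \<Longrightarrow> X t \<le> K + c * integral {0..t} X" and T: "0 \<le> T"
  shows "X T \<le> K * exp (c * T)"
proof -
  define Y where "Y t = K + c * integral {0..t} X" for t
  have dY: "(Y has_real_derivative c * X t) (at t within {0..})" if "0 \<le> t" for t
    unfolding Y_def by (rule derivative_eq_intros integral_has_right_derivative[OF cX that] refl | simp)+
  have cY: "continuous_on {0..} Y"
    unfolding continuous_on_eq_continuous_within using DERIV_continuous[OF dY] by auto
  have "Y T \<le> exp (- (- c) * T) * Y 0 + integral {0..T} (\<lambda>r. exp (- (- c) * (T - r)) * 0)"
  proof (rule exponential_gronwall[OF cY _ _ T])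
    fix t e :: real assume t: "0 \<le> t" and e: "0 < e"
    have "(Y has_real_derivative c * X t) (at t within {t..})"
      by (rule DERIV_subset[OF dY[OF t]]) (use t in auto)
    moreover have "c * X t < c * Y t + e"
      using mult_left_mono[OF le[OF t], of c] c e unfolding Y_def by linarith
    ultimately have "\<forall>\<^sub>F h in at_right 0. Y (t + h) \<le> Y t + (c * Y t + e) * h"
      by (rule eventually_le_of_right_derivative)
    thus "\<forall>\<^sub>F h in at_right 0. Y (t + h) \<le> Y t + h * (- (- c) * Y t + 0 + e)"
      by (simp add: mult.commute)
  qed auto
  moreover have "Y 0 = K" by (simp add: Y_def)
  ultimately show ?thesis using le[OF T] by (simp add: Y_def mult.commute)
qed

text \<open>The quadratic polynomial \<open>y \<mapsto> \<integral> \<rho> (w - y)\<^sup>2\<close>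
  is nonnegative. If the weight has positive mass it is evaluated at its minimum; if the mass
  vanishes it is affine, which forces the mixed integral to be zero.\<close>

lemma weighted_Cauchy_Schwarz:
  fixes \<rho> w :: "'a \<Rightarrow> real"
  assumes nn: "\<And>x. 0 \<le> \<rho> x" and i0: "integrable M \<rho>"
    and i1: "integrable M (\<lambda>x. \<rho> x * w x)" and i2: "integrable M (\<lambda>x. \<rho> x * (w x)\<^sup>2)"
  shows "(\<integral>x. \<rho> x * w x \<partial>M)\<^sup>2 \<le> (\<integral>x. \<rho> x \<partial>M) * (\<integral>x. \<rho> x * (w x)\<^sup>2 \<partial>M)"
proof -
  let ?a = "\<integral>x. \<rho> x \<partial>M" and ?b = "\<integral>x. \<rho> x * w x \<partial>M" and ?c = "\<integral>x. \<rho> x * (w x)\<^sup>2 \<partial>M"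
  have q: "0 \<le> ?c - 2 * y * ?b + y\<^sup>2 * ?a" for y
  proof -
    have "0 \<le> (\<integral>x. \<rho> x * (w x - y)\<^sup>2 \<partial>M)" using nn by (intro integral_nonneg_AE) auto
    also have "(\<lambda>x. \<rho> x * (w x - y)\<^sup>2) = (\<lambda>x. \<rho> x * (w x)\<^sup>2 - 2 * y * (\<rho> x * w x) + y\<^sup>2 * \<rho> x)"
      by (auto simp: power2_eq_square algebra_simps)
    also have "(\<integral>x. \<rho> x * (w x)\<^sup>2 - 2 * y * (\<rho> x * w x) + y\<^sup>2 * \<rho> x \<partial>M) = ?c - 2 * y * ?b + y\<^sup>2 * ?a"
      using i0 i1 i2 by simp
    finally show ?thesis .
  qed
  have a0: "0 \<le> ?a" using nn by (intro integral_nonneg_AE) auto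
  show ?thesis
  proof (cases "?a = 0")
    case True
    have "?b = 0"
    proof (rule ccontr)
      assume b: "?b \<noteq> 0"
      \<comment> \<open>The argument is chosen so that the affine function takes the value
        -1.\<close>
      have "0 \<le> ?c - 2 * ((?c + 1) / (2 * ?b)) * ?b" using q[of "(?c + 1) / (2 * ?b)"] True by simp
      also have "\<dots> = -1" using b by (simp add: field_simps)
      finally show False by simp
    qed
    thus ?thesis using True by simp
  next
    case False
    hence a: "0 < ?a" using a0 by simp
    have "0 \<le> ?a * (?c - 2 * (?b / ?a) * ?b + (?b / ?a)\<^sup>2 * ?a)" using q[of "?b / ?a"] a by (intro mult_nonneg_nonneg) linarith+
    also have "\<dots> = ?a * ?c - ?b\<^sup>2" using a by (simp add: field_simps power2_eq_square)
    finally show ?thesis by simp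
  qed
qed

section \<open>The scalar memory equation\<close>

lemma right_difference_quotient:
  fixes p :: "real \<Rightarrow> real"
  assumes "(p has_real_derivative d) (at t within {t..})"
  shows "((\<lambda>h. (p (t + h) - p t) / h) \<longlongrightarrow> d) (at_right 0)"
proof -
  have "((\<lambda>y. (p y - p t) / (y - t)) \<longlongrightarrow> d) (at_right t)"
    using assms by (auto simp: has_field_derivative_iff intro: tendsto_within_subset)
  thus ?thesis by (subst (asm) filterlim_at_right_to_0) (simp add: add.commute)
qed

text \<open>The kernel is extended by zero to the nonpositive axis, so that all integrals run over
  the whole line. The last clause is a finite-difference form of
  \<open>\<mu>' + \<delta> \<mu> \<le> 0\<close>, adapted to estimates over a time step
  \<open>h\<close>.\<close>

locale memory_kernel =
  fixes m :: "real \<Rightarrow> real" and \<delta> L :: real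
  assumes m_meas [measurable]: "m \<in> borel_measurable borel"
    and m_nonneg: "\<And>s. 0 \<le> m s" and m_le: "\<And>s. m s \<le> L" and m_zero: "\<And>s. s \<le> 0 \<Longrightarrow> m s = 0"
    and m_int: "integrable lborel m" and m_pos: "0 < (\<integral>s. m s \<partial>lborel)"
    and \<delta>_pos: "0 < \<delta>"
    and decay: "\<And>s h. 0 < s \<Longrightarrow> 0 \<le> h \<Longrightarrow> (1 + \<delta> * h) * m (s + h) \<le> m s"
begin

definition mass :: real where "mass = (\<integral>s. m s \<partial>lborel)"

definition sq :: "(real \<Rightarrow> real) \<Rightarrow> bool" where
  "sq w \<longleftrightarrow> w \<in> borel_measurable borel \<and> integrable lborel (\<lambda>s. m s * (w s)\<^sup>2)"

text \<open>For \<open>w\<close> a Fourier coefficient of the memory, \<open>P w\<close> is its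
  unweighted share of the squared memory norm and \<open>Q w\<close> its share of the memory
  integral in the equation.\<close>

definition P :: "(real \<Rightarrow> real) \<Rightarrow> real" where "P w = (\<integral>s. m s * (w s)\<^sup>2 \<partial>lborel)"

definition Q :: "(real \<Rightarrow> real) \<Rightarrow> real" where "Q w = (\<integral>s. m s * w s \<partial>lborel)"

lemma mass_pos: "0 < mass" using m_pos by (simp add: mass_def)

lemma L_pos: "0 < L"
proof (rule ccontr)
  assume "\<not> 0 < L"
  hence "m s = 0" for s using m_nonneg[of s] m_le[of s] by linarith
  hence "m = (\<lambda>_. 0)" by auto
  thus False using m_pos by simp
qed

lemma sq_measurable [measurable_dest]: "sq w \<Longrightarrow> w \<in> borel_measurable borel"
  by (simp add: sq_def)

lemma sq_integrable2: "sq w \<Longrightarrow> integrable lborel (\<lambda>s. m s * (w s)\<^sup>2)"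
  by (simp add: sq_def)

lemma sq_integrable: assumes "sq w" shows "integrable lborel (\<lambda>s. m s * w s)"
proof -
  have [measurable]: "w \<in> borel_measurable borel" using assms by (rule sq_measurable)
  have "integrable lborel (\<lambda>s. m s + m s * (w s)\<^sup>2)"
    using m_int sq_integrable2[OF assms] by simp
  thus ?thesis
  proof (rule Bochner_Integration.integrable_bound)
    have "\<bar>w s\<bar> \<le> 1 + (w s)\<^sup>2" for s
    proof -
      have "0 \<le> (\<bar>w s\<bar> - 1)\<^sup>2" by simp
      hence "2 * \<bar>w s\<bar> \<le> 1 + (w s)\<^sup>2" by (simp add: power2_eq_square algebra_simps)
      thus ?thesis by linarith
    qed
    hence "m s * \<bar>w s\<bar> \<le> m s * (1 + (w s)\<^sup>2)" for s using m_nonneg by (intro mult_left_mono)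
    thus "AE s in lborel. norm (m s * w s) \<le> norm (m s + m s * (w s)\<^sup>2)"
      using m_nonneg by (auto simp: abs_mult distrib_left)
  qed measurable
qed

lemma P_nonneg: "0 \<le> P w"
  unfolding P_def using m_nonneg by (intro integral_nonneg_AE) auto

lemma Q_square_le: assumes "sq w" shows "(Q w)\<^sup>2 \<le> mass * P w"
  unfolding Q_def P_def mass_def
  by (rule weighted_Cauchy_Schwarz[OF m_nonneg m_int sq_integrable[OF assms] sq_integrable2[OF assms]])

text \<open>The kernel as seen by old memory: during a time step \<open>h\<close> the value stored
  at \<open>s\<close> moves to \<open>s + h\<close>, where it is weighted by
  \<open>m (s + h)\<close>. The indicator excludes arguments that would correspond to nonpositive
  age before the step.\<close>

definition shifted :: "real \<Rightarrow> real \<Rightarrow> real" where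
  "shifted h s = indicator {0<..} s * m (s + h)"

lemma shifted_meas [measurable]: "shifted h \<in> borel_measurable borel"
  unfolding shifted_def by measurable

lemma shifted_bounds: assumes "0 \<le> h"
  shows "0 \<le> shifted h s" "(1 + \<delta> * h) * shifted h s \<le> m s" "shifted h s \<le> m s"
proof -
  show "0 \<le> shifted h s" using m_nonneg by (simp add: shifted_def)
  show *: "(1 + \<delta> * h) * shifted h s \<le> m s"
    using decay[of s h] assms m_nonneg by (auto simp: shifted_def indicator_def)
  have "1 * shifted h s \<le> (1 + \<delta> * h) * shifted h s"
    using \<open>0 \<le> shifted h s\<close> assms \<delta>_pos by (intro mult_right_mono) auto
  thus "shifted h s \<le> m s" using * by simp
qed

text \<open>The integral is cut at \<open>h\<close> and the far part is translated back by
  \<open>h\<close>. The near part sees only memory created during the step, the far part sees the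
  transported old memory.\<close>

lemma integral_split_shift:
  assumes h: "0 \<le> h" and i: "integrable lborel (\<lambda>s. m s * F s)"
  shows "integrable lborel (\<lambda>s. shifted h s * F (s + h))"
    and "(\<integral>s. m s * F s \<partial>lborel) =
      (\<integral>s. indicator {0<..h} s * (m s * F s) \<partial>lborel) + (\<integral>s. shifted h s * F (s + h) \<partial>lborel)"
proof -
  define G where "G s = indicator {h<..} s * (m s * F s)" for s
  have iG: "integrable lborel G" unfolding G_def
    using integrable_mult_indicator[OF _ i, of "{h<..}"] by (simp add: real_scaleR_def)
  have eq: "shifted h s * F (s + h) = G (h + 1 * s)" for s
    by (auto simp: G_def shifted_def indicator_def add.commute)
  show "integrable lborel (\<lambda>s. shifted h s * F (s + h))"
    unfolding eq using lborel_integrable_real_affine[OF iG, of 1 h] by simp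
  have "(\<integral>s. shifted h s * F (s + h) \<partial>lborel) = (\<integral>s. G s \<partial>lborel)"
    unfolding eq using lborel_integral_real_affine[of 1 G h] by simp
  moreover have iH: "integrable lborel (\<lambda>s. indicator {0<..h} s * (m s * F s))"
    using integrable_mult_indicator[OF _ i, of "{0<..h}"] by (simp add: real_scaleR_def)
  moreover have "m s * F s = indicator {0<..h} s * (m s * F s) + G s" for s
    using h m_zero[of s] by (auto simp: G_def indicator_def)
  hence "(\<integral>s. m s * F s \<partial>lborel) = (\<integral>s. indicator {0<..h} s * (m s * F s) + G s \<partial>lborel)"
    by presburger
  ultimately show "(\<integral>s. m s * F s \<partial>lborel) =
      (\<integral>s. indicator {0<..h} s * (m s * F s) \<partial>lborel) + (\<integral>s. shifted h s * F (s + h) \<partial>lborel)"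
    using iG by simp
qed

lemma initial_layer_bound:
  assumes h: "0 \<le> h" and b: "0 \<le> b" and i: "integrable lborel (\<lambda>s. m s * F s)"
    and F: "\<And>s. 0 < s \<Longrightarrow> s \<le> h \<Longrightarrow> \<bar>F s\<bar> \<le> b"
  shows "\<bar>\<integral>s. indicator {0<..h} s * (m s * F s) \<partial>lborel\<bar> \<le> L * b * h"
proof -
  have iH: "integrable lborel (\<lambda>s. indicator {0<..h} s * (m s * F s))"
    using integrable_mult_indicator[OF _ i, of "{0<..h}"] by (simp add: real_scaleR_def)
  have "\<bar>\<integral>s. indicator {0<..h} s * (m s * F s) \<partial>lborel\<bar> \<le> (\<integral>s. \<bar>indicator {0<..h} s * (m s * F s)\<bar> \<partial>lborel)"
    by (rule integral_abs_bound)
  also have "\<dots> \<le> (\<integral>s. L * b * indicator {0<..h} s \<partial>lborel)"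
  proof (rule integral_mono)
    show "integrable lborel (\<lambda>s. L * b * indicator {0<..h} s :: real)" using h by simp
    show "\<bar>indicator {0<..h} s * (m s * F s)\<bar> \<le> L * b * indicator {0<..h} s" for s
      using F[of s] m_nonneg[of s] m_le[of s] L_pos
      by (auto simp: indicator_def abs_mult intro!: mult_mono)
  qed (use iH in simp)
  also have "\<dots> = L * b * h" using h by simp
  finally show ?thesis .
qed

text \<open>Effect of one time step on \<open>P\<close> and \<open>Q\<close>, where \<open>D\<close>
  is the integral of the scalar over the step. \<open>G\<close> is the dissipation, that is, the
  part of \<open>P w\<close> lost by passing from the kernel to the shifted kernel; \<open>J\<close>
  is the corresponding loss in \<open>Q w\<close>, \<open>M\<close> the mass of the shifted kernel,
  and \<open>r\<close> the contribution of the newly created layer. The bound on \<open>J\<close> is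
  Cauchy-Schwarz in the weight kernel minus shifted kernel, whose mass is at most
  \<open>L * h\<close>.\<close>

lemma shift_increment:
  assumes w: "sq w" and w': "sq w'" and h: "0 < h" and V: "0 \<le> V"
    and shift: "\<And>s. 0 < s \<Longrightarrow> w' (s + h) = w s + D"
    and layer: "\<And>s. 0 < s \<Longrightarrow> s \<le> h \<Longrightarrow> \<bar>w' s\<bar> \<le> V * h"
  obtains G J r M where
    "P w' \<le> L * (V * h)\<^sup>2 * h + P w - G + 2 * D * (Q w - J) + D\<^sup>2 * mass"
    "Q w' = r + Q w - J + D * M" "\<bar>r\<bar> \<le> L * (V * h) * h"
    "mass - L * h \<le> M" "0 \<le> M" "M \<le> mass" "J\<^sup>2 \<le> L * h * G" "G \<le> P w" "\<delta> * h * P w \<le> (1 + \<delta> * h) * G"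
proof -
  have h0: "0 \<le> h" using h by simp
  have [measurable]: "w \<in> borel_measurable borel" "w' \<in> borel_measurable borel"
    using w w' by (auto intro: sq_measurable)
  define n where "n = shifted h"
  note n = shifted_bounds[OF h0, folded n_def]
  have [measurable]: "n \<in> borel_measurable borel" by (simp add: n_def)
  have abs_n: "\<bar>n s\<bar> = n s" "\<bar>m s\<bar> = m s" for s using n(1) m_nonneg by auto
  have i0: "integrable lborel n"
    by (rule Bochner_Integration.integrable_bound[OF m_int]) (use n abs_n in auto)
  have i1: "integrable lborel (\<lambda>s. n s * w s)"
    by (rule Bochner_Integration.integrable_bound[OF sq_integrable[OF w]])
       (use n in \<open>auto simp: abs_mult abs_n intro!: mult_right_mono\<close>)
  have i2: "integrable lborel (\<lambda>s. n s * (w s)\<^sup>2)"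
    by (rule Bochner_Integration.integrable_bound[OF sq_integrable2[OF w]])
       (use n in \<open>auto simp: abs_mult abs_n intro!: mult_right_mono\<close>)
  define M where "M = (\<integral>s. n s \<partial>lborel)"
  define G where "G = P w - (\<integral>s. n s * (w s)\<^sup>2 \<partial>lborel)"
  define J where "J = Q w - (\<integral>s. n s * w s \<partial>lborel)"
  define r where "r = (\<integral>s. indicator {0<..h} s * (m s * w' s) \<partial>lborel)"
  have sp: "n s * F (s + h) = n s * H s" if "\<And>s. 0 < s \<Longrightarrow> F (s + h) = H s" for F H :: "real \<Rightarrow> real" and s
    using that by (cases "0 < s") (auto simp: n_def shifted_def)
  have P': "P w' \<le> L * (V * h)\<^sup>2 * h + P w - G + 2 * D * (Q w - J) + D\<^sup>2 * mass"
  proof -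
    note s = integral_split_shift[OF h0 sq_integrable2[OF w'], folded n_def P_def]
    have "\<bar>\<integral>s. indicator {0<..h} s * (m s * (w' s)\<^sup>2) \<partial>lborel\<bar> \<le> L * (V * h)\<^sup>2 * h"
      by (rule initial_layer_bound[OF h0 _ sq_integrable2[OF w']])
         (use layer V h in \<open>auto simp: abs_le_square_iff[symmetric] intro!: power_mono\<close>)
    moreover have "(\<integral>s. n s * (w' (s + h))\<^sup>2 \<partial>lborel) = (\<integral>s. n s * (w s)\<^sup>2 + 2 * D * (n s * w s) + D\<^sup>2 * n s \<partial>lborel)"
    proof (rule Bochner_Integration.integral_cong[OF refl])
      fix s
      have "n s * (w' (s + h))\<^sup>2 = n s * (w s + D)\<^sup>2"
        using sp[of "\<lambda>s. (w' s)\<^sup>2" "\<lambda>s. (w s + D)\<^sup>2" s] shift by simp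
      thus "n s * (w' (s + h))\<^sup>2 = n s * (w s)\<^sup>2 + 2 * D * (n s * w s) + D\<^sup>2 * n s"
        by (simp add: power2_eq_square algebra_simps)
    qed
    moreover have "\<dots> = (P w - G) + 2 * D * (Q w - J) + D\<^sup>2 * M"
      using i0 i1 i2 by (simp add: G_def J_def M_def)
    moreover have "M \<le> mass" unfolding M_def mass_def using n by (intro integral_mono i0 m_int) auto
    hence "D\<^sup>2 * M \<le> D\<^sup>2 * mass" by (intro mult_left_mono) auto
    ultimately show ?thesis using s(2) by linarith
  qed
  have Q': "Q w' = r + Q w - J + D * M"
  proof -
    note s = integral_split_shift[OF h0 sq_integrable[OF w'], folded n_def Q_def]
    have "(\<integral>s. n s * w' (s + h) \<partial>lborel) = (\<integral>s. n s * w s + D * n s \<partial>lborel)"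
    proof (rule Bochner_Integration.integral_cong[OF refl])
      fix s show "n s * w' (s + h) = n s * w s + D * n s"
        using sp[of w' "\<lambda>s. w s + D" s] shift by (simp add: algebra_simps)
    qed
    also have "\<dots> = (Q w - J) + D * M" using i0 i1 by (simp add: J_def M_def)
    finally show ?thesis using s(2) by (simp add: r_def)
  qed
  have r: "\<bar>r\<bar> \<le> L * (V * h) * h" unfolding r_def
    by (rule initial_layer_bound[OF h0 _ sq_integrable[OF w'] layer]) (use V h in auto)
  have mn: "mass - M \<le> L * h"
  proof -
    have i: "integrable lborel (\<lambda>s. m s * 1)" using m_int by simp
    note s = integral_split_shift[OF h0 i, folded n_def]
    have "\<bar>\<integral>s. indicator {0<..h} s * (m s * 1) \<partial>lborel\<bar> \<le> L * 1 * h"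
      by (rule initial_layer_bound[OF h0 _ i]) auto
    thus ?thesis using s(2) by (simp add: mass_def M_def)
  qed
  have M: "M \<le> mass" unfolding M_def mass_def using n by (intro integral_mono i0 m_int) auto
  have diff: "(\<integral>s. (m s - n s) \<partial>lborel) = mass - M" "(\<integral>s. (m s - n s) * w s \<partial>lborel) = J"
     "(\<integral>s. (m s - n s) * (w s)\<^sup>2 \<partial>lborel) = G"
    using i0 i1 i2 m_int sq_integrable[OF w] sq_integrable2[OF w]
    by (simp_all add: mass_def M_def J_def G_def Q_def P_def left_diff_distrib)
  have "J\<^sup>2 \<le> (mass - M) * G" unfolding diff[symmetric]
    by (rule weighted_Cauchy_Schwarz)
       (use n i0 i1 i2 m_int sq_integrable[OF w] sq_integrable2[OF w] in \<open>auto simp: left_diff_distrib\<close>)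
  also have "G \<ge> 0" unfolding diff(3)[symmetric] using n by (intro integral_nonneg_AE) auto
  hence "(mass - M) * G \<le> (L * h) * G" using mn by (intro mult_right_mono)
  finally have J: "J\<^sup>2 \<le> L * h * G" .
  have "0 \<le> (\<integral>s. n s * (w s)\<^sup>2 \<partial>lborel)" using n by (intro integral_nonneg_AE) auto
  hence GP: "G \<le> P w" by (simp add: G_def)
  have "(1 + \<delta> * h) * (P w - G) = (\<integral>s. (1 + \<delta> * h) * (n s * (w s)\<^sup>2) \<partial>lborel)"
    by (simp add: G_def)
  also have "\<dots> \<le> P w" unfolding P_def
  proof (rule integral_mono)
    show "(1 + \<delta> * h) * (n s * (w s)\<^sup>2) \<le> m s * (w s)\<^sup>2" for s
      using mult_right_mono[OF n(2)[of s], of "(w s)\<^sup>2"] by (simp add: mult.assoc)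
  qed (use i2 sq_integrable2[OF w] in auto)
  finally have "\<delta> * h * P w \<le> (1 + \<delta> * h) * G" by (simp add: algebra_simps)
  moreover have "0 \<le> M" unfolding M_def using n by (intro integral_nonneg_AE) auto
  ultimately show ?thesis using P' Q' r mn M J GP by (intro that[of G J r M]) auto
qed

text \<open>The cross term makes the dissipation of the memory part act on the scalar as well. The drift \<open>J\<close> of
the weighted mean is absorbed by the dissipation \<open>G\<close> through \<open>J\<^sup>2 \<le> L h G\<close>, so the kernel is never
differentiated.\<close>

lemma lyapunov_step:
  fixes P Q P' Q' :: real
  assumes h: "0 < h" and \<theta>: "0 \<le> \<theta>" and V: "0 \<le> V" and P: "0 \<le> P"
    and P': "P' \<le> L * (V * h)\<^sup>2 * h + P - G + 2 * (h * y) * (Q - J) + (h * y)\<^sup>2 * mass"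
    and Q': "Q' = r + Q - J + h * y * M" and r: "\<bar>r\<bar> \<le> L * (V * h) * h"
    and M: "mass - L * h \<le> M" "0 \<le> M" "M \<le> mass"
    and J: "J\<^sup>2 \<le> L * h * G" and GP: "G \<le> P" and PG: "\<delta> * h * P \<le> (1 + \<delta> * h) * G"
  shows "(v + h * x)\<^sup>2 + P' - \<theta> * (v + h * x) * Q' \<le> v\<^sup>2 + P - \<theta> * v * Q + h *
    (2 * v * x + h * x\<^sup>2 + L * V\<^sup>2 * h\<^sup>2 - \<delta> / (2 * (1 + \<delta> * h)) * P + 2 * y * Q
      + 2 * \<bar>y\<bar> * sqrt (L * h * P) + h * y\<^sup>2 * mass + \<theta> * \<bar>v\<bar> * L * V * h + \<theta>\<^sup>2 * L * v\<^sup>2 / 2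
      - \<theta> * v * y * mass + \<theta> * \<bar>v * y\<bar> * L * h - \<theta> * Q * x
      + \<theta> * \<bar>x\<bar> * (L * V * h\<^sup>2 + sqrt (L * h * P) + h * \<bar>y\<bar> * mass))"
proof -
  define S where "S = sqrt (L * h * P)"
  have Lh: "0 < L * h" using L_pos h by simp
  have "J\<^sup>2 \<le> L * h * P" using J mult_left_mono[OF GP, of "L * h"] Lh by linarith
  hence JS: "\<bar>J\<bar> \<le> S" unfolding S_def by (metis real_sqrt_abs real_sqrt_le_iff)
  \<comment> \<open>Young's inequality between \<open>J\<close> and
    \<open>\<theta> * v * (L * h)\<close>. It spends one half of the dissipation \<open>G\<close>;
    the other half becomes the decay of \<open>P\<close> in the next bound.\<close>
  have vJ: "\<theta> * v * J \<le> G / 2 + h * (\<theta>\<^sup>2 * L * v\<^sup>2 / 2)"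
  proof -
    have "0 \<le> (J - \<theta> * v * (L * h))\<^sup>2" by simp
    hence "(L * h) * (2 * \<theta> * v * J) \<le> J\<^sup>2 + (L * h) * (h * (\<theta>\<^sup>2 * L * v\<^sup>2))"
      by (simp add: power2_eq_square algebra_simps)
    also have "\<dots> \<le> (L * h) * (G + h * (\<theta>\<^sup>2 * L * v\<^sup>2))" using J by (simp add: algebra_simps)
    finally have "2 * \<theta> * v * J \<le> G + h * (\<theta>\<^sup>2 * L * v\<^sup>2)" using Lh mult_le_cancel_left_pos by blast
    thus ?thesis by simp
  qed
  have G: "h * (\<delta> / (2 * (1 + \<delta> * h)) * P) \<le> G / 2"
  proof -
    have "0 < 1 + \<delta> * h" using h \<delta>_pos by (simp add: add_pos_pos)
    thus ?thesis using PG by (simp add: field_simps)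
  qed
  define dQ where "dQ = Q' - Q"
  have hy: "\<bar>h * y * M\<bar> \<le> h * \<bar>y\<bar> * mass"
    using M h by (auto simp: abs_mult intro!: mult_left_mono)
  have "\<bar>dQ\<bar> \<le> \<bar>r\<bar> + \<bar>J\<bar> + \<bar>h * y * M\<bar>" unfolding dQ_def Q' by linarith
  hence dQ: "\<bar>dQ\<bar> \<le> L * V * h\<^sup>2 + S + h * \<bar>y\<bar> * mass"
    using r JS hy by (simp add: power2_eq_square algebra_simps)
  have xQ: "- (\<theta> * x * dQ) \<le> \<theta> * \<bar>x\<bar> * (L * V * h\<^sup>2 + S + h * \<bar>y\<bar> * mass)"
  proof -
    have "- (\<theta> * x * dQ) \<le> \<bar>\<theta> * x * dQ\<bar>" by linarith
    also have "\<dots> = \<theta> * \<bar>x\<bar> * \<bar>dQ\<bar>" using \<theta> by (simp add: abs_mult)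
    also have "\<dots> \<le> \<theta> * \<bar>x\<bar> * (L * V * h\<^sup>2 + S + h * \<bar>y\<bar> * mass)"
      using dQ \<theta> by (intro mult_left_mono) auto
    finally show ?thesis .
  qed
  have yJ: "- (y * J) \<le> \<bar>y\<bar> * S"
  proof -
    have "- (y * J) \<le> \<bar>y\<bar> * \<bar>J\<bar>" by (metis abs_ge_minus_self abs_mult)
    also have "\<dots> \<le> \<bar>y\<bar> * S" using JS by (intro mult_left_mono) auto
    finally show ?thesis .
  qed
  have vr: "- (\<theta> * v * r) \<le> h * (\<theta> * \<bar>v\<bar> * L * V * h)"
  proof -
    have "- (\<theta> * v * r) \<le> \<bar>\<theta> * v * r\<bar>" by linarith
    also have "\<dots> = \<theta> * \<bar>v\<bar> * \<bar>r\<bar>" using \<theta> by (simp add: abs_mult)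
    also have "\<dots> \<le> \<theta> * \<bar>v\<bar> * (L * (V * h) * h)"
      using r \<theta> by (intro mult_left_mono) auto
    finally show ?thesis by (simp add: algebra_simps)
  qed
  have vM: "- (\<theta> * v * y * M) \<le> - (\<theta> * v * y * mass) + \<theta> * \<bar>v * y\<bar> * L * h"
  proof -
    have "(\<theta> * v * y) * (mass - M) \<le> \<theta> * \<bar>v * y\<bar> * (mass - M)"
      using M \<theta> by (intro mult_right_mono) (auto simp: mult.assoc intro!: mult_left_mono)
    also have "\<dots> \<le> \<theta> * \<bar>v * y\<bar> * (L * h)" using M \<theta> by (intro mult_left_mono) auto
    finally show ?thesis by (simp add: algebra_simps)
  qed
  have "(v + h * x)\<^sup>2 + P' - \<theta> * (v + h * x) * Q' = v\<^sup>2 + P' - \<theta> * v * Q + h * (2 * v * x + h * x\<^sup>2 - \<theta> * Q * x)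
      + (- (\<theta> * v * dQ)) + h * (- (\<theta> * x * dQ))"
    by (simp add: dQ_def power2_eq_square algebra_simps)
  also have "- (\<theta> * v * dQ) = - (\<theta> * v * r) + \<theta> * v * J + h * (- (\<theta> * v * y * M))"
    by (simp add: dQ_def Q' algebra_simps)
  also have "v\<^sup>2 + P' - \<theta> * v * Q + h * (2 * v * x + h * x\<^sup>2 - \<theta> * Q * x)
      + \<dots> + h * (- (\<theta> * x * dQ)) \<le> v\<^sup>2 + (L * (V * h)\<^sup>2 * h + P - G + 2 * (h * y) * Q + 2 * h * (- (y * J)) + (h * y)\<^sup>2 * mass)
      - \<theta> * v * Q + h * (2 * v * x + h * x\<^sup>2 - \<theta> * Q * x)
      + (h * (\<theta> * \<bar>v\<bar> * L * V * h) + (G / 2 + h * (\<theta>\<^sup>2 * L * v\<^sup>2 / 2)) + h * (- (\<theta> * v * y * mass) + \<theta> * \<bar>v * y\<bar> * L * h))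
      + h * (\<theta> * \<bar>x\<bar> * (L * V * h\<^sup>2 + S + h * \<bar>y\<bar> * mass))"
  proof -
    have "h * (- (\<theta> * v * y * M)) \<le> h * (- (\<theta> * v * y * mass) + \<theta> * \<bar>v * y\<bar> * L * h)"
      "h * (- (\<theta> * x * dQ)) \<le> h * (\<theta> * \<bar>x\<bar> * (L * V * h\<^sup>2 + S + h * \<bar>y\<bar> * mass))"
      using h xQ vM by (simp_all only: mult_left_mono less_imp_le)
    moreover have "2 * (h * y) * (Q - J) = 2 * (h * y) * Q + 2 * h * (- (y * J))" by (simp add: algebra_simps)
    ultimately show ?thesis using P' vr vJ by linarith
  qed
  also have "\<dots> \<le> v\<^sup>2 + (L * (V * h)\<^sup>2 * h + P - h * (\<delta> / (2 * (1 + \<delta> * h)) * P) + 2 * (h * y) * Q + 2 * h * (\<bar>y\<bar> * S) + (h * y)\<^sup>2 * mass)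
      - \<theta> * v * Q + h * (2 * v * x + h * x\<^sup>2 - \<theta> * Q * x)
      + (h * (\<theta> * \<bar>v\<bar> * L * V * h) + (h * (\<theta>\<^sup>2 * L * v\<^sup>2 / 2)) + h * (- (\<theta> * v * y * mass) + \<theta> * \<bar>v * y\<bar> * L * h))
      + h * (\<theta> * \<bar>x\<bar> * (L * V * h\<^sup>2 + S + h * \<bar>y\<bar> * mass))"
  proof -
    have "2 * h * (- (y * J)) \<le> 2 * h * (\<bar>y\<bar> * S)" using yJ h by (intro mult_left_mono) auto
    thus ?thesis using G by linarith
  qed
  also have "\<dots> = v\<^sup>2 + P - \<theta> * v * Q + h *
    (2 * v * x + h * x\<^sup>2 + L * V\<^sup>2 * h\<^sup>2 - \<delta> / (2 * (1 + \<delta> * h)) * P + 2 * y * Q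
      + 2 * \<bar>y\<bar> * S + h * y\<^sup>2 * mass + \<theta> * \<bar>v\<bar> * L * V * h + \<theta>\<^sup>2 * L * v\<^sup>2 / 2
      - \<theta> * v * y * mass + \<theta> * \<bar>v * y\<bar> * L * h - \<theta> * Q * x
      + \<theta> * \<bar>x\<bar> * (L * V * h\<^sup>2 + S + h * \<bar>y\<bar> * mass))"
  proof -
    have "L * (V * h)\<^sup>2 * h = h * (L * V\<^sup>2 * h\<^sup>2)" "(h * y)\<^sup>2 * mass = h * (h * y\<^sup>2 * mass)"
      "2 * (h * y) * Q = h * (2 * y * Q)" "2 * h * (\<bar>y\<bar> * S) = h * (2 * \<bar>y\<bar> * S)"
      by (simp_all add: power_mult_distrib power2_eq_square)
    thus ?thesis by (simp only: distrib_left right_diff_distrib)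
  qed
  finally show ?thesis unfolding S_def .
qed

text \<open>The left side is the limit, as the step tends to zero, of the bracket in the one-step
  estimate, with \<open>x\<close> replaced by \<open>g - Q\<close> and \<open>y\<close> by
  \<open>v\<close>. The terms \<open>2 * v * Q\<close> cancel, \<open>P\<close> is dissipated by the
  kernel and \<open>v\<close> by the derivative of the cross term; the smallness conditions on
  \<open>\<theta>\<close> let these two absorb everything except the forcing. The second claim makes
  the functional comparable with \<open>v\<^sup>2 + P\<close>.\<close>

lemma lyapunov_dissipation:
  fixes P Q :: real
  assumes Q: "Q\<^sup>2 \<le> mass * P" and \<theta>: "0 < \<theta>" "\<theta> * mass \<le> \<delta> / 4" "\<theta> * L \<le> mass" "\<theta>\<^sup>2 * mass \<le> 1"
    and \<nu>: "0 < \<nu>" "\<nu> \<le> \<delta> / 12" "\<nu> \<le> \<theta> * mass / 6"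
  shows "2 * v * (g - Q) - \<delta> / 2 * P + 2 * v * Q + \<theta>\<^sup>2 * L * v\<^sup>2 / 2 - \<theta> * v * v * mass - \<theta> * Q * (g - Q)
    \<le> - \<nu> * (v\<^sup>2 + P - \<theta> * v * Q) + (4 / (\<theta> * mass) + 4 * mass * \<theta>\<^sup>2 / \<delta>) * g\<^sup>2"
  and "\<bar>\<theta> * v * Q\<bar> \<le> (v\<^sup>2 + P) / 2"
proof -
  have k: "0 < mass" by (rule mass_pos)
  have P: "0 \<le> P" using Q k by (metis zero_le_power2 order_trans zero_le_mult_iff not_less)
  have "(\<theta> * v * Q)\<^sup>2 \<le> ((v\<^sup>2 + P) / 2)\<^sup>2"
  proof -
    have "(\<theta> * v * Q)\<^sup>2 = (\<theta>\<^sup>2 * v\<^sup>2) * Q\<^sup>2" by (simp add: power_mult_distrib)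
    also have "\<dots> \<le> (\<theta>\<^sup>2 * v\<^sup>2) * (mass * P)" using Q by (intro mult_left_mono) auto
    also have "\<dots> = (\<theta>\<^sup>2 * mass) * (v\<^sup>2 * P)" by simp
    also have "\<dots> \<le> 1 * (v\<^sup>2 * P)" using \<theta> P by (intro mult_right_mono) auto
    also have "\<dots> \<le> ((v\<^sup>2 + P) / 2)\<^sup>2"
    proof -
      have "0 \<le> (v\<^sup>2 - P)\<^sup>2" by simp
      thus ?thesis by (simp add: power2_eq_square field_simps)
    qed
    finally show ?thesis .
  qed
  hence "\<bar>\<theta> * v * Q\<bar> \<le> \<bar>(v\<^sup>2 + P) / 2\<bar>" by (simp only: abs_le_square_iff)
  thus cross: "\<bar>\<theta> * v * Q\<bar> \<le> (v\<^sup>2 + P) / 2" using P by simp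
  have 1: "\<theta> * Q\<^sup>2 \<le> \<delta> / 4 * P"
  proof -
    have "\<theta> * Q\<^sup>2 \<le> \<theta> * (mass * P)" using Q \<theta> by (intro mult_left_mono) auto
    also have "\<dots> \<le> \<delta> / 4 * P" using mult_right_mono[OF \<theta>(2) P] by (simp add: mult.assoc)
    finally show ?thesis .
  qed
  have 2: "\<theta>\<^sup>2 * L * v\<^sup>2 / 2 \<le> \<theta> * mass / 2 * v\<^sup>2"
  proof -
    have "(\<theta> * L) * (\<theta> * v\<^sup>2) \<le> mass * (\<theta> * v\<^sup>2)" using \<theta> by (intro mult_right_mono) auto
    thus ?thesis by (simp add: power2_eq_square algebra_simps)
  qed
  have 3: "2 * v * g \<le> \<theta> * mass / 4 * v\<^sup>2 + 4 / (\<theta> * mass) * g\<^sup>2"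
  proof -
    define c where "c = \<theta> * mass / 4"
    have c: "0 < c" using \<theta> k by (simp add: c_def)
    have "0 \<le> (c * v - g)\<^sup>2 / c" using c by simp
    also have "\<dots> = c * v\<^sup>2 - 2 * v * g + 1 / c * g\<^sup>2" using c by (simp add: power2_eq_square field_simps)
    finally show ?thesis by (simp add: c_def)
  qed
  have 4: "- (\<theta> * Q * g) \<le> \<delta> / 16 * P + 4 * mass * \<theta>\<^sup>2 / \<delta> * g\<^sup>2"
  proof -
    define c where "c = \<delta> / (16 * mass)"
    have c: "0 < c" using \<delta>_pos k by (simp add: c_def)
    have "0 \<le> (2 * c * Q + \<theta> * g)\<^sup>2 / (4 * c)" using c by simp
    also have "\<dots> = c * Q\<^sup>2 + \<theta> * Q * g + \<theta>\<^sup>2 / (4 * c) * g\<^sup>2" using c by (simp add: power2_eq_square field_simps)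
    finally have "- (\<theta> * Q * g) \<le> c * Q\<^sup>2 + \<theta>\<^sup>2 / (4 * c) * g\<^sup>2" by simp
    also have "c * Q\<^sup>2 \<le> c * (mass * P)" using Q c by (intro mult_left_mono) auto
    also have "c * (mass * P) = \<delta> / 16 * P" using k by (simp add: c_def)
    also have "\<theta>\<^sup>2 / (4 * c) = 4 * mass * \<theta>\<^sup>2 / \<delta>" using k \<delta>_pos by (simp add: c_def field_simps)
    finally show ?thesis by simp
  qed
  have 5: "\<nu> * (v\<^sup>2 + P - \<theta> * v * Q) \<le> \<theta> * mass / 4 * v\<^sup>2 + \<delta> / 8 * P"
  proof -
    have "\<nu> * (v\<^sup>2 + P - \<theta> * v * Q) \<le> \<nu> * (3 / 2 * (v\<^sup>2 + P))"
      using cross \<nu> by (intro mult_left_mono) auto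
    also have "\<dots> = 3 / 2 * (\<nu> * v\<^sup>2) + 3 / 2 * (\<nu> * P)" by (simp add: algebra_simps)
    also have "\<nu> * v\<^sup>2 \<le> \<theta> * mass / 6 * v\<^sup>2" using \<nu> by (intro mult_right_mono) auto
    also have "\<nu> * P \<le> \<delta> / 12 * P" using \<nu> P by (intro mult_right_mono) auto
    finally show ?thesis by (simp add: algebra_simps)
  qed
  have eq: "2 * v * (g - Q) - \<delta> / 2 * P + 2 * v * Q + \<theta>\<^sup>2 * L * v\<^sup>2 / 2 - \<theta> * v * v * mass - \<theta> * Q * (g - Q)
    = 2 * v * g - \<delta> / 2 * P + \<theta>\<^sup>2 * L * v\<^sup>2 / 2 - \<theta> * mass * v\<^sup>2 + \<theta> * Q\<^sup>2 + - (\<theta> * Q * g)"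
    by (simp add: power2_eq_square algebra_simps)
  have "0 \<le> \<delta> * P" using \<delta>_pos P by simp
  show "2 * v * (g - Q) - \<delta> / 2 * P + 2 * v * Q + \<theta>\<^sup>2 * L * v\<^sup>2 / 2 - \<theta> * v * v * mass - \<theta> * Q * (g - Q)
    \<le> - \<nu> * (v\<^sup>2 + P - \<theta> * v * Q) + (4 / (\<theta> * mass) + 4 * mass * \<theta>\<^sup>2 / \<delta>) * g\<^sup>2"
  proof -
    \<comment> \<open>The budget: the memory spends 1/4 + 1/16 + 1/8 of \<open>X\<close> against the
      available 1/2, and the scalar spends 1/2 + 1/4 + 1/4 of \<open>Y\<close>, which is all of
      it.\<close>
    define X Y \<alpha> \<beta> where "X = \<delta> * P" and "Y = \<theta> * mass * v\<^sup>2" and "\<alpha> = 4 / (\<theta> * mass) * g\<^sup>2"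
      and "\<beta> = 4 * mass * \<theta>\<^sup>2 / \<delta> * g\<^sup>2"
    have "\<theta> * Q\<^sup>2 \<le> X / 4" "\<theta>\<^sup>2 * L * v\<^sup>2 / 2 \<le> Y / 2" "2 * v * g \<le> Y / 4 + \<alpha>"
      "- (\<theta> * Q * g) \<le> X / 16 + \<beta>" "\<nu> * (v\<^sup>2 + P - \<theta> * v * Q) \<le> Y / 4 + X / 8" "\<delta> / 2 * P = X / 2"
      "\<theta> * mass * v\<^sup>2 = Y" "(4 / (\<theta> * mass) + 4 * mass * \<theta>\<^sup>2 / \<delta>) * g\<^sup>2 = \<alpha> + \<beta>"
      using 1 2 3 4 5 by (simp_all add: X_def Y_def \<alpha>_def \<beta>_def distrib_right)
    moreover have "- \<nu> * (v\<^sup>2 + P - \<theta> * v * Q) = - (\<nu> * (v\<^sup>2 + P - \<theta> * v * Q))" by (rule mult_minus_left)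
    moreover have "0 \<le> X" using \<open>0 \<le> \<delta> * P\<close> by (simp add: X_def)
    ultimately show ?thesis unfolding eq by linarith
  qed
qed

text \<open>\<open>v t\<close> stands for a Fourier coefficient at time \<open>t\<close>, \<open>w t s\<close> for that of its memory and \<open>g\<close> for the
forcing. The last two clauses are the integrated form of \<open>w\<^sub>t = - w\<^sub>s + v\<close> with \<open>w t 0 = 0\<close>.\<close>

definition mode :: "(real \<Rightarrow> real) \<Rightarrow> (real \<Rightarrow> real \<Rightarrow> real) \<Rightarrow> (real \<Rightarrow> real) \<Rightarrow> bool" where
  "mode v w g \<longleftrightarrow> continuous_on {0..} g \<and> continuous_on {0..} (\<lambda>t. P (w t)) \<and>
     continuous_on {0..} (\<lambda>t. Q (w t)) \<and> (\<forall>t\<ge>0. sq (w t)) \<and>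
     (\<forall>t\<ge>0. (v has_real_derivative g t - Q (w t)) (at t within {0..})) \<and>
     (\<forall>t\<ge>0. \<forall>h>0. \<forall>s>0. w (t + h) (s + h) = w t s + integral {t..t+h} v) \<and>
     (\<forall>t\<ge>0. \<forall>s>0. s \<le> t \<longrightarrow> w t s = integral {t-s..t} v)"

lemma mode_continuous: assumes "mode v w g" shows "continuous_on {0..} v"
proof -
  have "(v has_real_derivative g t - Q (w t)) (at t within {0..})" if "0 \<le> t" for t
    using assms that by (simp add: mode_def)
  thus ?thesis unfolding continuous_on_eq_continuous_within using DERIV_continuous by blast
qed

text \<open>The one-step estimate divided by the step passes to the limit and gives the increment
  hypothesis of the exponential inequality for the Lyapunov functional. The constants are fixed
  before the mode and depend on the kernel alone, hence serve all Fourier modes at once.\<close>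

theorem mode_decay:
  obtains C \<nu> where "0 < C" "0 < \<nu>"
    "\<And>v w g T. mode v w g \<Longrightarrow> 0 \<le> T \<Longrightarrow>
       (v T)\<^sup>2 + P (w T) \<le> C * (exp (- \<nu> * T) * ((v 0)\<^sup>2 + P (w 0)) + integral {0..T} (\<lambda>r. exp (- \<nu> * (T - r)) * (g r)\<^sup>2))"
proof -
  \<comment> \<open>Each entry of the minimum yields one of the smallness conditions
    \<open>\<theta>2\<close>, \<open>\<theta>3\<close>, \<open>\<theta>4\<close> below.\<close>
  define \<theta> where "\<theta> = min (\<delta> / (4 * mass)) (min (mass / L) (1 / sqrt mass))"
  have k: "0 < mass" "0 < L" "0 < \<delta>" using mass_pos L_pos \<delta>_pos by auto
  have \<theta>1: "0 < \<theta>" using k by (simp add: \<theta>_def)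
  have \<theta>2: "\<theta> * mass \<le> \<delta> / 4"
  proof -
    have "\<theta> \<le> \<delta> / (4 * mass)" by (simp add: \<theta>_def)
    thus ?thesis using k by (simp add: field_simps)
  qed
  have \<theta>3: "\<theta> * L \<le> mass"
  proof -
    have "\<theta> \<le> mass / L" by (simp add: \<theta>_def)
    thus ?thesis using k by (simp add: field_simps)
  qed
  have \<theta>4: "\<theta>\<^sup>2 * mass \<le> 1"
  proof -
    have "\<theta> \<le> 1 / sqrt mass" by (simp add: \<theta>_def)
    hence "\<theta>\<^sup>2 \<le> (1 / sqrt mass)\<^sup>2" using \<theta>1 by (intro power_mono) auto
    thus ?thesis using k by (simp add: power_divide field_simps)
  qed
  define \<nu> where "\<nu> = min (\<delta> / 12) (\<theta> * mass / 6)"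
  have \<nu>: "0 < \<nu>" "\<nu> \<le> \<delta> / 12" "\<nu> \<le> \<theta> * mass / 6" using k \<theta>1 by (auto simp: \<nu>_def)
  define c where "c = 4 / (\<theta> * mass) + 4 * mass * \<theta>\<^sup>2 / \<delta>"
  have c: "0 < c" using k \<theta>1 by (auto simp: c_def intro!: add_pos_pos)
  note diss = lyapunov_dissipation[OF _ \<theta>1 \<theta>2 \<theta>3 \<theta>4 \<nu>, folded c_def]
  show ?thesis
  proof (rule that[of "3 + 2 * c" \<nu>])
    fix v w g and T :: real
    assume mode: "mode v w g" and T: "0 \<le> T"
    have cg: "continuous_on {0..} g" and cP: "continuous_on {0..} (\<lambda>t. P (w t))"
      and cQ: "continuous_on {0..} (\<lambda>t. Q (w t))" and sq: "\<And>t. 0 \<le> t \<Longrightarrow> sq (w t)"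
      and dv: "\<And>t. 0 \<le> t \<Longrightarrow> (v has_real_derivative g t - Q (w t)) (at t within {0..})"
      and shift: "\<And>t h s. 0 \<le> t \<Longrightarrow> 0 < h \<Longrightarrow> 0 < s \<Longrightarrow> w (t + h) (s + h) = w t s + integral {t..t+h} v"
      and layer: "\<And>t s. 0 \<le> t \<Longrightarrow> 0 < s \<Longrightarrow> s \<le> t \<Longrightarrow> w t s = integral {t-s..t} v"
      using mode unfolding mode_def by auto
    have cv: "continuous_on {0..} v" by (rule mode_continuous[OF mode])
    define \<Psi> where "\<Psi> t = (v t)\<^sup>2 + P (w t) - \<theta> * v t * Q (w t)" for t
    have "\<Psi> T \<le> exp (- \<nu> * T) * \<Psi> 0 + integral {0..T} (\<lambda>r. exp (- \<nu> * (T - r)) * (c * (g r)\<^sup>2))"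
    proof (rule exponential_gronwall[OF _ _ _ T])
      show "continuous_on {0..} \<Psi>" unfolding \<Psi>_def by (intro continuous_intros cv cP cQ)
      show "continuous_on {0..} (\<lambda>r. c * (g r)\<^sup>2)" by (intro continuous_intros cg)
    next
      fix t e :: real assume t: "0 \<le> t" and e: "0 < e"
      have "bounded (v ` {0..t+1})"
        by (intro compact_imp_bounded compact_continuous_image continuous_on_subset[OF cv]) auto
      then obtain V where V: "0 < V" "\<And>r. r \<in> {0..t+1} \<Longrightarrow> \<bar>v r\<bar> \<le> V"
        by (auto simp: bounded_pos)
      \<comment> \<open>\<open>x\<close> is the difference quotient of the scalar and
        \<open>y\<close> its mean over the step; as the step shrinks they tend to
        \<open>g t - Q (w t)\<close> and \<open>v t\<close>.\<close>
      define x where "x h = (v (t + h) - v t) / h" for h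
      define y where "y h = integral {t..t+h} v / h" for h
      have x: "(x \<longlongrightarrow> g t - Q (w t)) (at_right 0)" unfolding x_def
        by (rule right_difference_quotient) (rule DERIV_subset[OF dv[OF t]], use t in auto)
      have "((\<lambda>h. (integral {0..t+h} v - integral {0..t} v) / h) \<longlongrightarrow> v t) (at_right 0)"
        by (rule right_difference_quotient) (rule DERIV_subset[OF integral_has_right_derivative[OF cv t]], use t in auto)
      moreover have "\<forall>\<^sub>F h in at_right 0. (integral {0..t+h} v - integral {0..t} v) / h = y h"
        using eventually_at_right_less[of 0]
      proof eventually_elim
        case (elim h)
        have "integral {0..t} v + integral {t..t+h} v = integral {0..t+h} v"
          by (rule Henstock_Kurzweil_Integration.integral_combine)
             (use t elim in \<open>auto intro!: integrable_continuous_real continuous_on_subset[OF cv]\<close>)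
        thus ?case by (simp add: y_def)
      qed
      ultimately have y: "(y \<longlongrightarrow> v t) (at_right 0)" by (rule Lim_transform_eventually)
      \<comment> \<open>The bracket of the one-step estimate. Every remainder carries a factor
        \<open>h\<close> or \<open>sqrt h\<close>, so the limit is the expression bounded by the
        dissipation estimate.\<close>
      define B where "B h = (2 * v t * x h + h * (x h)\<^sup>2 + L * V\<^sup>2 * h\<^sup>2 - \<delta> / (2 * (1 + \<delta> * h)) * P (w t) + 2 * y h * Q (w t)
      + 2 * \<bar>y h\<bar> * sqrt (L * h * P (w t)) + h * (y h)\<^sup>2 * mass + \<theta> * \<bar>v t\<bar> * L * V * h + \<theta>\<^sup>2 * L * (v t)\<^sup>2 / 2
      - \<theta> * v t * y h * mass + \<theta> * \<bar>v t * y h\<bar> * L * h - \<theta> * Q (w t) * x h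
      + \<theta> * \<bar>x h\<bar> * (L * V * h\<^sup>2 + sqrt (L * h * P (w t)) + h * \<bar>y h\<bar> * mass))" for h
      have id: "((\<lambda>h. h) \<longlongrightarrow> 0) (at_right (0::real))" by (rule tendsto_ident_at)
      have "(B \<longlongrightarrow> (2 * v t * (g t - Q (w t)) + 0 * (g t - Q (w t))\<^sup>2 + L * V\<^sup>2 * 0\<^sup>2 - \<delta> / (2 * (1 + \<delta> * 0)) * P (w t) + 2 * v t * Q (w t)
      + 2 * \<bar>v t\<bar> * sqrt (L * 0 * P (w t)) + 0 * (v t)\<^sup>2 * mass + \<theta> * \<bar>v t\<bar> * L * V * 0 + \<theta>\<^sup>2 * L * (v t)\<^sup>2 / 2
      - \<theta> * v t * v t * mass + \<theta> * \<bar>v t * v t\<bar> * L * 0 - \<theta> * Q (w t) * (g t - Q (w t))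
      + \<theta> * \<bar>g t - Q (w t)\<bar> * (L * V * 0\<^sup>2 + sqrt (L * 0 * P (w t)) + 0 * \<bar>v t\<bar> * mass))) (at_right 0)"
        unfolding B_def by (intro tendsto_intros x y id) auto
      hence B: "(B \<longlongrightarrow> 2 * v t * (g t - Q (w t)) - \<delta> / 2 * P (w t) + 2 * v t * Q (w t) + \<theta>\<^sup>2 * L * (v t)\<^sup>2 / 2
          - \<theta> * v t * v t * mass - \<theta> * Q (w t) * (g t - Q (w t))) (at_right 0)"
        by simp
      have "2 * v t * (g t - Q (w t)) - \<delta> / 2 * P (w t) + 2 * v t * Q (w t) + \<theta>\<^sup>2 * L * (v t)\<^sup>2 / 2
          - \<theta> * v t * v t * mass - \<theta> * Q (w t) * (g t - Q (w t)) < - \<nu> * \<Psi> t + c * (g t)\<^sup>2 + e"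
        using diss(1)[OF Q_square_le[OF sq[OF t]], of "v t" "g t"] e unfolding \<Psi>_def by linarith
      hence "\<forall>\<^sub>F h in at_right 0. B h < - \<nu> * \<Psi> t + c * (g t)\<^sup>2 + e"
        by (rule order_tendstoD(2)[OF B])
      moreover have "\<forall>\<^sub>F h::real in at_right 0. 0 < h" by (simp add: eventually_at_right_less)
      moreover have "\<forall>\<^sub>F h::real in at_right 0. h < 1" by (rule order_tendstoD(2)[OF id]) simp
      ultimately show "\<forall>\<^sub>F h in at_right 0. \<Psi> (t + h) \<le> \<Psi> t + h * (- \<nu> * \<Psi> t + c * (g t)\<^sup>2 + e)"
      proof eventually_elim
        case (elim h)
        have th: "0 \<le> t + h" using t elim by simp
        have "\<bar>w (t + h) s\<bar> \<le> V * h" if "0 < s" "s \<le> h" for s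
        proof -
          have "\<bar>integral {t+h-s..t+h} v\<bar> \<le> V * (t + h - (t + h - s))"
            unfolding real_norm_def[symmetric]
            by (rule integral_bound) (use that t elim V in \<open>auto intro!: continuous_on_subset[OF cv]\<close>)
          also have "\<dots> \<le> V * h" using that V by simp
          finally show ?thesis using layer[OF th that(1)] that t by simp
        qed
        moreover have "w (t + h) (s + h) = w t s + h * y h" if "0 < s" for s
          using shift[OF t elim(2) that] elim by (simp add: y_def)
        ultimately obtain G J r M where inc:
          "P (w (t + h)) \<le> L * (V * h)\<^sup>2 * h + P (w t) - G + 2 * (h * y h) * (Q (w t) - J) + (h * y h)\<^sup>2 * mass"
          "Q (w (t + h)) = r + Q (w t) - J + h * y h * M" "\<bar>r\<bar> \<le> L * (V * h) * h"
          "mass - L * h \<le> M" "0 \<le> M" "M \<le> mass" "J\<^sup>2 \<le> L * h * G" "G \<le> P (w t)"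
          "\<delta> * h * P (w t) \<le> (1 + \<delta> * h) * G"
          using shift_increment[OF sq[OF t] sq[OF th] elim(2), of V "h * y h"] V by (metis less_imp_le)
        have "v t + h * x h = v (t + h)" using elim by (simp add: x_def)
        hence "\<Psi> (t + h) \<le> \<Psi> t + h * B h"
          using lyapunov_step[OF elim(2) _ _ P_nonneg inc, of \<theta> "v t" "x h"] \<theta>1 V
          unfolding \<Psi>_def B_def by simp
        also have "\<dots> \<le> \<Psi> t + h * (- \<nu> * \<Psi> t + c * (g t)\<^sup>2 + e)"
          using elim by (intro add_left_mono mult_left_mono) auto
        finally show ?case .
      qed
    qed
    also have "integral {0..T} (\<lambda>r. exp (- \<nu> * (T - r)) * (c * (g r)\<^sup>2)) = c * integral {0..T} (\<lambda>r. exp (- \<nu> * (T - r)) * (g r)\<^sup>2)"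
      unfolding integral_mult_right[symmetric] by (simp add: mult.left_commute)
    finally have 1: "\<Psi> T \<le> exp (- \<nu> * T) * \<Psi> 0 + c * integral {0..T} (\<lambda>r. exp (- \<nu> * (T - r)) * (g r)\<^sup>2)" .
    have cr: "\<bar>\<theta> * v t * Q (w t)\<bar> \<le> ((v t)\<^sup>2 + P (w t)) / 2" if "0 \<le> t" for t
      using diss(2)[OF Q_square_le[OF sq[OF that]], of "v t"] .
    have I: "0 \<le> integral {0..T} (\<lambda>r. exp (- \<nu> * (T - r)) * (g r)\<^sup>2)"
      by (rule integral_nonneg) (auto intro!: integrable_continuous_real continuous_intros continuous_on_subset[OF cg])
    \<comment> \<open>The functional lies between one half and three halves of
      \<open>v\<^sup>2 + P\<close>. This accounts for the final constant: 3 = 2 * (3/2) in front of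
      the initial value, and \<open>2 * c\<close> in front of the forcing.\<close>
    have half: "x \<le> a / 2 \<Longrightarrow> a \<le> 2 * (a - x)" "- x \<le> a / 2 \<Longrightarrow> a - x \<le> 3 / 2 * a" for a x :: real
      by auto
    have "(v T)\<^sup>2 + P (w T) \<le> 2 * \<Psi> T" using abs_le_D1[OF cr[OF T]] unfolding \<Psi>_def by (rule half)
    also have "\<dots> \<le> 2 * (exp (- \<nu> * T) * \<Psi> 0) + 2 * c * integral {0..T} (\<lambda>r. exp (- \<nu> * (T - r)) * (g r)\<^sup>2)"
      using 1 by simp
    also have "exp (- \<nu> * T) * \<Psi> 0 \<le> exp (- \<nu> * T) * (3 / 2 * ((v 0)\<^sup>2 + P (w 0)))"
      using half(2)[OF abs_le_D2[OF cr[of 0]]] unfolding \<Psi>_def by (intro mult_left_mono) auto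
    also have "exp (- \<nu> * T) * (3 / 2 * ((v 0)\<^sup>2 + P (w 0))) = 3 / 2 * (exp (- \<nu> * T) * ((v 0)\<^sup>2 + P (w 0)))"
      by (rule mult.left_commute)
    finally have "(v T)\<^sup>2 + P (w T) \<le> 3 * (exp (- \<nu> * T) * ((v 0)\<^sup>2 + P (w 0))) + 2 * c * integral {0..T} (\<lambda>r. exp (- \<nu> * (T - r)) * (g r)\<^sup>2)"
      by linarith
    moreover have "0 \<le> exp (- \<nu> * T) * ((v 0)\<^sup>2 + P (w 0))" using P_nonneg by simp
    moreover have "3 * x + 2 * c * y \<le> (3 + 2 * c) * (x + y)" if "0 \<le> x" "0 \<le> y" for x y :: real
    proof -
      have "0 \<le> 2 * c * x + 3 * y" using that c by simp
      thus ?thesis by (simp add: algebra_simps)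
    qed
    ultimately show "(v T)\<^sup>2 + P (w T) \<le> (3 + 2 * c) * (exp (- \<nu> * T) * ((v 0)\<^sup>2 + P (w 0)) + integral {0..T} (\<lambda>r. exp (- \<nu> * (T - r)) * (g r)\<^sup>2))"
      using I order_trans by blast
  qed (use c \<nu> in auto)
qed

end

section \<open>The sine basis\<close>

lemma finite_bessel:
  fixes \<phi> :: "'i \<Rightarrow> 'a \<Rightarrow> real" and w :: "'a \<Rightarrow> real"
  assumes K: "finite K" and iw: "integrable M (\<lambda>x. (w x)\<^sup>2)"
    and iwk: "\<And>k. k \<in> K \<Longrightarrow> integrable M (\<lambda>x. w x * \<phi> k x)"
    and ijk: "\<And>j k. j \<in> K \<Longrightarrow> k \<in> K \<Longrightarrow> integrable M (\<lambda>x. \<phi> j x * \<phi> k x)"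
    and orth: "\<And>j k. j \<in> K \<Longrightarrow> k \<in> K \<Longrightarrow> (\<integral>x. \<phi> j x * \<phi> k x \<partial>M) = (if j = k then 1 else 0)"
  shows "(\<Sum>k\<in>K. (\<integral>x. w x * \<phi> k x \<partial>M)\<^sup>2) \<le> (\<integral>x. (w x)\<^sup>2 \<partial>M)"
proof -
  define c where "c k = (\<integral>x. w x * \<phi> k x \<partial>M)" for k
  have eq: "(w x - (\<Sum>k\<in>K. c k * \<phi> k x))\<^sup>2 =
      (w x)\<^sup>2 - 2 * (\<Sum>k\<in>K. c k * (w x * \<phi> k x)) + (\<Sum>j\<in>K. \<Sum>k\<in>K. c j * c k * (\<phi> j x * \<phi> k x))" for x
  proof -
    have "(\<Sum>k\<in>K. c k * \<phi> k x)\<^sup>2 = (\<Sum>j\<in>K. \<Sum>k\<in>K. c j * c k * (\<phi> j x * \<phi> k x))"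
      unfolding power2_eq_square sum_product by (simp add: mult_ac)
    moreover have "w x * (\<Sum>k\<in>K. c k * \<phi> k x) = (\<Sum>k\<in>K. c k * (w x * \<phi> k x))"
      by (simp add: sum_distrib_left mult_ac)
    ultimately show ?thesis by (simp add: power2_diff)
  qed
  have "0 \<le> (\<integral>x. (w x - (\<Sum>k\<in>K. c k * \<phi> k x))\<^sup>2 \<partial>M)" by (intro integral_nonneg_AE) auto
  also have "\<dots> = (\<integral>x. (w x)\<^sup>2 \<partial>M) - 2 * (\<Sum>k\<in>K. c k * c k) + (\<Sum>j\<in>K. \<Sum>k\<in>K. c j * c k * (if j = k then 1 else 0))"
    unfolding eq using iw iwk ijk
    by (simp add: orth c_def[symmetric] Bochner_Integration.integral_sum)
  also have "(\<Sum>j\<in>K. \<Sum>k\<in>K. c j * c k * (if j = k then 1 else 0)) = (\<Sum>j\<in>K. c j * c j)"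
    using K by (simp add: if_distrib cong: if_cong)
  finally show ?thesis by (simp add: c_def power2_eq_square)
qed

lemma summable_Cauchy_Schwarz:
  fixes x y :: "nat \<Rightarrow> real"
  assumes x: "summable (\<lambda>n. (x n)\<^sup>2)" and y: "summable (\<lambda>n. (y n)\<^sup>2)"
  shows "summable (\<lambda>n. \<bar>x n * y n\<bar>)"
    and "(\<Sum>n. \<bar>x n * y n\<bar>)\<^sup>2 \<le> (\<Sum>n. (x n)\<^sup>2) * (\<Sum>n. (y n)\<^sup>2)"
proof -
  let ?B = "(\<Sum>n. (x n)\<^sup>2) * (\<Sum>n. (y n)\<^sup>2)"
  have le: "(\<Sum>n<N. \<bar>x n * y n\<bar>)\<^sup>2 \<le> ?B" for N
  proof -
    have "(\<Sum>n<N. \<bar>x n * y n\<bar>)\<^sup>2 = (\<Sum>n<N. \<bar>x n\<bar> * \<bar>y n\<bar>)\<^sup>2" by (simp add: abs_mult)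
    also have "\<dots> \<le> (\<Sum>n<N. \<bar>x n\<bar>\<^sup>2) * (\<Sum>n<N. \<bar>y n\<bar>\<^sup>2)" by (rule Cauchy_Schwarz_ineq_sum)
    also have "\<dots> \<le> ?B" using x y
      by (auto intro!: mult_mono sum_le_suminf sum_nonneg suminf_nonneg)
    finally show ?thesis .
  qed
  have B0: "0 \<le> ?B" using x y by (auto intro!: mult_nonneg_nonneg suminf_nonneg)
  have le': "(\<Sum>n<N. \<bar>x n * y n\<bar>) \<le> sqrt ?B" for N
    using real_sqrt_le_mono[OF le[of N]] by (simp add: sum_nonneg)
  show s: "summable (\<lambda>n. \<bar>x n * y n\<bar>)"
    by (rule bounded_imp_summable[of _ "sqrt ?B"])
       (use le'[of "Suc _"] in \<open>auto simp del: sum.lessThan_Suc simp: lessThan_Suc_atMost[symmetric]\<close>)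
  have "(\<Sum>n. \<bar>x n * y n\<bar>) \<le> sqrt ?B" by (rule suminf_le_const[OF s le'])
  hence "(\<Sum>n. \<bar>x n * y n\<bar>)\<^sup>2 \<le> (sqrt ?B)\<^sup>2" using s by (intro power_mono suminf_nonneg) auto
  thus "(\<Sum>n. \<bar>x n * y n\<bar>)\<^sup>2 \<le> ?B" using B0 by simp
qed

text \<open>The half-lines form an intersection-stable generator of the Borel sets, and the sets
  over which \<open>H\<close> integrates to zero form a Dynkin system; the vanishing total integral
  takes care of complements.\<close>

lemma AE_zero_of_halflines:
  fixes H :: "real \<Rightarrow> real"
  assumes i: "integrable lborel H" and tot: "(\<integral>x. H x \<partial>lborel) = 0"
    and half: "\<And>x. (\<integral>y. indicator {x<..} y * H y \<partial>lborel) = 0"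
  shows "AE x in lborel. H x = 0"
proof (rule density_unique_real[OF i])
  show "integrable lborel (\<lambda>_::real. 0::real)" by simp
  fix A :: "real set" assume "A \<in> sets lborel"
  hence A: "A \<in> sigma_sets UNIV (range greaterThan)"
    using borel_Ioi by (metis sets_lborel sets_measure_of top_greatest Pow_UNIV)
  have "A \<in> sets borel \<and> (\<integral>y. indicator A y * H y \<partial>lborel) = 0"
  proof (rule sigma_sets_induct_disjoint[OF _ _ A, where P = "\<lambda>A. A \<in> sets borel \<and> (\<integral>y. indicator A y * H y \<partial>lborel) = 0"])
    show "Int_stable (range (greaterThan :: real \<Rightarrow> _))"
      by (auto simp: Int_stable_def lessThan_Int_lessThan)
  next
    fix B assume "B \<in> range (greaterThan :: real \<Rightarrow> _)"
    thus "B \<in> sets borel \<and> (\<integral>y. indicator B y * H y \<partial>lborel) = 0" using half by auto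
  next
    fix B assume B: "B \<in> sets borel \<and> (\<integral>y. indicator B y * H y \<partial>lborel) = 0"
    have iB: "integrable lborel (\<lambda>y. indicator B y * H y)"
      using integrable_mult_indicator[OF _ i, of B] B by simp
    have "(\<lambda>y. indicator (UNIV - B) y * H y) = (\<lambda>y. H y - indicator B y * H y)"
      by (auto simp: indicator_def)
    thus "UNIV - B \<in> sets borel \<and> (\<integral>y. indicator (UNIV - B) y * H y \<partial>lborel) = 0"
      using B i iB tot by (auto simp: Bochner_Integration.integral_diff)
  next
    fix F :: "nat \<Rightarrow> real set"
    assume dj: "disjoint_family F" and F: "\<And>i. F i \<in> sets borel \<and> (\<integral>y. indicator (F i) y * H y \<partial>lborel) = 0"
    have U: "\<Union>(range F) \<in> sets lborel" using F by (auto intro!: sets.countable_UN)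
    have "integrable lborel (\<lambda>x. indicator (\<Union>(range F)) x * H x)"
      using integrable_mult_indicator[OF U i] by simp
    note iU = this
    have "set_lebesgue_integral lborel (\<Union>(range F)) H = (\<Sum>i. set_lebesgue_integral lborel (F i) H)"
      by (rule lebesgue_integral_countable_add)
         (use F dj iU in \<open>auto simp: disjoint_family_on_def set_integrable_def\<close>)
    thus "\<Union> (range F) \<in> sets borel \<and> (\<integral>y. indicator (\<Union> (range F)) y * H y \<partial>lborel) = 0"
      using F by (auto simp: set_lebesgue_integral_def)
  qed auto
  thus "set_lebesgue_integral lborel A H = set_lebesgue_integral lborel A (\<lambda>_. 0)" by (simp add: set_lebesgue_integral_def)
qed

locale interval =
  fixes a b :: real
  assumes ab: "a < b"
begin

definition M :: "real measure" where "M = restrict_space lborel {a..b}"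

lemma space_M [simp]: "space M = {a..b}" by (simp add: M_def space_restrict_space)

lemma finite_measure_M: "finite_measure M"
  by (rule finite_measureI) (use ab in \<open>simp add: M_def emeasure_restrict_space space_restrict_space\<close>)

lemma LINT_M: "(LINT x:{a..b}|lborel. f x) = (\<integral>x. f x \<partial>M)" for f :: "real \<Rightarrow> real"
  by (simp add: M_def integral_restrict_space set_lebesgue_integral_def)

lemma integrable_M_iff: "integrable M f \<longleftrightarrow> set_integrable lborel {a..b} f" for f :: "real \<Rightarrow> real"
  by (simp add: M_def integrable_restrict_space set_integrable_def)

lemma measurable_M_iff: "f \<in> borel_measurable M \<longleftrightarrow> set_borel_measurable lborel {a..b} f" for f :: "real \<Rightarrow> real"
  unfolding M_def set_borel_measurable_def by (subst borel_measurable_restrict_space_iff) auto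

lemma L2_iff: "u \<in> L2 a b \<longleftrightarrow> u \<in> borel_measurable M \<and> integrable M (\<lambda>x. (u x)\<^sup>2)"
  by (simp add: L2_def integrable_M_iff measurable_M_iff)

lemma innerL2_M: "innerL2 a b u v = (\<integral>x. u x * v x \<partial>M)"
  by (simp add: innerL2_def LINT_M)

lemma continuous_measurable_M: "continuous_on {a..b} f \<Longrightarrow> f \<in> borel_measurable M" for f :: "real \<Rightarrow> real"
  unfolding measurable_M_iff set_borel_measurable_def
  using borel_measurable_continuous_on_indicator[of "{a..b}" f] by simp

lemma continuous_integrable_M: "continuous_on {a..b} f \<Longrightarrow> integrable M f" for f :: "real \<Rightarrow> real"
  unfolding integrable_M_iff by (rule borel_integrable_atLeastAtMost')

lemma continuous_L2: "continuous_on {a..b} u \<Longrightarrow> u \<in> L2 a b"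
  unfolding L2_iff by (auto intro!: continuous_measurable_M continuous_integrable_M continuous_intros)

lemma L2_mult_integrable:
  assumes "u \<in> L2 a b" "v \<in> L2 a b" shows "integrable M (\<lambda>x. u x * v x)"
proof (rule Bochner_Integration.integrable_bound)
  show "integrable M (\<lambda>x. (u x)\<^sup>2 + (v x)\<^sup>2)" using assms by (auto simp: L2_iff)
  show "(\<lambda>x. u x * v x) \<in> borel_measurable M" using assms by (auto simp: L2_iff)
  have "\<bar>u x * v x\<bar> \<le> (u x)\<^sup>2 + (v x)\<^sup>2" for x
  proof -
    have "0 \<le> (\<bar>u x\<bar> - \<bar>v x\<bar>)\<^sup>2" by simp
    hence "2 * \<bar>u x * v x\<bar> \<le> (u x)\<^sup>2 + (v x)\<^sup>2" by (simp add: power2_eq_square algebra_simps abs_mult)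
    thus ?thesis using abs_ge_zero[of "u x * v x"] by linarith
  qed
  thus "AE x in M. norm (u x * v x) \<le> norm ((u x)\<^sup>2 + (v x)\<^sup>2)" by auto
qed

lemma L2_integrable: "u \<in> L2 a b \<Longrightarrow> integrable M u"
  using L2_mult_integrable[of u "\<lambda>_. 1"] continuous_L2[of "\<lambda>_. 1"] by simp

lemma L2_diff: assumes "u \<in> L2 a b" "v \<in> L2 a b" shows "(\<lambda>x. u x - v x) \<in> L2 a b"
proof -
  have "(\<lambda>x. (u x - v x)\<^sup>2) = (\<lambda>x. (u x)\<^sup>2 - 2 * (u x * v x) + (v x)\<^sup>2)"
    by (simp add: power2_diff mult.assoc fun_eq_iff)
  moreover have "integrable M (\<lambda>x. (u x)\<^sup>2 - 2 * (u x * v x) + (v x)\<^sup>2)"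
    using assms L2_mult_integrable[OF assms] by (auto simp: L2_iff)
  ultimately show ?thesis using assms by (auto simp: L2_iff)
qed

lemma integral_M_FTC:
  fixes F f :: "real \<Rightarrow> real"
  assumes "\<And>x. (F has_real_derivative f x) (at x)" "continuous_on {a..b} f"
  shows "(\<integral>x. f x \<partial>M) = F b - F a"
proof -
  have "(f has_integral F b - F a) {a..b}"
    using assms(1) ab by (intro fundamental_theorem_of_calculus)
      (auto simp: has_real_derivative_iff_has_vector_derivative[symmetric] intro: has_field_derivative_at_within)
  hence "integral {a..b} f = F b - F a" by (rule integral_unique)
  thus ?thesis using set_borel_integral_eq_integral(2)[OF borel_integrable_atLeastAtMost'[OF assms(2)]]
    by (simp add: LINT_M)
qed

definition ang :: "real \<Rightarrow> real" where "ang x = pi * (x - a) / (b - a)"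

lemma ang_simps: "ang a = 0" "ang b = pi" using ab by (auto simp: ang_def)

lemma ang_deriv: "(ang has_real_derivative pi / (b - a)) (at x)"
  unfolding ang_def using ab by (auto intro!: derivative_eq_intros)

lemma ang_cont: "continuous_on S ang" unfolding ang_def using ab by (intro continuous_intros) auto

lemma ek_ang: "ek a b k x = sqrt (2 / (b - a)) * sin (real k * ang x)"
  by (simp add: ek_def ang_def mult.assoc)

lemma dek_ang: "dek a b k x = sqrt (2 / (b - a)) * (real k * pi / (b - a)) * cos (real k * ang x)"
  by (simp add: dek_def ang_def mult.assoc)

lemma ek_cont: "continuous_on S (ek a b k)" and dek_cont: "continuous_on S (dek a b k)"
  unfolding ek_ang dek_ang by (intro continuous_intros ang_cont)+

lemma ek_L2: "ek a b k \<in> L2 a b" and dek_L2: "dek a b k \<in> L2 a b"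
  by (intro continuous_L2 ek_cont dek_cont)+

lemma ek_deriv: "(ek a b k has_real_derivative dek a b k x) (at x)"
  unfolding ek_ang dek_ang by (rule derivative_eq_intros ang_deriv refl | simp)+

lemma ek_ends: "ek a b k a = 0" "ek a b k b = 0"
  by (auto simp: ek_ang ang_simps sin_npi)

lemma ek_abs_le: "\<bar>ek a b k x\<bar> \<le> sqrt (2 / (b - a))"
proof -
  have "sqrt (2 / (b - a)) * \<bar>sin (real k * ang x)\<bar> \<le> sqrt (2 / (b - a)) * 1"
    using ab by (intro mult_left_mono) auto
  thus ?thesis using ab by (simp add: ek_ang abs_mult)
qed

lemma lam_pos: "0 < k \<Longrightarrow> 0 < lam a b k" using ab by (simp add: lam_def)

lemma lam_nonneg: "0 \<le> lam a b k" by (simp add: lam_def)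

lemma lam_mono: "j \<le> k \<Longrightarrow> lam a b j \<le> lam a b k"
  unfolding lam_def using ab by (intro power_mono divide_right_mono mult_right_mono) auto

lemma integral_cos_ang: "(\<integral>x. cos (real_of_int n * ang x) \<partial>M) = (if n = 0 then b - a else 0)"
proof (cases "n = 0")
  case True
  have "(\<integral>x. 1 \<partial>M) = b - a"
    using integral_M_FTC[of "\<lambda>x. x" "\<lambda>_. 1"] by (simp add: DERIV_ident)
  thus ?thesis using True by simp
next
  case False
  define F where "F x = (b - a) / (real_of_int n * pi) * sin (real_of_int n * ang x)" for x
  have "(F has_real_derivative cos (real_of_int n * ang x)) (at x)" for x
    unfolding F_def using False ab by (auto intro!: derivative_eq_intros ang_deriv)
  moreover have "continuous_on {a..b} (\<lambda>x. cos (real_of_int n * ang x))"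
    by (intro continuous_intros ang_cont)
  ultimately have "(\<integral>x. cos (real_of_int n * ang x) \<partial>M) = F b - F a" by (rule integral_M_FTC)
  also have "\<dots> = 0" by (simp add: F_def ang_simps sin_int_times_real mult.commute)
  finally show ?thesis using False by simp
qed

lemma integrable_cos_ang: "integrable M (\<lambda>x. cos (real_of_int n * ang x))"
  by (intro continuous_integrable_M continuous_intros ang_cont)

lemma sin_sin_orth: assumes "1 \<le> j" "1 \<le> k"
  shows "(\<integral>x. ek a b j x * ek a b k x \<partial>M) = (if j = k then 1 else 0)"
proof -
  have "ek a b j x * ek a b k x = 1 / (b - a) * (cos (real_of_int (int j - int k) * ang x) - cos (real_of_int (int j + int k) * ang x))" for x
  proof -
    have "ek a b j x * ek a b k x = (sqrt (2 / (b - a)))\<^sup>2 * (sin (real j * ang x) * sin (real k * ang x))"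
      unfolding ek_ang power2_eq_square by (simp only: mult_ac)
    also have "\<dots> = 2 / (b - a) * (sin (real j * ang x) * sin (real k * ang x))" using ab by simp
    also have "\<dots> = 1 / (b - a) * (cos (real j * ang x - real k * ang x) - cos (real j * ang x + real k * ang x))"
      using ab by (simp add: sin_times_sin field_simps)
    finally show ?thesis by (simp add: algebra_simps)
  qed
  hence "(\<integral>x. ek a b j x * ek a b k x \<partial>M) = 1 / (b - a) * ((\<integral>x. cos (real_of_int (int j - int k) * ang x) \<partial>M) - (\<integral>x. cos (real_of_int (int j + int k) * ang x) \<partial>M))"
    by (simp only: integral_mult_right_zero Bochner_Integration.integral_diff[OF integrable_cos_ang integrable_cos_ang])
  also have "\<dots> = (if j = k then 1 else 0)"
    using assms ab unfolding integral_cos_ang by auto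
  finally show ?thesis .
qed

lemma cos_cos_orth: assumes "1 \<le> j" "1 \<le> k"
  shows "(\<integral>x. dek a b j x * dek a b k x \<partial>M) = (if j = k then lam a b k else 0)"
proof -
  define c where "c = (real j * pi / (b - a)) * (real k * pi / (b - a)) / (b - a)"
  have "dek a b j x * dek a b k x = c * (cos (real_of_int (int j - int k) * ang x) + cos (real_of_int (int j + int k) * ang x))" for x
  proof -
    have "dek a b j x * dek a b k x = (sqrt (2 / (b - a)))\<^sup>2 * ((real j * pi / (b - a)) * (real k * pi / (b - a))) * (cos (real j * ang x) * cos (real k * ang x))"
      unfolding dek_ang power2_eq_square by (simp only: mult_ac)
    also have "\<dots> = 2 * c * (cos (real j * ang x) * cos (real k * ang x))" using ab by (simp add: c_def)
    also have "\<dots> = c * (cos (real j * ang x - real k * ang x) + cos (real j * ang x + real k * ang x))"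
      by (simp add: cos_times_cos)
    finally show ?thesis by (simp add: algebra_simps)
  qed
  hence "(\<integral>x. dek a b j x * dek a b k x \<partial>M) = c * ((\<integral>x. cos (real_of_int (int j - int k) * ang x) \<partial>M) + (\<integral>x. cos (real_of_int (int j + int k) * ang x) \<partial>M))"
    by (simp only: integral_mult_right_zero Bochner_Integration.integral_add[OF integrable_cos_ang integrable_cos_ang])
  also have "\<dots> = (if j = k then lam a b k else 0)"
    using assms ab unfolding integral_cos_ang by (auto simp: c_def lam_def power2_eq_square)
  finally show ?thesis .
qed

lemma coef_M: "coef a b u k = (\<integral>x. u x * ek a b k x \<partial>M)"
  by (simp add: coef_def innerL2_M)

lemma coef_diff: assumes "u \<in> L2 a b" "v \<in> L2 a b"
  shows "coef a b (\<lambda>x. u x - v x) k = coef a b u k - coef a b v k"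
  unfolding coef_M using L2_mult_integrable[OF assms(1) ek_L2] L2_mult_integrable[OF assms(2) ek_L2]
  by (simp add: left_diff_distrib)

lemma bessel_sin: assumes "w \<in> L2 a b"
  shows "(\<Sum>n<N. (coef a b w (Suc n))\<^sup>2) \<le> (\<integral>x. (w x)\<^sup>2 \<partial>M)"
  unfolding coef_M
  by (rule finite_bessel)
     (use assms in \<open>auto simp: L2_iff sin_sin_orth intro!: L2_mult_integrable ek_L2\<close>)

text \<open>Divided by the square roots of the eigenvalues, the derivatives of the basis functions
  form an orthonormal cosine system. Fluxes weighted by the inverse eigenvalue are thus controlled
  by a mere L2 norm.\<close>

lemma bessel_cos: assumes "w \<in> L2 a b"
  shows "(\<Sum>n<N. (innerL2 a b w (dek a b (Suc n)))\<^sup>2 / lam a b (Suc n)) \<le> (\<integral>x. (w x)\<^sup>2 \<partial>M)"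
proof -
  define \<phi> where "\<phi> n x = dek a b (Suc n) x / sqrt (lam a b (Suc n))" for n x
  have l: "0 < lam a b (Suc n)" for n by (rule lam_pos) simp
  have "(\<Sum>n<N. (\<integral>x. w x * \<phi> n x \<partial>M)\<^sup>2) \<le> (\<integral>x. (w x)\<^sup>2 \<partial>M)"
  proof (rule finite_bessel)
    fix j k
    have "(\<integral>x. \<phi> j x * \<phi> k x \<partial>M) = (\<integral>x. dek a b (Suc j) x * dek a b (Suc k) x \<partial>M) / (sqrt (lam a b (Suc j)) * sqrt (lam a b (Suc k)))"
      by (simp add: \<phi>_def)
    also have "\<dots> = (if j = k then 1 else 0)" using l[of k] by (auto simp: cos_cos_orth)
    finally show "(\<integral>x. \<phi> j x * \<phi> k x \<partial>M) = (if j = k then 1 else 0)" .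
    show "integrable M (\<lambda>x. \<phi> j x * \<phi> k x)"
      unfolding \<phi>_def by (intro continuous_integrable_M continuous_intros dek_cont) (use l[of j] l[of k] in auto)
    show "integrable M (\<lambda>x. w x * \<phi> k x)"
      unfolding \<phi>_def using L2_mult_integrable[OF assms dek_L2] by simp
  qed (use assms in \<open>auto simp: L2_iff\<close>)
  moreover have "(\<integral>x. w x * \<phi> n x \<partial>M)\<^sup>2 = (innerL2 a b w (dek a b (Suc n)))\<^sup>2 / lam a b (Suc n)" for n
    using l[of n] by (simp add: \<phi>_def innerL2_M power_divide)
  ultimately show ?thesis by simp
qed

lemma continuous_mult_integrable:
  fixes h \<phi> :: "real \<Rightarrow> real"
  assumes h: "integrable M h" and c: "continuous_on {a..b} \<phi>"
  shows "integrable M (\<lambda>x. h x * \<phi> x)"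
proof -
  have "bounded (\<phi> ` {a..b})" by (intro compact_imp_bounded compact_continuous_image c compact_Icc)
  then obtain B where B: "\<forall>x\<in>{a..b}. \<bar>\<phi> x\<bar> \<le> B" "0 < B" by (auto simp: bounded_pos)
  have [measurable]: "h \<in> borel_measurable M" "\<phi> \<in> borel_measurable M"
    using h continuous_measurable_M[OF c] by auto
  show ?thesis
  proof (rule Bochner_Integration.integrable_bound)
    show "integrable M (\<lambda>x. B * h x)" using h by simp
    show "AE x in M. norm (h x * \<phi> x) \<le> norm (B * h x)"
    proof (rule AE_I2)
      fix x assume "x \<in> space M"
      hence "\<bar>\<phi> x\<bar> \<le> B" using B by auto
      hence "\<bar>h x\<bar> * \<bar>\<phi> x\<bar> \<le> \<bar>h x\<bar> * B" by (intro mult_left_mono) auto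
      thus "norm (h x * \<phi> x) \<le> norm (B * h x)" using B by (simp add: abs_mult mult.commute)
    qed
  qed measurable
qed

text \<open>Steep ramps starting at \<open>x\<close> converge pointwise to the indicator of the
  half-line beyond \<open>x\<close>, so dominated convergence reduces the claim to
  half-lines.\<close>

lemma AE_zero_of_continuous_tests:
  fixes h :: "real \<Rightarrow> real"
  assumes h: "integrable M h"
    and tests: "\<And>\<phi>. continuous_on {a..b} \<phi> \<Longrightarrow> (\<integral>x. h x * \<phi> x \<partial>M) = 0"
  shows "AE x in M. h x = 0"
proof -
  define H where "H x = indicator {a..b} x * h x" for x
  have iH: "integrable lborel H"
    using h by (simp add: H_def[abs_def] M_def integrable_restrict_space)
  have eqH: "(\<integral>x. H x * g x \<partial>lborel) = (\<integral>x. h x * g x \<partial>M)" for g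
    by (simp add: H_def M_def integral_restrict_space mult.assoc)
  have "AE x in lborel. H x = 0"
  proof (rule AE_zero_of_halflines[OF iH])
    show "(\<integral>x. H x \<partial>lborel) = 0" using eqH[of "\<lambda>_. 1"] tests[of "\<lambda>_. 1"] by simp
  next
    fix x :: real
    define g where "g n y = min 1 (max 0 (real n * (y - x)))" for n y
    have "(\<lambda>n. \<integral>y. H y * g n y \<partial>lborel) \<longlonglongrightarrow> (\<integral>y. indicator {x<..} y * H y \<partial>lborel)"
    proof (rule integral_dominated_convergence[where w = "\<lambda>y. \<bar>H y\<bar>"])
      have [measurable]: "H \<in> borel_measurable borel" using iH by auto
      show "(\<lambda>y. indicator {x<..} y * H y) \<in> borel_measurable lborel" by measurable
      show "(\<lambda>y. H y * g n y) \<in> borel_measurable lborel" for n unfolding g_def by measurable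
      show "integrable lborel (\<lambda>y. \<bar>H y\<bar>)" using iH by simp
      show "AE y in lborel. norm (H y * g n y) \<le> \<bar>H y\<bar>" for n
        by (rule AE_I2) (auto simp: abs_mult g_def intro!: mult_left_le)
      show "AE y in lborel. (\<lambda>n. H y * g n y) \<longlonglongrightarrow> indicator {x<..} y * H y"
      proof (rule AE_I2)
        fix y
        have "(\<lambda>n. g n y) \<longlonglongrightarrow> indicator {x<..} y"
        proof (cases "x < y")
          case True
          have "\<forall>\<^sub>F n in sequentially. 1 / (y - x) \<le> real n"
            using filterlim_real_sequentially by (auto simp: filterlim_at_top)
          hence "\<forall>\<^sub>F n in sequentially. indicator {x<..} y = g n y"
            by eventually_elim (use True in \<open>auto simp: g_def field_simps min_def max_def\<close>)
          thus ?thesis by (rule Lim_transform_eventually[OF tendsto_const])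
        next
          case False
          hence "real n * (y - x) \<le> 0" for n by (auto intro: mult_nonneg_nonpos)
          hence "g n y = 0" for n by (simp add: g_def max_absorb1)
          thus ?thesis using False by simp
        qed
        from tendsto_mult_left[OF this, of "H y"]
        show "(\<lambda>n. H y * g n y) \<longlonglongrightarrow> indicator {x<..} y * H y" by (simp add: mult.commute)
      qed
    qed
    moreover have "(\<integral>y. H y * g n y \<partial>lborel) = 0" for n
      unfolding eqH by (rule tests) (auto simp: g_def intro!: continuous_intros)
    ultimately show "(\<integral>y. indicator {x<..} y * H y \<partial>lborel) = 0"
      using LIMSEQ_unique tendsto_const by (simp add: LIMSEQ_const_iff)
  qed
  hence "AE x in lborel. x \<in> {a..b} \<longrightarrow> h x = 0" by eventually_elim (auto simp: H_def)
  thus ?thesis unfolding M_def by (subst AE_restrict_space_iff) auto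
qed

text \<open>Multiplying a sine by the cosine of the angle shifts its frequency by one in both directions, so
vanishing sine coefficients make all moments against sine times powers of the cosine vanish; those
powers span a dense set because the cosine is injective on the interval.\<close>

lemma AE_zero_of_coef_zero:
  assumes d: "d \<in> L2 a b" and z: "\<And>k. 1 \<le> k \<Longrightarrow> coef a b d k = 0"
  shows "AE x in M. d x = 0"
proof -
  have id: "integrable M d" by (rule L2_integrable[OF d])
  have cs: "continuous_on S (\<lambda>x. sin (real k * ang x))" for k S by (intro continuous_intros ang_cont)
  \<comment> \<open>The induction on the power runs over all frequencies at once, since raising the
    power by one involves both neighbouring frequencies.\<close>
  have pw: "(\<integral>x. d x * (sin (real k * ang x) * cos (ang x) ^ j) \<partial>M) = 0" for j k
  proof (induction j arbitrary: k)
    case 0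
    show ?case
    proof (cases "k = 0")
      case False
      hence True: "1 \<le> k" by simp
      have "sqrt (2 / (b - a)) * (\<integral>x. d x * sin (real k * ang x) \<partial>M) = coef a b d k"
        unfolding coef_M ek_ang mult.left_commute[of "d _"] by simp
      thus ?thesis using z[OF True] ab by simp
    qed simp
  next
    case (Suc j)
    define c where "c k x = d x * (sin (real k * ang x) * cos (ang x) ^ j)" for k x
    have ic: "integrable M (c k)" for k unfolding c_def
      by (intro continuous_mult_integrable id continuous_intros ang_cont)
    show ?case
    proof (cases k)
      case (Suc k')
      have "d x * (sin (real k * ang x) * cos (ang x) ^ Suc j) = 1 / 2 * c (Suc k) x + 1 / 2 * c k' x" for x
      proof -
        have "sin (real k * ang x) * cos (ang x) = 1 / 2 * sin (real (Suc k) * ang x) + 1 / 2 * sin (real k' * ang x)"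
          using sin_times_cos[of "real k * ang x" "ang x"] Suc by (simp add: algebra_simps)
        hence "d x * (sin (real k * ang x) * cos (ang x) ^ Suc j) = d x * ((1 / 2 * sin (real (Suc k) * ang x) + 1 / 2 * sin (real k' * ang x)) * cos (ang x) ^ j)"
          by (simp add: mult.assoc[symmetric])
        thus ?thesis unfolding c_def by (simp add: algebra_simps)
      qed
      hence "(\<integral>x. d x * (sin (real k * ang x) * cos (ang x) ^ Suc j) \<partial>M) = (\<integral>x. 1 / 2 * c (Suc k) x + 1 / 2 * c k' x \<partial>M)"
        by (intro Bochner_Integration.integral_cong) auto
      also have "\<dots> = 0" using ic Suc.IH by (simp add: c_def[symmetric])
      finally show ?thesis .
    qed simp
  qed
  \<comment> \<open>The factor is the sine of frequency one, so moments of \<open>h\<close> against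
    powers of the cosine are covered by \<open>pw\<close>. It vanishes only at the end points, hence
    can be divided out almost everywhere at the end.\<close>
  define h where "h x = d x * sin (ang x)" for x
  have ih: "integrable M h" unfolding h_def using continuous_mult_integrable[OF id cs[of _ 1]] by simp
  have "AE x in M. h x = 0"
  proof (rule AE_zero_of_continuous_tests[OF ih])
    fix \<phi> :: "real \<Rightarrow> real" assume \<phi>: "continuous_on {a..b} \<phi>"
    \<comment> \<open>The test function written in the variable \<open>y = cos (ang x)\<close>, so
      that polynomial approximation on \<open>{-1..1}\<close> produces powers of the cosine.\<close>
    define \<psi> where "\<psi> y = \<phi> (a + (b - a) * arccos y / pi)" for y
    have rng: "a + (b - a) * arccos y / pi \<in> {a..b}" if "y \<in> {-1..1}" for y
    proof -
      have "0 \<le> arccos y" "arccos y \<le> pi" using that by (auto intro: arccos_lbound arccos_ubound)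
      hence "0 \<le> (b - a) * arccos y / pi" "(b - a) * arccos y / pi \<le> b - a"
        using ab mult_left_mono[of "arccos y" pi "b - a"] by (auto simp: pos_divide_le_eq)
      thus ?thesis by auto
    qed
    have c\<psi>: "continuous_on {-1..1} \<psi>" unfolding \<psi>_def
      by (rule continuous_on_compose2[OF \<phi>]) (use rng in \<open>auto intro!: continuous_intros continuous_on_arccos'\<close>)
    have \<psi>\<phi>: "\<psi> (cos (ang x)) = \<phi> x" if "x \<in> {a..b}" for x
    proof -
      have "0 \<le> ang x" "ang x \<le> pi" using that ab by (auto simp: ang_def field_simps)
      hence "arccos (cos (ang x)) = ang x" by (rule arccos_cos)
      thus ?thesis using ab by (simp add: \<psi>_def ang_def)
    qed
    have "\<bar>\<integral>x. h x * \<phi> x \<partial>M\<bar> \<le> e * (\<integral>x. \<bar>h x\<bar> \<partial>M)" if e: "0 < e" for e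
    proof -
      obtain p where p: "real_polynomial_function p" "\<And>y. y \<in> {-1..1} \<Longrightarrow> \<bar>\<psi> y - p y\<bar> < e"
        using Stone_Weierstrass_real_polynomial_function[OF compact_Icc c\<psi> e] by blast
      then obtain q n where q: "p = (\<lambda>y. \<Sum>i\<le>n. q i * y ^ i)"
        using real_polynomial_function_iff_sum by auto
      have cp: "continuous_on {a..b} (\<lambda>x. p (cos (ang x)))" unfolding q
        by (intro continuous_intros ang_cont)
      have "(\<integral>x. h x * p (cos (ang x)) \<partial>M) = (\<integral>x. (\<Sum>i\<le>n. q i * (d x * (sin (real 1 * ang x) * cos (ang x) ^ i))) \<partial>M)"
        unfolding h_def q by (intro Bochner_Integration.integral_cong) (auto simp: sum_distrib_left mult_ac)
      also have "\<dots> = (\<Sum>i\<le>n. \<integral>x. q i * (d x * (sin (real 1 * ang x) * cos (ang x) ^ i)) \<partial>M)"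
        by (rule Bochner_Integration.integral_sum, rule integrable_mult_right, rule continuous_mult_integrable[OF id])
           (intro continuous_intros ang_cont)
      also have "\<dots> = 0" by (simp only: integral_mult_right_zero pw) simp
      finally have p0: "(\<integral>x. h x * p (cos (ang x)) \<partial>M) = 0" .
      have i1: "integrable M (\<lambda>x. h x * \<phi> x)" "integrable M (\<lambda>x. h x * p (cos (ang x)))"
        by (intro continuous_mult_integrable ih \<phi> cp)+
      have "\<bar>\<integral>x. h x * \<phi> x \<partial>M\<bar> = \<bar>\<integral>x. h x * \<phi> x - h x * p (cos (ang x)) \<partial>M\<bar>"
        using i1 p0 by simp
      also have "\<dots> \<le> (\<integral>x. \<bar>h x * \<phi> x - h x * p (cos (ang x))\<bar> \<partial>M)" by (rule integral_abs_bound)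
      also have "\<dots> \<le> (\<integral>x. e * \<bar>h x\<bar> \<partial>M)"
      proof (rule integral_mono)
        fix x assume "x \<in> space M"
        hence x: "x \<in> {a..b}" by simp
        have "\<bar>\<phi> x - p (cos (ang x))\<bar> \<le> e" using p(2)[of "cos (ang x)"] \<psi>\<phi>[OF x] by auto
        hence "\<bar>h x\<bar> * \<bar>\<phi> x - p (cos (ang x))\<bar> \<le> \<bar>h x\<bar> * e" by (intro mult_left_mono) auto
        thus "\<bar>h x * \<phi> x - h x * p (cos (ang x))\<bar> \<le> e * \<bar>h x\<bar>"
          unfolding right_diff_distrib[symmetric] abs_mult by (simp only: mult.commute)
      qed (use i1 ih in auto)
      finally show ?thesis by simp
    qed
    note le = this
    show "(\<integral>x. h x * \<phi> x \<partial>M) = 0"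
    proof (rule ccontr)
      assume n: "(\<integral>x. h x * \<phi> x \<partial>M) \<noteq> 0"
      let ?I = "\<integral>x. \<bar>h x\<bar> \<partial>M"
      have I: "0 \<le> ?I" by (intro integral_nonneg_AE) auto
      \<comment> \<open>The tolerance is half the value to be excluded, divided by
        \<open>?I + 1\<close>; the added 1 keeps the denominator positive even if \<open>h\<close>
        vanishes.\<close>
      have "\<bar>\<integral>x. h x * \<phi> x \<partial>M\<bar> \<le> (\<bar>\<integral>x. h x * \<phi> x \<partial>M\<bar> / (2 * (?I + 1))) * ?I"
        by (intro le divide_pos_pos mult_pos_pos add_nonneg_pos I) (use n in auto)
      also have "\<dots> \<le> \<bar>\<integral>x. h x * \<phi> x \<partial>M\<bar> / 2"
      proof -
        have "\<bar>\<integral>x. h x * \<phi> x \<partial>M\<bar> * ?I \<le> \<bar>\<integral>x. h x * \<phi> x \<partial>M\<bar> * (?I + 1)" by (intro mult_left_mono) auto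
        moreover have "0 < ?I + 1" by (intro add_nonneg_pos I) simp
        ultimately show ?thesis by (simp add: divide_simps distrib_left mult.commute mult.left_commute)
      qed
      finally show False using n by simp
    qed
  qed
  moreover have "AE x in M. x \<noteq> a \<and> x \<noteq> b"
  proof -
    have "AE x in lborel. x \<noteq> a \<and> x \<noteq> b" using AE_lborel_singleton[of a] AE_lborel_singleton[of b] by auto
    thus ?thesis unfolding M_def by (subst AE_restrict_space_iff) auto
  qed
  moreover have "AE x in M. x \<in> {a..b}" by (rule AE_I2) simp
  ultimately show ?thesis
  proof eventually_elim
    case (elim x)
    hence "0 < ang x" "ang x < pi" using ab by (auto simp: ang_def field_simps)
    hence "sin (ang x) \<noteq> 0" using sin_gt_zero by fastforce
    thus ?case using elim by (simp add: h_def)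
  qed
qed

section \<open>Sine series of finite energy, the sup-norm embedding and Parseval's identity\<close>

definition fser :: "(nat \<Rightarrow> real) \<Rightarrow> real \<Rightarrow> real" where
  "fser c x = (\<Sum>n. c n * ek a b (Suc n) x)"

text \<open>A constant for the embedding of the energy space into bounded functions, in squared
  form: \<open>(u x)\<^sup>2 \<le> sob * \<parallel>u\<parallel>\<^sub>1\<^sup>2\<close> almost
  everywhere.\<close>

definition sob :: real where
  "sob = 2 / (b - a) * (\<Sum>n. 1 / lam a b (Suc n))"

lemma summable_inverse_lam: "summable (\<lambda>n. 1 / lam a b (Suc n))"
proof -
  have "summable (\<lambda>n. 1 / (real (Suc n))\<^sup>2)"
    using inverse_squares_sums by (simp add: sums_iff add.commute)
  hence "summable (\<lambda>n. ((b - a) / pi)\<^sup>2 * (1 / (real (Suc n))\<^sup>2))" by (rule summable_mult)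
  moreover have "((b - a) / pi)\<^sup>2 * (1 / (real (Suc n))\<^sup>2) = 1 / lam a b (Suc n)" for n
    using ab by (simp add: lam_def power_divide power_mult_distrib)
  ultimately show ?thesis by simp
qed

lemma sob_nonneg: "0 \<le> sob"
  unfolding sob_def using ab summable_inverse_lam lam_nonneg
  by (intro mult_nonneg_nonneg suminf_nonneg) auto

text \<open>Cauchy-Schwarz after splitting each coefficient by the square root of the eigenvalue.
  The summability of the inverse eigenvalues is where one space dimension enters.\<close>

lemma coefs_abs_summable:
  assumes "summable (\<lambda>n. lam a b (Suc n) * (c n)\<^sup>2)"
  shows "summable (\<lambda>n. \<bar>c n\<bar>)"
    and "2 / (b - a) * (\<Sum>n. \<bar>c n\<bar>)\<^sup>2 \<le> sob * (\<Sum>n. lam a b (Suc n) * (c n)\<^sup>2)"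
proof -
  define x where "x n = sqrt (lam a b (Suc n)) * c n" for n
  define y where "y n = 1 / sqrt (lam a b (Suc n))" for n
  have l: "0 < lam a b (Suc n)" for n by (rule lam_pos) simp
  have xy: "\<bar>x n * y n\<bar> = \<bar>c n\<bar>" for n using l[of n] by (simp add: x_def y_def)
  have x2: "(x n)\<^sup>2 = lam a b (Suc n) * (c n)\<^sup>2" for n using l[of n] by (simp add: x_def power_mult_distrib)
  have y2: "(y n)\<^sup>2 = 1 / lam a b (Suc n)" for n using l[of n] by (simp add: y_def power_divide)
  have "summable (\<lambda>n. (x n)\<^sup>2)" "summable (\<lambda>n. (y n)\<^sup>2)"
    unfolding x2 y2 by (rule assms summable_inverse_lam)+
  note CS = summable_Cauchy_Schwarz[OF this, unfolded xy x2 y2]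
  show "summable (\<lambda>n. \<bar>c n\<bar>)" by (rule CS(1))
  have "2 / (b - a) * (\<Sum>n. \<bar>c n\<bar>)\<^sup>2 \<le> 2 / (b - a) * ((\<Sum>n. lam a b (Suc n) * (c n)\<^sup>2) * (\<Sum>n. 1 / lam a b (Suc n)))"
    using CS(2) ab by (intro mult_left_mono) auto
  thus "2 / (b - a) * (\<Sum>n. \<bar>c n\<bar>)\<^sup>2 \<le> sob * (\<Sum>n. lam a b (Suc n) * (c n)\<^sup>2)"
    by (simp add: sob_def mult_ac)
qed

context
  fixes c :: "nat \<Rightarrow> real"
  assumes c: "summable (\<lambda>n. lam a b (Suc n) * (c n)\<^sup>2)"
begin

lemma fser_term_le: "\<bar>c n * ek a b (Suc n) x\<bar> \<le> sqrt (2 / (b - a)) * \<bar>c n\<bar>"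
proof -
  have "\<bar>c n\<bar> * \<bar>ek a b (Suc n) x\<bar> \<le> \<bar>c n\<bar> * sqrt (2 / (b - a))"
    by (intro mult_left_mono ek_abs_le) auto
  thus ?thesis by (simp add: abs_mult mult.commute)
qed

lemma fser_majorant_summable: "summable (\<lambda>n. sqrt (2 / (b - a)) * \<bar>c n\<bar>)"
  by (intro summable_mult coefs_abs_summable(1)[OF c])

lemma fser_summable: "summable (\<lambda>n. \<bar>c n * ek a b (Suc n) x\<bar>)"
  by (rule summable_comparison_test'[OF fser_majorant_summable]) (use fser_term_le in auto)

lemma fser_partial_abs_le: "\<bar>\<Sum>n<N. c n * ek a b (Suc n) x\<bar> \<le> sqrt (2 / (b - a)) * (\<Sum>n. \<bar>c n\<bar>)"
proof -
  have "\<bar>\<Sum>n<N. c n * ek a b (Suc n) x\<bar> \<le> (\<Sum>n<N. \<bar>c n * ek a b (Suc n) x\<bar>)" by (rule sum_abs)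
  also have "\<dots> \<le> (\<Sum>n<N. sqrt (2 / (b - a)) * \<bar>c n\<bar>)" by (intro sum_mono fser_term_le)
  also have "\<dots> \<le> (\<Sum>n. sqrt (2 / (b - a)) * \<bar>c n\<bar>)"
    by (rule sum_le_suminf[OF fser_majorant_summable]) (use ab in auto)
  also have "\<dots> = sqrt (2 / (b - a)) * (\<Sum>n. \<bar>c n\<bar>)"
    by (rule suminf_mult[OF coefs_abs_summable(1)[OF c]])
  finally show ?thesis .
qed

lemma fser_partial_square_le:
  "(\<Sum>n<N. c n * ek a b (Suc n) x)\<^sup>2 \<le> sob * (\<Sum>n. lam a b (Suc n) * (c n)\<^sup>2)"
proof -
  have "\<bar>\<Sum>n<N. c n * ek a b (Suc n) x\<bar>\<^sup>2 \<le> (sqrt (2 / (b - a)) * (\<Sum>n. \<bar>c n\<bar>))\<^sup>2"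
    by (intro power_mono fser_partial_abs_le) auto
  also have "\<dots> = 2 / (b - a) * (\<Sum>n. \<bar>c n\<bar>)\<^sup>2"
    using ab by (simp add: power_mult_distrib)
  also have "\<dots> \<le> sob * (\<Sum>n. lam a b (Suc n) * (c n)\<^sup>2)" by (rule coefs_abs_summable(2)[OF c])
  finally show ?thesis by simp
qed

lemma fser_lim: "(\<lambda>N. \<Sum>n<N. c n * ek a b (Suc n) x) \<longlonglongrightarrow> fser c x"
  unfolding fser_def using summable_LIMSEQ summable_rabs_cancel[OF fser_summable] by blast

lemma fser_square_le: "(fser c x)\<^sup>2 \<le> sob * (\<Sum>n. lam a b (Suc n) * (c n)\<^sup>2)"
  by (rule LIMSEQ_le_const2[OF tendsto_power[OF fser_lim]]) (use fser_partial_square_le in auto)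

lemma fser_cont: "continuous_on S (fser c)"
proof -
  have "uniform_limit S (\<lambda>N x. \<Sum>n<N. c n * ek a b (Suc n) x) (fser c) sequentially"
    unfolding fser_def[abs_def]
    by (rule Weierstrass_m_test[OF _ fser_majorant_summable]) (use fser_term_le in auto)
  thus ?thesis
    by (rule uniform_limit_theorem[rotated]) (auto intro!: always_eventually continuous_intros ek_cont)
qed

text \<open>The partial sums are bounded uniformly in \<open>x\<close>, so a multiple of the
  absolute value of \<open>g\<close> dominates and the series may be integrated term by
  term.\<close>

lemma fser_integral:
  assumes g: "integrable M g"
  shows "(\<lambda>n. c n * (\<integral>x. g x * ek a b (Suc n) x \<partial>M)) sums (\<integral>x. g x * fser c x \<partial>M)"
proof -
  define p where "p N x = (\<Sum>n<N. c n * ek a b (Suc n) x)" for N x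
  let ?B = "sqrt (2 / (b - a)) * (\<Sum>n. \<bar>c n\<bar>)"
  have cp: "continuous_on {a..b} (p N)" for N unfolding p_def by (intro continuous_intros ek_cont)
  have "(\<lambda>N. \<integral>x. g x * p N x \<partial>M) \<longlonglongrightarrow> (\<integral>x. g x * fser c x \<partial>M)"
  proof (rule integral_dominated_convergence[where w = "\<lambda>x. ?B * \<bar>g x\<bar>"])
    show "(\<lambda>x. g x * fser c x) \<in> borel_measurable M" "\<And>N. (\<lambda>x. g x * p N x) \<in> borel_measurable M"
      by (intro borel_measurable_times borel_measurable_integrable[OF g] continuous_measurable_M cp fser_cont)+
    show "integrable M (\<lambda>x. ?B * \<bar>g x\<bar>)" using g by simp
    show "AE x in M. (\<lambda>N. g x * p N x) \<longlonglongrightarrow> g x * fser c x"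
      unfolding p_def by (intro AE_I2 tendsto_intros fser_lim)
    show "AE x in M. norm (g x * p N x) \<le> ?B * \<bar>g x\<bar>" for N
    proof (rule AE_I2)
      fix x
      have "\<bar>g x\<bar> * \<bar>p N x\<bar> \<le> \<bar>g x\<bar> * ?B" unfolding p_def by (intro mult_left_mono fser_partial_abs_le) auto
      thus "norm (g x * p N x) \<le> ?B * \<bar>g x\<bar>" by (simp add: abs_mult mult.commute)
    qed
  qed
  moreover have "(\<integral>x. g x * p N x \<partial>M) = (\<Sum>n<N. c n * (\<integral>x. g x * ek a b (Suc n) x \<partial>M))" for N
  proof -
    have "(\<integral>x. g x * p N x \<partial>M) = (\<integral>x. (\<Sum>n<N. c n * (g x * ek a b (Suc n) x)) \<partial>M)"
      unfolding p_def by (simp add: sum_distrib_left mult.left_commute)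
    also have "\<dots> = (\<Sum>n<N. \<integral>x. c n * (g x * ek a b (Suc n) x) \<partial>M)"
      by (intro Bochner_Integration.integral_sum integrable_mult_right continuous_mult_integrable g ek_cont)
    finally show ?thesis by simp
  qed
  ultimately show ?thesis by (simp add: sums_def)
qed

lemma fser_L2: "fser c \<in> L2 a b" by (intro continuous_L2 fser_cont)

lemma coef_fser: "coef a b (fser c) (Suc m) = c m"
proof -
  have "(\<lambda>n. c n * (\<integral>x. ek a b (Suc m) x * ek a b (Suc n) x \<partial>M)) sums (\<integral>x. ek a b (Suc m) x * fser c x \<partial>M)"
    by (rule fser_integral) (rule L2_integrable[OF ek_L2])
  moreover have "(\<lambda>n. c n * (\<integral>x. ek a b (Suc m) x * ek a b (Suc n) x \<partial>M)) = (\<lambda>n. if n = m then c m else 0)"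
    by (auto simp: sin_sin_orth fun_eq_iff)
  ultimately have "(\<lambda>n. if n = m then c m else 0) sums (\<integral>x. ek a b (Suc m) x * fser c x \<partial>M)" by simp
  hence "(\<integral>x. ek a b (Suc m) x * fser c x \<partial>M) = c m"
    by (rule sums_unique2) (rule sums_single)
  thus ?thesis by (simp add: coef_M mult.commute)
qed

end

lemma Hs_summable: "u \<in> Hs a b r \<Longrightarrow> summable (\<lambda>n. lam a b (Suc n) ^ r * (coef a b u (Suc n))\<^sup>2)"
  by (simp add: Hs_def)

lemma Hs_L2: "u \<in> Hs a b r \<Longrightarrow> u \<in> L2 a b" by (simp add: Hs_def)

lemma Hs1_summable: "u \<in> Hs a b 1 \<Longrightarrow> summable (\<lambda>n. lam a b (Suc n) * (coef a b u (Suc n))\<^sup>2)"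
  using Hs_summable[of u 1] by simp

text \<open>Both functions have the same sine coefficients, and square-integrable functions are
  determined almost everywhere by these. The series is the continuous representative through which
  pointwise bounds reach \<open>u\<close>.\<close>

lemma Hs1_AE_fser:
  assumes u: "u \<in> Hs a b 1"
  shows "AE x in M. u x = fser (\<lambda>n. coef a b u (Suc n)) x"
proof -
  let ?s = "fser (\<lambda>n. coef a b u (Suc n))"
  note cs = Hs1_summable[OF u]
  have "AE x in M. u x - ?s x = 0"
  proof (rule AE_zero_of_coef_zero)
    show "(\<lambda>x. u x - ?s x) \<in> L2 a b" by (intro L2_diff Hs_L2[OF u] fser_L2[OF cs])
    fix k :: nat assume "1 \<le> k"
    then obtain m where k: "k = Suc m" by (cases k) auto
    show "coef a b (\<lambda>x. u x - ?s x) k = 0"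
      unfolding coef_diff[OF Hs_L2[OF u] fser_L2[OF cs]] k coef_fser[OF cs] by simp
  qed
  thus ?thesis by eventually_elim simp
qed

lemma Hs1_sup_AE:
  assumes u: "u \<in> Hs a b 1"
  shows "AE x in M. (u x)\<^sup>2 \<le> sob * hnorm2 a b 1 u"
  using Hs1_AE_fser[OF u]
proof eventually_elim
  case (elim x)
  show ?case using fser_square_le[OF Hs1_summable[OF u], of x] by (simp add: elim[symmetric] hnorm2_def)
qed

lemma parseval_inner:
  assumes u: "u \<in> Hs a b 1" and f: "f \<in> L2 a b"
  shows "(\<lambda>n. coef a b u (Suc n) * coef a b f (Suc n)) sums (\<integral>x. f x * u x \<partial>M)"
proof -
  let ?s = "fser (\<lambda>n. coef a b u (Suc n))"
  note cs = Hs1_summable[OF u]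
  have "(\<integral>x. f x * u x \<partial>M) = (\<integral>x. f x * ?s x \<partial>M)"
  proof (rule integral_cong_AE)
    show "(\<lambda>x. f x * u x) \<in> borel_measurable M" using f Hs_L2[OF u] by (auto simp: L2_iff)
    show "(\<lambda>x. f x * ?s x) \<in> borel_measurable M" using f fser_L2[OF cs] by (auto simp: L2_iff)
    show "AE x in M. f x * u x = f x * ?s x" using Hs1_AE_fser[OF u] by eventually_elim simp
  qed
  thus ?thesis using fser_integral[OF cs L2_integrable[OF f]] by (simp add: coef_M)
qed

lemma parseval:
  assumes u: "u \<in> Hs a b 1"
  shows "(\<lambda>n. (coef a b u (Suc n))\<^sup>2) sums (\<integral>x. (u x)\<^sup>2 \<partial>M)"
  using parseval_inner[OF u Hs_L2[OF u]] by (simp add: power2_eq_square)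

lemma Hs_Suc_subset: assumes "u \<in> Hs a b (Suc r)" shows "u \<in> Hs a b r"
proof -
  have S: "summable (\<lambda>n. 1 / lam a b 1 * (lam a b (Suc n) ^ Suc r * (coef a b u (Suc n))\<^sup>2))"
    by (intro summable_mult Hs_summable assms)
  have "lam a b (Suc n) ^ r * (coef a b u (Suc n))\<^sup>2 \<le> 1 / lam a b 1 * (lam a b (Suc n) ^ Suc r * (coef a b u (Suc n))\<^sup>2)" for n
  proof -
    have l: "0 < lam a b 1" "lam a b 1 \<le> lam a b (Suc n)" using lam_pos[of 1] lam_mono[of 1 "Suc n"] by auto
    have "lam a b 1 * (lam a b (Suc n) ^ r * (coef a b u (Suc n))\<^sup>2) \<le> lam a b (Suc n) * (lam a b (Suc n) ^ r * (coef a b u (Suc n))\<^sup>2)"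
      using l lam_nonneg by (intro mult_right_mono) auto
    thus ?thesis using l by (simp add: field_simps)
  qed
  hence "norm (lam a b (Suc n) ^ r * (coef a b u (Suc n))\<^sup>2) \<le> 1 / lam a b 1 * (lam a b (Suc n) ^ Suc r * (coef a b u (Suc n))\<^sup>2)" for n
    using lam_nonneg by simp
  hence "summable (\<lambda>n. lam a b (Suc n) ^ r * (coef a b u (Suc n))\<^sup>2)"
    by (rule summable_comparison_test'[OF S, of 0])
  thus ?thesis using assms by (simp add: Hs_def)
qed

section \<open>The convective flux: Lipschitz and regularity estimates\<close>

text \<open>The sine coefficient of \<open>- (u_x + u u_x)\<close> in weak form, the derivative
  having been moved to the basis function, which vanishes at both ends.\<close>

definition flux :: "(real \<Rightarrow> real) \<Rightarrow> nat \<Rightarrow> real" where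
  "flux u k = innerL2 a b u (dek a b k) + innerL2 a b (\<lambda>x. (u x)\<^sup>2) (dek a b k) / 2"

definition convect :: "(real \<Rightarrow> real) \<Rightarrow> real \<Rightarrow> real" where
  "convect u x = u x + (u x)\<^sup>2 / 2"

lemma L2_of_bounded:
  assumes "w \<in> borel_measurable M" "AE x in M. (w x)\<^sup>2 \<le> B"
  shows "w \<in> L2 a b"
proof -
  interpret finite_measure M by (rule finite_measure_M)
  have "integrable M (\<lambda>x. (w x)\<^sup>2)"
    by (rule integrable_const_bound[where B = B]) (use assms in auto)
  thus ?thesis using assms by (simp add: L2_iff)
qed

lemma Hs1_square_L2: assumes u: "u \<in> Hs a b 1" shows "(\<lambda>x. (u x)\<^sup>2) \<in> L2 a b"
proof (rule L2_of_bounded)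
  show "(\<lambda>x. (u x)\<^sup>2) \<in> borel_measurable M" using Hs_L2[OF u] by (auto simp: L2_iff)
  show "AE x in M. ((u x)\<^sup>2)\<^sup>2 \<le> (sob * hnorm2 a b 1 u)\<^sup>2"
    using Hs1_sup_AE[OF u] by eventually_elim (intro power_mono, auto)
qed

lemma flux_convect: assumes u: "u \<in> Hs a b 1"
  shows "flux u k = (\<integral>x. convect u x * dek a b k x \<partial>M)"
  using L2_mult_integrable[OF Hs_L2[OF u] dek_L2, of k] L2_mult_integrable[OF Hs1_square_L2[OF u] dek_L2, of k]
  by (simp add: flux_def innerL2_M convect_def distrib_right)

lemma convect_L2: assumes u: "u \<in> Hs a b 1" shows "convect u \<in> L2 a b"
proof -
  have "(\<lambda>x. u x - (\<lambda>x. - (1 / 2) * (u x)\<^sup>2) x) \<in> L2 a b"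
    using Hs1_square_L2[OF u] by (intro L2_diff Hs_L2[OF u]) (auto simp: L2_iff power_divide)
  thus ?thesis by (simp add: convect_def[abs_def])
qed

text \<open>The difference of \<open>u + u\<^sup>2 / 2\<close> and \<open>v + v\<^sup>2 / 2\<close>
  factors as \<open>(1 + (u + v) / 2) * (u - v)\<close>. The sup-norm embedding bounds the first
  factor, and the weight in front of the flux leaves only the L2 norm of the second.\<close>

lemma flux_lipschitz:
  assumes u: "u \<in> Hs a b 1" and v: "v \<in> Hs a b 1"
  shows "(\<Sum>n<N. (flux u (Suc n) - flux v (Suc n))\<^sup>2 / lam a b (Suc n))
    \<le> (2 + sob * (hnorm2 a b 1 u + hnorm2 a b 1 v)) * (\<integral>x. (u x - v x)\<^sup>2 \<partial>M)"
proof -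
  define w where "w x = convect u x - convect v x" for x
  have wL: "w \<in> L2 a b" unfolding w_def by (intro L2_diff convect_L2 u v)
  have "flux u k - flux v k = innerL2 a b w (dek a b k)" for k
    unfolding flux_convect[OF u] flux_convect[OF v] innerL2_M w_def
    using L2_mult_integrable[OF convect_L2[OF u] dek_L2, of k] L2_mult_integrable[OF convect_L2[OF v] dek_L2, of k]
    by (simp add: left_diff_distrib)
  hence "(\<Sum>n<N. (flux u (Suc n) - flux v (Suc n))\<^sup>2 / lam a b (Suc n)) \<le> (\<integral>x. (w x)\<^sup>2 \<partial>M)"
    using bessel_cos[OF wL] by simp
  also have "\<dots> \<le> (\<integral>x. (2 + sob * (hnorm2 a b 1 u + hnorm2 a b 1 v)) * (u x - v x)\<^sup>2 \<partial>M)"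
  proof (rule integral_mono_AE)
    show "integrable M (\<lambda>x. (w x)\<^sup>2)" using wL by (simp add: L2_iff)
    show "integrable M (\<lambda>x. (2 + sob * (hnorm2 a b 1 u + hnorm2 a b 1 v)) * (u x - v x)\<^sup>2)"
      using L2_diff[OF Hs_L2[OF u] Hs_L2[OF v]] by (simp add: L2_iff)
    show "AE x in M. (w x)\<^sup>2 \<le> (2 + sob * (hnorm2 a b 1 u + hnorm2 a b 1 v)) * (u x - v x)\<^sup>2"
      using Hs1_sup_AE[OF u] Hs1_sup_AE[OF v]
    proof eventually_elim
      case (elim x)
      have "w x = (1 + (u x + v x) / 2) * (u x - v x)"
        by (simp add: w_def convect_def power2_eq_square field_simps)
      hence "(w x)\<^sup>2 = (1 + (u x + v x) / 2)\<^sup>2 * (u x - v x)\<^sup>2" by (simp add: power_mult_distrib)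
      also have "\<dots> \<le> (2 + sob * (hnorm2 a b 1 u + hnorm2 a b 1 v)) * (u x - v x)\<^sup>2"
      proof (rule mult_right_mono)
        have "0 \<le> (1 - (u x + v x) / 2)\<^sup>2" "0 \<le> (u x - v x)\<^sup>2" by auto
        hence "(1 + (u x + v x) / 2)\<^sup>2 \<le> 2 + (u x)\<^sup>2 + (v x)\<^sup>2" by (simp add: power2_eq_square field_simps)
        also have "\<dots> \<le> 2 + sob * (hnorm2 a b 1 u + hnorm2 a b 1 v)" using elim by (simp add: distrib_left)
        finally show "(1 + (u x + v x) / 2)\<^sup>2 \<le> 2 + sob * (hnorm2 a b 1 u + hnorm2 a b 1 v)" .
      qed simp
      finally show ?case .
    qed
  qed
  finally show ?thesis by simp
qed

text \<open>For sine polynomials one integrates by parts, which turns the flux coefficients into the sine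
coefficients of the derivative of the convected function; the general case follows by density.\<close>

lemma flux_bound:
  assumes u: "u \<in> Hs a b 1"
  shows "(\<Sum>n<N. (flux u (Suc n))\<^sup>2) \<le> 2 * (1 + sob * hnorm2 a b 1 u) * hnorm2 a b 1 u"
proof -
  define c where "c n = coef a b u (Suc n)" for n
  define h1 where "h1 = hnorm2 a b 1 u"
  have cs: "summable (\<lambda>n. lam a b (Suc n) * (c n)\<^sup>2)" using Hs1_summable[OF u] by (simp add: c_def)
  have h1: "h1 = (\<Sum>n. lam a b (Suc n) * (c n)\<^sup>2)" by (simp add: h1_def hnorm2_def c_def)
  define p where "p J x = (\<Sum>n<J. c n * ek a b (Suc n) x)" for J x
  define p' where "p' J x = (\<Sum>n<J. c n * dek a b (Suc n) x)" for J x
  have cp: "continuous_on S (p J)" "continuous_on S (p' J)" for S J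
    unfolding p_def p'_def by (intro continuous_intros ek_cont dek_cont)+
  have dp: "(p J has_real_derivative p' J x) (at x)" for J x
    unfolding p_def p'_def by (auto intro!: derivative_eq_intros ek_deriv simp: mult.commute)
  have p_le: "(p J x)\<^sup>2 \<le> sob * h1" for J x unfolding p_def h1 by (rule fser_partial_square_le[OF cs])
  have p'_int: "(\<integral>x. (p' J x)\<^sup>2 \<partial>M) \<le> h1" for J
  proof -
    have "(\<integral>x. (p' J x)\<^sup>2 \<partial>M) = (\<integral>x. (\<Sum>i<J. \<Sum>k<J. c i * c k * (dek a b (Suc i) x * dek a b (Suc k) x)) \<partial>M)"
      unfolding p'_def power2_eq_square sum_product by (simp add: mult_ac)
    also have "\<dots> = (\<Sum>i<J. \<Sum>k<J. c i * c k * (\<integral>x. dek a b (Suc i) x * dek a b (Suc k) x \<partial>M))"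
      by (simp add: Bochner_Integration.integral_sum L2_mult_integrable dek_L2)
    also have "\<dots> = (\<Sum>i<J. \<Sum>k<J. if i = k then lam a b (Suc i) * (c i)\<^sup>2 else 0)"
      by (intro sum.cong refl) (auto simp: cos_cos_orth power2_eq_square)
    also have "\<dots> = (\<Sum>i<J. lam a b (Suc i) * (c i)\<^sup>2)" by simp
    also have "\<dots> \<le> h1" unfolding h1 by (rule sum_le_suminf[OF cs]) (auto simp: lam_nonneg)
    finally show ?thesis .
  qed
  have pJ: "(\<Sum>n<N. (\<integral>x. convect (p J) x * dek a b (Suc n) x \<partial>M)\<^sup>2) \<le> 2 * (1 + sob * h1) * h1" for J
  proof -
    define q where "q x = (1 + p J x) * p' J x" for x
    have cq: "continuous_on S q" for S unfolding q_def by (intro continuous_intros cp)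
    have cW: "continuous_on S (convect (p J))" for S unfolding convect_def by (intro continuous_intros cp) auto
    have dW: "(convect (p J) has_real_derivative q x) (at x)" for x
      unfolding convect_def q_def by (auto intro!: derivative_eq_intros dp simp: algebra_simps)
    \<comment> \<open>Integration by parts; the boundary terms vanish with the sine functions.
      Bessel's inequality for the sines then applies to the derivative \<open>q\<close>.\<close>
    have "(\<integral>x. convect (p J) x * dek a b k x \<partial>M) = - coef a b q k" for k
    proof -
      have "(\<integral>x. convect (p J) x * dek a b k x + q x * ek a b k x \<partial>M) = convect (p J) b * ek a b k b - convect (p J) a * ek a b k a"
        by (rule integral_M_FTC) (auto intro!: derivative_eq_intros dW ek_deriv continuous_intros cW cq ek_cont dek_cont)
      moreover have "integrable M (\<lambda>x. convect (p J) x * dek a b k x)" "integrable M (\<lambda>x. q x * ek a b k x)"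
        by (intro continuous_integrable_M continuous_intros cW cq ek_cont dek_cont)+
      ultimately show ?thesis by (simp add: ek_ends coef_M)
    qed
    hence "(\<Sum>n<N. (\<integral>x. convect (p J) x * dek a b (Suc n) x \<partial>M)\<^sup>2) = (\<Sum>n<N. (coef a b q (Suc n))\<^sup>2)" by simp
    also have "\<dots> \<le> (\<integral>x. (q x)\<^sup>2 \<partial>M)" by (rule bessel_sin) (intro continuous_L2 cq)
    also have "\<dots> \<le> (\<integral>x. 2 * (1 + sob * h1) * (p' J x)\<^sup>2 \<partial>M)"
    proof (rule integral_mono)
      fix x
      have "0 \<le> (1 - p J x)\<^sup>2" by simp
      hence "(1 + p J x)\<^sup>2 \<le> 2 * (1 + (p J x)\<^sup>2)" by (simp add: power2_eq_square algebra_simps)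
      also have "\<dots> \<le> 2 * (1 + sob * h1)" using p_le by simp
      finally show "(q x)\<^sup>2 \<le> 2 * (1 + sob * h1) * (p' J x)\<^sup>2"
        unfolding q_def power_mult_distrib by (intro mult_right_mono) auto
    qed (intro continuous_integrable_M continuous_intros cp cq)+
    also have "\<dots> = 2 * (1 + sob * h1) * (\<integral>x. (p' J x)\<^sup>2 \<partial>M)" by simp
    also have "\<dots> \<le> 2 * (1 + sob * h1) * h1"
    proof (rule mult_left_mono[OF p'_int])
      have "0 \<le> sob * h1" using p_le[of 0 0] by (simp add: p_def)
      thus "0 \<le> 2 * (1 + sob * h1)" by simp
    qed
    finally show ?thesis .
  qed
  \<comment> \<open>The truncation is removed with the number of flux coefficients held fixed: the
    sup bound on the partial sums does not depend on \<open>J\<close> and provides the dominating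
    function.\<close>
  have lim: "(\<lambda>J. \<integral>x. convect (p J) x * dek a b k x \<partial>M) \<longlonglongrightarrow> flux u k" for k
  proof -
    have "(\<lambda>J. \<integral>x. convect (p J) x * dek a b k x \<partial>M) \<longlonglongrightarrow> (\<integral>x. convect u x * dek a b k x \<partial>M)"
    proof (rule integral_dominated_convergence[where w = "\<lambda>x. (1 + sob * h1) * \<bar>dek a b k x\<bar>"])
      show "(\<lambda>x. convect u x * dek a b k x) \<in> borel_measurable M"
        by (intro borel_measurable_integrable L2_mult_integrable convect_L2 u dek_L2)
      show "(\<lambda>x. convect (p J) x * dek a b k x) \<in> borel_measurable M" for J
        unfolding convect_def by (intro continuous_measurable_M continuous_intros cp dek_cont) auto
      show "integrable M (\<lambda>x. (1 + sob * h1) * \<bar>dek a b k x\<bar>)"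
        by (intro continuous_integrable_M continuous_intros dek_cont)
      show "AE x in M. (\<lambda>J. convect (p J) x * dek a b k x) \<longlonglongrightarrow> convect u x * dek a b k x"
        using Hs1_AE_fser[OF u]
      proof eventually_elim
        case (elim x)
        have "(\<lambda>J. p J x) \<longlonglongrightarrow> u x" unfolding elim p_def using fser_lim[OF cs] by (simp add: c_def)
        thus ?case unfolding convect_def by (intro tendsto_intros) auto
      qed
      show "AE x in M. norm (convect (p J) x * dek a b k x) \<le> (1 + sob * h1) * \<bar>dek a b k x\<bar>" for J
      proof (rule AE_I2)
        fix x
        have "0 \<le> (1 - \<bar>p J x\<bar>)\<^sup>2" by simp
        hence "2 * \<bar>p J x\<bar> \<le> 1 + (p J x)\<^sup>2" by (simp add: power2_eq_square algebra_simps)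
        moreover have "\<bar>convect (p J) x\<bar> \<le> \<bar>p J x\<bar> + (p J x)\<^sup>2 / 2"
          unfolding convect_def using abs_triangle_ineq[of "p J x" "(p J x)\<^sup>2 / 2"] by simp
        ultimately have "\<bar>convect (p J) x\<bar> \<le> 1 + sob * h1" using p_le[of J x] by linarith
        thus "norm (convect (p J) x * dek a b k x) \<le> (1 + sob * h1) * \<bar>dek a b k x\<bar>"
          unfolding real_norm_def abs_mult by (intro mult_right_mono) auto
      qed
    qed
    thus ?thesis by (simp add: flux_convect[OF u])
  qed
  have "(\<lambda>J. \<Sum>n<N. (\<integral>x. convect (p J) x * dek a b (Suc n) x \<partial>M)\<^sup>2) \<longlonglongrightarrow> (\<Sum>n<N. (flux u (Suc n))\<^sup>2)"
    by (intro tendsto_intros lim)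
  thus ?thesis unfolding h1_def[symmetric] by (rule LIMSEQ_le_const2) (use pJ in auto)
qed

end

section \<open>Attractors in a pseudometric space\<close>

text \<open>\<open>A\<close> consists of the limits of \<open>S (t n) (z n)\<close> with times
  tending to infinity that lie in \<open>D \<inter> N\<close>. Limits are unique only up to distance
  zero, and \<open>N\<close>, which will carry the regularity, need not be closed under that
  relation; therefore membership in \<open>N\<close> is built into \<open>A\<close>, and invariance
  is stated up to distance zero.\<close>

lemma pseudo_metric_attractor:
  fixes d :: "'x \<Rightarrow> 'x \<Rightarrow> real" and S :: "real \<Rightarrow> 'x \<Rightarrow> 'x" and X D N :: "'x set"
  assumes nn: "\<And>x y. x \<in> X \<Longrightarrow> y \<in> X \<Longrightarrow> 0 \<le> d x y"
    and sym: "\<And>x y. x \<in> X \<Longrightarrow> y \<in> X \<Longrightarrow> d x y = d y x"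
    and tri: "\<And>x y z. x \<in> X \<Longrightarrow> y \<in> X \<Longrightarrow> z \<in> X \<Longrightarrow> d x z \<le> d x y + d y z"
    and DX: "D \<subseteq> X"
    and inv: "\<And>t z. 0 \<le> t \<Longrightarrow> z \<in> D \<Longrightarrow> S t z \<in> D"
    and semi: "\<And>s t z. 0 \<le> s \<Longrightarrow> 0 \<le> t \<Longrightarrow> z \<in> D \<Longrightarrow> d (S (t + s) z) (S t (S s z)) = 0"
    and cont: "\<And>t z w. 0 \<le> t \<Longrightarrow> (\<And>n. z n \<in> D) \<Longrightarrow> w \<in> D \<Longrightarrow> (\<lambda>n::nat. d (z n) w) \<longlonglongrightarrow> 0
      \<Longrightarrow> (\<lambda>n. d (S t (z n)) (S t w)) \<longlonglongrightarrow> 0"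
    and comp: "\<And>z t. (\<And>n. z n \<in> D) \<Longrightarrow> (\<And>n. 0 \<le> t n) \<Longrightarrow> filterlim t at_top sequentially
      \<Longrightarrow> \<exists>g y. strict_mono (g :: nat \<Rightarrow> nat) \<and> y \<in> D \<inter> N \<and> (\<lambda>n. d (S (t (g n)) (z (g n))) y) \<longlonglongrightarrow> 0"
  obtains A where "A \<subseteq> D \<inter> N"
    "\<And>x. (\<And>n. x n \<in> A) \<Longrightarrow> \<exists>g y. strict_mono (g :: nat \<Rightarrow> nat) \<and> y \<in> A \<and> (\<lambda>n. d (x (g n)) y) \<longlonglongrightarrow> 0"
    "\<And>t y. 0 \<le> t \<Longrightarrow> y \<in> A \<Longrightarrow> \<exists>w\<in>A. d (S t y) w = 0"
    "\<And>t w. 0 \<le> t \<Longrightarrow> w \<in> A \<Longrightarrow> \<exists>y\<in>A. d (S t y) w = 0"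
    "\<And>e. 0 < e \<Longrightarrow> \<exists>T. \<forall>t\<ge>T. \<forall>z\<in>D. \<exists>y\<in>A. d (S t z) y < e"
proof -
  define A where "A = {y \<in> D \<inter> N. \<exists>z t. (\<forall>n::nat. z n \<in> D \<and> 0 \<le> t n) \<and> filterlim t at_top sequentially
      \<and> (\<lambda>n. d (S (t n) (z n)) y) \<longlonglongrightarrow> 0}"
  have AI: "y \<in> A" if "y \<in> D \<inter> N" "\<And>n::nat. z n \<in> D" "\<And>n. 0 \<le> t n" "filterlim t at_top sequentially"
      "(\<lambda>n. d (S (t n) (z n)) y) \<longlonglongrightarrow> 0" for y z t
    unfolding A_def by (rule CollectI, intro conjI exI[of _ z] exI[of _ t]) (use that in auto)
  have sub: "filterlim (\<lambda>n. t (g n)) at_top sequentially"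
    if "filterlim t at_top sequentially" "strict_mono g" for t :: "nat \<Rightarrow> real" and g
    by (rule filterlim_compose[OF that(1) filterlim_subseq[OF that(2)]])
  have compA: "\<exists>g y. strict_mono (g :: nat \<Rightarrow> nat) \<and> y \<in> A \<and> (\<lambda>n. d (S (t (g n)) (z (g n))) y) \<longlonglongrightarrow> 0"
    if z: "\<And>n. z n \<in> D" and t: "\<And>n. 0 \<le> t n" "filterlim t at_top sequentially" for z t
  proof -
    obtain g y where g: "strict_mono g" "y \<in> D \<inter> N" "(\<lambda>n. d (S (t (g n)) (z (g n))) y) \<longlonglongrightarrow> 0"
      using comp[of z t, OF z t] by blast
    have "y \<in> A" by (rule AI[of y "\<lambda>n. z (g n)" "\<lambda>n. t (g n)"]) (use g z t sub[OF t(2) g(1)] in auto)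
    thus ?thesis using g by blast
  qed
  have uniq: "d x y = 0" if "x \<in> D" "y \<in> D" "\<And>n. v n \<in> D" "(\<lambda>n::nat. d (v n) x) \<longlonglongrightarrow> 0" "(\<lambda>n. d (v n) y) \<longlonglongrightarrow> 0"
    for x y v
  proof -
    have "(\<lambda>n. d (v n) x + d (v n) y) \<longlonglongrightarrow> 0 + 0" by (intro tendsto_add that)
    moreover have "d x y \<le> d (v n) x + d (v n) y" for n
      using tri[of x "v n" y] sym[of x "v n"] that DX by (auto simp: subset_iff)
    ultimately have "d x y \<le> 0" by (intro LIMSEQ_le_const[of _ 0]) auto
    thus ?thesis using nn[of x y] that DX by (simp add: subset_iff)
  qed
  have near: "(\<lambda>n. d (v n) y) \<longlonglongrightarrow> 0"
    if "\<And>n. v n \<in> D" "\<And>n. v' n \<in> D" "y \<in> D" "(\<lambda>n::nat. d (v' n) y) \<longlonglongrightarrow> 0" "(\<lambda>n. d (v n) (v' n)) \<longlonglongrightarrow> 0" for v v' y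
  proof (rule tendsto_sandwich[where f = "\<lambda>_. 0"])
    have "(\<lambda>n. d (v n) (v' n) + d (v' n) y) \<longlonglongrightarrow> 0 + 0" by (intro tendsto_add that)
    thus "(\<lambda>n. d (v n) (v' n) + d (v' n) y) \<longlonglongrightarrow> 0" by simp
    show "\<forall>\<^sub>F n in sequentially. d (v n) y \<le> d (v n) (v' n) + d (v' n) y"
      using that DX by (intro always_eventually allI tri) (auto simp: subset_iff)
  qed (use nn that DX in \<open>auto simp: subset_iff\<close>)
  show ?thesis
  proof (rule that[of A])
    show "A \<subseteq> D \<inter> N" by (auto simp: A_def)
  next
    fix x :: "nat \<Rightarrow> 'x" assume x: "\<And>n. x n \<in> A"
    \<comment> \<open>Diagonal choice: each \<open>x n\<close> is replaced by a point of an orbit at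
      a time beyond \<open>n\<close> and within \<open>1 / Suc n\<close>, so that asymptotic
      compactness applies to the replaced sequence.\<close>
    have "\<exists>z t. z \<in> D \<and> real n \<le> t \<and> d (S t z) (x n) < 1 / real (Suc n)" for n
    proof -
      obtain z t where zt: "\<And>i::nat. z i \<in> D" "filterlim t at_top sequentially" "(\<lambda>i. d (S (t i) (z i)) (x n)) \<longlonglongrightarrow> 0"
        using x[of n] unfolding A_def by blast
      have "\<forall>\<^sub>F i in sequentially. real n \<le> t i" using zt(2) by (auto simp: filterlim_at_top)
      moreover have "\<forall>\<^sub>F i in sequentially. d (S (t i) (z i)) (x n) < 1 / real (Suc n)"
        by (rule order_tendstoD(2)[OF zt(3)]) simp
      ultimately have "\<forall>\<^sub>F i in sequentially. real n \<le> t i \<and> d (S (t i) (z i)) (x n) < 1 / real (Suc n)"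
        by eventually_elim simp
      then obtain i where "real n \<le> t i \<and> d (S (t i) (z i)) (x n) < 1 / real (Suc n)"
        by (auto simp: eventually_sequentially)
      thus ?thesis using zt(1) by blast
    qed
    then obtain z t where zt: "\<And>n. z n \<in> D" "\<And>n. real n \<le> t n" "\<And>n. d (S (t n) (z n)) (x n) < 1 / real (Suc n)"
      by metis
    have t0: "0 \<le> t n" for n using zt(2)[of n] by linarith
    have "filterlim t at_top sequentially"
      by (rule filterlim_at_top_mono[OF filterlim_real_sequentially]) (use zt in auto)
    then obtain g y where g: "strict_mono g" "y \<in> A" "(\<lambda>n. d (S (t (g n)) (z (g n))) y) \<longlonglongrightarrow> 0"
      using compA[of z t, OF zt(1) t0] by blast
    have xD: "x n \<in> D" for n using x by (auto simp: A_def)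
    have yD: "y \<in> D" using g by (auto simp: A_def)
    have S0: "S (t n) (z n) \<in> D" for n by (rule inv[OF t0 zt(1)])
    have "(\<lambda>n. d (x n) (S (t n) (z n))) \<longlonglongrightarrow> 0"
    proof (rule tendsto_sandwich[where f = "\<lambda>_. 0"])
      show "(\<lambda>n. 1 / real (Suc n)) \<longlonglongrightarrow> 0" using LIMSEQ_inverse_real_of_nat by (simp add: inverse_eq_divide)
      show "\<forall>\<^sub>F n in sequentially. d (x n) (S (t n) (z n)) \<le> 1 / real (Suc n)"
      proof (intro always_eventually allI)
        fix n
        have "d (x n) (S (t n) (z n)) = d (S (t n) (z n)) (x n)" using xD S0 DX by (intro sym) auto
        thus "d (x n) (S (t n) (z n)) \<le> 1 / real (Suc n)" using zt(3)[of n] by simp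
      qed
    qed (use nn xD S0 DX in \<open>auto simp: subset_iff\<close>)
    hence "(\<lambda>n. d (x (g n)) (S (t (g n)) (z (g n)))) \<longlonglongrightarrow> 0"
      using LIMSEQ_subseq_LIMSEQ[OF _ g(1)] by (auto simp: o_def)
    hence "(\<lambda>n. d (x (g n)) y) \<longlonglongrightarrow> 0"
      by (rule near[of "\<lambda>n. x (g n)" "\<lambda>n. S (t (g n)) (z (g n))" y, OF xD S0 yD g(3)])
    thus "\<exists>g y. strict_mono (g :: nat \<Rightarrow> nat) \<and> y \<in> A \<and> (\<lambda>n. d (x (g n)) y) \<longlonglongrightarrow> 0" using g by blast
  next
    fix \<tau> :: real and y assume \<tau>: "0 \<le> \<tau>" and y: "y \<in> A"
    obtain z t where zt: "\<And>i::nat. z i \<in> D" "\<And>i. 0 \<le> t i" "filterlim t at_top sequentially" "(\<lambda>i. d (S (t i) (z i)) y) \<longlonglongrightarrow> 0"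
      using y unfolding A_def by blast
    have yD: "y \<in> D" using y by (auto simp: A_def)
    \<comment> \<open>The image of a limit is approached by the same orbits at times later by
      \<open>\<tau>\<close>, and a subsequence of these has a limit inside \<open>A\<close>.\<close>
    have "filterlim (\<lambda>n. \<tau> + t n) at_top sequentially"
      by (rule filterlim_tendsto_add_at_top[OF tendsto_const zt(3)])
    then obtain g w where g: "strict_mono g" "w \<in> A" "(\<lambda>n. d (S (\<tau> + t (g n)) (z (g n))) w) \<longlonglongrightarrow> 0"
      using compA[of z "\<lambda>n. \<tau> + t n", OF zt(1)] \<tau> zt(2) by auto
    have "(\<lambda>n. d (S \<tau> (S (t (g n)) (z (g n)))) (S \<tau> y)) \<longlonglongrightarrow> 0"
      by (rule cont[of \<tau> "\<lambda>n. S (t (g n)) (z (g n))" y]) (use \<tau> inv zt yD LIMSEQ_subseq_LIMSEQ[OF zt(4) g(1)] in \<open>auto simp: o_def\<close>)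
    hence "(\<lambda>n. d (S (\<tau> + t (g n)) (z (g n))) (S \<tau> y)) \<longlonglongrightarrow> 0"
      by (intro near[of "\<lambda>n. S (\<tau> + t (g n)) (z (g n))" "\<lambda>n. S \<tau> (S (t (g n)) (z (g n)))" "S \<tau> y"]) (use semi[OF zt(2) \<tau> zt(1)] \<tau> zt inv yD in auto)
    hence "d (S \<tau> y) w = 0"
      by (intro uniq[of "S \<tau> y" w "\<lambda>n. S (\<tau> + t (g n)) (z (g n))"]) (use g \<tau> zt inv yD in \<open>auto simp: A_def\<close>)
    thus "\<exists>w\<in>A. d (S \<tau> y) w = 0" using g by blast
  next
    fix \<tau> :: real and w assume \<tau>: "0 \<le> \<tau>" and w: "w \<in> A"
    obtain z t where zt: "\<And>i::nat. z i \<in> D" "\<And>i. 0 \<le> t i" "filterlim t at_top sequentially" "(\<lambda>i. d (S (t i) (z i)) w) \<longlonglongrightarrow> 0"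
      using w unfolding A_def by blast
    have wD: "w \<in> D" using w by (auto simp: A_def)
    \<comment> \<open>A preimage arises as a limit along the earlier times; truncation at zero
      concerns only finitely many terms and keeps all times admissible.\<close>
    define t' where "t' n = max 0 (t n - \<tau>)" for n
    have t'0: "0 \<le> t' n" for n by (simp add: t'_def)
    have "filterlim (\<lambda>n. - \<tau> + t n) at_top sequentially"
      by (rule filterlim_tendsto_add_at_top[OF tendsto_const zt(3)])
    hence "filterlim t' at_top sequentially"
      by (rule filterlim_at_top_mono) (auto simp: t'_def)
    then obtain g y where g: "strict_mono g" "y \<in> A" "(\<lambda>n. d (S (t' (g n)) (z (g n))) y) \<longlonglongrightarrow> 0"
      using compA[of z t', OF zt(1) t'0] by blast
    have yD: "y \<in> D" using g by (auto simp: A_def)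
    have 1: "(\<lambda>n. d (S \<tau> (S (t' (g n)) (z (g n)))) (S \<tau> y)) \<longlonglongrightarrow> 0"
      by (rule cont[of \<tau> "\<lambda>n. S (t' (g n)) (z (g n))" y, OF \<tau> inv[OF t'0 zt(1)] yD g(3)])
    have "\<forall>\<^sub>F n in sequentially. \<tau> \<le> t (g n)"
      using sub[OF zt(3) g(1)] by (auto simp: filterlim_at_top)
    hence "\<forall>\<^sub>F n in sequentially. 0 = d (S \<tau> (S (t' (g n)) (z (g n)))) (S (t (g n)) (z (g n)))"
    proof eventually_elim
      case (elim n)
      have e: "\<tau> + t' (g n) = t (g n)" using elim by (simp add: t'_def)
      have "d (S \<tau> (S (t' (g n)) (z (g n)))) (S (\<tau> + t' (g n)) (z (g n))) = d (S (\<tau> + t' (g n)) (z (g n))) (S \<tau> (S (t' (g n)) (z (g n))))"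
        using \<tau> t'0 zt inv DX by (intro sym) (auto simp: subset_iff)
      thus ?case using semi[OF t'0[of "g n"] \<tau> zt(1)[of "g n"]] by (simp add: e)
    qed
    hence "(\<lambda>n. d (S \<tau> (S (t' (g n)) (z (g n)))) (S (t (g n)) (z (g n)))) \<longlonglongrightarrow> 0"
      by (rule Lim_transform_eventually[OF tendsto_const])
    hence 2: "(\<lambda>n. d (S \<tau> (S (t' (g n)) (z (g n)))) w) \<longlonglongrightarrow> 0"
      by (intro near[of "\<lambda>n. S \<tau> (S (t' (g n)) (z (g n)))" "\<lambda>n. S (t (g n)) (z (g n))" w]) (use LIMSEQ_subseq_LIMSEQ[OF zt(4) g(1)] \<tau> t'0 zt inv wD in \<open>auto simp: o_def\<close>)
    have "d (S \<tau> y) w = 0"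
      by (rule uniq[of "S \<tau> y" w "\<lambda>n. S \<tau> (S (t' (g n)) (z (g n)))", OF _ _ _ 1 2]) (use \<tau> t'0 zt inv yD wD in auto)
    thus "\<exists>y\<in>A. d (S \<tau> y) w = 0" using g by blast
  next
    fix e :: real assume e: "0 < e"
    \<comment> \<open>If attraction failed, points of \<open>D\<close> at times beyond each
      \<open>n\<close> would stay at distance at least \<open>e\<close> from every point of
      \<open>A\<close>, against the existence of a subsequence converging to one.\<close>
    show "\<exists>T. \<forall>t\<ge>T. \<forall>z\<in>D. \<exists>y\<in>A. d (S t z) y < e"
    proof (rule ccontr)
      assume "\<not> ?thesis"
      hence "\<forall>n::nat. \<exists>t z. real n \<le> t \<and> z \<in> D \<and> (\<forall>y\<in>A. \<not> d (S t z) y < e)" by blast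
      then obtain t z where tz: "\<And>n. real n \<le> t n" "\<And>n::nat. z n \<in> D" "\<And>n y. y \<in> A \<Longrightarrow> \<not> d (S (t n) (z n)) y < e"
        by metis
      have t0: "0 \<le> t n" for n using tz(1)[of n] by linarith
      have "filterlim t at_top sequentially"
        by (rule filterlim_at_top_mono[OF filterlim_real_sequentially]) (use tz in auto)
      then obtain g y where g: "strict_mono g" "y \<in> A" "(\<lambda>n. d (S (t (g n)) (z (g n))) y) \<longlonglongrightarrow> 0"
        using compA[of z t, OF tz(2) t0] by blast
      have "\<forall>\<^sub>F n in sequentially. d (S (t (g n)) (z (g n))) y < e" by (rule order_tendstoD(2)[OF g(3) e])
      thus False using tz(3)[OF g(2)] by (auto simp: eventually_sequentially)
    qed
  qed
qed

section \<open>Moments and decay of the kernel\<close>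

text \<open>Decay with step equal to the argument gives
  \<open>\<delta> * r * m (2 * r) \<le> m r\<close>, so the second moment, after the substitution
  \<open>s = 2 * r\<close>, is dominated by the first. It will dominate memories that grow linearly
  in \<open>s\<close>.\<close>

lemma (in memory_kernel) second_moment_integrable:
  assumes i: "integrable lborel (\<lambda>s. s * m s)"
  shows "integrable lborel (\<lambda>s. m s * s\<^sup>2)"
proof -
  have "integrable lborel (\<lambda>r. m (0 + 2 * r) * (0 + 2 * r)\<^sup>2)"
  proof (rule Bochner_Integration.integrable_bound)
    show "integrable lborel (\<lambda>r. 4 / \<delta> * (r * m r))" using i by simp
    show "AE r in lborel. norm (m (0 + 2 * r) * (0 + 2 * r)\<^sup>2) \<le> norm (4 / \<delta> * (r * m r))"
    proof (rule AE_I2)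
      fix r :: real
      show "norm (m (0 + 2 * r) * (0 + 2 * r)\<^sup>2) \<le> norm (4 / \<delta> * (r * m r))"
      proof (cases "0 < r")
        case True
        have "\<delta> * r * m (2 * r) \<le> m r" using decay[OF True, of r] True m_nonneg[of "2 * r"] by (simp add: distrib_right)
        hence "r * m (2 * r) \<le> m r / \<delta>" using \<delta>_pos by (simp add: field_simps)
        hence "4 * r * (r * m (2 * r)) \<le> 4 * r * (m r / \<delta>)" using True by (intro mult_left_mono) auto
        thus ?thesis using True m_nonneg \<delta>_pos by (simp add: power2_eq_square abs_mult mult_ac)
      next
        case False
        thus ?thesis using m_zero[of "2 * r"] by simp
      qed
    qed
  qed measurable
  thus ?thesis by (subst (asm) lborel_integrable_real_affine_iff) auto
qed

text \<open>After translating the second term, the two integrals cancel except on a strip of length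
  \<open>\<epsilon>\<close> at each end. Monotonicity bounds the kernel by \<open>\<mu> s\<close> on
  the near strip, and by \<open>\<mu> (s + h)\<close> from below on the far one, which stays left of
  \<open>s + h\<close> because \<open>h' + \<epsilon> \<le> h\<close>.\<close>

lemma kernel_difference_bound:
  assumes mu: "kernel_ok \<mu>" and s: "0 < s" and h': "0 \<le> h'" and \<epsilon>: "0 < \<epsilon>" "h' + \<epsilon> \<le> h"
  shows "set_integrable lborel {s..s+h'} (\<lambda>r. \<mu> r - \<mu> (r + \<epsilon>))"
    "(LINT r:{s..s+h'}|lborel. \<mu> r - \<mu> (r + \<epsilon>)) \<le> \<epsilon> * (\<mu> s - \<mu> (s + h))"
proof -
  have nn: "\<And>s. 0 < s \<Longrightarrow> 0 \<le> \<mu> s" and mono: "\<And>s t. 0 < s \<Longrightarrow> s \<le> t \<Longrightarrow> \<mu> t \<le> \<mu> s"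
    and i: "integrable lborel (\<lambda>s. indicator {0<..} s * \<mu> s)"
    using mu by (auto simp: kernel_ok_def set_integrable_def)
  define m where "m s = indicator {0<..} s * \<mu> s" for s
  have im: "integrable lborel m" using i by (simp add: m_def[abs_def])
  have i1: "integrable lborel (\<lambda>r. indicator {s..s+h'} r * m r)" "integrable lborel (\<lambda>r. indicator {s+\<epsilon>..s+h'+\<epsilon>} r * m r)"
    using integrable_mult_indicator[OF _ im, of "{s..s+h'}"] integrable_mult_indicator[OF _ im, of "{s+\<epsilon>..s+h'+\<epsilon>}"] by auto
  have sh: "indicator {s..s+h'} r * m (r + \<epsilon>) = indicator {s+\<epsilon>..s+h'+\<epsilon>} (\<epsilon> + 1 * r) * m (\<epsilon> + 1 * r)" for r
    by (auto simp: indicator_def add.commute)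
  have i2: "integrable lborel (\<lambda>r. indicator {s..s+h'} r * m (r + \<epsilon>))"
    unfolding sh using lborel_integrable_real_affine[OF i1(2), of 1 \<epsilon>] by simp
  have e2: "(\<integral>r. indicator {s..s+h'} r * m (r + \<epsilon>) \<partial>lborel) = (\<integral>r. indicator {s+\<epsilon>..s+h'+\<epsilon>} r * m r \<partial>lborel)"
    unfolding sh using lborel_integral_real_affine[of 1 "\<lambda>r. indicator {s+\<epsilon>..s+h'+\<epsilon>} r * m r" \<epsilon>] by simp
  have eq: "indicator {s..s+h'} r *\<^sub>R (\<mu> r - \<mu> (r + \<epsilon>)) = indicator {s..s+h'} r * m r - indicator {s..s+h'} r * m (r + \<epsilon>)" for r
    using s \<epsilon> by (auto simp: indicator_def m_def)
  show "set_integrable lborel {s..s+h'} (\<lambda>r. \<mu> r - \<mu> (r + \<epsilon>))"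
    unfolding set_integrable_def eq using i1 i2 by simp
  have "(LINT r:{s..s+h'}|lborel. \<mu> r - \<mu> (r + \<epsilon>)) = (\<integral>r. indicator {s..s+h'} r * m r - indicator {s+\<epsilon>..s+h'+\<epsilon>} r * m r \<partial>lborel)"
    unfolding set_lebesgue_integral_def eq using i1 i2 e2 by simp
  also have "\<dots> \<le> (\<integral>r. \<mu> s * indicator {s..<s+\<epsilon>} r - \<mu> (s + h) * indicator {s+h'<..s+h'+\<epsilon>} r \<partial>lborel)"
  proof (rule integral_mono)
    fix r
    have "0 \<le> \<mu> (s + h)" using nn s h' \<epsilon> by simp
    moreover have "\<mu> (s + h) \<le> \<mu> s" by (rule mono) (use s h' \<epsilon> in auto)
    moreover have "s \<le> r \<Longrightarrow> \<mu> r \<le> \<mu> s" by (rule mono) (use s in auto)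
    moreover have "s \<le> r \<Longrightarrow> r \<le> s + h \<Longrightarrow> \<mu> (s + h) \<le> \<mu> r" by (rule mono) (use s in auto)
    ultimately show "indicator {s..s+h'} r * m r - indicator {s+\<epsilon>..s+h'+\<epsilon>} r * m r \<le> \<mu> s * indicator {s..<s+\<epsilon>} r - \<mu> (s + h) * indicator {s+h'<..s+h'+\<epsilon>} r"
      using s h' \<epsilon> by (auto simp: indicator_def m_def)
  qed (use i1 \<epsilon> in auto)
  also have "\<dots> = \<epsilon> * (\<mu> s - \<mu> (s + h))" using \<epsilon> by (simp add: algebra_simps)
  finally show "(LINT r:{s..s+h'}|lborel. \<mu> r - \<mu> (r + \<epsilon>)) \<le> \<epsilon> * (\<mu> s - \<mu> (s + h))" .
qed

text \<open>Monotonicity and Fatou's lemma bound the decrease of the kernel from below by the integral of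
its almost everywhere derivative.\<close>

lemma kernel_decay:
  assumes mu: "kernel_ok \<mu>"
    and AE: "AE s in lborel. s > 0 \<longrightarrow> (\<mu> differentiable (at s) \<and> deriv \<mu> s + \<delta> * \<mu> s \<le> 0)"
    and \<delta>: "0 < \<delta>" and s: "0 < s" and h: "0 \<le> h"
  shows "(1 + \<delta> * h) * \<mu> (s + h) \<le> \<mu> s"
proof -
  have nn: "\<And>s. 0 < s \<Longrightarrow> 0 \<le> \<mu> s" and mono: "\<And>s t. 0 < s \<Longrightarrow> s \<le> t \<Longrightarrow> \<mu> t \<le> \<mu> s"
    using mu by (auto simp: kernel_ok_def)
  have le: "\<delta> * h' * \<mu> (s + h) \<le> \<mu> s - \<mu> (s + h)" if h': "0 \<le> h'" "h' < h" for h'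
  proof -
    \<comment> \<open>The offset makes every increment \<open>\<epsilon> n\<close> fit into the gap
      between \<open>h'\<close> and \<open>h\<close>.\<close>
    define N where "N = nat \<lceil>1 / (h - h')\<rceil>"
    define \<epsilon> where "\<epsilon> n = 1 / real (Suc (n + N))" for n
    have \<epsilon>0: "0 < \<epsilon> n" for n by (simp add: \<epsilon>_def)
    have \<epsilon>h: "h' + \<epsilon> n \<le> h" for n
    proof -
      have "1 / (h - h') \<le> real N" unfolding N_def by linarith
      also have "\<dots> \<le> real (Suc (n + N))" by simp
      finally show ?thesis using h' by (simp add: \<epsilon>_def field_simps)
    qed
    have "(\<lambda>n. inverse (real (Suc n))) \<longlonglongrightarrow> 0" by (rule LIMSEQ_inverse_real_of_nat)
    hence \<epsilon>lim: "\<epsilon> \<longlonglongrightarrow> 0" unfolding \<epsilon>_def[abs_def] by (subst inverse_eq_divide[symmetric]) (rule LIMSEQ_ignore_initial_segment)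
    define g where "g n r = indicator {s..s+h'} r * ((\<mu> r - \<mu> (r + \<epsilon> n)) / \<epsilon> n)" for n r
    have gi: "integrable lborel (g n)" for n
    proof -
      have "integrable lborel (\<lambda>r. indicator {s..s+h'} r * (\<mu> r - \<mu> (r + \<epsilon> n)))"
        using kernel_difference_bound(1)[OF mu s h'(1) \<epsilon>0 \<epsilon>h, of n] by (simp add: set_integrable_def)
      from integrable_divide[OF this, of "\<epsilon> n"] show ?thesis by (simp add: g_def[abs_def])
    qed
    have g0: "0 \<le> g n r" for n r
      using mono[of r "r + \<epsilon> n"] s \<epsilon>0[of n] by (auto simp: g_def indicator_def)
    have gle: "(\<integral>r. g n r \<partial>lborel) \<le> \<mu> s - \<mu> (s + h)" for n
    proof -
      have "(\<integral>r. g n r \<partial>lborel) = (LINT r:{s..s+h'}|lborel. \<mu> r - \<mu> (r + \<epsilon> n)) / \<epsilon> n"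
        unfolding g_def set_lebesgue_integral_def by simp
      thus ?thesis using kernel_difference_bound(2)[OF mu s h'(1) \<epsilon>0 \<epsilon>h, of n] \<epsilon>0[of n]
        by (simp add: pos_divide_le_eq mult.commute)
    qed
    have "ennreal (\<delta> * h' * \<mu> (s + h)) = (\<integral>\<^sup>+ r. ennreal (\<delta> * \<mu> (s + h)) * indicator {s..s+h'} r \<partial>lborel)"
      using \<delta> h' nn[of "s + h"] s by (simp add: nn_integral_cmult_indicator ennreal_mult'[symmetric] mult_ac)
    \<comment> \<open>Wherever the derivative exists, the difference quotients tend to
      \<open>- deriv \<mu> r\<close>, which is at least \<open>\<delta> * \<mu> r\<close> and hence
      at least \<open>\<delta> * \<mu> (s + h)\<close>.\<close>
    also have "\<dots> \<le> (\<integral>\<^sup>+ r. liminf (\<lambda>n. ennreal (g n r)) \<partial>lborel)"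
    proof (rule nn_integral_mono_AE, use AE in eventually_elim)
      fix r assume A: "r > 0 \<longrightarrow> (\<mu> differentiable (at r) \<and> deriv \<mu> r + \<delta> * \<mu> r \<le> 0)"
      show "ennreal (\<delta> * \<mu> (s + h)) * indicator {s..s+h'} r \<le> liminf (\<lambda>n. ennreal (g n r))"
      proof (cases "r \<in> {s..s+h'}")
        case True
        hence r: "0 < r" "r \<le> s + h" using s h' by auto
        have "(\<mu> has_real_derivative deriv \<mu> r) (at r)"
          using A r by (simp add: DERIV_deriv_iff_real_differentiable)
        hence "((\<lambda>x. (\<mu> (r + x) - \<mu> r) / x) \<longlongrightarrow> deriv \<mu> r) (at 0)" by (simp add: DERIV_def)
        moreover have "filterlim \<epsilon> (at 0) sequentially"
          using \<epsilon>lim \<epsilon>0 by (auto simp: filterlim_at less_imp_neq[symmetric])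
        ultimately have "(\<lambda>n. (\<mu> (r + \<epsilon> n) - \<mu> r) / \<epsilon> n) \<longlonglongrightarrow> deriv \<mu> r"
          by (rule filterlim_compose)
        hence "(\<lambda>n. - ((\<mu> (r + \<epsilon> n) - \<mu> r) / \<epsilon> n)) \<longlonglongrightarrow> - deriv \<mu> r" by (rule tendsto_minus)
        hence "(\<lambda>n. g n r) \<longlonglongrightarrow> - deriv \<mu> r"
          using True by (simp add: g_def minus_divide_left)
        hence "(\<lambda>n. ennreal (g n r)) \<longlonglongrightarrow> ennreal (- deriv \<mu> r)" by (rule tendsto_ennrealI)
        hence "liminf (\<lambda>n. ennreal (g n r)) = ennreal (- deriv \<mu> r)"
          by (rule lim_imp_Liminf[rotated]) simp
        moreover have "\<delta> * \<mu> (s + h) \<le> \<delta> * \<mu> r" using mono[OF r] \<delta> by (intro mult_left_mono) auto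
        hence "\<delta> * \<mu> (s + h) \<le> - deriv \<mu> r" using A r by linarith
        ultimately show ?thesis using True by (simp add: ennreal_leI)
      qed simp
    qed
    also have "\<dots> \<le> liminf (\<lambda>n. \<integral>\<^sup>+ r. ennreal (g n r) \<partial>lborel)"
      using gi by (intro nn_integral_liminf) auto
    also have "\<dots> \<le> liminf (\<lambda>n. ennreal (\<mu> s - \<mu> (s + h)))"
    proof (rule Liminf_mono, intro always_eventually allI)
      fix n
      have "(\<integral>\<^sup>+ r. ennreal (g n r) \<partial>lborel) = ennreal (\<integral>r. g n r \<partial>lborel)"
        using gi g0 by (intro nn_integral_eq_integral) auto
      thus "(\<integral>\<^sup>+ r. ennreal (g n r) \<partial>lborel) \<le> ennreal (\<mu> s - \<mu> (s + h))"
        using gle[of n] by (simp add: ennreal_leI)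
    qed
    also have "\<dots> = ennreal (\<mu> s - \<mu> (s + h))" by (simp add: Liminf_const)
    finally show ?thesis using mono[OF s, of "s + h"] h by (subst (asm) ennreal_le_iff) auto
  qed
  show ?thesis
  proof (cases "h = 0")
    case False
    hence hp: "0 < h" using h by simp
    \<comment> \<open>The gap needed for the difference quotients is closed by letting
      \<open>h'\<close> increase to \<open>h\<close>.\<close>
    have "((\<lambda>h'. \<delta> * h' * \<mu> (s + h)) \<longlongrightarrow> \<delta> * h * \<mu> (s + h)) (at_left h)"
      by (intro tendsto_intros)
    moreover have "\<forall>\<^sub>F h' in at_left h. \<delta> * h' * \<mu> (s + h) \<le> \<mu> s - \<mu> (s + h)"
      using eventually_at_left_real[OF hp] by eventually_elim (use le in auto)
    ultimately have "\<delta> * h * \<mu> (s + h) \<le> \<mu> s - \<mu> (s + h)"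
      by (rule tendsto_upperbound) simp
    thus ?thesis by (simp add: distrib_right)
  qed simp
qed

definition ker :: "(real \<Rightarrow> real) \<Rightarrow> real \<Rightarrow> real" where
  "ker \<mu> s = indicator {0<..} s * \<mu> s"

lemma kernel_ok_memory_kernel:
  assumes mu: "kernel_ok \<mu>"
  obtains \<delta> L where "memory_kernel (ker \<mu>) \<delta> L"
proof -
  have nn: "\<And>s. 0 < s \<Longrightarrow> 0 \<le> \<mu> s" and mono: "\<And>s t. 0 < s \<Longrightarrow> s \<le> t \<Longrightarrow> \<mu> t \<le> \<mu> s"
    and i: "integrable lborel (ker \<mu>)" and k: "0 < (\<integral>s. ker \<mu> s \<partial>lborel)"
    using mu by (auto simp: kernel_ok_def set_integrable_def kappa_def set_lebesgue_integral_def ker_def[abs_def])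
  obtain L where L: "(\<mu> \<longlongrightarrow> L) (at_right 0)" using mu by (auto simp: kernel_ok_def)
  obtain \<delta> where \<delta>: "0 < \<delta>" "AE s in lborel. s > 0 \<longrightarrow> (\<mu> differentiable (at s) \<and> deriv \<mu> s + \<delta> * \<mu> s \<le> 0)"
    using mu by (auto simp: kernel_ok_def)
  have le: "\<mu> s \<le> L" if "0 < s" for s
  proof (rule tendsto_lowerbound[OF L])
    show "\<forall>\<^sub>F r in at_right 0. \<mu> s \<le> \<mu> r"
      using eventually_at_right_real[OF that] by eventually_elim (use mono in auto)
  qed simp
  have "0 \<le> L" using le[of 1] nn[of 1] by simp
  have "memory_kernel (ker \<mu>) \<delta> L"
  proof
    show "ker \<mu> \<in> borel_measurable borel" using i by auto
    show "0 \<le> ker \<mu> s" for s using nn by (auto simp: ker_def indicator_def)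
    show "ker \<mu> s \<le> L" for s using le[of s] \<open>0 \<le> L\<close> by (auto simp: ker_def indicator_def)
    show "(1 + \<delta> * h) * ker \<mu> (s + h) \<le> ker \<mu> s" if "0 < s" "0 \<le> h" for s h
      using kernel_decay[OF mu \<delta>(2,1) that] that by (simp add: ker_def)
  qed (use i k \<delta> in \<open>auto simp: ker_def\<close>)
  thus ?thesis by (rule that)
qed

section \<open>Fourier modes of a state\<close>

lemma square_add_young:
  fixes x y \<tau> :: real
  assumes "0 < \<tau>"
  shows "(x + y)\<^sup>2 \<le> (1 + \<tau>) * x\<^sup>2 + (1 + 1 / \<tau>) * y\<^sup>2"
proof -
  have "0 \<le> (\<tau> * x - y)\<^sup>2 / \<tau>" using assms by simp
  also have "\<dots> = \<tau> * x\<^sup>2 - 2 * x * y + 1 / \<tau> * y\<^sup>2" using assms by (simp add: power2_eq_square field_simps)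
  finally show ?thesis by (simp add: power2_sum algebra_simps)
qed

text \<open>The optimal parameter is the quotient of the two square roots, for which the bound is
  the square of their sum; enlarging both roots by \<open>e / 2\<close> avoids a zero denominator.
  In the form with a parameter the triangle inequality is linear in squared norms, so it can be
  integrated over \<open>s\<close> and summed over modes before the square root is taken.\<close>

lemma sqrt_triangle_of_young:
  fixes x y z :: real
  assumes x: "0 \<le> x" and y: "0 \<le> y" and le: "\<And>\<tau>. 0 < \<tau> \<Longrightarrow> z \<le> (1 + \<tau>) * x + (1 + 1 / \<tau>) * y"
  shows "sqrt z \<le> sqrt x + sqrt y"
proof (rule field_le_epsilon)
  fix e :: real assume e: "0 < e"
  define p q where "p = sqrt x + e / 2" and "q = sqrt y + e / 2"
  have pq: "0 < p" "0 < q" using x y e by (auto simp: p_def q_def add_nonneg_pos)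
  have "x \<le> p\<^sup>2" "y \<le> q\<^sup>2" using x y e unfolding p_def q_def
    by (metis real_sqrt_ge_zero real_sqrt_pow2 power_mono less_eq_real_def add_increasing2 half_gt_zero order_refl)+
  have "z \<le> (1 + q / p) * x + (1 + 1 / (q / p)) * y" using pq by (intro le) simp
  also have "\<dots> \<le> (1 + q / p) * p\<^sup>2 + (1 + 1 / (q / p)) * q\<^sup>2"
    using pq \<open>x \<le> p\<^sup>2\<close> \<open>y \<le> q\<^sup>2\<close> by (intro add_mono mult_left_mono) auto
  also have "\<dots> = (p + q)\<^sup>2" using pq by (simp add: power2_eq_square field_simps)
  finally have "sqrt z \<le> p + q" using pq by (intro real_le_lsqrt) auto
  thus "sqrt z \<le> sqrt x + sqrt y + e" by (simp add: p_def q_def)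
qed

section \<open>The weighted memory space of a single mode\<close>

context memory_kernel
begin

lemma sq_lincomb: assumes "sq x" "sq y" shows "sq (\<lambda>s. \<alpha> * x s + \<beta> * y s)"
proof -
  have [measurable]: "x \<in> borel_measurable borel" "y \<in> borel_measurable borel"
    using assms by (auto intro: sq_measurable)
  have "integrable lborel (\<lambda>s. m s * (\<alpha> * x s + \<beta> * y s)\<^sup>2)"
  proof (rule Bochner_Integration.integrable_bound)
    show "integrable lborel (\<lambda>s. 2 * \<alpha>\<^sup>2 * (m s * (x s)\<^sup>2) + 2 * \<beta>\<^sup>2 * (m s * (y s)\<^sup>2))"
      using assms by (simp add: sq_def)
    have "(\<alpha> * x s + \<beta> * y s)\<^sup>2 \<le> 2 * \<alpha>\<^sup>2 * (x s)\<^sup>2 + 2 * \<beta>\<^sup>2 * (y s)\<^sup>2" for s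
      using square_add_young[of 1 "\<alpha> * x s" "\<beta> * y s"] by (simp add: power_mult_distrib)
    hence "m s * (\<alpha> * x s + \<beta> * y s)\<^sup>2 \<le> m s * (2 * \<alpha>\<^sup>2 * (x s)\<^sup>2 + 2 * \<beta>\<^sup>2 * (y s)\<^sup>2)" for s
      using m_nonneg by (intro mult_left_mono)
    thus "AE s in lborel. norm (m s * (\<alpha> * x s + \<beta> * y s)\<^sup>2) \<le> norm (2 * \<alpha>\<^sup>2 * (m s * (x s)\<^sup>2) + 2 * \<beta>\<^sup>2 * (m s * (y s)\<^sup>2))"
      using m_nonneg by (auto simp: algebra_simps)
  qed measurable
  moreover have "(\<lambda>s. \<alpha> * x s + \<beta> * y s) \<in> borel_measurable borel" by measurable
  ultimately show ?thesis by (simp add: sq_def)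
qed

lemma sq_add: "sq x \<Longrightarrow> sq y \<Longrightarrow> sq (\<lambda>s. x s + y s)" using sq_lincomb[of x y 1 1] by simp

lemma sq_diff: "sq x \<Longrightarrow> sq y \<Longrightarrow> sq (\<lambda>s. x s - y s)" using sq_lincomb[of x y 1 "-1"] by simp

lemma Q_diff: "sq x \<Longrightarrow> sq y \<Longrightarrow> Q (\<lambda>s. x s - y s) = Q x - Q y"
  unfolding Q_def using sq_integrable[of x] sq_integrable[of y] by (simp add: right_diff_distrib)

lemma P_young:
  assumes "sq x" "sq y" "0 < \<tau>"
  shows "P (\<lambda>s. x s + y s) \<le> (1 + \<tau>) * P x + (1 + 1 / \<tau>) * P y"
proof -
  have "P (\<lambda>s. x s + y s) \<le> (\<integral>s. (1 + \<tau>) * (m s * (x s)\<^sup>2) + (1 + 1 / \<tau>) * (m s * (y s)\<^sup>2) \<partial>lborel)"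
    unfolding P_def
  proof (rule integral_mono)
    fix s
    have "m s * (x s + y s)\<^sup>2 \<le> m s * ((1 + \<tau>) * (x s)\<^sup>2 + (1 + 1 / \<tau>) * (y s)\<^sup>2)"
      using m_nonneg square_add_young[OF assms(3)] by (intro mult_left_mono)
    thus "m s * (x s + y s)\<^sup>2 \<le> (1 + \<tau>) * (m s * (x s)\<^sup>2) + (1 + 1 / \<tau>) * (m s * (y s)\<^sup>2)"
      by (simp only: distrib_left mult.left_commute)
  qed (use assms sq_integrable2 sq_integrable2[OF sq_add[OF assms(1,2)]] in auto)
  thus ?thesis using assms by (simp add: P_def sq_def)
qed

lemma P_uminus: "P (\<lambda>s. x s - y s) = P (\<lambda>s. y s - x s)"
  by (simp add: P_def power2_commute)

lemma P_diff_le: assumes "sq x" "sq y" shows "P (\<lambda>s. x s - y s) \<le> 2 * P x + 2 * P y"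
proof -
  have "sq (\<lambda>s. 0 * y s + - 1 * y s)" by (rule sq_lincomb) (use assms in auto)
  hence "sq (\<lambda>s. - y s)" by simp
  from P_young[OF assms(1) this, of 1] show ?thesis by (simp add: P_def)
qed

lemma sqrt_P_triangle: assumes "sq x" "sq y"
  shows "sqrt (P x) \<le> sqrt (P y) + sqrt (P (\<lambda>s. x s - y s))"
proof (rule sqrt_triangle_of_young)
  fix \<tau> :: real assume "0 < \<tau>"
  from P_young[OF assms(2) sq_diff[OF assms] this]
  show "P x \<le> (1 + \<tau>) * P y + (1 + 1 / \<tau>) * P (\<lambda>s. x s - y s)" by simp
qed (auto simp: P_nonneg)

end

section \<open>The phase space in Fourier modes\<close>

locale bbm = interval a b + memory_kernel "ker \<mu>" \<delta> L for a b \<mu> \<delta> L +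
  fixes f :: "real \<Rightarrow> real"
  assumes f_L2: "f \<in> L2 a b"
begin

abbreviation \<Lambda> :: "nat \<Rightarrow> real" where "\<Lambda> n \<equiv> lam a b (Suc n)"

definition uc :: "state \<Rightarrow> nat \<Rightarrow> real" where "uc z n = coef a b (fst z) (Suc n)"

text \<open>The indicator turns a memory coefficient, meaningful for positive \<open>s\<close> only,
  into a Borel function on the line that vanishes on the nonpositive axis.\<close>

definition ec :: "state \<Rightarrow> nat \<Rightarrow> real \<Rightarrow> real" where
  "ec z n s = indicator {0<..} s * coef a b (snd z s) (Suc n)"

lemma \<Lambda>_pos: "0 < \<Lambda> n" by (rule lam_pos) simp

lemma \<Lambda>_ge: "\<Lambda> 0 \<le> \<Lambda> n" by (rule lam_mono) simp

lemma coef_0: "coef a b u 0 = 0" by (simp add: coef_M ek_def)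

lemma ker_indicator: "ker \<mu> s * (indicator {0<..} s * x) = ker \<mu> s * x"
  by (simp add: ker_def indicator_def)

lemma measurable_ec_iff:
  "(\<lambda>s. coef a b (\<eta> s) (Suc n)) \<in> borel_measurable (restrict_space lborel {0<..}) \<longleftrightarrow> ec (u, \<eta>) n \<in> borel_measurable borel"
  by (subst borel_measurable_restrict_space_iff) (auto simp: ec_def[abs_def])

text \<open>The partial sums over modes are dominated by the integrand of the memory norm itself, so
  the sum over modes and the integral over \<open>s\<close> may be exchanged.\<close>

lemma Mem_modes:
  assumes "\<eta> \<in> Mem a b \<mu> r"
  shows "sq (ec (u, \<eta>) n)" and "(\<lambda>n. \<Lambda> n ^ Suc r * P (ec (u, \<eta>) n)) sums Mnorm2 a b \<mu> r \<eta>"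
proof -
  define K where "K s = ker \<mu> s * hnorm2 a b (Suc r) (\<eta> s)" for s
  have iK: "integrable lborel K"
    using assms by (simp add: Mem_def set_integrable_def K_def[abs_def] ker_def mult.assoc)
  have Mn: "Mnorm2 a b \<mu> r \<eta> = (\<integral>s. K s \<partial>lborel)"
    by (simp add: Mnorm2_def set_lebesgue_integral_def K_def ker_def mult.assoc)
  have [measurable]: "ec (u, \<eta>) n \<in> borel_measurable borel" for n
    using assms by (auto simp: Mem_def measurable_ec_iff[symmetric])
  have term_sums: "(\<lambda>n. \<Lambda> n ^ Suc r * (ker \<mu> s * (ec (u, \<eta>) n s)\<^sup>2)) sums K s" for s
  proof (cases "0 < s")
    case True
    hence "summable (\<lambda>n. \<Lambda> n ^ Suc r * (coef a b (\<eta> s) (Suc n))\<^sup>2)"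
      using assms by (intro Hs_summable) (simp add: Mem_def)
    hence "(\<lambda>n. ker \<mu> s * (\<Lambda> n ^ Suc r * (coef a b (\<eta> s) (Suc n))\<^sup>2)) sums K s"
      unfolding K_def hnorm2_def by (intro sums_mult summable_sums)
    thus ?thesis using True by (simp add: ec_def mult.left_commute)
  next
    case False
    thus ?thesis by (simp add: K_def m_zero)
  qed
  have nn: "0 \<le> \<Lambda> n ^ Suc r * (ker \<mu> s * (ec (u, \<eta>) n s)\<^sup>2)" for n s
    by (simp add: m_nonneg less_imp_le[OF \<Lambda>_pos])
  have le: "(\<Sum>n<N. \<Lambda> n ^ Suc r * (ker \<mu> s * (ec (u, \<eta>) n s)\<^sup>2)) \<le> K s" for N s
    using term_sums[of s] nn[of _ s] sum_le_suminf[of "\<lambda>n. \<Lambda> n ^ Suc r * (ker \<mu> s * (ec (u, \<eta>) n s)\<^sup>2)" "{..<N}"]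
    by (auto simp: sums_iff)
  have le1: "\<Lambda> n ^ Suc r * (ker \<mu> s * (ec (u, \<eta>) n s)\<^sup>2) \<le> K s" for n s
    using le[where N = "Suc n" and s = s] sum_nonneg[of "{..<n}" "\<lambda>n. \<Lambda> n ^ Suc r * (ker \<mu> s * (ec (u, \<eta>) n s)\<^sup>2)"] nn[of _ s] by simp
  have it: "integrable lborel (\<lambda>s. \<Lambda> n ^ Suc r * (ker \<mu> s * (ec (u, \<eta>) n s)\<^sup>2))" for n
    by (rule Bochner_Integration.integrable_bound[OF iK]) (use le1 nn in \<open>auto intro!: AE_I2 order_trans[OF _ abs_ge_self]\<close>)
  show sq: "sq (ec (u, \<eta>) n)" for n
    using it[of n] \<Lambda>_pos[of n] by (auto simp: sq_def)
  have "(\<lambda>N. \<integral>s. (\<Sum>n<N. \<Lambda> n ^ Suc r * (ker \<mu> s * (ec (u, \<eta>) n s)\<^sup>2)) \<partial>lborel) \<longlonglongrightarrow> (\<integral>s. K s \<partial>lborel)"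
  proof (rule integral_dominated_convergence[where w = K])
    show "AE s in lborel. (\<lambda>N. \<Sum>n<N. \<Lambda> n ^ Suc r * (ker \<mu> s * (ec (u, \<eta>) n s)\<^sup>2)) \<longlonglongrightarrow> K s"
      using term_sums by (simp add: sums_def)
    show "AE s in lborel. norm (\<Sum>n<N. \<Lambda> n ^ Suc r * (ker \<mu> s * (ec (u, \<eta>) n s)\<^sup>2)) \<le> K s" for N
      using le nn by (simp add: sum_nonneg)
  qed (use iK in auto)
  thus "(\<lambda>n. \<Lambda> n ^ Suc r * P (ec (u, \<eta>) n)) sums Mnorm2 a b \<mu> r \<eta>"
    unfolding sums_def Mn P_def using it by (simp add: Bochner_Integration.integral_sum)
qed

text \<open>The converse passage: for nonnegative terms, summability of the integrals makes the sum
  over modes integrable in \<open>s\<close>.\<close>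

lemma MemI:
  assumes Hs: "\<And>s. 0 < s \<Longrightarrow> \<eta> s \<in> Hs a b (Suc r)" and sq: "\<And>n. sq (ec (u, \<eta>) n)"
    and sm: "summable (\<lambda>n. \<Lambda> n ^ Suc r * P (ec (u, \<eta>) n))"
  shows "\<eta> \<in> Mem a b \<mu> r"
proof -
  have m: "(\<lambda>s. coef a b (\<eta> s) k) \<in> borel_measurable (restrict_space lborel {0<..})" for k
    using sq_measurable[OF sq] by (cases k) (auto simp: coef_0 measurable_ec_iff[where u = u])
  define F where "F n s = \<Lambda> n ^ Suc r * (ker \<mu> s * (ec (u, \<eta>) n s)\<^sup>2)" for n s
  have F0: "0 \<le> F n s" for n s unfolding F_def
    by (simp add: m_nonneg less_imp_le[OF \<Lambda>_pos])
  have F_sums: "(\<lambda>n. F n s) sums (ker \<mu> s * hnorm2 a b (Suc r) (\<eta> s))" for s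
  proof (cases "0 < s")
    case True
    hence "(\<lambda>n. ker \<mu> s * (\<Lambda> n ^ Suc r * (coef a b (\<eta> s) (Suc n))\<^sup>2)) sums (ker \<mu> s * hnorm2 a b (Suc r) (\<eta> s))"
      unfolding hnorm2_def by (intro sums_mult summable_sums Hs_summable Hs)
    thus ?thesis using True by (simp add: F_def ec_def mult.left_commute)
  next
    case False
    thus ?thesis by (simp add: F_def m_zero)
  qed
  have "integrable lborel (\<lambda>s. \<Sum>n. F n s)"
  proof (rule integrable_suminf)
    show "integrable lborel (F n)" for n using sq_integrable2[OF sq] by (simp add: F_def[abs_def])
    show "AE s in lborel. summable (\<lambda>n. norm (F n s))" using F_sums F0 by (auto simp: sums_iff)
    show "summable (\<lambda>n. \<integral>s. norm (F n s) \<partial>lborel)" using sm F0 by (simp add: F_def P_def)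
  qed
  moreover have "(\<Sum>n. F n s) = ker \<mu> s * hnorm2 a b (Suc r) (\<eta> s)" for s using F_sums by (simp add: sums_iff)
  ultimately have "set_integrable lborel {0<..} (\<lambda>s. \<mu> s * hnorm2 a b (Suc r) (\<eta> s))"
    by (simp add: set_integrable_def ker_def mult.assoc)
  thus ?thesis using Hs m by (simp add: Mem_def)
qed

lemma Hsp_fst: "z \<in> Hsp a b \<mu> r \<Longrightarrow> fst z \<in> Hs a b (Suc r)" by (auto simp: Hsp_def)

lemma Hsp_fst1: "z \<in> Hsp a b \<mu> 0 \<Longrightarrow> fst z \<in> Hs a b 1" using Hsp_fst[of z 0] by simp

lemma Hsp_snd: "z \<in> Hsp a b \<mu> r \<Longrightarrow> snd z \<in> Mem a b \<mu> r" by (auto simp: Hsp_def)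

lemma Hsp_sq: "z \<in> Hsp a b \<mu> r \<Longrightarrow> sq (ec z n)"
  using Mem_modes(1)[OF Hsp_snd, of z r "fst z" n] by simp

lemma Hnorm2_sums:
  assumes "z \<in> Hsp a b \<mu> r"
  shows "(\<lambda>n. \<Lambda> n ^ r * ((1 + \<Lambda> n) * (uc z n)\<^sup>2 + \<Lambda> n * P (ec z n))) sums Hnorm2 a b \<mu> r z"
proof -
  have "(\<lambda>n. \<Lambda> n ^ r * (uc z n)\<^sup>2 + \<Lambda> n ^ Suc r * (uc z n)\<^sup>2 + \<Lambda> n ^ Suc r * P (ec z n)) sums Hnorm2 a b \<mu> r z"
    unfolding Hnorm2_def hnorm2_def uc_def using Mem_modes(2)[OF Hsp_snd[OF assms], of "fst z"]
    by (intro sums_add summable_sums Hs_summable Hs_Suc_subset[OF Hsp_fst[OF assms]] Hsp_fst[OF assms]) auto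
  thus ?thesis by (simp add: algebra_simps)
qed

definition en :: "state \<Rightarrow> nat \<Rightarrow> real" where "en z n = (1 + \<Lambda> n) * (uc z n)\<^sup>2 + \<Lambda> n * P (ec z n)"

lemma en_nonneg: "0 \<le> en z n"
  unfolding en_def using \<Lambda>_pos[of n] P_nonneg by (intro add_nonneg_nonneg mult_nonneg_nonneg) auto

lemma Hnorm2_0_sums: "z \<in> Hsp a b \<mu> 0 \<Longrightarrow> en z sums Hnorm2 a b \<mu> 0 z"
  using Hnorm2_sums[of z 0] by (simp add: en_def[abs_def])

lemma en_sum_le: "z \<in> Hsp a b \<mu> 0 \<Longrightarrow> finite K \<Longrightarrow> sum (en z) K \<le> Hnorm2 a b \<mu> 0 z"
  using Hnorm2_0_sums[of z] sum_le_suminf[of "en z" K] en_nonneg by (auto simp: sums_iff)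

lemma en_le: "z \<in> Hsp a b \<mu> 0 \<Longrightarrow> en z n \<le> Hnorm2 a b \<mu> 0 z"
  using en_sum_le[of z "{n}"] by simp

lemma Hnorm2_nonneg: "z \<in> Hsp a b \<mu> 0 \<Longrightarrow> 0 \<le> Hnorm2 a b \<mu> 0 z"
  using en_sum_le[of z "{}"] by simp

definition sdiff :: "state \<Rightarrow> state \<Rightarrow> state" where
  "sdiff z w = (\<lambda>x. fst z x - fst w x, \<lambda>s x. snd z s x - snd w s x)"

lemma Hdist_sdiff: "Hdist a b \<mu> z w = sqrt (Hnorm2 a b \<mu> 0 (sdiff z w))"
  by (simp add: Hdist_def sdiff_def)

lemma Hs_diff: assumes "u \<in> Hs a b r" "v \<in> Hs a b r" shows "(\<lambda>x. u x - v x) \<in> Hs a b r"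
proof -
  have "summable (\<lambda>n. 2 * (\<Lambda> n ^ r * (coef a b u (Suc n))\<^sup>2) + 2 * (\<Lambda> n ^ r * (coef a b v (Suc n))\<^sup>2))"
    by (intro summable_add summable_mult Hs_summable assms)
  moreover have "norm (\<Lambda> n ^ r * (coef a b u (Suc n) - coef a b v (Suc n))\<^sup>2)
      \<le> 2 * (\<Lambda> n ^ r * (coef a b u (Suc n))\<^sup>2) + 2 * (\<Lambda> n ^ r * (coef a b v (Suc n))\<^sup>2)" for n
  proof -
    have "\<Lambda> n ^ r * (coef a b u (Suc n) - coef a b v (Suc n))\<^sup>2 \<le> \<Lambda> n ^ r * (2 * (coef a b u (Suc n))\<^sup>2 + 2 * (coef a b v (Suc n))\<^sup>2)"
      using square_add_young[of 1 "coef a b u (Suc n)" "- coef a b v (Suc n)"] \<Lambda>_pos[of n]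
      by (intro mult_left_mono) auto
    thus ?thesis using \<Lambda>_pos[of n] by (simp add: distrib_left mult.left_commute)
  qed
  ultimately have "summable (\<lambda>n. \<Lambda> n ^ r * (coef a b u (Suc n) - coef a b v (Suc n))\<^sup>2)"
    by (rule summable_comparison_test'[where N = 0])
  thus ?thesis using assms by (simp add: Hs_def L2_diff coef_diff)
qed

lemma uc_sdiff: "z \<in> Hsp a b \<mu> 0 \<Longrightarrow> w \<in> Hsp a b \<mu> 0 \<Longrightarrow> uc (sdiff z w) n = uc z n - uc w n"
  by (simp add: uc_def sdiff_def coef_diff[OF Hs_L2 Hs_L2, OF Hsp_fst Hsp_fst])

lemma ec_sdiff: assumes "z \<in> Hsp a b \<mu> 0" "w \<in> Hsp a b \<mu> 0" shows "ec (sdiff z w) n = (\<lambda>s. ec z n s - ec w n s)"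
proof
  fix s
  show "ec (sdiff z w) n s = ec z n s - ec w n s"
  proof (cases "0 < s")
    case True
    hence "snd z s \<in> L2 a b" "snd w s \<in> L2 a b"
      using Hsp_snd[OF assms(1)] Hsp_snd[OF assms(2)] by (auto simp: Mem_def intro: Hs_L2)
    thus ?thesis by (simp add: ec_def sdiff_def coef_diff right_diff_distrib)
  qed (simp add: ec_def)
qed

lemma sdiff_Hsp: assumes z: "z \<in> Hsp a b \<mu> 0" and w: "w \<in> Hsp a b \<mu> 0" shows "sdiff z w \<in> Hsp a b \<mu> 0"
proof -
  have "snd (sdiff z w) \<in> Mem a b \<mu> 0"
  proof (rule MemI)
    fix s :: real assume "0 < s"
    thus "snd (sdiff z w) s \<in> Hs a b (Suc 0)"
      using Hsp_snd[OF z] Hsp_snd[OF w] by (auto simp: sdiff_def Mem_def intro!: Hs_diff)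
  next
    show "sq (ec (fst (sdiff z w), snd (sdiff z w)) n)" for n
      using sq_diff[OF Hsp_sq[OF z] Hsp_sq[OF w]] by (simp add: ec_sdiff[OF z w])
    have "summable (\<lambda>n. 2 * (\<Lambda> n ^ Suc 0 * P (ec (fst z, snd z) n)) + 2 * (\<Lambda> n ^ Suc 0 * P (ec (fst w, snd w) n)))"
      by (intro summable_add summable_mult sums_summable[OF Mem_modes(2)] Hsp_snd z w)
    moreover have "norm (\<Lambda> n ^ Suc 0 * P (ec (fst (sdiff z w), snd (sdiff z w)) n))
        \<le> 2 * (\<Lambda> n ^ Suc 0 * P (ec (fst z, snd z) n)) + 2 * (\<Lambda> n ^ Suc 0 * P (ec (fst w, snd w) n))" for n
      using mult_left_mono[OF P_diff_le[OF Hsp_sq[OF z] Hsp_sq[OF w], of n n], of "\<Lambda> n"] \<Lambda>_pos[of n] P_nonneg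
      by (simp add: ec_sdiff[OF z w] distrib_left mult.left_commute)
    ultimately show "summable (\<lambda>n. \<Lambda> n ^ Suc 0 * P (ec (fst (sdiff z w), snd (sdiff z w)) n))"
      by (rule summable_comparison_test'[where N = 0])
  qed
  moreover have "fst (sdiff z w) \<in> Hs a b (Suc 0)"
    unfolding sdiff_def fst_conv by (intro Hs_diff Hsp_fst z w)
  ultimately show ?thesis by (simp add: Hsp_def case_prod_unfold)
qed

text \<open>The energy of one mode of a difference of states, written in the coefficients of the two
  states so that it can be estimated without forming the difference.\<close>

definition dd :: "state \<Rightarrow> state \<Rightarrow> nat \<Rightarrow> real" where
  "dd z w n = (1 + \<Lambda> n) * (uc z n - uc w n)\<^sup>2 + \<Lambda> n * P (\<lambda>s. ec z n s - ec w n s)"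

lemma dd_en: "z \<in> Hsp a b \<mu> 0 \<Longrightarrow> w \<in> Hsp a b \<mu> 0 \<Longrightarrow> dd z w n = en (sdiff z w) n"
  by (simp add: dd_def en_def uc_sdiff ec_sdiff)

definition D2 :: "state \<Rightarrow> state \<Rightarrow> real" where "D2 z w = Hnorm2 a b \<mu> 0 (sdiff z w)"

lemma D2_sums: assumes "z \<in> Hsp a b \<mu> 0" "w \<in> Hsp a b \<mu> 0" shows "dd z w sums D2 z w"
  using Hnorm2_0_sums[OF sdiff_Hsp[OF assms]] by (simp add: D2_def dd_en[OF assms, abs_def])

lemma dd_nonneg: "0 \<le> dd z w n"
  unfolding dd_def using \<Lambda>_pos[of n] P_nonneg by (intro add_nonneg_nonneg mult_nonneg_nonneg) auto

lemma dd_le: "z \<in> Hsp a b \<mu> 0 \<Longrightarrow> w \<in> Hsp a b \<mu> 0 \<Longrightarrow> dd z w n \<le> D2 z w"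
  using en_le[OF sdiff_Hsp] by (simp add: dd_en D2_def)

lemma D2_nonneg: "z \<in> Hsp a b \<mu> 0 \<Longrightarrow> w \<in> Hsp a b \<mu> 0 \<Longrightarrow> 0 \<le> D2 z w"
  using Hnorm2_nonneg[OF sdiff_Hsp] by (simp add: D2_def)

lemma Hdist_D2: "Hdist a b \<mu> z w = sqrt (D2 z w)" by (simp add: Hdist_sdiff D2_def)

lemma D2_sym: "z \<in> Hsp a b \<mu> 0 \<Longrightarrow> w \<in> Hsp a b \<mu> 0 \<Longrightarrow> D2 z w = D2 w z"
proof -
  assume zw: "z \<in> Hsp a b \<mu> 0" "w \<in> Hsp a b \<mu> 0"
  have "dd z w = dd w z" by (auto simp: dd_def fun_eq_iff P_uminus[of "ec z _"] power2_commute)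
  thus ?thesis using D2_sums[OF zw] D2_sums[OF zw(2,1)] sums_unique2 by metis
qed

text \<open>The inequality holds in each mode with the same parameter \<open>\<tau>\<close> and is
  linear in the squared quantities, hence it sums over the modes.\<close>

lemma D2_young:
  assumes zw: "z \<in> Hsp a b \<mu> 0" "v \<in> Hsp a b \<mu> 0" "w \<in> Hsp a b \<mu> 0" and \<tau>: "0 < \<tau>"
  shows "D2 z w \<le> (1 + \<tau>) * D2 z v + (1 + 1 / \<tau>) * D2 v w"
proof (rule sums_le)
  show "dd z w sums D2 z w" by (rule D2_sums[OF zw(1,3)])
  show "(\<lambda>n. (1 + \<tau>) * dd z v n + (1 + 1 / \<tau>) * dd v w n) sums ((1 + \<tau>) * D2 z v + (1 + 1 / \<tau>) * D2 v w)"
    by (intro sums_add sums_mult D2_sums zw)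
  fix n
  have 1: "(uc z n - uc w n)\<^sup>2 \<le> (1 + \<tau>) * (uc z n - uc v n)\<^sup>2 + (1 + 1 / \<tau>) * (uc v n - uc w n)\<^sup>2"
    using square_add_young[OF \<tau>, of "uc z n - uc v n" "uc v n - uc w n"] by simp
  have 2: "P (\<lambda>s. ec z n s - ec w n s) \<le> (1 + \<tau>) * P (\<lambda>s. ec z n s - ec v n s) + (1 + 1 / \<tau>) * P (\<lambda>s. ec v n s - ec w n s)"
    using P_young[OF sq_diff[OF Hsp_sq[OF zw(1)] Hsp_sq[OF zw(2)]] sq_diff[OF Hsp_sq[OF zw(2)] Hsp_sq[OF zw(3)]] \<tau>, of n n n n] by simp
  show "dd z w n \<le> (1 + \<tau>) * dd z v n + (1 + 1 / \<tau>) * dd v w n"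
    using mult_left_mono[OF 1, of "1 + \<Lambda> n"] mult_left_mono[OF 2, of "\<Lambda> n"] \<Lambda>_pos[of n]
    unfolding dd_def by (simp only: distrib_left mult.left_commute[of "1 + \<tau>"] mult.left_commute[of "1 + 1 / \<tau>"]) linarith
qed

lemma Hdist_triangle:
  assumes "z \<in> Hsp a b \<mu> 0" "v \<in> Hsp a b \<mu> 0" "w \<in> Hsp a b \<mu> 0"
  shows "Hdist a b \<mu> z w \<le> Hdist a b \<mu> z v + Hdist a b \<mu> v w"
  unfolding Hdist_D2 by (intro sqrt_triangle_of_young D2_nonneg D2_young assms)

lemma Hdist_nonneg: "z \<in> Hsp a b \<mu> 0 \<Longrightarrow> w \<in> Hsp a b \<mu> 0 \<Longrightarrow> 0 \<le> Hdist a b \<mu> z w"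
  unfolding Hdist_D2 using D2_nonneg by simp

lemma Hdist_sym: "z \<in> Hsp a b \<mu> 0 \<Longrightarrow> w \<in> Hsp a b \<mu> 0 \<Longrightarrow> Hdist a b \<mu> z w = Hdist a b \<mu> w z"
  unfolding Hdist_D2 using D2_sym by simp

lemma sqrt_Hnorm2_triangle:
  assumes zw: "z \<in> Hsp a b \<mu> 0" "w \<in> Hsp a b \<mu> 0"
  shows "sqrt (Hnorm2 a b \<mu> 0 z) \<le> sqrt (Hnorm2 a b \<mu> 0 w) + Hdist a b \<mu> z w"
  unfolding Hdist_D2
proof (intro sqrt_triangle_of_young Hnorm2_nonneg D2_nonneg zw)
  fix \<tau> :: real assume \<tau>: "0 < \<tau>"
  show "Hnorm2 a b \<mu> 0 z \<le> (1 + \<tau>) * Hnorm2 a b \<mu> 0 w + (1 + 1 / \<tau>) * D2 z w"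
  proof (rule sums_le)
    show "en z sums Hnorm2 a b \<mu> 0 z" by (rule Hnorm2_0_sums[OF zw(1)])
    show "(\<lambda>n. (1 + \<tau>) * en w n + (1 + 1 / \<tau>) * dd z w n) sums ((1 + \<tau>) * Hnorm2 a b \<mu> 0 w + (1 + 1 / \<tau>) * D2 z w)"
      by (intro sums_add sums_mult D2_sums Hnorm2_0_sums zw)
    fix n
    have 1: "(uc z n)\<^sup>2 \<le> (1 + \<tau>) * (uc w n)\<^sup>2 + (1 + 1 / \<tau>) * (uc z n - uc w n)\<^sup>2"
      using square_add_young[OF \<tau>, of "uc w n" "uc z n - uc w n"] by simp
    have 2: "P (ec z n) \<le> (1 + \<tau>) * P (ec w n) + (1 + 1 / \<tau>) * P (\<lambda>s. ec z n s - ec w n s)"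
      using P_young[OF Hsp_sq[OF zw(2)] sq_diff[OF Hsp_sq[OF zw(1)] Hsp_sq[OF zw(2)]] \<tau>, of n n n] by simp
    show "en z n \<le> (1 + \<tau>) * en w n + (1 + 1 / \<tau>) * dd z w n"
      using mult_left_mono[OF 1, of "1 + \<Lambda> n"] mult_left_mono[OF 2, of "\<Lambda> n"] \<Lambda>_pos[of n]
      unfolding dd_def en_def by (simp only: distrib_left mult.left_commute[of "1 + \<tau>"] mult.left_commute[of "1 + 1 / \<tau>"]) linarith
  qed
qed

text \<open>The forcing of a mode after division by \<open>1 + \<Lambda> n\<close>, the eigenvalue
  of \<open>B\<close>. The summand \<open>Q\<close> compensates for replacing the memory term
  \<open>\<Lambda> n / (1 + \<Lambda> n) * Q\<close> by the full \<open>Q\<close> in the scalar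
  equation.\<close>

definition G :: "state \<Rightarrow> nat \<Rightarrow> real" where
  "G z n = (Q (ec z n) + flux (fst z) (Suc n) + coef a b f (Suc n)) / (1 + \<Lambda> n)"

lemma uc_square_le: "z \<in> Hsp a b \<mu> 0 \<Longrightarrow> w \<in> Hsp a b \<mu> 0 \<Longrightarrow> (uc z n - uc w n)\<^sup>2 \<le> D2 z w"
proof -
  assume zw: "z \<in> Hsp a b \<mu> 0" "w \<in> Hsp a b \<mu> 0"
  have "1 * (uc z n - uc w n)\<^sup>2 \<le> (1 + \<Lambda> n) * (uc z n - uc w n)\<^sup>2 + \<Lambda> n * P (\<lambda>s. ec z n s - ec w n s)"
    using \<Lambda>_pos[of n] P_nonneg by (intro add_increasing2 mult_nonneg_nonneg mult_right_mono) auto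
  also have "\<dots> \<le> D2 z w" using dd_le[OF zw, of n] by (simp add: dd_def)
  finally show ?thesis by simp
qed

lemma \<Lambda>P_le: "z \<in> Hsp a b \<mu> 0 \<Longrightarrow> w \<in> Hsp a b \<mu> 0 \<Longrightarrow> \<Lambda> n * P (\<lambda>s. ec z n s - ec w n s) \<le> dd z w n"
  unfolding dd_def using \<Lambda>_pos[of n] by (intro add_increasing) auto

lemma P_le_dd: assumes "z \<in> Hsp a b \<mu> 0" "w \<in> Hsp a b \<mu> 0"
  shows "P (\<lambda>s. ec z n s - ec w n s) \<le> dd z w n / \<Lambda> 0"
proof -
  have "\<Lambda> 0 * P (\<lambda>s. ec z n s - ec w n s) \<le> \<Lambda> n * P (\<lambda>s. ec z n s - ec w n s)"
    by (intro mult_right_mono \<Lambda>_ge P_nonneg)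
  also note \<Lambda>P_le[OF assms]
  finally show ?thesis using \<Lambda>_pos[of 0] by (simp add: field_simps)
qed

lemma Q_square_dd: assumes "z \<in> Hsp a b \<mu> 0" "w \<in> Hsp a b \<mu> 0"
  shows "(Q (ec z n) - Q (ec w n))\<^sup>2 \<le> mass / \<Lambda> 0 * dd z w n"
proof -
  have "(Q (ec z n) - Q (ec w n))\<^sup>2 \<le> mass * P (\<lambda>s. ec z n s - ec w n s)"
    using Q_square_le[OF sq_diff[OF Hsp_sq[OF assms(1)] Hsp_sq[OF assms(2)]]]
    by (simp add: Q_diff[OF Hsp_sq[OF assms(1)] Hsp_sq[OF assms(2)]])
  also have "\<dots> \<le> mass * (dd z w n / \<Lambda> 0)"
    using P_le_dd[OF assms] mass_pos by (intro mult_left_mono) auto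
  finally show ?thesis by simp
qed

lemma sum_dd_le: assumes "z \<in> Hsp a b \<mu> 0" "w \<in> Hsp a b \<mu> 0" shows "(\<Sum>n<N. dd z w n) \<le> D2 z w"
  using D2_sums[OF assms] sum_le_suminf[of "dd z w" "{..<N}"] dd_nonneg by (auto simp: sums_iff)

lemma hnorm2_1_le: assumes z: "z \<in> Hsp a b \<mu> 0" shows "hnorm2 a b 1 (fst z) \<le> Hnorm2 a b \<mu> 0 z" "0 \<le> hnorm2 a b 1 (fst z)"
proof -
  have s: "summable (\<lambda>n. \<Lambda> n ^ r * (coef a b (fst z) (Suc n))\<^sup>2)" if "r \<le> 1" for r
    using that Hs_summable[OF Hsp_fst1[OF z]] Hs_summable[OF Hs_Suc_subset, of "fst z" 0] Hsp_fst1[OF z]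
    by (cases r) auto
  show "0 \<le> hnorm2 a b 1 (fst z)" unfolding hnorm2_def
    by (rule suminf_nonneg[OF s]) (auto simp: lam_nonneg)
  moreover have "0 \<le> hnorm2 a b 0 (fst z)" unfolding hnorm2_def
    by (rule suminf_nonneg[OF s]) auto
  moreover have "0 \<le> Mnorm2 a b \<mu> 0 (snd z)"
    unfolding sums_unique[OF Mem_modes(2)[OF Hsp_snd[OF z], of "fst z"]]
    by (rule suminf_nonneg[OF sums_summable[OF Mem_modes(2)[OF Hsp_snd[OF z]]]]) (simp add: lam_nonneg P_nonneg)
  ultimately show "hnorm2 a b 1 (fst z) \<le> Hnorm2 a b \<mu> 0 z" by (simp add: Hnorm2_def)
qed

lemma integral_square_diff_le: assumes zw: "z \<in> Hsp a b \<mu> 0" "w \<in> Hsp a b \<mu> 0"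
  shows "(\<integral>x. (fst z x - fst w x)\<^sup>2 \<partial>M) \<le> D2 z w"
proof -
  have "fst (sdiff z w) \<in> Hs a b 1" by (rule Hsp_fst1[OF sdiff_Hsp[OF zw]])
  from parseval[OF this] have 1: "(\<lambda>n. (uc (sdiff z w) n)\<^sup>2) sums (\<integral>x. (fst z x - fst w x)\<^sup>2 \<partial>M)"
    by (simp add: uc_def sdiff_def)
  have 2: "(uc (sdiff z w) n)\<^sup>2 \<le> en (sdiff z w) n" for n
  proof -
    have "1 * (uc (sdiff z w) n)\<^sup>2 \<le> en (sdiff z w) n" unfolding en_def
      using \<Lambda>_pos[of n] P_nonneg by (intro add_increasing2 mult_nonneg_nonneg mult_right_mono) auto
    thus ?thesis by simp
  qed
  show ?thesis unfolding D2_def by (rule sums_le[OF 2 1 Hnorm2_0_sums[OF sdiff_Hsp[OF zw]]])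
qed

lemma flux_diff_sum_le:
  assumes zw: "z \<in> Hsp a b \<mu> 0" "w \<in> Hsp a b \<mu> 0" and R: "Hnorm2 a b \<mu> 0 z \<le> R" "Hnorm2 a b \<mu> 0 w \<le> R"
  shows "(\<Sum>n<N. (flux (fst z) (Suc n) - flux (fst w) (Suc n))\<^sup>2 / \<Lambda> n) \<le> (2 + 2 * sob * R) * D2 z w"
proof -
  have "(\<Sum>n<N. (flux (fst z) (Suc n) - flux (fst w) (Suc n))\<^sup>2 / \<Lambda> n) \<le> (2 + sob * (hnorm2 a b 1 (fst z) + hnorm2 a b 1 (fst w))) * (\<integral>x. (fst z x - fst w x)\<^sup>2 \<partial>M)"
    by (intro flux_lipschitz Hsp_fst1 zw)
  also have "\<dots> \<le> (2 + 2 * sob * R) * D2 z w"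
  proof (rule mult_mono)
    have "sob * (hnorm2 a b 1 (fst z) + hnorm2 a b 1 (fst w)) \<le> sob * (2 * R)"
      using hnorm2_1_le(1)[OF zw(1)] hnorm2_1_le(1)[OF zw(2)] R sob_nonneg by (intro mult_left_mono) auto
    thus "2 + sob * (hnorm2 a b 1 (fst z) + hnorm2 a b 1 (fst w)) \<le> 2 + 2 * sob * R" by simp
    show "0 \<le> 2 + 2 * sob * R" using Hnorm2_nonneg[OF zw(1)] R sob_nonneg
      by (intro add_nonneg_nonneg mult_nonneg_nonneg) auto
    show "0 \<le> (\<integral>x. (fst z x - fst w x)\<^sup>2 \<partial>M)" by (intro integral_nonneg_AE) auto
  qed (rule integral_square_diff_le[OF zw])
  finally show ?thesis .
qed

text \<open>Of the two factors \<open>1 + \<Lambda> n\<close> in the denominator one is used up by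
  the weight. The other leaves the flux with at most the inverse eigenvalue, exactly the weight in
  which it is Lipschitz for the energy distance.\<close>

lemma G_diff_sum_le:
  assumes zw: "z \<in> Hsp a b \<mu> 0" "w \<in> Hsp a b \<mu> 0" and R: "Hnorm2 a b \<mu> 0 z \<le> R" "Hnorm2 a b \<mu> 0 w \<le> R"
  shows "(\<Sum>n<N. (1 + \<Lambda> n) * (G z n - G w n)\<^sup>2) \<le> (2 * (mass / \<Lambda> 0) + 2 * (2 + 2 * sob * R)) * D2 z w"
proof -
  have "(1 + \<Lambda> n) * (G z n - G w n)\<^sup>2 \<le> 2 * (mass / \<Lambda> 0) * dd z w n + 2 * ((flux (fst z) (Suc n) - flux (fst w) (Suc n))\<^sup>2 / \<Lambda> n)" for n
  proof -
    let ?q = "Q (ec z n) - Q (ec w n)" and ?p = "flux (fst z) (Suc n) - flux (fst w) (Suc n)"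
    have l: "0 < \<Lambda> n" by (rule \<Lambda>_pos)
    have "G z n - G w n = (?q + ?p) / (1 + \<Lambda> n)" unfolding G_def by (simp add: diff_divide_distrib[symmetric])
    hence "(1 + \<Lambda> n) * (G z n - G w n)\<^sup>2 = (?q + ?p)\<^sup>2 / (1 + \<Lambda> n)"
      using l by (simp add: power_divide power2_eq_square)
    also have "\<dots> \<le> (2 * ?q\<^sup>2 + 2 * ?p\<^sup>2) / (1 + \<Lambda> n)"
      using square_add_young[of 1 ?q ?p] l by (intro divide_right_mono) auto
    also have "\<dots> = 2 * (?q\<^sup>2 / (1 + \<Lambda> n)) + 2 * (?p\<^sup>2 / (1 + \<Lambda> n))" by (simp add: add_divide_distrib)
    also have "\<dots> \<le> 2 * ?q\<^sup>2 + 2 * (?p\<^sup>2 / \<Lambda> n)"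
    proof -
      have "?q\<^sup>2 / (1 + \<Lambda> n) \<le> ?q\<^sup>2 / 1" "?p\<^sup>2 / (1 + \<Lambda> n) \<le> ?p\<^sup>2 / \<Lambda> n"
        using l by (intro divide_left_mono; simp)+
      thus ?thesis by simp
    qed
    also have "\<dots> \<le> 2 * (mass / \<Lambda> 0) * dd z w n + 2 * (?p\<^sup>2 / \<Lambda> n)"
      using Q_square_dd[OF zw, of n] by simp
    finally show ?thesis .
  qed
  hence "(\<Sum>n<N. (1 + \<Lambda> n) * (G z n - G w n)\<^sup>2) \<le> (\<Sum>n<N. 2 * (mass / \<Lambda> 0) * dd z w n + 2 * ((flux (fst z) (Suc n) - flux (fst w) (Suc n))\<^sup>2 / \<Lambda> n))"
    by (rule sum_mono)
  also have "\<dots> = 2 * (mass / \<Lambda> 0) * (\<Sum>n<N. dd z w n) + 2 * (\<Sum>n<N. (flux (fst z) (Suc n) - flux (fst w) (Suc n))\<^sup>2 / \<Lambda> n)"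
    by (simp add: sum.distrib sum_distrib_left)
  also have "\<dots> \<le> 2 * (mass / \<Lambda> 0) * D2 z w + 2 * ((2 + 2 * sob * R) * D2 z w)"
    using mass_pos \<Lambda>_pos[of 0] by (intro add_mono mult_left_mono sum_dd_le flux_diff_sum_le zw R) auto
  also have "\<dots> = (2 * (mass / \<Lambda> 0) + 2 * (2 + 2 * sob * R)) * D2 z w" by (simp add: algebra_simps)
  finally show ?thesis .
qed

definition forcing_bound :: "real \<Rightarrow> real" where
  "forcing_bound R = 3 * (mass / \<Lambda> 0 * R) + 3 * (2 * (1 + sob * R) * R) + 3 * (\<integral>x. (f x)\<^sup>2 \<partial>M)"

text \<open>The squared weight undoes the division completely and leaves unweighted sums of memory
  integrals, flux coefficients and coefficients of \<open>f\<close>, all bounded by the energy. The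
  weight is one power of \<open>1 + \<Lambda> n\<close> above that of the energy: the gained
  derivative.\<close>

lemma G_sum_le:
  assumes z: "z \<in> Hsp a b \<mu> 0" and R: "Hnorm2 a b \<mu> 0 z \<le> R"
  shows "(\<Sum>n<N. (1 + \<Lambda> n)\<^sup>2 * (G z n)\<^sup>2) \<le> forcing_bound R"
proof -
  have "(1 + \<Lambda> n)\<^sup>2 * (G z n)\<^sup>2 \<le> 3 * (mass / \<Lambda> 0 * en z n) + 3 * (flux (fst z) (Suc n))\<^sup>2 + 3 * (coef a b f (Suc n))\<^sup>2" for n
  proof -
    let ?q = "Q (ec z n)" and ?p = "flux (fst z) (Suc n)" and ?f = "coef a b f (Suc n)"
    have l: "0 < 1 + \<Lambda> n" using \<Lambda>_pos[of n] by simp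
    have "(1 + \<Lambda> n)\<^sup>2 * (G z n)\<^sup>2 = ((1 + \<Lambda> n) * G z n)\<^sup>2" by (simp add: power_mult_distrib)
    also have "(1 + \<Lambda> n) * G z n = ?q + ?p + ?f" using l by (simp add: G_def)
    also have "(?q + ?p + ?f)\<^sup>2 \<le> 3 * ?q\<^sup>2 + 3 * ?p\<^sup>2 + 3 * ?f\<^sup>2"
    proof -
      have "0 \<le> (?q - ?p)\<^sup>2 + (?q - ?f)\<^sup>2 + (?p - ?f)\<^sup>2" by simp
      thus ?thesis by (simp add: power2_eq_square algebra_simps)
    qed
    also have "?q\<^sup>2 \<le> mass / \<Lambda> 0 * en z n"
    proof -
      have "?q\<^sup>2 \<le> mass * P (ec z n)" by (rule Q_square_le[OF Hsp_sq[OF z]])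
      also have "P (ec z n) \<le> en z n / \<Lambda> 0"
      proof -
        have "\<Lambda> 0 * P (ec z n) \<le> \<Lambda> n * P (ec z n)" by (intro mult_right_mono \<Lambda>_ge P_nonneg)
        also have "\<dots> \<le> en z n" unfolding en_def using l by (intro add_increasing) auto
        finally show ?thesis using \<Lambda>_pos[of 0] by (simp add: field_simps)
      qed
      finally show ?thesis using mass_pos by (simp add: mult_left_mono)
    qed
    finally show ?thesis by simp
  qed
  hence "(\<Sum>n<N. (1 + \<Lambda> n)\<^sup>2 * (G z n)\<^sup>2) \<le> (\<Sum>n<N. 3 * (mass / \<Lambda> 0 * en z n) + 3 * (flux (fst z) (Suc n))\<^sup>2 + 3 * (coef a b f (Suc n))\<^sup>2)"
    by (rule sum_mono)
  also have "\<dots> = 3 * (mass / \<Lambda> 0 * (\<Sum>n<N. en z n)) + 3 * (\<Sum>n<N. (flux (fst z) (Suc n))\<^sup>2) + 3 * (\<Sum>n<N. (coef a b f (Suc n))\<^sup>2)"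
    by (simp add: sum.distrib sum_distrib_left)
  also have "\<dots> \<le> forcing_bound R"
    unfolding forcing_bound_def
  proof (intro add_mono mult_left_mono bessel_sin f_L2)
    show "(\<Sum>n<N. en z n) \<le> R" using en_sum_le[OF z, of "{..<N}"] R by simp
    have h: "0 \<le> hnorm2 a b 1 (fst z)" "hnorm2 a b 1 (fst z) \<le> R" using hnorm2_1_le[OF z] R by auto
    have "(\<Sum>n<N. (flux (fst z) (Suc n))\<^sup>2) \<le> 2 * (1 + sob * hnorm2 a b 1 (fst z)) * hnorm2 a b 1 (fst z)"
      by (rule flux_bound[OF Hsp_fst1[OF z]])
    also have "\<dots> \<le> 2 * (1 + sob * R) * R"
      using h sob_nonneg by (intro mult_mono add_mono mult_left_mono) (auto intro!: add_nonneg_nonneg mult_nonneg_nonneg)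
    finally show "(\<Sum>n<N. (flux (fst z) (Suc n))\<^sup>2) \<le> 2 * (1 + sob * R) * R" .
  qed (use mass_pos \<Lambda>_pos[of 0] in auto)
  finally show ?thesis .
qed

section \<open>Continuity of modes, norm and forcing along convergent sequences of states\<close>

context
  fixes z :: "nat \<Rightarrow> state" and w :: state
  assumes z: "\<And>j. z j \<in> Hsp a b \<mu> 0" and w: "w \<in> Hsp a b \<mu> 0"
    and lim: "(\<lambda>j. Hdist a b \<mu> (z j) w) \<longlonglongrightarrow> 0"
begin

lemma D2_tendsto: "(\<lambda>j. D2 (z j) w) \<longlonglongrightarrow> 0"
proof -
  have "(\<lambda>j. (Hdist a b \<mu> (z j) w)\<^sup>2) \<longlonglongrightarrow> 0\<^sup>2" by (intro tendsto_power lim)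
  thus ?thesis using D2_nonneg[OF z w] by (simp add: Hdist_D2)
qed

lemma tendsto_of_square_le:
  fixes x :: "nat \<Rightarrow> real"
  assumes "\<And>j. (x j - y)\<^sup>2 \<le> c j * D2 (z j) w" "bounded (range c)"
  shows "x \<longlonglongrightarrow> y"
proof -
  obtain B where B: "\<And>j. norm (c j) \<le> B" using assms(2) by (auto simp: bounded_iff)
  have "(\<lambda>j. c j * D2 (z j) w) \<longlonglongrightarrow> 0"
    by (rule lim_null_mult_left_bounded[OF _ D2_tendsto, of _ B]) (use B in auto)
  hence "(\<lambda>j. (x j - y)\<^sup>2) \<longlonglongrightarrow> 0"
    by (rule tendsto_sandwich[OF _ _ tendsto_const, rotated 2]) (use assms(1) in auto)
  hence "(\<lambda>j. x j - y) \<longlonglongrightarrow> 0" by (simp add: tendsto_null_power)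
  thus ?thesis by (simp add: LIM_zero_iff)
qed

lemma uc_tendsto: "(\<lambda>j. uc (z j) n) \<longlonglongrightarrow> uc w n"
  by (rule tendsto_of_square_le[where c = "\<lambda>_. 1"]) (use uc_square_le[OF z w] in auto)

lemma Q_tendsto: "(\<lambda>j. Q (ec (z j) n)) \<longlonglongrightarrow> Q (ec w n)"
proof (rule tendsto_of_square_le[where c = "\<lambda>_. mass / \<Lambda> 0"])
  fix j
  have "mass / \<Lambda> 0 * dd (z j) w n \<le> mass / \<Lambda> 0 * D2 (z j) w"
    using dd_le[OF z w] mass_pos \<Lambda>_pos[of 0] by (intro mult_left_mono) auto
  thus "(Q (ec (z j) n) - Q (ec w n))\<^sup>2 \<le> mass / \<Lambda> 0 * D2 (z j) w" using Q_square_dd[OF z w, of j n] by simp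
qed auto

lemma P_tendsto: "(\<lambda>j. P (ec (z j) n)) \<longlonglongrightarrow> P (ec w n)"
proof -
  have "(\<lambda>j. sqrt (P (ec (z j) n))) \<longlonglongrightarrow> sqrt (P (ec w n))"
  proof (rule tendsto_of_square_le[where c = "\<lambda>_. 1 / \<Lambda> 0"])
    fix j
    have "\<bar>sqrt (P (ec (z j) n)) - sqrt (P (ec w n))\<bar> \<le> sqrt (P (\<lambda>s. ec (z j) n s - ec w n s))"
      using sqrt_P_triangle[OF Hsp_sq[OF z] Hsp_sq[OF w], of j n n] sqrt_P_triangle[OF Hsp_sq[OF w] Hsp_sq[OF z], of n j n]
      unfolding P_uminus[of "ec w n" "ec (z j) n"] abs_le_iff by linarith
    hence "\<bar>sqrt (P (ec (z j) n)) - sqrt (P (ec w n))\<bar>\<^sup>2 \<le> (sqrt (P (\<lambda>s. ec (z j) n s - ec w n s)))\<^sup>2"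
      by (rule power_mono) simp
    also have "\<dots> = P (\<lambda>s. ec (z j) n s - ec w n s)" using P_nonneg by simp
    also have "\<dots> \<le> dd (z j) w n / \<Lambda> 0" by (rule P_le_dd[OF z w])
    also have "\<dots> \<le> 1 / \<Lambda> 0 * D2 (z j) w"
      using dd_le[OF z w, of j n] \<Lambda>_pos[of 0] by (simp add: divide_right_mono)
    finally show "(sqrt (P (ec (z j) n)) - sqrt (P (ec w n)))\<^sup>2 \<le> 1 / \<Lambda> 0 * D2 (z j) w" by simp
  qed auto
  from tendsto_power[OF this, of 2] show ?thesis using P_nonneg by simp
qed

lemma Hnorm2_tendsto: "(\<lambda>j. Hnorm2 a b \<mu> 0 (z j)) \<longlonglongrightarrow> Hnorm2 a b \<mu> 0 w"
proof -
  have "(\<lambda>j. sqrt (Hnorm2 a b \<mu> 0 (z j)) - sqrt (Hnorm2 a b \<mu> 0 w)) \<longlonglongrightarrow> 0"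
  proof (rule Lim_null_comparison[OF _ lim], intro always_eventually allI)
    fix j
    show "norm (sqrt (Hnorm2 a b \<mu> 0 (z j)) - sqrt (Hnorm2 a b \<mu> 0 w)) \<le> Hdist a b \<mu> (z j) w"
      using sqrt_Hnorm2_triangle[OF z w, of j] sqrt_Hnorm2_triangle[OF w z, of j] Hdist_sym[OF w z, of j]
      by (simp add: abs_le_iff)
  qed
  hence "(\<lambda>j. sqrt (Hnorm2 a b \<mu> 0 (z j))) \<longlonglongrightarrow> sqrt (Hnorm2 a b \<mu> 0 w)" by (simp add: LIM_zero_iff)
  from tendsto_power[OF this, of 2] show ?thesis using Hnorm2_nonneg[OF z] Hnorm2_nonneg[OF w] by simp
qed

lemma Hnorm2_bounded: obtains R where "\<And>j. Hnorm2 a b \<mu> 0 (z j) \<le> R" "Hnorm2 a b \<mu> 0 w \<le> R"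
proof -
  have "Bseq (\<lambda>j. Hnorm2 a b \<mu> 0 (z j))" using Hnorm2_tendsto convergentI convergent_imp_Bseq by blast
  then obtain K where K: "\<And>j. norm (Hnorm2 a b \<mu> 0 (z j)) \<le> K" by (auto simp: Bseq_def)
  have "Hnorm2 a b \<mu> 0 (z j) \<le> max K (Hnorm2 a b \<mu> 0 w)" for j using K[of j] by simp
  thus ?thesis using that[of "max K (Hnorm2 a b \<mu> 0 w)"] by simp
qed

lemma flux_tendsto: "(\<lambda>j. flux (fst (z j)) (Suc n)) \<longlonglongrightarrow> flux (fst w) (Suc n)"
proof -
  obtain R where R: "\<And>j. Hnorm2 a b \<mu> 0 (z j) \<le> R" "Hnorm2 a b \<mu> 0 w \<le> R" using Hnorm2_bounded by blast
  show ?thesis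
  proof (rule tendsto_of_square_le[where c = "\<lambda>_. \<Lambda> n * (2 + 2 * sob * R)"])
    fix j
    have "(flux (fst (z j)) (Suc n) - flux (fst w) (Suc n))\<^sup>2 / \<Lambda> n \<le> (\<Sum>n<Suc n. (flux (fst (z j)) (Suc n) - flux (fst w) (Suc n))\<^sup>2 / \<Lambda> n)"
      by (rule member_le_sum) (auto simp: lam_nonneg)
    also have "\<dots> \<le> (2 + 2 * sob * R) * D2 (z j) w" by (rule flux_diff_sum_le[OF z w R])
    finally show "(flux (fst (z j)) (Suc n) - flux (fst w) (Suc n))\<^sup>2 \<le> \<Lambda> n * (2 + 2 * sob * R) * D2 (z j) w"
      using \<Lambda>_pos[of n] by (simp add: field_simps)
  qed auto
qed

lemma G_tendsto: "(\<lambda>j. G (z j) n) \<longlonglongrightarrow> G w n"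
proof -
  have "1 + \<Lambda> n \<noteq> 0" using \<Lambda>_pos[of n] by linarith
  thus ?thesis unfolding G_def by (intro tendsto_intros Q_tendsto flux_tendsto) auto
qed

end

section \<open>Curves that are continuous in the energy distance\<close>

definition curve :: "(real \<Rightarrow> state) \<Rightarrow> bool" where
  "curve U \<longleftrightarrow> (\<forall>t\<ge>0. U t \<in> Hsp a b \<mu> 0) \<and>
     (\<forall>t\<ge>0. \<forall>e>0. \<exists>d>0. \<forall>t'\<ge>0. \<bar>t' - t\<bar> < d \<longrightarrow> Hdist a b \<mu> (U t') (U t) < e)"

lemma curve_Hsp: "curve U \<Longrightarrow> 0 \<le> t \<Longrightarrow> U t \<in> Hsp a b \<mu> 0" by (simp add: curve_def)

lemma curve_tendsto:
  assumes U: "curve U" and x: "\<And>j. 0 \<le> x j" "0 \<le> t" "x \<longlonglongrightarrow> t"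
  shows "(\<lambda>j. Hdist a b \<mu> (U (x j)) (U t)) \<longlonglongrightarrow> 0"
proof (rule LIMSEQ_I)
  fix e :: real assume "0 < e"
  then obtain d where d: "0 < d" "\<And>t'. 0 \<le> t' \<Longrightarrow> \<bar>t' - t\<bar> < d \<Longrightarrow> Hdist a b \<mu> (U t') (U t) < e"
    using U x(2) unfolding curve_def by meson
  obtain N where N: "\<And>j. N \<le> j \<Longrightarrow> norm (x j - t) < d" using LIMSEQ_D[OF x(3) d(1)] by blast
  have "norm (Hdist a b \<mu> (U (x j)) (U t) - 0) < e" if "N \<le> j" for j
    using d(2)[OF x(1), of j] N[OF that] Hdist_nonneg[OF curve_Hsp[OF U x(1)] curve_Hsp[OF U x(2)], of j] by simp
  thus "\<exists>N. \<forall>j\<ge>N. norm (Hdist a b \<mu> (U (x j)) (U t) - 0) < e" by blast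
qed

lemma curve_continuous_on:
  fixes \<phi> :: "state \<Rightarrow> real"
  assumes U: "curve U"
    and \<phi>: "\<And>z w. (\<And>j::nat. z j \<in> Hsp a b \<mu> 0) \<Longrightarrow> w \<in> Hsp a b \<mu> 0 \<Longrightarrow> (\<lambda>j. Hdist a b \<mu> (z j) w) \<longlonglongrightarrow> 0
      \<Longrightarrow> (\<lambda>j. \<phi> (z j)) \<longlonglongrightarrow> \<phi> w"
  shows "continuous_on {0..} (\<lambda>t. \<phi> (U t))"
  unfolding continuous_on_sequentially o_def
proof (intro allI ballI impI)
  fix x and t :: real assume "t \<in> {0..}" and "(\<forall>n. x n \<in> {0..}) \<and> x \<longlonglongrightarrow> t"
  hence x: "\<And>j. 0 \<le> x j" "0 \<le> t" "x \<longlonglongrightarrow> t" by auto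
  show "(\<lambda>n. \<phi> (U (x n))) \<longlonglongrightarrow> \<phi> (U t)"
    by (rule \<phi>[of "\<lambda>n. U (x n)"]) (use curve_tendsto[OF U x] curve_Hsp[OF U] x in auto)
qed

lemma curve_D2_continuous:
  assumes U: "curve U" and V: "curve V"
  shows "continuous_on {0..} (\<lambda>t. D2 (U t) (V t))"
proof -
  have "continuous_on {0..} (\<lambda>t. Hdist a b \<mu> (U t) (V t))"
    unfolding continuous_on_sequentially o_def
  proof (intro allI ballI impI)
    fix x and t :: real assume "t \<in> {0..}" and "(\<forall>n. x n \<in> {0..}) \<and> x \<longlonglongrightarrow> t"
    hence x: "\<And>j. 0 \<le> x j" "0 \<le> t" "x \<longlonglongrightarrow> t" by auto
    have "(\<lambda>j. Hdist a b \<mu> (U (x j)) (U t) + Hdist a b \<mu> (V (x j)) (V t)) \<longlonglongrightarrow> 0 + 0"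
      by (intro tendsto_add curve_tendsto U V x)
    hence lim: "(\<lambda>j. Hdist a b \<mu> (U (x j)) (U t) + Hdist a b \<mu> (V (x j)) (V t)) \<longlonglongrightarrow> 0" by simp
    have "(\<lambda>j. Hdist a b \<mu> (U (x j)) (V (x j)) - Hdist a b \<mu> (U t) (V t)) \<longlonglongrightarrow> 0"
    proof (rule Lim_null_comparison[OF _ lim], intro always_eventually allI)
      fix j
      note h = curve_Hsp[OF U x(1)] curve_Hsp[OF U x(2)] curve_Hsp[OF V x(1)] curve_Hsp[OF V x(2)]
      have "Hdist a b \<mu> (U (x j)) (V (x j)) \<le> Hdist a b \<mu> (U (x j)) (U t) + (Hdist a b \<mu> (U t) (V t) + Hdist a b \<mu> (V t) (V (x j)))"
        using Hdist_triangle[of "U (x j)" "U t" "V (x j)"] Hdist_triangle[of "U t" "V t" "V (x j)"] h by fastforce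
      moreover have "Hdist a b \<mu> (U t) (V t) \<le> Hdist a b \<mu> (U t) (U (x j)) + (Hdist a b \<mu> (U (x j)) (V (x j)) + Hdist a b \<mu> (V (x j)) (V t))"
        using Hdist_triangle[of "U t" "U (x j)" "V t"] Hdist_triangle[of "U (x j)" "V (x j)" "V t"] h by fastforce
      ultimately show "norm (Hdist a b \<mu> (U (x j)) (V (x j)) - Hdist a b \<mu> (U t) (V t)) \<le> Hdist a b \<mu> (U (x j)) (U t) + Hdist a b \<mu> (V (x j)) (V t)"
        using Hdist_sym[OF h(2) h(1), of j] Hdist_sym[OF h(4) h(3), of j] by (simp add: abs_le_iff)
    qed
    thus "(\<lambda>n. Hdist a b \<mu> (U (x n)) (V (x n))) \<longlonglongrightarrow> Hdist a b \<mu> (U t) (V t)" by (simp add: LIM_zero_iff)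
  qed
  hence "continuous_on {0..} (\<lambda>t. (Hdist a b \<mu> (U t) (V t))\<^sup>2)" by (intro continuous_intros)
  thus ?thesis
    by (rule continuous_on_eq) (use D2_nonneg curve_Hsp[OF U] curve_Hsp[OF V] in \<open>auto simp: Hdist_D2\<close>)
qed

end

section \<open>Trajectories\<close>

lemma reflected_integral:
  fixes u :: "real \<Rightarrow> real"
  assumes u: "continuous_on {0..} u" and s: "0 \<le> s" "s \<le> t"
  shows "(LINT r:{0..s}|lborel. u (t - r)) = integral {t-s..t} u"
proof -
  have "continuous_on {0..s} (\<lambda>r. u (t - r))"
    by (rule continuous_on_compose2[OF u]) (use s in \<open>auto intro!: continuous_intros\<close>)
  hence "(LINT r:{0..s}|lborel. u (t - r)) = integral {0..s} (\<lambda>r. u (t - r))"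
    by (intro set_borel_integral_eq_integral borel_integrable_atLeastAtMost')
  also have "\<dots> = integral {- s..0} (\<lambda>x. u (x + t))"
    using Henstock_Kurzweil_Integration.integral_reflect_real[of 0 "- s" "\<lambda>x. u (x + t)"] by simp
  also have "\<dots> = integral {t-s..t} u"
    using integral_shift_real_ivl[of "t - s" t t u] by simp
  finally show ?thesis .
qed

context bbm
begin

text \<open>Unlike \<^const>\<open>is_sol\<close>, this does not refer to the initial datum and is invariant under time shifts.\<close>

definition traj :: "(real \<Rightarrow> state) \<Rightarrow> bool" where
  "traj U \<longleftrightarrow> curve U \<and>
     (\<forall>n. \<forall>t\<ge>0. ((\<lambda>r. uc (U r) n) has_real_derivative G (U t) n - Q (ec (U t) n)) (at t within {0..})) \<and>
     (\<forall>n. \<forall>t\<ge>0. \<forall>h>0. \<forall>s>0. ec (U (t + h)) n (s + h) = ec (U t) n s + integral {t..t+h} (\<lambda>r. uc (U r) n)) \<and>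
     (\<forall>n. \<forall>t\<ge>0. \<forall>s>0. s \<le> t \<longrightarrow> ec (U t) n s = integral {t-s..t} (\<lambda>r. uc (U r) n))"

lemma curve_uc_continuous: "curve U \<Longrightarrow> continuous_on {0..} (\<lambda>t. uc (U t) n)"
  by (rule curve_continuous_on[of U "\<lambda>z. uc z n"], assumption, rule uc_tendsto)

lemma curve_Q_continuous: "curve U \<Longrightarrow> continuous_on {0..} (\<lambda>t. Q (ec (U t) n))"
  by (rule curve_continuous_on[of U "\<lambda>z. Q (ec z n)"], assumption, rule Q_tendsto)

lemma curve_G_continuous: "curve U \<Longrightarrow> continuous_on {0..} (\<lambda>t. G (U t) n)"
  by (rule curve_continuous_on[of U "\<lambda>z. G z n"], assumption, rule G_tendsto)

text \<open>Along a continuous curve the integrand of the weak equation is continuous in time, so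
  the integrated equation can be differentiated mode by mode. The initial datum is recovered in its
  coefficients only, which is what distances see.\<close>

lemma is_sol_traj:
  assumes sol: "is_sol a b \<mu> f z U"
  shows "traj U" "uc (U 0) n = uc z n" "ec (U 0) n = ec z n"
proof -
  have U: "curve U" using sol by (simp add: is_sol_def curve_def)
  define u where "u n t = uc (U t) n" for n t
  have cu: "continuous_on {0..} (u n)" for n unfolding u_def by (rule curve_uc_continuous[OF U])
  have ci: "u n integrable_on {x..y}" if "0 \<le> x" for n x y
    by (rule integrable_continuous_real[OF continuous_on_subset[OF cu]]) (use that in auto)
  have comb: "integral {x..y} (u n) + integral {y..w} (u n) = integral {x..w} (u n)" if "0 \<le> x" "x \<le> y" "y \<le> w" for n x y w
    by (rule Henstock_Kurzweil_Integration.integral_combine[OF that(2,3) ci[OF that(1)]])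
  have ec_sol: "ec (U t) n s = (if s \<le> t then integral {t-s..t} (u n) else ec z n (s - t) + integral {0..t} (u n))"
    if t: "0 \<le> t" and s: "0 < s" for t s n
  proof -
    have "coef a b (snd (U t) s) (Suc n) =
        (if s \<le> t then (LINT r:{0..s}|lborel. u n (t - r))
         else coef a b (snd z (s - t)) (Suc n) + (LINT r:{0..t}|lborel. u n (t - r)))"
      using sol t s unfolding is_sol_def u_def uc_def by (auto simp del: One_nat_def)
    thus ?thesis using t s reflected_integral[OF cu, of s t n] reflected_integral[OF cu, of t t n]
      by (simp add: ec_def)
  qed
  have der: "((\<lambda>r. u n r) has_real_derivative G (U t) n - Q (ec (U t) n)) (at t within {0..})" and u0: "u n 0 = uc z n" if t: "0 \<le> t" for n t
  proof -
    have l: "0 < 1 + \<Lambda> n" using \<Lambda>_pos[of n] by simp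
    define \<Phi> where "\<Phi> r = G (U r) n - Q (ec (U r) n)" for r
    have c\<Phi>: "continuous_on {0..} \<Phi>" unfolding \<Phi>_def
      by (intro continuous_intros curve_G_continuous curve_Q_continuous U)
    \<comment> \<open>The memory term is rewritten through
      \<open>- \<Lambda> n * Q = Q - (1 + \<Lambda> n) * Q\<close>; the first summand goes into the
      forcing \<open>G\<close>.\<close>
    have eq: "innerL2 a b (fst (U \<tau>)) (dek a b (Suc n)) - \<Lambda> n * (LINT s:{0<..}|lborel. \<mu> s * coef a b (snd (U \<tau>) s) (Suc n))
            + innerL2 a b (\<lambda>x. (fst (U \<tau>) x)\<^sup>2) (dek a b (Suc n)) / 2 + coef a b f (Suc n) = (1 + \<Lambda> n) * \<Phi> \<tau>" for \<tau>
    proof -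
      have "(LINT s:{0<..}|lborel. \<mu> s * coef a b (snd (U \<tau>) s) (Suc n)) = Q (ec (U \<tau>) n)"
        unfolding Q_def set_lebesgue_integral_def ec_def ker_indicator by (simp add: ker_def mult.assoc)
      moreover have "(1 + \<Lambda> n) * G (U \<tau>) n = Q (ec (U \<tau>) n) + flux (fst (U \<tau>)) (Suc n) + coef a b f (Suc n)"
        using l by (simp add: G_def)
      ultimately show ?thesis by (simp add: \<Phi>_def flux_def right_diff_distrib distrib_right)
    qed
    have int: "u n t - uc z n = integral {0..t} \<Phi>" if "0 \<le> t" for t
    proof -
      have "(1 + \<Lambda> n) * (u n t - uc z n) = (LINT \<tau>:{0..t}|lborel. (1 + \<Lambda> n) * \<Phi> \<tau>)"
        using sol that unfolding is_sol_def u_def uc_def eq[symmetric] by (auto simp del: One_nat_def)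
      also have "\<dots> = (1 + \<Lambda> n) * (LINT \<tau>:{0..t}|lborel. \<Phi> \<tau>)" by simp
      also have "(LINT \<tau>:{0..t}|lborel. \<Phi> \<tau>) = integral {0..t} \<Phi>"
        by (intro set_borel_integral_eq_integral borel_integrable_atLeastAtMost' continuous_on_subset[OF c\<Phi>]) auto
      finally show ?thesis using l by simp
    qed
    show "u n 0 = uc z n" using int[of 0] by simp
    have "((\<lambda>t. uc z n + integral {0..t} \<Phi>) has_real_derivative 0 + \<Phi> t) (at t within {0..})"
      by (intro DERIV_add DERIV_const integral_has_right_derivative[OF c\<Phi> t])
    hence "(u n has_real_derivative 0 + \<Phi> t) (at t within {0..})"
      by (rule has_field_derivative_transform_within[where d = 1]) (use int t in \<open>auto simp: algebra_simps\<close>)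
    thus "((\<lambda>r. u n r) has_real_derivative G (U t) n - Q (ec (U t) n)) (at t within {0..})" by (simp add: \<Phi>_def)
  qed
  show "uc (U 0) n = uc z n" using u0[of 0] by (simp add: u_def)
  show "ec (U 0) n = ec z n"
  proof
    fix s show "ec (U 0) n s = ec z n s" using ec_sol[of 0 s n] by (cases "0 < s") (auto simp: ec_def)
  qed
  have shift: "ec (U (t + h)) n (s + h) = ec (U t) n s + integral {t..t+h} (u n)" if "0 \<le> t" "0 < h" "0 < s" for n t h s
    using ec_sol[of "t + h" "s + h" n] ec_sol[of t s n] that comb[of "t - s" t "t + h" n] comb[of 0 t "t + h" n]
    by (cases "s \<le> t") auto
  show "traj U"
    unfolding traj_def using U der shift ec_sol by (auto simp: u_def[abs_def])
qed

lemma traj_curve: "traj U \<Longrightarrow> curve U" by (simp add: traj_def)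

lemma traj_Hsp: "traj U \<Longrightarrow> 0 \<le> t \<Longrightarrow> U t \<in> Hsp a b \<mu> 0" by (simp add: traj_def curve_def)

lemma traj_shift: assumes U: "traj U" and \<sigma>: "0 \<le> \<sigma>" shows "traj (\<lambda>t. U (t + \<sigma>))"
  unfolding traj_def
proof (intro conjI allI impI)
  show "curve (\<lambda>t. U (t + \<sigma>))"
    unfolding curve_def
  proof (intro conjI allI impI)
    fix t e :: real assume t: "0 \<le> t" and e: "0 < e"
    have "\<forall>t\<ge>0. \<forall>e>0. \<exists>d>0. \<forall>t'\<ge>0. \<bar>t' - t\<bar> < d \<longrightarrow> Hdist a b \<mu> (U t') (U t) < e"
      using traj_curve[OF U] unfolding curve_def by (rule conjunct2)
    from this[rule_format, of "t + \<sigma>" e]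
    obtain d where d: "0 < d" "\<forall>t'\<ge>0. \<bar>t' - (t + \<sigma>)\<bar> < d \<longrightarrow> Hdist a b \<mu> (U t') (U (t + \<sigma>)) < e"
      using t \<sigma> e by auto
    show "\<exists>d>0. \<forall>t'\<ge>0. \<bar>t' - t\<bar> < d \<longrightarrow> Hdist a b \<mu> (U (t' + \<sigma>)) (U (t + \<sigma>)) < e"
      using d \<sigma> by (intro exI[of _ d]) auto
  qed (use traj_Hsp[OF U] \<sigma> in auto)
  have ish: "integral {x..y} (\<lambda>r. uc (U (r + \<sigma>)) n) = integral {x+\<sigma>..y+\<sigma>} (\<lambda>r. uc (U r) n)" for x y n
    using integral_shift_real_ivl[of "x + \<sigma>" \<sigma> "y + \<sigma>" "\<lambda>r. uc (U r) n"] by simp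
  fix n and t :: real assume t: "0 \<le> t"
  have t\<sigma>: "0 \<le> t + \<sigma>" using t \<sigma> by simp
  have "((\<lambda>r. uc (U r) n) has_real_derivative G (U (t + \<sigma>)) n - Q (ec (U (t + \<sigma>)) n)) (at (t + \<sigma>) within {0..})"
    using U t\<sigma> by (simp add: traj_def)
  hence "((\<lambda>r. uc (U r) n) has_real_derivative G (U (t + \<sigma>)) n - Q (ec (U (t + \<sigma>)) n)) (at (t + \<sigma>) within (\<lambda>t. t + \<sigma>) ` {0..})"
    by (rule DERIV_subset) (use \<sigma> in auto)
  note d0 = this
  have d1: "((\<lambda>t. t + \<sigma>) has_real_derivative 1) (at t within {0..})" by (auto intro!: derivative_eq_intros)
  from DERIV_image_chain[OF d0 d1]
  show "((\<lambda>r. uc (U (r + \<sigma>)) n) has_real_derivative G (U (t + \<sigma>)) n - Q (ec (U (t + \<sigma>)) n)) (at t within {0..})"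
    by (simp add: o_def)
  show "ec (U (t + \<sigma>)) n s = integral {t-s..t} (\<lambda>r. uc (U (r + \<sigma>)) n)" if "0 < s" "s \<le> t" for s
  proof -
    have "ec (U (t + \<sigma>)) n s = integral {t+\<sigma>-s..t+\<sigma>} (\<lambda>r. uc (U r) n)"
      using U t\<sigma> that \<sigma> by (simp add: traj_def)
    thus ?thesis unfolding ish by (simp add: algebra_simps)
  qed
  show "ec (U (t + h + \<sigma>)) n (s + h) = ec (U (t + \<sigma>)) n s + integral {t..t+h} (\<lambda>r. uc (U (r + \<sigma>)) n)" if "0 < h" "0 < s" for h s
  proof -
    have "ec (U (t + \<sigma> + h)) n (s + h) = ec (U (t + \<sigma>)) n s + integral {t+\<sigma>..t+\<sigma>+h} (\<lambda>r. uc (U r) n)"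
      using U t\<sigma> that by (simp add: traj_def)
    thus ?thesis unfolding ish by (simp add: algebra_simps)
  qed
qed

lemma traj_mode: assumes U: "traj U" shows "mode (\<lambda>t. uc (U t) n) (\<lambda>t. ec (U t) n) (\<lambda>t. G (U t) n)"
  unfolding mode_def
proof (intro conjI)
  note c = traj_curve[OF U]
  show "continuous_on {0..} (\<lambda>t. G (U t) n)" by (rule curve_G_continuous[OF c])
  show "continuous_on {0..} (\<lambda>t. Q (ec (U t) n))" by (rule curve_Q_continuous[OF c])
  show "continuous_on {0..} (\<lambda>t. P (ec (U t) n))"
    by (rule curve_continuous_on[OF c, of "\<lambda>z. P (ec z n)"]) (rule P_tendsto)
  show "\<forall>t\<ge>0. sq (ec (U t) n)" using Hsp_sq traj_Hsp[OF U] by blast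
qed (use U in \<open>auto simp: traj_def\<close>)

text \<open>Once the forcing is regarded as given, the scalar memory equation is linear, so the
  difference of two trajectories is again a mode, driven by the difference of the forcings.\<close>

lemma traj_diff_mode: assumes U: "traj U" and V: "traj V"
  shows "mode (\<lambda>t. uc (U t) n - uc (V t) n) (\<lambda>t s. ec (U t) n s - ec (V t) n s) (\<lambda>t. G (U t) n - G (V t) n)"
proof -
  note cU = traj_curve[OF U] and cV = traj_curve[OF V]
  have sqU: "sq (ec (U t) n)" and sqV: "sq (ec (V t) n)" if "0 \<le> t" for t
    using Hsp_sq traj_Hsp[OF U that] traj_Hsp[OF V that] by blast+
  have Qd: "Q (\<lambda>s. ec (U t) n s - ec (V t) n s) = Q (ec (U t) n) - Q (ec (V t) n)" if "0 \<le> t" for t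
    by (rule Q_diff[OF sqU[OF that] sqV[OF that]])
  have int: "integral {x..y} (\<lambda>r. uc (U r) n - uc (V r) n) = integral {x..y} (\<lambda>r. uc (U r) n) - integral {x..y} (\<lambda>r. uc (V r) n)"
    if "0 \<le> x" for x y
    by (rule Henstock_Kurzweil_Integration.integral_diff; rule integrable_continuous_real; rule continuous_on_subset)
       (use that in \<open>auto intro!: curve_uc_continuous cU cV\<close>)
  \<comment> \<open>The distance between two difference states is at most the sum of the distances
    of the original states, so the difference state depends continuously on time and
    \<open>P\<close> of its modes follows.\<close>
  have cP: "continuous_on {0..} (\<lambda>t. P (\<lambda>s. ec (U t) n s - ec (V t) n s))"
    unfolding continuous_on_sequentially o_def
  proof (intro allI ballI impI)
    fix x and t :: real assume "t \<in> {0..}" and "(\<forall>n. x n \<in> {0..}) \<and> x \<longlonglongrightarrow> t"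
    hence x: "\<And>j. 0 \<le> x j" "0 \<le> t" "x \<longlonglongrightarrow> t" by auto
    have e: "P (\<lambda>s. ec (U r) n s - ec (V r) n s) = P (ec (sdiff (U r) (V r)) n)" if "0 \<le> r" for r
      by (simp add: ec_sdiff[OF traj_Hsp[OF U that] traj_Hsp[OF V that]])
    have "(\<lambda>j. P (ec (sdiff (U (x j)) (V (x j))) n)) \<longlonglongrightarrow> P (ec (sdiff (U t) (V t)) n)"
    proof (rule P_tendsto[of "\<lambda>j. sdiff (U (x j)) (V (x j))" "sdiff (U t) (V t)"])
      show "\<And>j. sdiff (U (x j)) (V (x j)) \<in> Hsp a b \<mu> 0" "sdiff (U t) (V t) \<in> Hsp a b \<mu> 0"
        by (intro sdiff_Hsp traj_Hsp[OF U] traj_Hsp[OF V] x)+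
      have le: "Hdist a b \<mu> (sdiff (U (x j)) (V (x j))) (sdiff (U t) (V t)) \<le> Hdist a b \<mu> (U (x j)) (U t) + Hdist a b \<mu> (V (x j)) (V t)" for j
      proof -
        let ?A = "sdiff (U (x j)) (U t)" and ?B = "sdiff (V (x j)) (V t)"
        have h: "U (x j) \<in> Hsp a b \<mu> 0" "U t \<in> Hsp a b \<mu> 0" "V (x j) \<in> Hsp a b \<mu> 0" "V t \<in> Hsp a b \<mu> 0"
          by (intro traj_Hsp[OF U] traj_Hsp[OF V] x)+
        have "sdiff (sdiff (U (x j)) (V (x j))) (sdiff (U t) (V t)) = sdiff ?A ?B"
          by (auto simp: sdiff_def fun_eq_iff)
        hence "Hdist a b \<mu> (sdiff (U (x j)) (V (x j))) (sdiff (U t) (V t)) = Hdist a b \<mu> ?A ?B"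
          by (simp add: Hdist_sdiff)
        also have "\<dots> \<le> Hdist a b \<mu> ?A (sdiff (U t) (U t)) + Hdist a b \<mu> (sdiff (U t) (U t)) ?B"
          by (intro Hdist_triangle sdiff_Hsp h)
        also have "Hdist a b \<mu> (sdiff (U t) (U t)) ?B = Hdist a b \<mu> ?B (sdiff (U t) (U t))"
          by (intro Hdist_sym sdiff_Hsp h)
        also have "Hdist a b \<mu> ?A (sdiff (U t) (U t)) = Hdist a b \<mu> (U (x j)) (U t)"
          unfolding Hdist_sdiff by (simp add: sdiff_def)
        also have "Hdist a b \<mu> ?B (sdiff (U t) (U t)) = Hdist a b \<mu> (V (x j)) (V t)"
          unfolding Hdist_sdiff by (simp add: sdiff_def)
        finally show ?thesis .
      qed
      have "(\<lambda>j. Hdist a b \<mu> (U (x j)) (U t) + Hdist a b \<mu> (V (x j)) (V t)) \<longlonglongrightarrow> 0 + 0"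
        by (intro tendsto_add curve_tendsto cU cV x)
      hence "(\<lambda>j. Hdist a b \<mu> (U (x j)) (U t) + Hdist a b \<mu> (V (x j)) (V t)) \<longlonglongrightarrow> 0" by simp
      thus "(\<lambda>j. Hdist a b \<mu> (sdiff (U (x j)) (V (x j))) (sdiff (U t) (V t))) \<longlonglongrightarrow> 0"
      proof (rule Lim_null_comparison[rotated], intro always_eventually allI)
        fix j
        have "0 \<le> Hdist a b \<mu> (sdiff (U (x j)) (V (x j))) (sdiff (U t) (V t))"
          by (intro Hdist_nonneg sdiff_Hsp traj_Hsp[OF U] traj_Hsp[OF V] x)
        thus "norm (Hdist a b \<mu> (sdiff (U (x j)) (V (x j))) (sdiff (U t) (V t))) \<le> Hdist a b \<mu> (U (x j)) (U t) + Hdist a b \<mu> (V (x j)) (V t)"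
          using le[of j] by simp
      qed
    qed
    thus "(\<lambda>j. P (\<lambda>s. ec (U (x j)) n s - ec (V (x j)) n s)) \<longlonglongrightarrow> P (\<lambda>s. ec (U t) n s - ec (V t) n s)"
      using x by (simp add: e)
  qed
  have cQ: "continuous_on {0..} (\<lambda>t. Q (\<lambda>s. ec (U t) n s - ec (V t) n s))"
  proof (rule continuous_on_eq)
    show "continuous_on {0..} (\<lambda>t. Q (ec (U t) n) - Q (ec (V t) n))"
      by (intro continuous_intros curve_Q_continuous cU cV)
  qed (simp add: Qd)
  show ?thesis
    unfolding mode_def
  proof (intro conjI allI impI)
    show "continuous_on {0..} (\<lambda>t. G (U t) n - G (V t) n)"
      by (intro continuous_intros curve_G_continuous cU cV)
  next
    fix t :: real assume t: "0 \<le> t"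
    show "sq (\<lambda>s. ec (U t) n s - ec (V t) n s)" by (rule sq_diff[OF sqU[OF t] sqV[OF t]])
    have "((\<lambda>r. uc (U r) n) has_real_derivative G (U t) n - Q (ec (U t) n)) (at t within {0..})"
      "((\<lambda>r. uc (V r) n) has_real_derivative G (V t) n - Q (ec (V t) n)) (at t within {0..})"
      using U V t by (auto simp: traj_def)
    from DERIV_diff[OF this]
    show "((\<lambda>t. uc (U t) n - uc (V t) n) has_real_derivative G (U t) n - G (V t) n - Q (\<lambda>s. ec (U t) n s - ec (V t) n s)) (at t within {0..})"
      by (simp add: Qd[OF t] algebra_simps)
  next
    fix t h s :: real assume "0 \<le> t" "0 < h" "0 < s"
    thus "ec (U (t + h)) n (s + h) - ec (V (t + h)) n (s + h) = ec (U t) n s - ec (V t) n s + integral {t..t+h} (\<lambda>t. uc (U t) n - uc (V t) n)"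
      using U V by (simp add: traj_def int)
  next
    fix t s :: real assume "0 \<le> t" "0 < s" "s \<le> t"
    thus "ec (U t) n s - ec (V t) n s = integral {t-s..t} (\<lambda>t. uc (U t) n - uc (V t) n)"
      using U V by (simp add: traj_def int)
  qed (rule cP cQ)+
qed

text \<open>The scalar estimate for differences is summed with weight
  \<open>1 + \<Lambda> n\<close>; the forcing difference is then bounded by the squared distance
  itself and Gronwall closes the estimate. Trajectories from data at distance zero remain at
  distance zero, which yields uniqueness and the semigroup law as well as continuity in the
  data.\<close>

lemma continuous_dependence:
  assumes R: "0 \<le> R"
  obtains K where "0 < K" "\<And>U V T. traj U \<Longrightarrow> traj V \<Longrightarrow> (\<And>t. 0 \<le> t \<Longrightarrow> Hnorm2 a b \<mu> 0 (U t) \<le> R) \<Longrightarrow>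
      (\<And>t. 0 \<le> t \<Longrightarrow> Hnorm2 a b \<mu> 0 (V t) \<le> R) \<Longrightarrow> 0 \<le> T \<Longrightarrow> D2 (U T) (V T) \<le> K * D2 (U 0) (V 0) * exp (K * T)"
proof -
  obtain C \<nu> where C: "0 < C" "0 < \<nu>" and dec: "\<And>v w g T. mode v w g \<Longrightarrow> 0 \<le> T \<Longrightarrow>
       (v T)\<^sup>2 + P (w T) \<le> C * (exp (- \<nu> * T) * ((v 0)\<^sup>2 + P (w 0)) + integral {0..T} (\<lambda>r. exp (- \<nu> * (T - r)) * (g r)\<^sup>2))"
    using mode_decay by blast
  define B where "B = 2 * (mass / \<Lambda> 0) + 2 * (2 + 2 * sob * R)"
  have B: "0 < B" unfolding B_def using mass_pos \<Lambda>_pos[of 0] R sob_nonneg by (intro add_pos_nonneg) auto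
  \<comment> \<open>One constant for both terms: \<open>C * B\<close> multiplies the time integral
    and \<open>C * (1 + 1 / \<Lambda> 0)\<close> the initial distance.\<close>
  define K where "K = max (C * B) (C * (1 + 1 / \<Lambda> 0))"
  have K: "0 < K" using B C by (simp add: K_def less_max_iff_disj)
  show ?thesis
  proof (rule that[OF K])
    fix U V and T :: real
    assume U: "traj U" and V: "traj V" and RU: "\<And>t. 0 \<le> t \<Longrightarrow> Hnorm2 a b \<mu> 0 (U t) \<le> R"
      and RV: "\<And>t. 0 \<le> t \<Longrightarrow> Hnorm2 a b \<mu> 0 (V t) \<le> R" and T: "0 \<le> T"
    note cU = traj_curve[OF U] and cV = traj_curve[OF V]
    have HU: "U t \<in> Hsp a b \<mu> 0" and HV: "V t \<in> Hsp a b \<mu> 0" if "0 \<le> t" for t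
      using traj_Hsp U V that by auto
    have cD: "continuous_on {0..} (\<lambda>t. D2 (U t) (V t))" by (rule curve_D2_continuous[OF cU cV])
    have cG: "continuous_on {0..} (\<lambda>t. G (U t) n - G (V t) n)" for n
      by (intro continuous_intros curve_G_continuous cU cV)
    have le: "D2 (U t) (V t) \<le> K * D2 (U 0) (V 0) + K * integral {0..t} (\<lambda>r. D2 (U r) (V r))" if t: "0 \<le> t" for t
    proof -
      let ?I = "integral {0..t} (\<lambda>r. D2 (U r) (V r))"
      have iD: "(\<lambda>r. B * D2 (U r) (V r)) integrable_on {0..t}"
        by (intro integrable_continuous_real continuous_intros continuous_on_subset[OF cD]) auto
      define g where "g n r = (1 + \<Lambda> n) * (G (U r) n - G (V r) n)\<^sup>2" for n r
      have ig: "(\<lambda>r. exp (- \<nu> * (t - r)) * g n r) integrable_on {0..t}" "g n integrable_on {0..t}" for n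
        unfolding g_def by (intro integrable_continuous_real continuous_intros continuous_on_subset[OF cG]; auto)+
      have g0: "0 \<le> g n r" for n r unfolding g_def using \<Lambda>_pos[of n] by simp
      have dd: "dd (U t) (V t) n \<le> C * (1 + 1 / \<Lambda> 0) * dd (U 0) (V 0) n + C * integral {0..t} (g n)" for n
      proof -
        let ?E = "\<lambda>t. (uc (U t) n - uc (V t) n)\<^sup>2 + P (\<lambda>s. ec (U t) n s - ec (V t) n s)"
        have l: "0 < \<Lambda> n" "0 < \<Lambda> 0" "\<Lambda> 0 \<le> \<Lambda> n" using \<Lambda>_pos \<Lambda>_ge by auto
        have E0: "0 \<le> ?E t" for t using P_nonneg by simp
        have "dd (U t) (V t) n \<le> (1 + \<Lambda> n) * ?E t"
          unfolding dd_def distrib_left using l P_nonneg by (intro add_mono mult_right_mono) auto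
        also have "\<dots> \<le> (1 + \<Lambda> n) * (C * (exp (- \<nu> * t) * ?E 0 + integral {0..t} (\<lambda>r. exp (- \<nu> * (t - r)) * (G (U r) n - G (V r) n)\<^sup>2)))"
          using dec[OF traj_diff_mode[OF U V] t, of n] l by (intro mult_left_mono) auto
        also have "\<dots> = C * (exp (- \<nu> * t) * ((1 + \<Lambda> n) * ?E 0)) + C * integral {0..t} (\<lambda>r. exp (- \<nu> * (t - r)) * g n r)"
        proof -
          have "(\<lambda>r. exp (- \<nu> * (t - r)) * g n r) = (\<lambda>r. (1 + \<Lambda> n) * (exp (- \<nu> * (t - r)) * (G (U r) n - G (V r) n)\<^sup>2))"
            by (auto simp: g_def fun_eq_iff)
          hence "integral {0..t} (\<lambda>r. exp (- \<nu> * (t - r)) * g n r) = (1 + \<Lambda> n) * integral {0..t} (\<lambda>r. exp (- \<nu> * (t - r)) * (G (U r) n - G (V r) n)\<^sup>2)"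
            by simp
          thus ?thesis by (simp only: distrib_left mult_ac)
        qed
        also have "\<dots> \<le> C * (1 * ((1 + 1 / \<Lambda> 0) * dd (U 0) (V 0) n)) + C * integral {0..t} (g n)"
        proof -
          \<comment> \<open>The energy weights the memory by \<open>\<Lambda> n\<close> only;
            raising this to \<open>1 + \<Lambda> n\<close> costs the factor
            \<open>1 + 1 / \<Lambda> 0\<close>.\<close>
          have p: "(1 + \<Lambda> n) * P (\<lambda>s. ec (U 0) n s - ec (V 0) n s) \<le> (1 + 1 / \<Lambda> 0) * (\<Lambda> n * P (\<lambda>s. ec (U 0) n s - ec (V 0) n s))"
          proof -
            have "(1 + \<Lambda> n) \<le> (1 + 1 / \<Lambda> 0) * \<Lambda> n" using l by (simp add: field_simps)
            from mult_right_mono[OF this P_nonneg] show ?thesis by (simp only: mult.assoc)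
          qed
          have "(1 + \<Lambda> n) * (uc (U 0) n - uc (V 0) n)\<^sup>2 \<le> (1 + 1 / \<Lambda> 0) * ((1 + \<Lambda> n) * (uc (U 0) n - uc (V 0) n)\<^sup>2)"
            using l mult_right_mono[of 1 "1 + 1 / \<Lambda> 0" "(1 + \<Lambda> n) * (uc (U 0) n - uc (V 0) n)\<^sup>2"] by simp
          hence "(1 + \<Lambda> n) * ?E 0 \<le> (1 + 1 / \<Lambda> 0) * dd (U 0) (V 0) n"
            using p unfolding dd_def distrib_left by linarith
          moreover have "exp (- \<nu> * t) \<le> 1" using C t by simp
          ultimately have 1: "exp (- \<nu> * t) * ((1 + \<Lambda> n) * ?E 0) \<le> 1 * ((1 + 1 / \<Lambda> 0) * dd (U 0) (V 0) n)"
            using l E0[of 0] by (intro mult_mono[of "exp (- \<nu> * t)" 1]) auto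
          have 2: "integral {0..t} (\<lambda>r. exp (- \<nu> * (t - r)) * g n r) \<le> integral {0..t} (g n)"
          proof (rule integral_le[OF ig])
            show "exp (- \<nu> * (t - r)) * g n r \<le> g n r" if "r \<in> {0..t}" for r
              using that C g0[of n r] by (intro mult_left_le_one_le) auto
          qed
          show ?thesis using C by (intro add_mono mult_left_mono 1 2) auto
        qed
        finally show ?thesis by (simp add: mult.assoc)
      qed
      have "(\<Sum>n<N. dd (U t) (V t) n) \<le> K * D2 (U 0) (V 0) + K * ?I" for N
      proof -
        have "(\<Sum>n<N. dd (U t) (V t) n) \<le> (\<Sum>n<N. C * (1 + 1 / \<Lambda> 0) * dd (U 0) (V 0) n + C * integral {0..t} (g n))"
          by (rule sum_mono) (rule dd)
        also have "\<dots> = C * (1 + 1 / \<Lambda> 0) * (\<Sum>n<N. dd (U 0) (V 0) n) + C * integral {0..t} (\<lambda>r. \<Sum>n<N. g n r)"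
          using ig by (simp add: sum.distrib sum_distrib_left Henstock_Kurzweil_Integration.integral_sum)
        also have "\<dots> \<le> C * (1 + 1 / \<Lambda> 0) * D2 (U 0) (V 0) + C * integral {0..t} (\<lambda>r. B * D2 (U r) (V r))"
        proof (intro add_mono mult_left_mono integral_le iD)
          show "(\<lambda>r. \<Sum>n<N. g n r) integrable_on {0..t}" using ig by (intro integrable_sum) auto
          show "(\<Sum>n<N. g n r) \<le> B * D2 (U r) (V r)" if "r \<in> {0..t}" for r
            unfolding g_def B_def using that by (intro G_diff_sum_le HU HV RU RV) auto
          show "(\<Sum>n<N. dd (U 0) (V 0) n) \<le> D2 (U 0) (V 0)" by (intro sum_dd_le HU HV) auto
        qed (use C \<Lambda>_pos[of 0] in auto)
        also have "\<dots> = C * (1 + 1 / \<Lambda> 0) * D2 (U 0) (V 0) + C * B * ?I" by simp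
        also have "\<dots> \<le> K * D2 (U 0) (V 0) + K * ?I"
        proof (intro add_mono mult_right_mono)
          show "0 \<le> ?I" by (rule integral_nonneg)
            (use HU HV in \<open>auto intro!: integrable_continuous_real continuous_on_subset[OF cD] D2_nonneg\<close>)
        qed (auto simp: K_def intro!: D2_nonneg HU HV)
        finally show ?thesis .
      qed
      thus ?thesis using D2_sums[OF HU[OF t] HV[OF t]] by (auto simp: sums_def intro: LIMSEQ_le_const2)
    qed
    show "D2 (U T) (V T) \<le> K * D2 (U 0) (V 0) * exp (K * T)"
      by (rule integral_gronwall[OF cD K _ le T]) (use K in \<open>auto intro!: mult_nonneg_nonneg D2_nonneg HU HV\<close>)
  qed
qed

end

section \<open>The energy functional\<close>

context bbm
begin

definition N1 :: "state \<Rightarrow> real" where "N1 z = (\<Sum>n. (1 + \<Lambda> n) * (uc z n)\<^sup>2)"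

definition N2 :: "state \<Rightarrow> real" where "N2 z = (\<Sum>n. \<Lambda> n * P (ec z n))"

lemma N12: assumes z: "z \<in> Hsp a b \<mu> 0"
  shows "summable (\<lambda>n. (1 + \<Lambda> n) * (uc z n)\<^sup>2)" "summable (\<lambda>n. \<Lambda> n * P (ec z n))"
    "0 \<le> N1 z" "0 \<le> N2 z" "Hnorm2 a b \<mu> 0 z = N1 z + N2 z"
proof -
  have en: "summable (en z)" "Hnorm2 a b \<mu> 0 z = (\<Sum>n. en z n)" using Hnorm2_0_sums[OF z] by (auto simp: sums_iff)
  have nn: "0 \<le> (1 + \<Lambda> n) * (uc z n)\<^sup>2" "0 \<le> \<Lambda> n * P (ec z n)" for n by (simp_all add: lam_nonneg P_nonneg)
  show s1: "summable (\<lambda>n. (1 + \<Lambda> n) * (uc z n)\<^sup>2)"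
    by (rule summable_comparison_test'[OF en(1), of 0]) (use nn in \<open>simp add: en_def\<close>)
  show s2: "summable (\<lambda>n. \<Lambda> n * P (ec z n))"
    by (rule summable_comparison_test'[OF en(1), of 0]) (use nn in \<open>simp add: en_def\<close>)
  show "0 \<le> N1 z" "0 \<le> N2 z" unfolding N1_def N2_def by (intro suminf_nonneg s1 s2 nn)+
  show "Hnorm2 a b \<mu> 0 z = N1 z + N2 z" unfolding en(2) N1_def N2_def en_def by (rule suminf_add[OF s1 s2, symmetric])
qed

text \<open>Each product is split as \<open>c n / sqrt (\<Lambda> n)\<close> times
  \<open>sqrt (\<Lambda> n) * Q (ec z n)\<close>, and the square of \<open>Q\<close> is at most the
  kernel mass times \<open>P\<close>. One statement serves both memory terms of the energy
  functional: \<open>c\<close> is the coefficient of \<open>f\<close> in the linear one and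
  \<open>(1 + \<Lambda> n) * uc z n\<close> in the quadratic one.\<close>

lemma memory_pairing:
  assumes z: "z \<in> Hsp a b \<mu> 0" and c: "summable (\<lambda>n. (c n)\<^sup>2 / \<Lambda> n)"
  shows "summable (\<lambda>n. c n * Q (ec z n))"
    and "(\<Sum>n. c n * Q (ec z n))\<^sup>2 \<le> (\<Sum>n. (c n)\<^sup>2 / \<Lambda> n) * (mass * N2 z)"
    and "(\<integral>s. ker \<mu> s * (\<Sum>n. c n * ec z n s) \<partial>lborel) = (\<Sum>n. c n * Q (ec z n))"
proof -
  have l: "0 < \<Lambda> n" for n by (rule \<Lambda>_pos)
  define x where "x n = c n / sqrt (\<Lambda> n)" for n
  have x2: "(x n)\<^sup>2 = (c n)\<^sup>2 / \<Lambda> n" for n using l[of n] by (simp add: x_def power_divide)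
  have sx: "summable (\<lambda>n. (x n)\<^sup>2)" unfolding x2 by (rule c)
  define y where "y n = sqrt (\<Lambda> n) * Q (ec z n)" for n
  define y' where "y' n = sqrt (\<Lambda> n) * sqrt (mass * P (ec z n))" for n
  have y'2: "(y' n)\<^sup>2 = mass * (\<Lambda> n * P (ec z n))" for n
    using l[of n] mass_pos P_nonneg by (simp add: y'_def power_mult_distrib)
  have sy': "summable (\<lambda>n. (y' n)\<^sup>2)" unfolding y'2 by (intro summable_mult N12(2)[OF z])
  have y2: "(y n)\<^sup>2 \<le> (y' n)\<^sup>2" for n
  proof -
    have "(y n)\<^sup>2 = \<Lambda> n * (Q (ec z n))\<^sup>2" using l[of n] by (simp add: y_def power_mult_distrib)
    also have "\<dots> \<le> \<Lambda> n * (mass * P (ec z n))" using l[of n] by (intro mult_left_mono Q_square_le Hsp_sq[OF z]) auto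
    finally show ?thesis unfolding y'2 by (simp only: mult.left_commute)
  qed
  have sy: "summable (\<lambda>n. (y n)\<^sup>2)"
    by (rule summable_comparison_test'[OF sy', of 0]) (use y2 in simp)
  have xy: "x n * y n = c n * Q (ec z n)" for n using l[of n] by (simp add: x_def y_def)
  have xy': "\<bar>x n * y' n\<bar> = \<bar>c n\<bar> * sqrt (mass * P (ec z n))" for n
    using l[of n] P_nonneg mass_pos by (simp add: x_def y'_def abs_mult)
  note CS = summable_Cauchy_Schwarz[OF sx sy, unfolded xy x2]
  note CS' = summable_Cauchy_Schwarz(1)[OF sx sy', unfolded xy']
  show s: "summable (\<lambda>n. c n * Q (ec z n))" by (rule summable_rabs_cancel[OF CS(1)])
  have "\<bar>\<Sum>n. c n * Q (ec z n)\<bar> \<le> (\<Sum>n. \<bar>c n * Q (ec z n)\<bar>)" by (rule summable_rabs[OF CS(1)])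
  hence "\<bar>\<Sum>n. c n * Q (ec z n)\<bar>\<^sup>2 \<le> (\<Sum>n. \<bar>c n * Q (ec z n)\<bar>)\<^sup>2" by (rule power_mono) simp
  hence "(\<Sum>n. c n * Q (ec z n))\<^sup>2 \<le> (\<Sum>n. \<bar>c n * Q (ec z n)\<bar>)\<^sup>2" by simp
  also note CS(2)
  also have "(\<Sum>n. (c n)\<^sup>2 / \<Lambda> n) * (\<Sum>n. (y n)\<^sup>2) \<le> (\<Sum>n. (c n)\<^sup>2 / \<Lambda> n) * (mass * N2 z)"
  proof (rule mult_left_mono)
    have "(\<Sum>n. (y n)\<^sup>2) \<le> (\<Sum>n. (y' n)\<^sup>2)" by (rule suminf_le[OF y2 sy sy'])
    also have "\<dots> = mass * N2 z" unfolding y'2 N2_def by (rule suminf_mult[OF N12(2)[OF z]])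
    finally show "(\<Sum>n. (y n)\<^sup>2) \<le> mass * N2 z" .
    show "0 \<le> (\<Sum>n. (c n)\<^sup>2 / \<Lambda> n)" by (rule suminf_nonneg[OF c]) (simp add: lam_nonneg)
  qed
  finally show "(\<Sum>n. c n * Q (ec z n))\<^sup>2 \<le> (\<Sum>n. (c n)\<^sup>2 / \<Lambda> n) * (mass * N2 z)" .
  define F where "F n s = ker \<mu> s * (c n * ec z n s)" for n s
  have sabs: "summable (\<lambda>n. \<bar>c n * ec z n s\<bar>)" for s
  proof (cases "0 < s")
    case True
    hence "summable (\<lambda>n. \<Lambda> n * (coef a b (snd z s) (Suc n))\<^sup>2)"
      using Hsp_snd[OF z] Hs_summable[of "snd z s" 1] by (auto simp: Mem_def)
    hence s2: "summable (\<lambda>n. (sqrt (\<Lambda> n) * ec z n s)\<^sup>2)" using True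
      by (simp add: ec_def power_mult_distrib lam_nonneg)
    have "x n * (sqrt (\<Lambda> n) * ec z n s) = c n * ec z n s" for n using l[of n] by (simp add: x_def)
    thus ?thesis using summable_Cauchy_Schwarz(1)[OF sx s2] by (simp only:)
  qed (simp add: ec_def)
  have iF: "integrable lborel (F n)" for n
    unfolding F_def using sq_integrable[OF Hsp_sq[OF z], of n] by (simp add: mult.left_commute)
  have "(\<integral>s. (\<Sum>n. F n s) \<partial>lborel) = (\<Sum>n. \<integral>s. F n s \<partial>lborel)"
  proof (rule integral_suminf[OF iF])
    show "AE s in lborel. summable (\<lambda>n. norm (F n s))"
      by (rule AE_I2) (use sabs in \<open>auto simp: F_def abs_mult intro!: summable_mult\<close>)
    show "summable (\<lambda>n. \<integral>s. norm (F n s) \<partial>lborel)"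
    proof (rule summable_comparison_test'[OF CS', of 0])
      fix n
      have sqa: "sq (\<lambda>s. \<bar>ec z n s\<bar>)" using Hsp_sq[OF z, of n] by (auto simp: sq_def)
      have "(\<integral>s. norm (F n s) \<partial>lborel) = \<bar>c n\<bar> * Q (\<lambda>s. \<bar>ec z n s\<bar>)"
        using m_nonneg by (simp add: F_def Q_def abs_mult mult.left_commute)
      also have "\<dots> \<le> \<bar>c n\<bar> * sqrt (mass * P (ec z n))"
      proof (rule mult_left_mono)
        have "(Q (\<lambda>s. \<bar>ec z n s\<bar>))\<^sup>2 \<le> mass * P (ec z n)" using Q_square_le[OF sqa] by (simp add: P_def)
        thus "Q (\<lambda>s. \<bar>ec z n s\<bar>) \<le> sqrt (mass * P (ec z n))" by (rule real_le_rsqrt)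
      qed simp
      finally show "norm (\<integral>s. norm (F n s) \<partial>lborel) \<le> \<bar>c n\<bar> * sqrt (mass * P (ec z n))" by simp
    qed
  qed
  moreover have "(\<Sum>n. F n s) = ker \<mu> s * (\<Sum>n. c n * ec z n s)" for s
    unfolding F_def by (rule suminf_mult[OF summable_rabs_cancel[OF sabs]])
  moreover have "(\<integral>s. F n s \<partial>lborel) = c n * Q (ec z n)" for n
    unfolding F_def Q_def by (simp add: mult.left_commute)
  ultimately show "(\<integral>s. ker \<mu> s * (\<Sum>n. c n * ec z n s) \<partial>lborel) = (\<Sum>n. c n * Q (ec z n))" by simp
qed

text \<open>The square of the constant omega from the formulation, since \<open>\<Lambda> 0\<close>
  is the lowest eigenvalue. It is the best factor for passing from \<open>\<Lambda> n\<close> to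
  \<open>1 + \<Lambda> n\<close> in all modes.\<close>

definition om2 :: real where "om2 = 1 + 1 / \<Lambda> 0"

lemma om2_ge: "1 \<le> om2" unfolding om2_def by (simp add: lam_nonneg)

lemma one_plus_\<Lambda>_le: "1 + \<Lambda> n \<le> om2 * \<Lambda> n"
  using \<Lambda>_pos[of 0] \<Lambda>_ge[of n] by (simp add: om2_def field_simps)

definition \<alpha> :: "state \<Rightarrow> real" where "\<alpha> z = (\<Sum>n. coef a b f (Suc n) * Q (ec z n))"

text \<open>The cross term of the energy functional as a bilinear form with separate arguments, so
  that the difference of its values on two diagonals can be polarised.\<close>

definition \<beta> :: "state \<Rightarrow> state \<Rightarrow> real" where "\<beta> z w = (\<Sum>n. (1 + \<Lambda> n) * uc z n * Q (ec w n))"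

text \<open>The squared norm of \<open>f\<close> in the dual of the energy space.\<close>

definition cf :: real where "cf = (\<Sum>n. (coef a b f (Suc n))\<^sup>2 / \<Lambda> n)"

lemma cf_summable: "summable (\<lambda>n. (coef a b f (Suc n))\<^sup>2 / \<Lambda> n)"
proof (rule summable_comparison_test'[where N = 0])
  have "summable (\<lambda>n. (coef a b f (Suc n))\<^sup>2)"
  proof (rule bounded_imp_summable)
    fix n show "(\<Sum>k\<le>n. (coef a b f (Suc k))\<^sup>2) \<le> (\<integral>x. (f x)\<^sup>2 \<partial>M)"
      using bessel_sin[OF f_L2, of "Suc n"] by (simp only: lessThan_Suc_atMost)
  qed simp
  thus "summable (\<lambda>n. (coef a b f (Suc n))\<^sup>2 * (1 / \<Lambda> 0))" by (rule summable_mult2)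
  show "norm ((coef a b f (Suc n))\<^sup>2 / \<Lambda> n) \<le> (coef a b f (Suc n))\<^sup>2 * (1 / \<Lambda> 0)" for n
    using \<Lambda>_pos[of 0] \<Lambda>_pos[of n] \<Lambda>_ge[of n] by (simp add: divide_left_mono)
qed

lemma uc_weight_summable:
  assumes z: "z \<in> Hsp a b \<mu> 0"
  shows "summable (\<lambda>n. ((1 + \<Lambda> n) * uc z n)\<^sup>2 / \<Lambda> n)" "(\<Sum>n. ((1 + \<Lambda> n) * uc z n)\<^sup>2 / \<Lambda> n) \<le> om2 * N1 z"
proof -
  have le: "((1 + \<Lambda> n) * uc z n)\<^sup>2 / \<Lambda> n \<le> om2 * ((1 + \<Lambda> n) * (uc z n)\<^sup>2)" for n
  proof -
    have "((1 + \<Lambda> n) * uc z n)\<^sup>2 / \<Lambda> n = (1 + \<Lambda> n) / \<Lambda> n * ((1 + \<Lambda> n) * (uc z n)\<^sup>2)"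
      by (simp add: power2_eq_square)
    also have "\<dots> \<le> om2 * ((1 + \<Lambda> n) * (uc z n)\<^sup>2)"
      using one_plus_\<Lambda>_le[of n] \<Lambda>_pos[of n] by (intro mult_right_mono) (auto simp: pos_divide_le_eq)
    finally show ?thesis .
  qed
  have s: "summable (\<lambda>n. om2 * ((1 + \<Lambda> n) * (uc z n)\<^sup>2))" by (intro summable_mult N12(1)[OF z])
  show t: "summable (\<lambda>n. ((1 + \<Lambda> n) * uc z n)\<^sup>2 / \<Lambda> n)"
    by (rule summable_comparison_test'[OF s, of 0]) (use le in \<open>simp add: lam_nonneg\<close>)
  have "(\<Sum>n. ((1 + \<Lambda> n) * uc z n)\<^sup>2 / \<Lambda> n) \<le> (\<Sum>n. om2 * ((1 + \<Lambda> n) * (uc z n)\<^sup>2))" by (rule suminf_le[OF le t s])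
  also have "\<dots> = om2 * N1 z" unfolding N1_def by (rule suminf_mult[OF N12(1)[OF z]])
  finally show "(\<Sum>n. ((1 + \<Lambda> n) * uc z n)\<^sup>2 / \<Lambda> n) \<le> om2 * N1 z" .
qed

lemma \<alpha>_square_le: "z \<in> Hsp a b \<mu> 0 \<Longrightarrow> (\<alpha> z)\<^sup>2 \<le> cf * (mass * N2 z)"
  unfolding \<alpha>_def cf_def by (rule memory_pairing(2)[OF _ cf_summable])

lemma \<beta>_square_le: assumes z: "z \<in> Hsp a b \<mu> 0" and w: "w \<in> Hsp a b \<mu> 0"
  shows "(\<beta> z w)\<^sup>2 \<le> om2 * N1 z * (mass * N2 w)"
proof -
  have "(\<beta> z w)\<^sup>2 \<le> (\<Sum>n. ((1 + \<Lambda> n) * uc z n)\<^sup>2 / \<Lambda> n) * (mass * N2 w)"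
    unfolding \<beta>_def by (rule memory_pairing(2)[OF w uc_weight_summable(1)[OF z]])
  also have "\<dots> \<le> om2 * N1 z * (mass * N2 w)"
    using uc_weight_summable(2)[OF z] mass_pos N12(4)[OF w] by (intro mult_right_mono) auto
  finally show ?thesis .
qed

lemma kappa_mass: "kappa \<mu> = mass"
  by (simp add: kappa_def mass_def set_lebesgue_integral_def ker_def)

text \<open>Both memory integrals are expanded in modes and integrated term by term. The minus sign
  before \<open>\<alpha>\<close> reflects \<open>\<langle>F, \<eta>_x\<rangle> = - \<langle>f,
  \<eta>\<rangle>\<close>.\<close>

lemma Lam_eq:
  assumes z: "z \<in> Hsp a b \<mu> 0"
  shows "Lam a b \<mu> f \<epsilon> z = Hnorm2 a b \<mu> 0 z - 2 / mass * \<alpha> z + 2 / mass * (normF a b f)\<^sup>2 - \<epsilon> / sqrt mass * \<beta> z z"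
proof -
  have "(LINT s:{0<..}|lborel. \<mu> s * (- innerL2 a b f (snd z s))) = - (\<integral>s. ker \<mu> s * (\<Sum>n. coef a b f (Suc n) * ec z n s) \<partial>lborel)"
  proof -
    have "indicator {0<..} s *\<^sub>R (\<mu> s * (- innerL2 a b f (snd z s))) = - (ker \<mu> s * (\<Sum>n. coef a b f (Suc n) * ec z n s))" for s
    proof (cases "0 < s")
      case True
      hence "snd z s \<in> Hs a b 1" using Hsp_snd[OF z] by (auto simp: Mem_def)
      from sums_unique[OF parseval_inner[OF this f_L2]] show ?thesis
        using True by (simp add: ker_def ec_def innerL2_M mult.commute)
    qed (simp add: ker_def)
    thus ?thesis by (simp add: set_lebesgue_integral_def)
  qed
  also have "\<dots> = - \<alpha> z" unfolding \<alpha>_def by (simp add: memory_pairing(3)[OF z cf_summable])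
  finally have 1: "(LINT s:{0<..}|lborel. \<mu> s * (- innerL2 a b f (snd z s))) = - \<alpha> z" .
  have "(LINT s:{0<..}|lborel. \<mu> s * inner1 a b (fst z) (snd z s)) = (\<integral>s. ker \<mu> s * (\<Sum>n. ((1 + \<Lambda> n) * uc z n) * ec z n s) \<partial>lborel)"
  proof -
    have "indicator {0<..} s *\<^sub>R (\<mu> s * inner1 a b (fst z) (snd z s)) = ker \<mu> s * (\<Sum>n. ((1 + \<Lambda> n) * uc z n) * ec z n s)" for s
      by (cases "0 < s") (simp_all add: ker_def ec_def inner1_def uc_def)
    thus ?thesis by (simp add: set_lebesgue_integral_def)
  qed
  also have "\<dots> = \<beta> z z" unfolding \<beta>_def by (rule memory_pairing(3)[OF z uc_weight_summable(1)[OF z]])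
  finally have 2: "(LINT s:{0<..}|lborel. \<mu> s * inner1 a b (fst z) (snd z s)) = \<beta> z z" .
  show ?thesis unfolding Lam_def 1 2 kappa_mass by simp
qed

lemma \<alpha>_diff: assumes z: "z \<in> Hsp a b \<mu> 0" and w: "w \<in> Hsp a b \<mu> 0" shows "\<alpha> z - \<alpha> w = \<alpha> (sdiff z w)"
proof -
  have "\<alpha> z - \<alpha> w = (\<Sum>n. coef a b f (Suc n) * Q (ec z n) - coef a b f (Suc n) * Q (ec w n))"
    unfolding \<alpha>_def by (rule suminf_diff[OF memory_pairing(1)[OF z cf_summable] memory_pairing(1)[OF w cf_summable]])
  also have "\<dots> = \<alpha> (sdiff z w)" unfolding \<alpha>_def ec_sdiff[OF z w]
    by (simp add: Q_diff[OF Hsp_sq[OF z] Hsp_sq[OF w]] right_diff_distrib)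
  finally show ?thesis .
qed

lemma \<beta>_diff: assumes z: "z \<in> Hsp a b \<mu> 0" and w: "w \<in> Hsp a b \<mu> 0"
  shows "\<beta> z z - \<beta> w w = \<beta> (sdiff z w) z + \<beta> w (sdiff z w)"
proof -
  note d = sdiff_Hsp[OF z w]
  have "\<beta> (sdiff z w) z + \<beta> w (sdiff z w) = (\<Sum>n. (1 + \<Lambda> n) * uc (sdiff z w) n * Q (ec z n) + (1 + \<Lambda> n) * uc w n * Q (ec (sdiff z w) n))"
    unfolding \<beta>_def
    by (rule suminf_add[OF memory_pairing(1)[OF z uc_weight_summable(1)[OF d]] memory_pairing(1)[OF d uc_weight_summable(1)[OF w]]])
  also have "\<dots> = (\<Sum>n. (1 + \<Lambda> n) * uc z n * Q (ec z n) - (1 + \<Lambda> n) * uc w n * Q (ec w n))"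
    unfolding ec_sdiff[OF z w] by (simp add: Q_diff[OF Hsp_sq[OF z] Hsp_sq[OF w]] uc_sdiff[OF z w] algebra_simps)
  also have "\<dots> = \<beta> z z - \<beta> w w" unfolding \<beta>_def
    by (rule suminf_diff[symmetric, OF memory_pairing(1)[OF z uc_weight_summable(1)[OF z]] memory_pairing(1)[OF w uc_weight_summable(1)[OF w]]])
  finally show ?thesis by simp
qed

lemma N_le: "z \<in> Hsp a b \<mu> 0 \<Longrightarrow> N1 z \<le> Hnorm2 a b \<mu> 0 z" "z \<in> Hsp a b \<mu> 0 \<Longrightarrow> N2 z \<le> Hnorm2 a b \<mu> 0 z"
  using N12 by auto

text \<open>The increments of the linear and of the cross term are, in square, bounded by a constant
  times the squared distance. Continuity makes the sublevel set closed, and applied to constant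
  sequences it shows that the functional does not distinguish states at distance zero.\<close>

lemma Lam_tendsto:
  assumes z: "\<And>j. z j \<in> Hsp a b \<mu> 0" and w: "w \<in> Hsp a b \<mu> 0" and lim: "(\<lambda>j. Hdist a b \<mu> (z j) w) \<longlonglongrightarrow> 0"
  shows "(\<lambda>j. Lam a b \<mu> f \<epsilon> (z j)) \<longlonglongrightarrow> Lam a b \<mu> f \<epsilon> w"
proof -
  obtain R where R: "\<And>j. Hnorm2 a b \<mu> 0 (z j) \<le> R" "Hnorm2 a b \<mu> 0 w \<le> R"
    using Hnorm2_bounded[OF z w lim] by blast
  note d = sdiff_Hsp[OF z w]
  have om: "0 \<le> om2" using om2_ge by simp
  have \<alpha>: "(\<lambda>j. \<alpha> (z j)) \<longlonglongrightarrow> \<alpha> w"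
  proof (rule tendsto_of_square_le[OF z w lim, where c = "\<lambda>_. cf * mass"])
    fix j
    have "0 \<le> cf" unfolding cf_def by (rule suminf_nonneg[OF cf_summable]) (simp add: lam_nonneg)
    hence "cf * (mass * N2 (sdiff (z j) w)) \<le> cf * (mass * D2 (z j) w)"
      using mass_pos N_le(2)[OF d, of j] unfolding D2_def by (intro mult_left_mono) auto
    thus "(\<alpha> (z j) - \<alpha> w)\<^sup>2 \<le> cf * mass * D2 (z j) w"
      using \<alpha>_square_le[OF d, of j] unfolding \<alpha>_diff[OF z w] by (simp add: mult.assoc)
  qed simp
  have \<beta>: "(\<lambda>j. \<beta> (z j) (z j)) \<longlonglongrightarrow> \<beta> w w"
  proof (rule tendsto_of_square_le[OF z w lim, where c = "\<lambda>_. 4 * om2 * mass * R"])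
    fix j
    have "(\<beta> (sdiff (z j) w) (z j))\<^sup>2 \<le> om2 * N1 (sdiff (z j) w) * (mass * N2 (z j))" by (rule \<beta>_square_le[OF d z])
    also have "\<dots> \<le> om2 * D2 (z j) w * (mass * R)"
      using N_le[OF d, of j] N_le[OF z, of j] R(1)[of j] om mass_pos N12(3,4)[OF d, of j] N12(4)[OF z, of j] unfolding D2_def
      by (intro mult_mono mult_nonneg_nonneg) auto
    finally have 1: "(\<beta> (sdiff (z j) w) (z j))\<^sup>2 \<le> om2 * D2 (z j) w * (mass * R)" .
    have "(\<beta> w (sdiff (z j) w))\<^sup>2 \<le> om2 * N1 w * (mass * N2 (sdiff (z j) w))" by (rule \<beta>_square_le[OF w d])
    also have "\<dots> \<le> om2 * R * (mass * D2 (z j) w)"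
      using N_le[OF d, of j] N_le[OF w] R(2) om mass_pos N12(3,4)[OF d, of j] N12(3)[OF w] unfolding D2_def
      by (intro mult_mono mult_nonneg_nonneg) auto
    finally have 2: "(\<beta> w (sdiff (z j) w))\<^sup>2 \<le> om2 * R * (mass * D2 (z j) w)" .
    have "(\<beta> (z j) (z j) - \<beta> w w)\<^sup>2 \<le> 2 * (\<beta> (sdiff (z j) w) (z j))\<^sup>2 + 2 * (\<beta> w (sdiff (z j) w))\<^sup>2"
      unfolding \<beta>_diff[OF z w] using square_add_young[of 1 "\<beta> (sdiff (z j) w) (z j)" "\<beta> w (sdiff (z j) w)"] by simp
    also have "\<dots> \<le> 2 * (om2 * D2 (z j) w * (mass * R)) + 2 * (om2 * R * (mass * D2 (z j) w))" by (intro add_mono mult_left_mono 1 2) auto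
    also have "\<dots> = 4 * om2 * mass * R * D2 (z j) w" by simp
    finally show "(\<beta> (z j) (z j) - \<beta> w w)\<^sup>2 \<le> 4 * om2 * mass * R * D2 (z j) w" .
  qed simp
  show ?thesis unfolding Lam_eq[OF z] Lam_eq[OF w]
    by (intro tendsto_intros Hnorm2_tendsto[OF z w lim] \<alpha> \<beta>)
qed

text \<open>The bound on \<open>\<epsilon>\<close> gives
  \<open>\<epsilon>\<^sup>2 * om2 \<le> 1 / 4\<close>, so the cross term is at most a quarter of the
  squared norm; the linear term costs another quarter plus a multiple of \<open>cf\<close>. Half of
  the norm survives, hence the factor 2.\<close>

lemma Lam_coercive:
  assumes z: "z \<in> Hsp a b \<mu> 0" and \<epsilon>: "0 < \<epsilon>" "\<epsilon> < 1 / (2 * sqrt om2)"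
  shows "Hnorm2 a b \<mu> 0 z \<le> 2 * Lam a b \<mu> f \<epsilon> z + 8 * cf / mass"
proof -
  let ?H = "Hnorm2 a b \<mu> 0 z"
  have k: "0 < mass" by (rule mass_pos)
  have om: "0 < om2" using om2_ge by simp
  note N = N12(3,4,5)[OF z]
  have arith: "\<bar>e\<bar> \<le> H / 4 \<Longrightarrow> x \<le> H / 4 + y \<Longrightarrow> 0 \<le> F \<Longrightarrow> H \<le> 2 * (H - x + F - e) + 2 * y" for e H x y F :: real
    by (simp add: abs_le_iff)
  have "\<bar>\<epsilon> / sqrt mass * \<beta> z z\<bar> \<le> ?H / 4"
  proof -
    have "(\<epsilon> / sqrt mass * \<beta> z z)\<^sup>2 = \<epsilon>\<^sup>2 / mass * (\<beta> z z)\<^sup>2" using k by (simp add: power_mult_distrib power_divide)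
    also have "\<dots> \<le> \<epsilon>\<^sup>2 / mass * (om2 * N1 z * (mass * N2 z))"
      using \<beta>_square_le[OF z z] k by (intro mult_left_mono) auto
    also have "\<dots> = (\<epsilon>\<^sup>2 * om2) * (N1 z * N2 z)" using k by simp
    also have "\<dots> \<le> (1 / 4) * (N1 z * N2 z)"
    proof (rule mult_right_mono)
      have "\<epsilon> * sqrt om2 \<le> 1 / 2" using \<epsilon> om by (simp add: field_simps)
      hence "(\<epsilon> * sqrt om2)\<^sup>2 \<le> (1 / 2)\<^sup>2" using \<epsilon> om by (intro power_mono) auto
      thus "\<epsilon>\<^sup>2 * om2 \<le> 1 / 4" using om by (simp add: power_mult_distrib power_divide)
    qed (use N in auto)
    also have "\<dots> \<le> (?H / 4)\<^sup>2"
    proof -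
      have "0 \<le> (N1 z - N2 z)\<^sup>2" by simp
      thus ?thesis unfolding N(3) by (simp add: power2_eq_square field_simps)
    qed
    finally have "\<bar>\<epsilon> / sqrt mass * \<beta> z z\<bar> \<le> \<bar>?H / 4\<bar>" by (simp only: abs_le_square_iff)
    thus ?thesis using N by simp
  qed
  moreover have "2 / mass * \<alpha> z \<le> ?H / 4 + 4 * cf / mass"
  proof -
    \<comment> \<open>The Young estimate below divides by \<open>N2 z\<close>, so vanishing memory
      is treated separately; there the linear term is zero.\<close>
    have "2 / mass * \<alpha> z \<le> ?H / 4 + 4 * cf / mass" if "N2 z = 0"
    proof -
      have "\<alpha> z = 0" using \<alpha>_square_le[OF z] that by simp
      moreover have "0 \<le> cf" unfolding cf_def by (rule suminf_nonneg[OF cf_summable]) (simp add: lam_nonneg)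
      ultimately show ?thesis using N k by simp
    qed
    moreover have "2 / mass * \<alpha> z \<le> ?H / 4 + 4 * cf / mass" if "0 < N2 z"
    proof -
      have "2 / mass * \<alpha> z \<le> N2 z / 4 + 4 * (\<alpha> z)\<^sup>2 / (mass\<^sup>2 * N2 z)"
      proof -
        have "0 \<le> (N2 z - 4 * \<alpha> z / mass)\<^sup>2 / (4 * N2 z)" using that by simp
        also have "\<dots> = N2 z / 4 + 4 * (\<alpha> z)\<^sup>2 / (mass\<^sup>2 * N2 z) - 2 / mass * \<alpha> z"
          using that k by (simp add: power2_eq_square field_simps)
        finally show ?thesis by simp
      qed
      also have "4 * (\<alpha> z)\<^sup>2 / (mass\<^sup>2 * N2 z) \<le> 4 * (cf * (mass * N2 z)) / (mass\<^sup>2 * N2 z)"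
        using \<alpha>_square_le[OF z] that k by (intro divide_right_mono mult_left_mono) auto
      also have "\<dots> = 4 * cf / mass" using that k by (simp add: power2_eq_square)
      also have "N2 z / 4 \<le> ?H / 4" using N by simp
      finally show ?thesis by simp
    qed
    ultimately show ?thesis using N by fastforce
  qed
  moreover have "0 \<le> 2 / mass * (normF a b f)\<^sup>2" using k by simp
  ultimately have "?H \<le> 2 * (?H - 2 / mass * \<alpha> z + 2 / mass * (normF a b f)\<^sup>2 - \<epsilon> / sqrt mass * \<beta> z z) + 2 * (4 * cf / mass)"
    by (intro arith) auto
  thus ?thesis unfolding Lam_eq[OF z] by simp
qed

end

text \<open>After the last time at which \<open>Y \<le> B\<close>, the factorised bound gives
  \<open>Y' \<le> K * (Y - B)\<close>, so \<open>exp (- K * r) * (Y r - B)\<close> cannot increase.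
  It starts nonpositive, hence cannot be positive at time \<open>T\<close>.\<close>

lemma barrier_comparison:
  fixes Y :: "real \<Rightarrow> real"
  assumes dY: "\<And>t. 0 \<le> t \<Longrightarrow> \<exists>D. (Y has_real_derivative D) (at t within {0..}) \<and> D \<le> p (Y t)"
    and p: "\<And>y. p y \<le> (y - B) * q y" and q: "continuous_on UNIV q"
    and Y0: "Y 0 \<le> B" and T: "0 \<le> T"
  shows "Y T \<le> B"
proof (rule ccontr)
  assume n: "\<not> Y T \<le> B"
  obtain Y' where Y': "\<And>t. 0 \<le> t \<Longrightarrow> (Y has_real_derivative Y' t) (at t within {0..})" "\<And>t. 0 \<le> t \<Longrightarrow> Y' t \<le> p (Y t)"
    using dY by metis
  have cY: "continuous_on {0..} Y" unfolding continuous_on_eq_continuous_within using DERIV_continuous[OF Y'(1)] by simp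
  \<comment> \<open>The factor \<open>q\<close> may be unbounded on the line; along \<open>Y\<close>
    it is bounded because \<open>Y\<close> has compact range on the time interval.\<close>
  have "bounded ((\<lambda>t. q (Y t)) ` {0..T})"
    by (intro compact_imp_bounded compact_continuous_image continuous_on_compose2[OF q] continuous_on_subset[OF cY]) auto
  then obtain K where K: "\<forall>t\<in>{0..T}. \<bar>q (Y t)\<bar> \<le> K" by (auto simp: bounded_iff)
  define X where "X = {t \<in> {0..T}. Y t \<le> B}"
  have "closed X" unfolding X_def
    by (intro continuous_on_closed_Collect_le continuous_on_subset[OF cY] continuous_on_const closed_atLeastAtMost) auto
  moreover have "0 \<in> X" using Y0 T by (simp add: X_def)
  moreover have bdd: "bdd_above X" by (auto simp: X_def intro!: bdd_aboveI[of _ T])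
  ultimately have tX: "Sup X \<in> X" using closed_contains_Sup by blast
  define t where "t = Sup X"
  have t: "0 \<le> t" "t < T" "Y t \<le> B" using tX n by (auto simp: X_def t_def less_le)
  have above: "B < Y r" if "t < r" "r \<le> T" for r
  proof (rule ccontr)
    assume "\<not> B < Y r"
    hence "r \<in> X" using that t by (auto simp: X_def)
    hence "r \<le> t" unfolding t_def using bdd by (rule cSup_upper)
    thus False using that by simp
  qed
  define Z where "Z r = exp (- K * r) * (Y r - B)" for r
  have dZ: "(Z has_real_derivative (exp (- K * r) * (Y' r - K * (Y r - B)))) (at r)"
    and neg: "exp (- K * r) * (Y' r - K * (Y r - B)) \<le> 0" if r: "t < r" "r < T" for r
  proof -
    have "(Y has_real_derivative Y' r) (at r)"
      using Y'(1)[of r] r t at_within_interior[of r "{0..}"] by (simp add: interior_Ici[of "-1"])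
    thus "(Z has_real_derivative (exp (- K * r) * (Y' r - K * (Y r - B)))) (at r)"
      unfolding Z_def by (auto intro!: derivative_eq_intros simp: algebra_simps)
    have "Y' r \<le> (Y r - B) * q (Y r)" using Y'(2)[of r] p[of "Y r"] r t by simp
    also have "\<dots> \<le> (Y r - B) * K"
    proof (rule mult_left_mono)
      have "\<bar>q (Y r)\<bar> \<le> K" using K r t by auto
      thus "q (Y r) \<le> K" by simp
    qed (use above[of r] r in auto)
    finally show "exp (- K * r) * (Y' r - K * (Y r - B)) \<le> 0" by (simp add: mult_nonneg_nonpos mult.commute)
  qed
  have "continuous_on {t..T} Z" unfolding Z_def
    by (intro continuous_intros continuous_on_subset[OF cY]) (use t in auto)
  moreover have "\<And>r. t < r \<Longrightarrow> r < T \<Longrightarrow> Z differentiable (at r)"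
    using dZ real_differentiable_def by blast
  ultimately obtain l r where r: "t < r" "r < T" "DERIV Z r :> l" "Z T - Z t = (T - t) * l"
    using MVT[OF t(2)] by blast
  have "l \<le> 0" using neg[OF r(1,2)] DERIV_unique[OF r(3) dZ[OF r(1,2)]] by simp
  hence "Z T \<le> Z t" using r(4) t mult_nonneg_nonpos[of "T - t" l] by simp
  moreover have "Z t \<le> 0" using t by (simp add: Z_def mult_nonneg_nonpos)
  moreover have "0 < Z T" using n by (simp add: Z_def)
  ultimately show False by simp
qed

section \<open>Asymptotic compactness\<close>

text \<open>A product of compact intervals is compact, and over a countable index type also
  sequentially compact; convergence in the product is convergence of every coordinate.\<close>

lemma bounded_family_subsequence:
  fixes x :: "nat \<Rightarrow> 'i::countable \<Rightarrow> real" and B :: "'i \<Rightarrow> real"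
  assumes "\<And>j i. \<bar>x j i\<bar> \<le> B i"
  obtains g l where "strict_mono (g :: nat \<Rightarrow> nat)" "\<And>i. (\<lambda>j. x (g j) i) \<longlonglongrightarrow> l i"
proof -
  have "compactin (product_topology (\<lambda>i. euclidean) UNIV) (PiE UNIV (\<lambda>i. {- B i..B i}))"
    by (simp add: compactin_PiE)
  hence "compact (PiE UNIV (\<lambda>i. {- B i..B i}))"
    by (simp add: euclidean_product_topology)
  hence "seq_compact (PiE UNIV (\<lambda>i. {- B i..B i}))" by (rule compact_imp_seq_compact)
  moreover have "\<forall>j. x j \<in> PiE UNIV (\<lambda>i. {- B i..B i})" using assms by (auto simp: abs_le_iff minus_le_iff)
  ultimately obtain l g where g: "strict_mono g" "(x \<circ> g) \<longlonglongrightarrow> l"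
    unfolding seq_compact_def by blast
  have "(\<lambda>j. x (g j) i) \<longlonglongrightarrow> l i" for i
  proof -
    have "continuous_on UNIV (\<lambda>f :: 'i \<Rightarrow> real. f i)" by (rule continuous_on_product_coordinates)
    hence "isCont (\<lambda>f :: 'i \<Rightarrow> real. f i) l" using continuous_on_eq_continuous_at[OF open_UNIV] by blast
    from isCont_tendsto_compose[OF this g(2)] show ?thesis by (simp add: o_def)
  qed
  thus ?thesis using that g(1) by blast
qed

text \<open>The common Lipschitz constant transfers the Cauchy property from a nearby rational
  point: one third of the tolerance for each change of point and one for the rational
  itself.\<close>

lemma convergent_of_dense_lipschitz:
  fixes \<rho> :: "nat \<Rightarrow> real \<Rightarrow> real"
  assumes lip: "\<And>j s r. \<bar>\<rho> j s - \<rho> j r\<bar> \<le> K * \<bar>s - r\<bar>" and K: "0 \<le> K"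
    and rat: "\<And>q :: rat. convergent (\<lambda>j. \<rho> j (of_rat q))"
  shows "convergent (\<lambda>j. \<rho> j s)"
proof -
  have "Cauchy (\<lambda>j. \<rho> j s)"
  proof (rule CauchyI)
    fix e :: real assume e: "0 < e"
    \<comment> \<open>The factor \<open>3 * (K + 1)\<close> brings
      \<open>K * \<bar>s - q\<bar>\<close> below a third of \<open>e\<close>, and remains positive
      when \<open>K = 0\<close>.\<close>
    obtain q :: rat where q: "\<bar>s - of_rat q\<bar> * (3 * (K + 1)) < e"
    proof -
      have "s < s + e / (3 * (K + 1))" using e K by simp
      then obtain q where q: "s < of_rat q" "of_rat q < s + e / (3 * (K + 1))" using of_rat_dense by blast
      have "\<bar>s - of_rat q\<bar> < e / (3 * (K + 1))" using q by simp
      thus ?thesis using K by (intro that[of q]) (simp add: pos_less_divide_eq)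
    qed
    have Kq: "K * \<bar>s - of_rat q\<bar> < e / 3"
    proof -
      have "3 * (K * \<bar>s - of_rat q\<bar>) \<le> \<bar>s - of_rat q\<bar> * (3 * (K + 1))" by (simp add: algebra_simps)
      thus ?thesis using q by linarith
    qed
    have "Cauchy (\<lambda>j. \<rho> j (of_rat q))" by (rule convergent_Cauchy[OF rat])
    then obtain N where N: "\<And>m n. N \<le> m \<Longrightarrow> N \<le> n \<Longrightarrow> norm (\<rho> m (of_rat q) - \<rho> n (of_rat q)) < e / 3"
      using e CauchyD[of _ "e / 3"] by (metis divide_pos_pos zero_less_numeral)
    have "norm (\<rho> m s - \<rho> n s) < e" if "N \<le> m" "N \<le> n" for m n
    proof -
      have "\<bar>x - y\<bar> < e" if "\<bar>x' - y'\<bar> < e / 3" "\<bar>x - x'\<bar> \<le> k" "\<bar>y - y'\<bar> \<le> k" "k < e / 3" for x y x' y' k :: real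
        using that by linarith
      from this[OF _ lip lip Kq] show ?thesis using N[OF that] by simp
    qed
    thus "\<exists>N. \<forall>m\<ge>N. \<forall>n\<ge>N. norm (\<rho> m s - \<rho> n s) < e" by blast
  qed
  thus ?thesis by (simp add: Cauchy_convergent_iff)
qed

context bbm
begin

lemma sq_of_linear_bound:
  assumes i2: "integrable lborel (\<lambda>s. ker \<mu> s * s\<^sup>2)" and [measurable]: "x \<in> borel_measurable borel" and le: "\<And>s. \<bar>x s\<bar> \<le> K * \<bar>s\<bar>"
  shows "sq x"
proof -
  have "integrable lborel (\<lambda>s. ker \<mu> s * (x s)\<^sup>2)"
  proof (rule Bochner_Integration.integrable_bound)
    show "integrable lborel (\<lambda>s. K\<^sup>2 * (ker \<mu> s * s\<^sup>2))" using i2 by simp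
    show "AE s in lborel. norm (ker \<mu> s * (x s)\<^sup>2) \<le> norm (K\<^sup>2 * (ker \<mu> s * s\<^sup>2))"
    proof (rule AE_I2)
      fix s
      have "\<bar>x s\<bar>\<^sup>2 \<le> (K * \<bar>s\<bar>)\<^sup>2" by (intro power_mono le) auto
      hence "ker \<mu> s * (x s)\<^sup>2 \<le> ker \<mu> s * (K\<^sup>2 * s\<^sup>2)" using m_nonneg by (intro mult_left_mono) (auto simp: power_mult_distrib)
      thus "norm (ker \<mu> s * (x s)\<^sup>2) \<le> norm (K\<^sup>2 * (ker \<mu> s * s\<^sup>2))" using m_nonneg by (simp add: abs_mult mult.left_commute)
    qed
  qed measurable
  thus ?thesis by (simp add: sq_def)
qed

text \<open>The quantity controlled by the scalar decay estimate. It carries no weight, so that the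
  powers of \<open>1 + \<Lambda> n\<close> can be chosen when summing.\<close>

definition E :: "state \<Rightarrow> nat \<Rightarrow> real" where "E z n = (uc z n)\<^sup>2 + P (ec z n)"

text \<open>The part of the memory created since time zero; the rest is the initial memory shifted by \<open>t\<close>.\<close>

definition recent :: "(real \<Rightarrow> state) \<Rightarrow> real \<Rightarrow> nat \<Rightarrow> real \<Rightarrow> real" where
  "recent U t n s = integral {max 0 (t - s)..t} (\<lambda>r. uc (U r) n)"

context
  fixes U :: "real \<Rightarrow> state" and R :: real
  assumes U: "traj U" and R: "\<And>t. 0 \<le> t \<Longrightarrow> Hnorm2 a b \<mu> 0 (U t) \<le> R"
begin

lemma R_nonneg: "0 \<le> R" using Hnorm2_nonneg[OF traj_Hsp[OF U], of 0] R[of 0] by simp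

lemma uc_abs_le: "0 \<le> t \<Longrightarrow> \<bar>uc (U t) n\<bar> \<le> sqrt R"
proof -
  assume t: "0 \<le> t"
  have "1 * (uc (U t) n)\<^sup>2 \<le> en (U t) n" unfolding en_def
    using P_nonneg by (intro add_increasing2 mult_nonneg_nonneg mult_right_mono) (auto simp: lam_nonneg)
  also have "\<dots> \<le> R" using en_le[OF traj_Hsp[OF U t], of n] R[OF t] by simp
  finally show ?thesis using real_le_rsqrt[of "\<bar>uc (U t) n\<bar>" R] by simp
qed

lemma uc_integrable: "0 \<le> x \<Longrightarrow> (\<lambda>r. uc (U r) n) integrable_on {x..y}"
  by (rule integrable_continuous_real[OF continuous_on_subset[OF curve_uc_continuous[OF traj_curve[OF U]]]]) auto

lemma uc_integral_abs_le: "0 \<le> x \<Longrightarrow> x \<le> y \<Longrightarrow> \<bar>integral {x..y} (\<lambda>r. uc (U r) n)\<bar> \<le> sqrt R * (y - x)"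
  unfolding real_norm_def[symmetric]
  by (rule integral_bound) (use uc_abs_le in \<open>auto intro!: continuous_on_subset[OF curve_uc_continuous[OF traj_curve[OF U]]]\<close>)

lemma recent_nonpos: "s \<le> 0 \<Longrightarrow> recent U t n s = 0"
  by (cases "s = 0 \<and> 0 \<le> t") (auto simp: recent_def max_def)

text \<open>Changing \<open>s\<close> changes the window of integration by at most the same length,
  and each coefficient of \<open>u\<close> is at most \<open>sqrt R\<close>. The constant depends
  neither on time nor on mode; this equicontinuity replaces the missing compactness in
  \<open>s\<close>.\<close>

lemma recent_lipschitz: assumes t: "0 \<le> t" shows "\<bar>recent U t n s - recent U t n r\<bar> \<le> sqrt R * \<bar>s - r\<bar>"
proof -
  have le: "\<bar>recent U t n s - recent U t n r\<bar> \<le> sqrt R * (r - s)" if "s \<le> r" for s r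
  proof (cases "0 \<le> s")
    case True
    have "integral {max 0 (t - r)..max 0 (t - s)} (\<lambda>r. uc (U r) n) + recent U t n s = recent U t n r"
      unfolding recent_def
      by (rule Henstock_Kurzweil_Integration.integral_combine) (use True that t uc_integrable in auto)
    hence "\<bar>recent U t n s - recent U t n r\<bar> = \<bar>integral {max 0 (t - r)..max 0 (t - s)} (\<lambda>r. uc (U r) n)\<bar>" by linarith
    also have "\<dots> \<le> sqrt R * (max 0 (t - s) - max 0 (t - r))" by (rule uc_integral_abs_le) (use that in auto)
    also have "\<dots> \<le> sqrt R * (r - s)" using that R_nonneg by (intro mult_left_mono) auto
    finally show ?thesis .
  next
    case False
    hence s: "recent U t n s = 0" by (intro recent_nonpos) simp
    show ?thesis
    proof (cases "0 \<le> r")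
      case True
      have "\<bar>recent U t n r\<bar> \<le> sqrt R * (t - max 0 (t - r))"
        unfolding recent_def by (rule uc_integral_abs_le) (use True t in auto)
      also have "\<dots> \<le> sqrt R * (r - s)" using that False R_nonneg True by (intro mult_left_mono) auto
      finally show ?thesis by (simp add: s)
    next
      case False
      thus ?thesis using s recent_nonpos[of r t n] R_nonneg that by simp
    qed
  qed
  show ?thesis using le[of s r] le[of r s] by (cases "s \<le> r") (auto simp: abs_minus_commute)
qed

lemma recent_abs_le: "0 \<le> t \<Longrightarrow> \<bar>recent U t n s\<bar> \<le> sqrt R * \<bar>s\<bar>"
  using recent_lipschitz[of t n s 0] recent_nonpos[of 0 t n] by simp

lemma recent_measurable: "0 \<le> t \<Longrightarrow> recent U t n \<in> borel_measurable borel"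
proof (rule borel_measurable_continuous_onI)
  assume t: "0 \<le> t"
  have "(sqrt R)-lipschitz_on UNIV (recent U t n)"
    by (rule lipschitz_onI) (use recent_lipschitz[OF t] R_nonneg in \<open>auto simp: dist_real_def\<close>)
  thus "continuous_on UNIV (recent U t n)" by (rule lipschitz_on_continuous_on)
qed

lemma ec_recent_small: assumes "0 \<le> t" "0 < s" "s \<le> t" shows "ec (U t) n s = recent U t n s"
  using U assms by (simp add: traj_def recent_def)

lemma ec_recent_large: assumes t: "0 \<le> t" and s: "0 < s" shows "ec (U t) n (s + t) = ec (U 0) n s + recent U t n (s + t)"
proof (cases "t = 0")
  case True
  thus ?thesis using s by (simp add: recent_def)
next
  case False
  hence "ec (U (0 + t)) n (s + t) = ec (U 0) n s + integral {0..0+t} (\<lambda>r. uc (U r) n)"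
    using U t s unfolding traj_def by (metis order_refl less_le)
  thus ?thesis using s by (simp add: recent_def)
qed

context
  assumes i2: "integrable lborel (\<lambda>s. ker \<mu> s * s\<^sup>2)"
begin

lemma recent_sq: "0 \<le> t \<Longrightarrow> sq (recent U t n)"
  by (rule sq_of_linear_bound[OF i2 recent_measurable recent_abs_le])

text \<open>Up to age \<open>t\<close> the memory is entirely recent. Beyond it the remainder is the
  initial memory transported by \<open>t\<close>, and the shifted kernel weighs it down by the
  factor \<open>1 + \<delta> * t\<close>.\<close>

lemma P_ec_minus_recent: assumes t: "0 \<le> t" shows "(1 + \<delta> * t) * P (\<lambda>s. ec (U t) n s - recent U t n s) \<le> R / \<Lambda> 0"
proof -
  have H0: "U 0 \<in> Hsp a b \<mu> 0" and Ht: "U t \<in> Hsp a b \<mu> 0" using traj_Hsp[OF U] t by auto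
  define y where "y s = ec (U t) n s - recent U t n s" for s
  have sqy: "sq y" unfolding y_def by (rule sq_diff[OF Hsp_sq[OF Ht] recent_sq[OF t]])
  note sp = integral_split_shift[OF t sq_integrable2[OF sqy]]
  have "(\<integral>s. indicator {0<..t} s * (ker \<mu> s * (y s)\<^sup>2) \<partial>lborel) = (\<integral>s. 0 \<partial>(lborel :: real measure))"
    by (rule Bochner_Integration.integral_cong) (use ec_recent_small[OF t] in \<open>auto simp: indicator_def y_def\<close>)
  moreover have sh: "(\<lambda>s. shifted t s * (y (s + t))\<^sup>2) = (\<lambda>s. shifted t s * (ec (U 0) n s)\<^sup>2)"
  proof
    fix s show "shifted t s * (y (s + t))\<^sup>2 = shifted t s * (ec (U 0) n s)\<^sup>2"
      using ec_recent_large[OF t, of s n] by (cases "0 < s") (auto simp: shifted_def y_def)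
  qed
  ultimately have Py: "P y = (\<integral>s. shifted t s * (ec (U 0) n s)\<^sup>2 \<partial>lborel)" and ip: "integrable lborel (\<lambda>s. shifted t s * (ec (U 0) n s)\<^sup>2)"
    using sp unfolding sh by (simp_all add: P_def)
  have "(1 + \<delta> * t) * P y = (\<integral>s. (1 + \<delta> * t) * (shifted t s * (ec (U 0) n s)\<^sup>2) \<partial>lborel)" by (simp add: Py)
  also have "\<dots> \<le> P (ec (U 0) n)" unfolding P_def
  proof (rule integral_mono)
    show "(1 + \<delta> * t) * (shifted t s * (ec (U 0) n s)\<^sup>2) \<le> ker \<mu> s * (ec (U 0) n s)\<^sup>2" for s
      using mult_right_mono[OF shifted_bounds(2)[OF t, of s], of "(ec (U 0) n s)\<^sup>2"] by (simp add: mult.assoc)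
  qed (use ip sq_integrable2[OF Hsp_sq[OF H0]] in auto)
  also have "\<dots> \<le> R / \<Lambda> 0"
  proof -
    have "\<Lambda> 0 * P (ec (U 0) n) \<le> \<Lambda> n * P (ec (U 0) n)" by (intro mult_right_mono \<Lambda>_ge P_nonneg)
    also have "\<dots> \<le> en (U 0) n" unfolding en_def by (intro add_increasing) (auto simp: lam_nonneg)
    also have "\<dots> \<le> R" using en_le[OF H0, of n] R[of 0] by simp
    finally show ?thesis using \<Lambda>_pos[of 0] by (simp add: field_simps)
  qed
  finally show ?thesis by (simp add: y_def[abs_def])
qed

end

text \<open>The factor \<open>om2\<close> is needed because the energy weights the memory by
  \<open>\<Lambda> n\<close> instead of \<open>1 + \<Lambda> n\<close>.\<close>

lemma E_initial_sum: "(\<Sum>n<N. (1 + \<Lambda> n) * E (U 0) n) \<le> om2 * R"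
proof -
  have "(1 + \<Lambda> n) * E (U 0) n \<le> om2 * en (U 0) n" for n
  proof -
    have "(1 + \<Lambda> n) * P (ec (U 0) n) \<le> om2 * \<Lambda> n * P (ec (U 0) n)"
      by (intro mult_right_mono one_plus_\<Lambda>_le P_nonneg)
    moreover have "1 * ((1 + \<Lambda> n) * (uc (U 0) n)\<^sup>2) \<le> om2 * ((1 + \<Lambda> n) * (uc (U 0) n)\<^sup>2)"
      by (intro mult_right_mono om2_ge) (auto simp: lam_nonneg)
    ultimately show ?thesis unfolding E_def en_def by (simp add: distrib_left mult.assoc)
  qed
  hence "(\<Sum>n<N. (1 + \<Lambda> n) * E (U 0) n) \<le> (\<Sum>n<N. om2 * en (U 0) n)" by (rule sum_mono)
  also have "\<dots> = om2 * (\<Sum>n<N. en (U 0) n)" by (simp add: sum_distrib_left)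
  also have "\<dots> \<le> om2 * R"
    using en_sum_le[OF traj_Hsp[OF U, of 0], of "{..<N}"] R[of 0] om2_ge by (intro mult_left_mono) auto
  finally show ?thesis .
qed

text \<open>The sum over modes is taken under the time integral, where the forcing bound is uniform
  in time; the remaining exponential integrates to at most \<open>1 / \<nu>\<close>, whatever the
  length of the interval.\<close>

lemma forcing_memory_sum:
  assumes \<nu>: "0 < \<nu>" and t: "0 \<le> t"
  shows "(\<Sum>n<N. (1 + \<Lambda> n)\<^sup>2 * integral {0..t} (\<lambda>r. exp (- \<nu> * (t - r)) * (G (U r) n)\<^sup>2)) \<le> forcing_bound R / \<nu>"
proof -
  have cG: "continuous_on {0..t} (\<lambda>r. G (U r) n)" for n
    by (rule continuous_on_subset[OF curve_G_continuous[OF traj_curve[OF U]]]) auto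
  have ig: "(\<lambda>r. (1 + \<Lambda> n)\<^sup>2 * (exp (- \<nu> * (t - r)) * (G (U r) n)\<^sup>2)) integrable_on {0..t}" for n
    by (intro integrable_continuous_real continuous_intros cG)
  have "(\<Sum>n<N. (1 + \<Lambda> n)\<^sup>2 * integral {0..t} (\<lambda>r. exp (- \<nu> * (t - r)) * (G (U r) n)\<^sup>2))
      = integral {0..t} (\<lambda>r. \<Sum>n<N. (1 + \<Lambda> n)\<^sup>2 * (exp (- \<nu> * (t - r)) * (G (U r) n)\<^sup>2))"
    using ig by (simp add: Henstock_Kurzweil_Integration.integral_sum)
  also have "\<dots> \<le> integral {0..t} (\<lambda>r. exp (- \<nu> * (t - r)) * forcing_bound R)"
  proof (rule integral_le)
    show "(\<lambda>r. \<Sum>n<N. (1 + \<Lambda> n)\<^sup>2 * (exp (- \<nu> * (t - r)) * (G (U r) n)\<^sup>2)) integrable_on {0..t}"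
      using ig by (intro integrable_sum) auto
    show "(\<lambda>r. exp (- \<nu> * (t - r)) * forcing_bound R) integrable_on {0..t}"
      by (intro integrable_continuous_real continuous_intros)
    fix r assume r: "r \<in> {0..t}"
    have "(\<Sum>n<N. (1 + \<Lambda> n)\<^sup>2 * (exp (- \<nu> * (t - r)) * (G (U r) n)\<^sup>2)) = exp (- \<nu> * (t - r)) * (\<Sum>n<N. (1 + \<Lambda> n)\<^sup>2 * (G (U r) n)\<^sup>2)"
      by (simp add: sum_distrib_left mult.left_commute)
    also have "\<dots> \<le> exp (- \<nu> * (t - r)) * forcing_bound R"
      using r by (intro mult_left_mono G_sum_le traj_Hsp[OF U] R) auto
    finally show "(\<Sum>n<N. (1 + \<Lambda> n)\<^sup>2 * (exp (- \<nu> * (t - r)) * (G (U r) n)\<^sup>2)) \<le> exp (- \<nu> * (t - r)) * forcing_bound R" .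
  qed
  also have "\<dots> \<le> forcing_bound R / \<nu>"
  proof -
    have "((\<lambda>r. exp (- \<nu> * (t - r)) * forcing_bound R) has_integral
        exp (- \<nu> * (t - t)) * forcing_bound R / \<nu> - exp (- \<nu> * (t - 0)) * forcing_bound R / \<nu>) {0..t}"
      by (rule fundamental_theorem_of_calculus[OF t])
         (use \<nu> in \<open>auto intro!: derivative_eq_intros simp: has_real_derivative_iff_has_vector_derivative[symmetric]\<close>)
    from integral_unique[OF this]
    have "integral {0..t} (\<lambda>r. exp (- \<nu> * (t - r)) * forcing_bound R) = forcing_bound R / \<nu> - exp (- \<nu> * t) * forcing_bound R / \<nu>"
      by simp
    moreover have "0 \<le> forcing_bound R" using G_sum_le[OF traj_Hsp[OF U, of 0] R[of 0], of 0] by simp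
    ultimately show ?thesis using \<nu> by simp
  qed
  finally show ?thesis .
qed

end

lemma Hsp_1_subset: assumes "z \<in> Hsp a b \<mu> 1" shows "z \<in> Hsp a b \<mu> 0"
proof -
  have "fst z \<in> Hs a b (Suc 0)" using Hs_Suc_subset[of "fst z" "Suc 0"] Hsp_fst[OF assms] by simp
  moreover have "snd z \<in> Mem a b \<mu> 0"
  proof (rule MemI[where u = "fst z"])
    note M = Hsp_snd[OF assms]
    show "snd z s \<in> Hs a b (Suc 0)" if "0 < s" for s
      using M that Hs_Suc_subset[of "snd z s" "Suc 0"] by (simp add: Mem_def)
    show "sq (ec (fst z, snd z) n)" for n by (rule Mem_modes(1)[OF M])
    have s: "summable (\<lambda>n. 1 / \<Lambda> 0 * (\<Lambda> n ^ Suc 1 * P (ec (fst z, snd z) n)))"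
      by (intro summable_mult sums_summable[OF Mem_modes(2)[OF M]])
    show "summable (\<lambda>n. \<Lambda> n ^ Suc 0 * P (ec (fst z, snd z) n))"
    proof (rule summable_comparison_test'[OF s, of 0])
      fix n
      have "\<Lambda> 0 * (\<Lambda> n * P (ec (fst z, snd z) n)) \<le> \<Lambda> n * (\<Lambda> n * P (ec (fst z, snd z) n))"
        by (intro mult_right_mono \<Lambda>_ge mult_nonneg_nonneg P_nonneg lam_nonneg)
      thus "norm (\<Lambda> n ^ Suc 0 * P (ec (fst z, snd z) n)) \<le> 1 / \<Lambda> 0 * (\<Lambda> n ^ Suc 1 * P (ec (fst z, snd z) n))"
        using \<Lambda>_pos[of 0] P_nonneg[of "ec (fst z, snd z) n"] lam_nonneg[of "Suc n"]
        by (simp add: abs_mult power2_eq_square field_simps)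
    qed
  qed
  ultimately show ?thesis by (simp add: Hsp_def case_prod_unfold)
qed

lemma summable_\<Lambda>_of_\<Lambda>2:
  assumes "summable (\<lambda>n. \<Lambda> n ^ 2 * (x n)\<^sup>2)" shows "summable (\<lambda>n. \<Lambda> n * (x n)\<^sup>2)"
proof (rule summable_comparison_test'[where N = 0])
  show "summable (\<lambda>n. 1 / \<Lambda> 0 * (\<Lambda> n ^ 2 * (x n)\<^sup>2))" by (intro summable_mult assms)
  fix n
  have "\<Lambda> 0 * (\<Lambda> n * (x n)\<^sup>2) \<le> \<Lambda> n * (\<Lambda> n * (x n)\<^sup>2)"
    by (intro mult_right_mono \<Lambda>_ge mult_nonneg_nonneg lam_nonneg) auto
  thus "norm (\<Lambda> n * (x n)\<^sup>2) \<le> 1 / \<Lambda> 0 * (\<Lambda> n ^ 2 * (x n)\<^sup>2)"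
    using \<Lambda>_pos[of 0] lam_nonneg[of "Suc n"] by (simp add: abs_mult power2_eq_square field_simps)
qed

text \<open>The memory coefficients are only in the smoother space for almost every \<open>s\<close>; redefining them
as zero on the exceptional set does not change any weighted integral.\<close>

lemma state_of_modes:
  assumes sqc: "\<And>n. sq (c n)" and c0: "\<And>n s. s \<le> 0 \<Longrightarrow> c n s = 0"
    and le: "\<And>N. (\<Sum>n<N. (1 + \<Lambda> n)\<^sup>2 * ((v n)\<^sup>2 + P (c n))) \<le> K"
  obtains y where "y \<in> Hsp a b \<mu> 1" "Hnorm2 a b \<mu> 1 y \<le> K" "\<And>n. uc y n = v n"
    "\<And>n x. sq x \<Longrightarrow> P (\<lambda>s. x s - ec y n s) = P (\<lambda>s. x s - c n s)" "\<And>n. P (ec y n) = P (c n)"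
proof -
  have [measurable]: "c n \<in> borel_measurable borel" for n by (rule sq_measurable[OF sqc])
  have nn: "0 \<le> (1 + \<Lambda> n)\<^sup>2 * ((v n)\<^sup>2 + P (c n))" for n using P_nonneg by simp
  have S: "summable (\<lambda>n. (1 + \<Lambda> n)\<^sup>2 * ((v n)\<^sup>2 + P (c n)))"
  proof (rule bounded_imp_summable[OF nn])
    show "(\<Sum>n\<le>N. (1 + \<Lambda> n)\<^sup>2 * ((v n)\<^sup>2 + P (c n))) \<le> K" for N
      using le[of "Suc N"] by (simp only: lessThan_Suc_atMost)
  qed
  have l2: "\<Lambda> n ^ 2 \<le> (1 + \<Lambda> n)\<^sup>2" for n using lam_nonneg[of "Suc n"] by (intro power_mono) auto
  have Sv: "summable (\<lambda>n. \<Lambda> n ^ 2 * (v n)\<^sup>2)"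
    by (rule summable_comparison_test'[OF S, of 0]) (use l2 P_nonneg in \<open>auto simp: abs_mult intro!: mult_mono\<close>)
  have Sc: "summable (\<lambda>n. \<Lambda> n ^ 2 * P (c n))"
    by (rule summable_comparison_test'[OF S, of 0]) (use l2 P_nonneg in \<open>auto simp: abs_mult intro!: mult_mono\<close>)
  \<comment> \<open>Those \<open>s\<close> at which the memory coefficients define an element of the
    smoother space; phrased with extended sums to stay measurable.\<close>
  define good where "good s \<longleftrightarrow> (\<Sum>n. ennreal (\<Lambda> n ^ 2 * (c n s)\<^sup>2)) \<noteq> top" for s
  have [measurable]: "Measurable.pred borel good" unfolding good_def by measurable
  define c' where "c' n s = (if good s then c n s else 0)" for n s
  have [measurable]: "c' n \<in> borel_measurable borel" for n unfolding c'_def by measurable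
  have c'_sum: "summable (\<lambda>n. \<Lambda> n ^ 2 * (c' n s)\<^sup>2)" for s
  proof (cases "good s")
    case True
    thus ?thesis unfolding good_def c'_def by (simp add: summable_suminf_not_top)
  qed (simp add: c'_def)
  \<comment> \<open>The weighted sum over modes has finite integral, hence is finite almost
    everywhere; wherever the kernel is positive this makes \<open>s\<close> good.\<close>
  have AEc: "AE s in lborel. ker \<mu> s = 0 \<or> good s"
  proof -
    have "(\<integral>\<^sup>+ s. (\<Sum>n. ennreal (ker \<mu> s) * ennreal (\<Lambda> n ^ 2 * (c n s)\<^sup>2)) \<partial>lborel) = (\<Sum>n. \<integral>\<^sup>+ s. ennreal (ker \<mu> s) * ennreal (\<Lambda> n ^ 2 * (c n s)\<^sup>2) \<partial>lborel)"
      by (rule nn_integral_suminf) measurable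
    also have "\<dots> = (\<Sum>n. ennreal (\<Lambda> n ^ 2 * P (c n)))"
    proof (rule suminf_cong)
      fix n
      have "(\<integral>\<^sup>+ s. ennreal (ker \<mu> s) * ennreal (\<Lambda> n ^ 2 * (c n s)\<^sup>2) \<partial>lborel) = (\<integral>\<^sup>+ s. ennreal (\<Lambda> n ^ 2 * (ker \<mu> s * (c n s)\<^sup>2)) \<partial>lborel)"
        using m_nonneg by (intro nn_integral_cong) (simp add: ennreal_mult[symmetric] mult.left_commute)
      also have "\<dots> = ennreal (\<integral>s. \<Lambda> n ^ 2 * (ker \<mu> s * (c n s)\<^sup>2) \<partial>lborel)"
        using m_nonneg sq_integrable2[OF sqc] by (intro nn_integral_eq_integral) auto
      finally show "(\<integral>\<^sup>+ s. ennreal (ker \<mu> s) * ennreal (\<Lambda> n ^ 2 * (c n s)\<^sup>2) \<partial>lborel) = ennreal (\<Lambda> n ^ 2 * P (c n))"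
        by (simp add: P_def)
    qed
    also have "\<dots> \<noteq> \<infinity>"
      unfolding infinity_ennreal_def by (rule ennreal_suminf_neq_top[OF Sc]) (simp add: P_nonneg)
    finally have "(\<integral>\<^sup>+ s. (\<Sum>n. ennreal (ker \<mu> s) * ennreal (\<Lambda> n ^ 2 * (c n s)\<^sup>2)) \<partial>lborel) \<noteq> \<infinity>" .
    hence "AE s in lborel. (\<Sum>n. ennreal (ker \<mu> s) * ennreal (\<Lambda> n ^ 2 * (c n s)\<^sup>2)) \<noteq> \<infinity>"
      by (intro nn_integral_PInf_AE) auto
    thus ?thesis
    proof eventually_elim
      case (elim s)
      show ?case
      proof (rule ccontr)
        assume "\<not> ?thesis"
        hence "ker \<mu> s \<noteq> 0" "(\<Sum>n. ennreal (\<Lambda> n ^ 2 * (c n s)\<^sup>2)) = top" by (auto simp: good_def)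
        hence "0 < ker \<mu> s" using m_nonneg[of s] by simp
        hence "(\<Sum>n. ennreal (ker \<mu> s) * ennreal (\<Lambda> n ^ 2 * (c n s)\<^sup>2)) = top"
          using \<open>(\<Sum>n. ennreal (\<Lambda> n ^ 2 * (c n s)\<^sup>2)) = top\<close> by (simp add: ennreal_suminf_cmult ennreal_mult_top)
        thus False using elim by simp
      qed
    qed
  qed
  have AE': "AE s in lborel. ker \<mu> s * (x s - c' n s)\<^sup>2 = ker \<mu> s * (x s - c n s)\<^sup>2" for x n
    using AEc by eventually_elim (auto simp: c'_def)
  have Peq: "P (\<lambda>s. x s - c' n s) = P (\<lambda>s. x s - c n s)" if [measurable]: "x \<in> borel_measurable borel" for x n
    unfolding P_def by (rule integral_cong_AE[OF _ _ AE']) measurable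
  have sqc': "sq (c' n)" for n
  proof -
    have "AE s in lborel. ker \<mu> s * (c n s)\<^sup>2 = ker \<mu> s * (c' n s)\<^sup>2"
      using AE'[of "\<lambda>_. 0" n] by eventually_elim auto
    hence "integrable lborel (\<lambda>s. ker \<mu> s * (c' n s)\<^sup>2)"
      using sq_integrable2[OF sqc, of n] by (subst integrable_cong_AE[symmetric, where f = "\<lambda>s. ker \<mu> s * (c n s)\<^sup>2"]) auto
    thus ?thesis by (simp add: sq_def)
  qed
  have P0: "P (c' n) = P (c n)" for n using Peq[of "\<lambda>_. 0" n] by (simp add: P_def)
  have Sv1: "summable (\<lambda>n. \<Lambda> n * (v n)\<^sup>2)" by (rule summable_\<Lambda>_of_\<Lambda>2[OF Sv])
  have Sc1: "summable (\<lambda>n. \<Lambda> n * (c' n s)\<^sup>2)" for s by (rule summable_\<Lambda>_of_\<Lambda>2[OF c'_sum])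
  define y :: state where "y = (fser v, \<lambda>s. fser (\<lambda>n. c' n s))"
  have uy: "uc y n = v n" for n by (simp add: uc_def y_def coef_fser[OF Sv1])
  have ey: "ec y n = c' n" for n
  proof
    fix s show "ec y n s = c' n s"
    proof (cases "0 < s")
      case True
      thus ?thesis by (simp add: ec_def y_def coef_fser[OF Sc1])
    next
      case False
      thus ?thesis using c0[of s n] by (simp add: ec_def c'_def)
    qed
  qed
  have "fst y \<in> Hs a b (Suc 1)"
    unfolding y_def fst_conv Hs_def using Sv by (simp add: fser_L2[OF Sv1] coef_fser[OF Sv1] numeral_2_eq_2)
  moreover have "snd y \<in> Mem a b \<mu> 1"
  proof (rule MemI[where u = "fst y"])
    show "snd y s \<in> Hs a b (Suc 1)" for s
      unfolding y_def snd_conv Hs_def using c'_sum[of s] by (simp add: fser_L2[OF Sc1] coef_fser[OF Sc1] numeral_2_eq_2)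
    show "sq (ec (fst y, snd y) n)" for n by (simp add: ey sqc')
    show "summable (\<lambda>n. \<Lambda> n ^ Suc 1 * P (ec (fst y, snd y) n))" using Sc by (simp add: ey P0 numeral_2_eq_2)
  qed
  ultimately have yH: "y \<in> Hsp a b \<mu> 1" by (simp add: Hsp_def case_prod_unfold)
  have "Hnorm2 a b \<mu> 1 y \<le> K"
  proof -
    note sm = Hnorm2_sums[OF yH]
    have "(\<Sum>n<N. \<Lambda> n ^ 1 * ((1 + \<Lambda> n) * (uc y n)\<^sup>2 + \<Lambda> n * P (ec y n))) \<le> K" for N
    proof -
      have "\<Lambda> n ^ 1 * ((1 + \<Lambda> n) * (uc y n)\<^sup>2 + \<Lambda> n * P (ec y n)) \<le> (1 + \<Lambda> n)\<^sup>2 * ((v n)\<^sup>2 + P (c n))" for n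
      proof -
        have l: "0 \<le> \<Lambda> n" by (rule lam_nonneg)
        have "\<Lambda> n ^ 1 * ((1 + \<Lambda> n) * (uc y n)\<^sup>2 + \<Lambda> n * P (ec y n)) \<le> (1 + \<Lambda> n) * ((1 + \<Lambda> n) * (v n)\<^sup>2 + (1 + \<Lambda> n) * P (c n))"
          unfolding uy ey P0 using l P_nonneg by (intro mult_mono add_mono mult_right_mono) (auto intro!: add_nonneg_nonneg mult_nonneg_nonneg)
        moreover have "x * (x * p + x * q) = x\<^sup>2 * (p + q)" for x p q :: real
          by (simp add: power2_eq_square algebra_simps)
        ultimately show ?thesis by simp
      qed
      hence "(\<Sum>n<N. \<Lambda> n ^ 1 * ((1 + \<Lambda> n) * (uc y n)\<^sup>2 + \<Lambda> n * P (ec y n))) \<le> (\<Sum>n<N. (1 + \<Lambda> n)\<^sup>2 * ((v n)\<^sup>2 + P (c n)))"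
        by (rule sum_mono)
      thus ?thesis using le[of N] by linarith
    qed
    thus ?thesis using suminf_le_const[OF sums_summable[OF sm]] sums_unique[OF sm] by simp
  qed
  thus ?thesis using that[OF yH _ uy] Peq[OF sq_measurable] by (simp add: ey P0)
qed

lemma tendsto_\<Lambda>: "filterlim \<Lambda> at_top sequentially"
proof -
  have "filterlim (\<lambda>n. (pi / (b - a))\<^sup>2 * real n) at_top sequentially"
    using ab by (intro filterlim_tendsto_pos_mult_at_top[OF tendsto_const] filterlim_real_sequentially) auto
  thus ?thesis
  proof (rule filterlim_at_top_mono, intro always_eventually allI)
    fix n
    have "real n * 1 \<le> real (Suc n) * real (Suc n)" by (intro mult_mono) auto
    hence "(pi / (b - a))\<^sup>2 * real n \<le> (pi / (b - a))\<^sup>2 * (real (Suc n))\<^sup>2"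
      by (intro mult_left_mono) (auto simp: power2_eq_square)
    thus "(pi / (b - a))\<^sup>2 * real n \<le> \<Lambda> n"
      by (simp add: lam_def power_mult_distrib power_divide mult.commute)
  qed
qed

text \<open>Every single mode converges along a subsequence, by boundedness of the coefficients and
  equicontinuity of the recent memory. High modes are uniformly small because the influence of the
  initial data decays exponentially and the forcing gains a power of \<open>1 + \<Lambda> n\<close>.
  The radius of the smoother ball is fixed before the trajectories are chosen.\<close>

theorem asymptotic_compactness:
  assumes i2: "integrable lborel (\<lambda>s. ker \<mu> s * s\<^sup>2)"
  obtains K where "\<And>U t. (\<And>j. traj (U j)) \<Longrightarrow> (\<And>j r. 0 \<le> r \<Longrightarrow> Hnorm2 a b \<mu> 0 (U j r) \<le> R) \<Longrightarrow>
      (\<And>j. 0 \<le> t j) \<Longrightarrow> filterlim t at_top sequentially \<Longrightarrow>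
      \<exists>g y. strict_mono (g :: nat \<Rightarrow> nat) \<and> y \<in> Hsp a b \<mu> 1 \<and> Hnorm2 a b \<mu> 1 y \<le> K \<and>
        (\<lambda>j. Hdist a b \<mu> (U (g j) (t (g j))) y) \<longlonglongrightarrow> 0"
proof -
  obtain C \<nu> where C: "0 < C" "0 < \<nu>" and dec: "\<And>v w g T. mode v w g \<Longrightarrow> 0 \<le> T \<Longrightarrow>
       (v T)\<^sup>2 + P (w T) \<le> C * (exp (- \<nu> * T) * ((v 0)\<^sup>2 + P (w 0)) + integral {0..T} (\<lambda>r. exp (- \<nu> * (T - r)) * (g r)\<^sup>2))"
    using mode_decay by blast
  define F where "F = forcing_bound R / \<nu>"
  show ?thesis
  proof (rule that[of "C * F"])
    fix U :: "nat \<Rightarrow> real \<Rightarrow> state" and t :: "nat \<Rightarrow> real"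
    assume U: "\<And>j. traj (U j)" and R: "\<And>j r. 0 \<le> r \<Longrightarrow> Hnorm2 a b \<mu> 0 (U j r) \<le> R"
      and t: "\<And>j. 0 \<le> t j" and tlim: "filterlim t at_top sequentially"
    note R0 = R_nonneg[OF U R]
    define X where "X j = U j (t j)" for j
    have XH: "X j \<in> Hsp a b \<mu> 0" for j unfolding X_def by (rule traj_Hsp[OF U t])
    define I where "I j n = integral {0..t j} (\<lambda>r. exp (- \<nu> * (t j - r)) * (G (U j r) n)\<^sup>2)" for j n
    have EX: "E (X j) n \<le> C * (exp (- \<nu> * t j) * E (U j 0) n + I j n)" for j n
      unfolding E_def X_def I_def by (rule dec[OF traj_mode[OF U] t])
    have E0: "0 \<le> E z n" for z n unfolding E_def using P_nonneg by simp
    have I0: "0 \<le> I j n" for j n unfolding I_def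
      by (rule integral_nonneg)
         (auto intro!: integrable_continuous_real continuous_intros continuous_on_subset[OF curve_G_continuous[OF traj_curve[OF U]]])
    have Isum: "(\<Sum>n<N. (1 + \<Lambda> n)\<^sup>2 * I j n) \<le> F" for j N
      unfolding I_def F_def by (rule forcing_memory_sum[OF U R C(2) t])
    have E0sum: "(\<Sum>n<N. (1 + \<Lambda> n) * E (U j 0) n) \<le> om2 * R" for j N by (rule E_initial_sum[OF U R])
    define \<rho> where "\<rho> j = recent (U j) (t j)" for j
    have lip: "\<bar>\<rho> j n s - \<rho> j n r\<bar> \<le> sqrt R * \<bar>s - r\<bar>" for j n s r unfolding \<rho>_def by (rule recent_lipschitz[OF U R t])
    have \<rho>_le: "\<bar>\<rho> j n s\<bar> \<le> sqrt R * \<bar>s\<bar>" for j n s unfolding \<rho>_def by (rule recent_abs_le[OF U R t])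
    \<comment> \<open>One countable family for the diagonal extraction: \<open>None\<close> marks
      the coefficient of \<open>u\<close>, and \<open>Some q\<close> the recent memory at age
      \<open>q\<close>.\<close>
    define x :: "nat \<Rightarrow> nat \<times> rat option \<Rightarrow> real" where
      "x j i = (case snd i of None \<Rightarrow> uc (X j) (fst i) | Some q \<Rightarrow> \<rho> j (fst i) (of_rat q))" for j i
    have xb: "\<bar>x j i\<bar> \<le> (case snd i of None \<Rightarrow> sqrt R | Some q \<Rightarrow> sqrt R * \<bar>of_rat q\<bar>)" for j i
    proof (cases "snd i")
      case None
      thus ?thesis unfolding x_def X_def using uc_abs_le[OF U R t, of j j "fst i"] by simp
    next
      case (Some q)
      thus ?thesis unfolding x_def using \<rho>_le[of j "fst i" "of_rat q"] by simp
    qed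
    obtain g l where g: "strict_mono g" "\<And>i. (\<lambda>j. x (g j) i) \<longlonglongrightarrow> l i"
      using bounded_family_subsequence[of x, OF xb] by blast
    define v where "v n = l (n, None)" for n
    have vlim: "(\<lambda>j. uc (X (g j)) n) \<longlonglongrightarrow> v n" for n using g(2)[of "(n, None)"] by (simp add: x_def v_def)
    have tg: "filterlim (\<lambda>j. t (g j)) at_top sequentially" by (rule filterlim_compose[OF tlim filterlim_subseq[OF g(1)]])
    have conv: "convergent (\<lambda>j. \<rho> (g j) n s)" for n s
    proof (rule convergent_of_dense_lipschitz[of "\<lambda>j. \<rho> (g j) n" "sqrt R"])
      show "convergent (\<lambda>j. \<rho> (g j) n (of_rat q))" for q
        using g(2)[of "(n, Some q)"] by (auto simp: x_def convergent_def)
    qed (use lip R0 in auto)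
    define c where "c n s = lim (\<lambda>j. \<rho> (g j) n s)" for n s
    have clim: "(\<lambda>j. \<rho> (g j) n s) \<longlonglongrightarrow> c n s" for n s unfolding c_def using conv by (simp add: convergent_LIMSEQ_iff)
    have \<rho>m [measurable]: "\<rho> j n \<in> borel_measurable borel" for j n unfolding \<rho>_def by (rule recent_measurable[OF U R t])
    have cm [measurable]: "c n \<in> borel_measurable borel" for n
      by (rule borel_measurable_LIMSEQ_metric[OF \<rho>m]) (rule clim)
    have c_le: "\<bar>c n s\<bar> \<le> sqrt R * \<bar>s\<bar>" for n s
      by (rule LIMSEQ_le_const2[OF tendsto_rabs[OF clim]]) (use \<rho>_le in auto)
    have c0: "c n s = 0" if "s \<le> 0" for n s
      using clim[of n s] that recent_nonpos[OF U R] by (simp add: \<rho>_def LIMSEQ_const_iff)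
    have sqc: "sq (c n)" for n by (rule sq_of_linear_bound[OF i2 cm c_le])
    have sq\<rho>: "sq (\<rho> j n)" for j n by (rule sq_of_linear_bound[OF i2 \<rho>m \<rho>_le])
    \<comment> \<open>The recent memories and their limit grow at most linearly in \<open>s\<close>,
      so the kernel times \<open>s\<^sup>2\<close> dominates; this is the use of the second
      moment.\<close>
    have P\<rho>: "(\<lambda>j. P (\<lambda>s. \<rho> (g j) n s - c n s)) \<longlonglongrightarrow> 0" for n
    proof -
      have "(\<lambda>j. \<integral>s. ker \<mu> s * (\<rho> (g j) n s - c n s)\<^sup>2 \<partial>lborel) \<longlonglongrightarrow> (\<integral>s. 0 \<partial>(lborel :: real measure))"
      proof (rule integral_dominated_convergence[where w = "\<lambda>s. 4 * R * (ker \<mu> s * s\<^sup>2)"])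
        show "integrable lborel (\<lambda>s. 4 * R * (ker \<mu> s * s\<^sup>2))" using i2 by simp
        show "AE s in lborel. (\<lambda>j. ker \<mu> s * (\<rho> (g j) n s - c n s)\<^sup>2) \<longlonglongrightarrow> 0"
        proof (rule AE_I2)
          fix s
          have "(\<lambda>j. ker \<mu> s * (\<rho> (g j) n s - c n s)\<^sup>2) \<longlonglongrightarrow> ker \<mu> s * (c n s - c n s)\<^sup>2" by (intro tendsto_intros clim)
          thus "(\<lambda>j. ker \<mu> s * (\<rho> (g j) n s - c n s)\<^sup>2) \<longlonglongrightarrow> 0" by simp
        qed
        show "AE s in lborel. norm (ker \<mu> s * (\<rho> (g j) n s - c n s)\<^sup>2) \<le> 4 * R * (ker \<mu> s * s\<^sup>2)" for j
        proof (rule AE_I2)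
          fix s
          have "\<bar>\<rho> (g j) n s - c n s\<bar> \<le> 2 * sqrt R * \<bar>s\<bar>" using \<rho>_le[of "g j" n s] c_le[of n s] by linarith
          hence "\<bar>\<rho> (g j) n s - c n s\<bar>\<^sup>2 \<le> (2 * sqrt R * \<bar>s\<bar>)\<^sup>2" by (rule power_mono) simp
          hence "(\<rho> (g j) n s - c n s)\<^sup>2 \<le> 4 * R * s\<^sup>2" using R0 by (simp add: power_mult_distrib)
          hence "ker \<mu> s * (\<rho> (g j) n s - c n s)\<^sup>2 \<le> ker \<mu> s * (4 * R * s\<^sup>2)" using m_nonneg by (intro mult_left_mono)
          thus "norm (ker \<mu> s * (\<rho> (g j) n s - c n s)\<^sup>2) \<le> 4 * R * (ker \<mu> s * s\<^sup>2)"
            using m_nonneg by (simp add: abs_mult mult_ac)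
        qed
      qed measurable
      thus ?thesis by (simp add: P_def)
    qed
    \<comment> \<open>The full memory differs from the recent one by the inherited part, which
      disappears like \<open>1 / (1 + \<delta> * t)\<close>.\<close>
    have Pw: "(\<lambda>j. P (\<lambda>s. ec (X (g j)) n s - c n s)) \<longlonglongrightarrow> 0" for n
    proof (rule tendsto_sandwich[where f = "\<lambda>_. 0"])
      have "filterlim (\<lambda>j. \<delta> * t (g j)) at_top sequentially"
        by (rule filterlim_tendsto_pos_mult_at_top[OF tendsto_const \<delta>_pos tg])
      hence "filterlim (\<lambda>j. 1 + \<delta> * t (g j)) at_top sequentially"
        by (rule filterlim_tendsto_add_at_top[OF tendsto_const])
      hence "(\<lambda>j. inverse (1 + \<delta> * t (g j))) \<longlonglongrightarrow> 0" by (rule tendsto_inverse_0_at_top)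
      hence "(\<lambda>j. 2 * (R / \<Lambda> 0 * inverse (1 + \<delta> * t (g j))) + 2 * P (\<lambda>s. \<rho> (g j) n s - c n s)) \<longlonglongrightarrow> 2 * (R / \<Lambda> 0 * 0) + 2 * 0"
        by (intro tendsto_add tendsto_mult tendsto_const P\<rho>)
      thus "(\<lambda>j. 2 * (R / \<Lambda> 0 * inverse (1 + \<delta> * t (g j))) + 2 * P (\<lambda>s. \<rho> (g j) n s - c n s)) \<longlonglongrightarrow> 0" by simp
      show "\<forall>\<^sub>F j in sequentially. P (\<lambda>s. ec (X (g j)) n s - c n s) \<le> 2 * (R / \<Lambda> 0 * inverse (1 + \<delta> * t (g j))) + 2 * P (\<lambda>s. \<rho> (g j) n s - c n s)"
      proof (intro always_eventually allI)
        fix j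
        have "P (\<lambda>s. (ec (X (g j)) n s - \<rho> (g j) n s) + (\<rho> (g j) n s - c n s)) \<le> (1 + 1) * P (\<lambda>s. ec (X (g j)) n s - \<rho> (g j) n s) + (1 + 1 / 1) * P (\<lambda>s. \<rho> (g j) n s - c n s)"
          by (rule P_young) (auto intro!: sq_diff Hsp_sq[OF XH] sq\<rho> sqc)
        hence "P (\<lambda>s. ec (X (g j)) n s - c n s) \<le> 2 * P (\<lambda>s. ec (X (g j)) n s - \<rho> (g j) n s) + 2 * P (\<lambda>s. \<rho> (g j) n s - c n s)" by simp
        moreover have "P (\<lambda>s. ec (X (g j)) n s - \<rho> (g j) n s) \<le> R / \<Lambda> 0 * inverse (1 + \<delta> * t (g j))"
        proof -
          have "0 < 1 + \<delta> * t (g j)" using \<delta>_pos t[of "g j"] by (simp add: add_pos_nonneg)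
          hence "P (\<lambda>s. ec (X (g j)) n s - \<rho> (g j) n s) \<le> (R / \<Lambda> 0) / (1 + \<delta> * t (g j))"
            using P_ec_minus_recent[OF U R i2 t, of "g j" "g j" n] unfolding X_def \<rho>_def
            by (subst pos_le_divide_eq) (simp_all only: mult.commute)
          thus ?thesis by (simp only: divide_inverse)
        qed
        ultimately show "P (\<lambda>s. ec (X (g j)) n s - c n s) \<le> 2 * (R / \<Lambda> 0 * inverse (1 + \<delta> * t (g j))) + 2 * P (\<lambda>s. \<rho> (g j) n s - c n s)"
          by linarith
      qed
    qed (use P_nonneg in auto)
    have PwP: "(\<lambda>j. P (ec (X (g j)) n)) \<longlonglongrightarrow> P (c n)" for n
    proof -
      have z: "(\<lambda>j. sqrt (P (\<lambda>s. ec (X (g j)) n s - c n s))) \<longlonglongrightarrow> 0" using tendsto_real_sqrt[OF Pw[of n]] by simp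
      have "(\<lambda>j. sqrt (P (ec (X (g j)) n)) - sqrt (P (c n))) \<longlonglongrightarrow> 0"
      proof (rule Lim_null_comparison[OF _ z], intro always_eventually allI)
        fix j
        show "norm (sqrt (P (ec (X (g j)) n)) - sqrt (P (c n))) \<le> sqrt (P (\<lambda>s. ec (X (g j)) n s - c n s))"
          using sqrt_P_triangle[OF Hsp_sq[OF XH] sqc, of "g j" n n] sqrt_P_triangle[OF sqc Hsp_sq[OF XH], of n "g j" n]
          unfolding P_uminus[of "c n" "ec (X (g j)) n"] real_norm_def abs_le_iff by linarith
      qed
      hence "(\<lambda>j. sqrt (P (ec (X (g j)) n))) \<longlonglongrightarrow> sqrt (P (c n))" by (simp add: LIM_zero_iff)
      from tendsto_power[OF this, of 2] show ?thesis using P_nonneg by simp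
    qed
    have explim: "(\<lambda>j. exp (- \<nu> * t (g j))) \<longlonglongrightarrow> 0"
    proof -
      have "filterlim (\<lambda>j. \<nu> * t (g j)) at_top sequentially"
        by (rule filterlim_tendsto_pos_mult_at_top[OF tendsto_const C(2) tg])
      hence "filterlim (\<lambda>j. - (\<nu> * t (g j))) at_bot sequentially" by (simp add: filterlim_uminus_at_top)
      from filterlim_compose[OF exp_at_bot this] show ?thesis by simp
    qed
    \<comment> \<open>With \<open>N\<close> fixed, one factor \<open>1 + \<Lambda> n\<close> of the
      weight on the initial energy is replaced by \<open>1 + \<Lambda> N\<close> and then killed by
      the exponential. Only the forcing remains, and its bound does not depend on
      \<open>N\<close>.\<close>
    have lim_sum: "(\<Sum>n<N. (1 + \<Lambda> n)\<^sup>2 * ((v n)\<^sup>2 + P (c n))) \<le> C * F" for N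
    proof -
      have "(\<lambda>j. \<Sum>n<N. (1 + \<Lambda> n)\<^sup>2 * E (X (g j)) n) \<longlonglongrightarrow> (\<Sum>n<N. (1 + \<Lambda> n)\<^sup>2 * ((v n)\<^sup>2 + P (c n)))"
        unfolding E_def by (intro tendsto_intros vlim PwP)
      moreover have "(\<lambda>j. C * (exp (- \<nu> * t (g j)) * ((1 + \<Lambda> N) * (om2 * R)) + F)) \<longlonglongrightarrow> C * (0 * ((1 + \<Lambda> N) * (om2 * R)) + F)"
        by (intro tendsto_intros explim)
      moreover have "(\<Sum>n<N. (1 + \<Lambda> n)\<^sup>2 * E (X j) n) \<le> C * (exp (- \<nu> * t j) * ((1 + \<Lambda> N) * (om2 * R)) + F)" for j
      proof -
        have "(1 + \<Lambda> n)\<^sup>2 * E (X j) n \<le> C * (exp (- \<nu> * t j) * ((1 + \<Lambda> N) * ((1 + \<Lambda> n) * E (U j 0) n)) + (1 + \<Lambda> n)\<^sup>2 * I j n)" if "n < N" for n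
        proof -
          have "(1 + \<Lambda> n)\<^sup>2 * E (X j) n \<le> (1 + \<Lambda> n)\<^sup>2 * (C * (exp (- \<nu> * t j) * E (U j 0) n + I j n))"
            by (intro mult_left_mono EX) simp
          also have "\<dots> = C * (exp (- \<nu> * t j) * ((1 + \<Lambda> n)\<^sup>2 * E (U j 0) n) + (1 + \<Lambda> n)\<^sup>2 * I j n)" by (simp add: algebra_simps)
          also have "(1 + \<Lambda> n)\<^sup>2 * E (U j 0) n \<le> (1 + \<Lambda> N) * ((1 + \<Lambda> n) * E (U j 0) n)"
            unfolding power2_eq_square mult.assoc using lam_mono[of "Suc n" "Suc N"] that E0 lam_nonneg[of "Suc n"]
            by (intro mult_right_mono) auto
          finally show ?thesis using C by (simp add: mult_left_mono)
        qed
        hence "(\<Sum>n<N. (1 + \<Lambda> n)\<^sup>2 * E (X j) n) \<le> (\<Sum>n<N. C * (exp (- \<nu> * t j) * ((1 + \<Lambda> N) * ((1 + \<Lambda> n) * E (U j 0) n)) + (1 + \<Lambda> n)\<^sup>2 * I j n))"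
          by (intro sum_mono) auto
        also have "\<dots> = C * (exp (- \<nu> * t j) * ((1 + \<Lambda> N) * (\<Sum>n<N. (1 + \<Lambda> n) * E (U j 0) n)) + (\<Sum>n<N. (1 + \<Lambda> n)\<^sup>2 * I j n))"
          by (simp only: sum_distrib_left sum.distrib distrib_left)
        also have "\<dots> \<le> C * (exp (- \<nu> * t j) * ((1 + \<Lambda> N) * (om2 * R)) + F)"
          using C lam_nonneg[of "Suc N"] by (intro mult_left_mono add_mono E0sum Isum) auto
        finally show ?thesis .
      qed
      ultimately have "(\<Sum>n<N. (1 + \<Lambda> n)\<^sup>2 * ((v n)\<^sup>2 + P (c n))) \<le> C * (0 * ((1 + \<Lambda> N) * (om2 * R)) + F)"
        by (intro LIMSEQ_le) auto
      thus ?thesis by simp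
    qed
    obtain y where y: "y \<in> Hsp a b \<mu> 1" "Hnorm2 a b \<mu> 1 y \<le> C * F" "\<And>n. uc y n = v n"
      "\<And>n x. sq x \<Longrightarrow> P (\<lambda>s. x s - ec y n s) = P (\<lambda>s. x s - c n s)" "\<And>n. P (ec y n) = P (c n)"
      using state_of_modes[OF sqc c0 lim_sum] by blast
    have yH: "y \<in> Hsp a b \<mu> 0" by (rule Hsp_1_subset[OF y(1)])
    have ddlim: "(\<lambda>j. dd (X (g j)) y n) \<longlonglongrightarrow> 0" for n
    proof -
      have "(\<lambda>j. (1 + \<Lambda> n) * (uc (X (g j)) n - v n)\<^sup>2 + \<Lambda> n * P (\<lambda>s. ec (X (g j)) n s - c n s)) \<longlonglongrightarrow> (1 + \<Lambda> n) * (v n - v n)\<^sup>2 + \<Lambda> n * 0"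
        by (intro tendsto_intros vlim Pw)
      thus ?thesis by (simp add: dd_def y(3) y(4)[OF Hsp_sq[OF XH]])
    qed
    \<comment> \<open>Modes below \<open>N\<close> are kept as they are. For the others one factor
      \<open>1 + \<Lambda> n\<close> is traded for \<open>1 / (1 + \<Lambda> N)\<close> times the
      squared weight; the orbit and the limit contribute \<open>2 * C * F\<close> each.\<close>
    have bound: "D2 (X j) y \<le> (\<Sum>n<N. dd (X j) y n) + 2 * C * exp (- \<nu> * t j) * (om2 * R) + 4 * C * F / (1 + \<Lambda> N)" for j N
    proof -
      have lN: "0 < 1 + \<Lambda> N" using lam_nonneg[of "Suc N"] by linarith
      define h where "h n = (if n < N then dd (X j) y n else 0)" for n
      have summand: "dd (X j) y n \<le> h n + 2 * C * exp (- \<nu> * t j) * ((1 + \<Lambda> n) * E (U j 0) n)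
          + 1 / (1 + \<Lambda> N) * (2 * C * ((1 + \<Lambda> n)\<^sup>2 * I j n) + 2 * ((1 + \<Lambda> n)\<^sup>2 * ((v n)\<^sup>2 + P (c n))))" for n
      proof (cases "n < N")
        case True
        have "0 \<le> 2 * C * exp (- \<nu> * t j) * ((1 + \<Lambda> n) * E (U j 0) n)" "0 \<le> 1 / (1 + \<Lambda> N) * (2 * C * ((1 + \<Lambda> n)\<^sup>2 * I j n) + 2 * ((1 + \<Lambda> n)\<^sup>2 * ((v n)\<^sup>2 + P (c n))))"
          using C E0[of "U j 0" n] I0[of j n] lN P_nonneg[of "c n"] lam_nonneg[of "Suc n"] by auto
        thus ?thesis using True unfolding h_def by simp
      next
        case False
        have l: "0 \<le> \<Lambda> n" by (rule lam_nonneg)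
        have "dd (X j) y n \<le> (1 + \<Lambda> n) * ((uc (X j) n - v n)\<^sup>2 + P (\<lambda>s. ec (X j) n s - c n s))"
          unfolding dd_def y(3) y(4)[OF Hsp_sq[OF XH]] distrib_left using l P_nonneg by (intro add_mono mult_right_mono) auto
        also have "\<dots> \<le> (1 + \<Lambda> n) * (2 * E (X j) n + 2 * ((v n)\<^sup>2 + P (c n)))"
        proof (rule mult_left_mono)
          have "(uc (X j) n - v n)\<^sup>2 \<le> 2 * (uc (X j) n)\<^sup>2 + 2 * (v n)\<^sup>2" using square_add_young[of 1 "uc (X j) n" "- v n"] by simp
          thus "(uc (X j) n - v n)\<^sup>2 + P (\<lambda>s. ec (X j) n s - c n s) \<le> 2 * E (X j) n + 2 * ((v n)\<^sup>2 + P (c n))"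
            using P_diff_le[OF Hsp_sq[OF XH] sqc, of j n n] unfolding E_def by simp
        qed (use l in simp)
        also have "\<dots> \<le> (1 + \<Lambda> n) * (2 * (C * (exp (- \<nu> * t j) * E (U j 0) n + I j n)) + 2 * ((v n)\<^sup>2 + P (c n)))"
          using l by (intro mult_left_mono add_mono EX) auto
        also have "\<dots> = 2 * C * exp (- \<nu> * t j) * ((1 + \<Lambda> n) * E (U j 0) n) + (1 + \<Lambda> n) * (2 * C * I j n + 2 * ((v n)\<^sup>2 + P (c n)))"
          by (simp add: algebra_simps)
        also have "(1 + \<Lambda> n) * (2 * C * I j n + 2 * ((v n)\<^sup>2 + P (c n))) \<le> 1 / (1 + \<Lambda> N) * (1 + \<Lambda> n)\<^sup>2 * (2 * C * I j n + 2 * ((v n)\<^sup>2 + P (c n)))"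
        proof (rule mult_right_mono)
          have "\<Lambda> N \<le> \<Lambda> n" using False by (intro lam_mono) simp
          hence "(1 + \<Lambda> n) * (1 + \<Lambda> N) \<le> (1 + \<Lambda> n) * (1 + \<Lambda> n)" using l by (intro mult_left_mono) auto
          thus "1 + \<Lambda> n \<le> 1 / (1 + \<Lambda> N) * (1 + \<Lambda> n)\<^sup>2" using lN by (simp add: power2_eq_square pos_le_divide_eq)
          show "0 \<le> 2 * C * I j n + 2 * ((v n)\<^sup>2 + P (c n))" using C I0[of j n] P_nonneg[of "c n"] by simp
        qed
        also have "1 / (1 + \<Lambda> N) * (1 + \<Lambda> n)\<^sup>2 * (2 * C * I j n + 2 * ((v n)\<^sup>2 + P (c n))) = 1 / (1 + \<Lambda> N) * (2 * C * ((1 + \<Lambda> n)\<^sup>2 * I j n) + 2 * ((1 + \<Lambda> n)\<^sup>2 * ((v n)\<^sup>2 + P (c n))))"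
          by (simp only: distrib_left mult_ac)
        finally show ?thesis using False by (simp add: h_def)
      qed
      have "(\<Sum>n<N'. dd (X j) y n) \<le> (\<Sum>n<N. dd (X j) y n) + 2 * C * exp (- \<nu> * t j) * (om2 * R) + 4 * C * F / (1 + \<Lambda> N)" for N'
      proof -
        have "(\<Sum>n<N'. dd (X j) y n) \<le> (\<Sum>n<N'. h n + 2 * C * exp (- \<nu> * t j) * ((1 + \<Lambda> n) * E (U j 0) n)
          + 1 / (1 + \<Lambda> N) * (2 * C * ((1 + \<Lambda> n)\<^sup>2 * I j n) + 2 * ((1 + \<Lambda> n)\<^sup>2 * ((v n)\<^sup>2 + P (c n)))))"
          by (rule sum_mono) (rule summand)
        also have "\<dots> = (\<Sum>n<N'. h n) + 2 * C * exp (- \<nu> * t j) * (\<Sum>n<N'. (1 + \<Lambda> n) * E (U j 0) n)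
          + 1 / (1 + \<Lambda> N) * (2 * C * (\<Sum>n<N'. (1 + \<Lambda> n)\<^sup>2 * I j n) + 2 * (\<Sum>n<N'. (1 + \<Lambda> n)\<^sup>2 * ((v n)\<^sup>2 + P (c n))))"
          by (simp only: sum.distrib sum_distrib_left distrib_left)
        also have "\<dots> \<le> (\<Sum>n<N. dd (X j) y n) + 2 * C * exp (- \<nu> * t j) * (om2 * R) + 1 / (1 + \<Lambda> N) * (2 * C * F + 2 * (C * F))"
        proof (intro add_mono mult_left_mono E0sum Isum lim_sum)
          have "(\<Sum>n<N'. h n) = (\<Sum>n\<in>{..<N'} \<inter> {..<N}. dd (X j) y n)"
            unfolding sum.inter_restrict[OF finite_lessThan] by (simp add: h_def)
          also have "\<dots> \<le> (\<Sum>n<N. dd (X j) y n)" by (rule sum_mono2) (auto simp: dd_nonneg)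
          finally show "(\<Sum>n<N'. h n) \<le> (\<Sum>n<N. dd (X j) y n)" .
        qed (use C lN in auto)
        finally show ?thesis using lN by (simp add: field_simps)
      qed
      thus ?thesis using D2_sums[OF XH yH, of j] by (auto simp: sums_def intro: LIMSEQ_le_const2)
    qed
    have "(\<lambda>j. D2 (X (g j)) y) \<longlonglongrightarrow> 0"
    proof (rule LIMSEQ_I)
      fix e :: real assume e: "0 < e"
      \<comment> \<open>The cutoff \<open>N\<close> is fixed by the tail alone, before the index
        \<open>j\<close> is taken large for the finitely many low modes and the exponential.\<close>
      have "(\<lambda>N. 4 * C * F * inverse (1 + \<Lambda> N)) \<longlonglongrightarrow> 4 * C * F * 0"
        by (intro tendsto_mult tendsto_const tendsto_inverse_0_at_top filterlim_tendsto_add_at_top[OF tendsto_const tendsto_\<Lambda>])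
      hence "\<forall>\<^sub>F N in sequentially. 4 * C * F * inverse (1 + \<Lambda> N) < e / 2" using e by (intro order_tendstoD(2)) auto
      then obtain N where N: "4 * C * F * inverse (1 + \<Lambda> N) < e / 2" by (auto simp: eventually_sequentially)
      have "(\<lambda>j. (\<Sum>n<N. dd (X (g j)) y n) + 2 * C * exp (- \<nu> * t (g j)) * (om2 * R)) \<longlonglongrightarrow> (\<Sum>n<N. 0) + 2 * C * 0 * (om2 * R)"
        by (intro tendsto_intros ddlim explim)
      hence "\<forall>\<^sub>F j in sequentially. (\<Sum>n<N. dd (X (g j)) y n) + 2 * C * exp (- \<nu> * t (g j)) * (om2 * R) < e / 2"
        using e by (intro order_tendstoD(2)) auto
      then obtain J where J: "\<And>j. J \<le> j \<Longrightarrow> (\<Sum>n<N. dd (X (g j)) y n) + 2 * C * exp (- \<nu> * t (g j)) * (om2 * R) < e / 2"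
        by (auto simp: eventually_sequentially)
      have "norm (D2 (X (g j)) y - 0) < e" if "J \<le> j" for j
      proof -
        have "D2 (X (g j)) y \<le> ((\<Sum>n<N. dd (X (g j)) y n) + 2 * C * exp (- \<nu> * t (g j)) * (om2 * R)) + 4 * C * F * inverse (1 + \<Lambda> N)"
          using bound[of "g j" N] unfolding divide_inverse .
        also have "\<dots> < e / 2 + e / 2" by (rule add_strict_mono[OF J[OF that] N])
        finally show ?thesis using D2_nonneg[OF XH yH, of "g j"] by simp
      qed
      thus "\<exists>J. \<forall>j\<ge>J. norm (D2 (X (g j)) y - 0) < e" by blast
    qed
    from tendsto_real_sqrt[OF this] have "(\<lambda>j. Hdist a b \<mu> (U (g j) (t (g j))) y) \<longlonglongrightarrow> 0"
      by (simp add: Hdist_D2 X_def)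
    thus "\<exists>g y. strict_mono (g :: nat \<Rightarrow> nat) \<and> y \<in> Hsp a b \<mu> 1 \<and> Hnorm2 a b \<mu> 1 y \<le> C * F \<and>
        (\<lambda>j. Hdist a b \<mu> (U (g j) (t (g j))) y) \<longlonglongrightarrow> 0"
      using g(1) y(1,2) by blast
  qed
qed

end

section \<open>The global attractor\<close>

theorem theorem10p1:
  fixes a b :: real and \<mu> f :: "real \<Rightarrow> real" and S :: "real \<Rightarrow> state \<Rightarrow> state"
    and c1 c2 c3 \<epsilon>0 \<epsilon> :: real
  assumes ab: "a < b"
    and f: "f \<in> L2 a b"
    and mu: "kernel_ok \<mu>"
    and S: "\<forall>z \<in> Hsp a b \<mu> 0. is_sol a b \<mu> f z (\<lambda>t. S t z)"
    and c: "c1 > 0" "c2 > 0" "c3 > 0"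
    and eps0: "0 < \<epsilon>0" "\<epsilon>0 < 1 / (2 * sqrt ((1 + lam a b 1) / lam a b 1))"
    and ineq: "\<forall>z \<in> Hsp a b \<mu> 0. \<forall>\<epsilon>'. 0 < \<epsilon>' \<and> \<epsilon>' \<le> \<epsilon>0 \<longrightarrow> (\<forall>t\<ge>0. \<exists>D.
        ((\<lambda>\<tau>. Lam a b \<mu> f \<epsilon>' (S \<tau> z)) has_real_derivative D) (at t within {0..}) \<and>
        D + \<epsilon>' * c1 * Lam a b \<mu> f \<epsilon>' (S t z)
          \<le> c2 * (normF a b f)\<^sup>2 + c3 * \<epsilon>'\<^sup>2 * (Lam a b \<mu> f \<epsilon>' (S t z))\<^sup>2)"
    and small: "normF a b f < c1 / (2 * sqrt (c2 * c3))"
    and eps: "0 < \<epsilon>" "\<epsilon> \<le> \<epsilon>0"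
  shows "let cstar = sqrt (c2 / c3) * (c1 / sqrt (c2 * c3) - normF a b f);
             D = {z \<in> Hsp a b \<mu> 0. Lam a b \<mu> f \<epsilon> z \<le> cstar / \<epsilon>}
         in \<exists>A K. global_attractor a b \<mu> S D A \<and>
                  Hcompact a b \<mu> K \<and> Hbounded a b \<mu> 1 K \<and> A \<subseteq> K"
proof -
  obtain \<delta> L where "memory_kernel (ker \<mu>) \<delta> L" using kernel_ok_memory_kernel[OF mu] .
  then interpret memory_kernel "ker \<mu>" \<delta> L .
  interpret bbm a b \<mu> \<delta> L f by unfold_locales (use ab f in auto)
  define Fn where "Fn = normF a b f"
  define cstar where "cstar = sqrt (c2 / c3) * (c1 / sqrt (c2 * c3) - Fn)"
  define D where "D = {z \<in> Hsp a b \<mu> 0. Lam a b \<mu> f \<epsilon> z \<le> cstar / \<epsilon>}"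
  have DH: "z \<in> Hsp a b \<mu> 0" if "z \<in> D" for z using that by (simp add: D_def)
  \<comment> \<open>At time zero the solution reproduces only the Fourier coefficients of its datum,
    so \<open>S 0 z\<close> is known to be at distance zero from \<open>z\<close> and need not equal
    it.\<close>
  have trS: "traj (\<lambda>t. S t z)" and S0: "D2 (S 0 z) z = 0" if z: "z \<in> Hsp a b \<mu> 0" for z
  proof -
    note sol = is_sol_traj[OF S[rule_format, OF z]]
    show "traj (\<lambda>t. S t z)" by (rule sol(1))
    hence "S 0 z \<in> Hsp a b \<mu> 0" by (rule traj_Hsp) simp
    moreover have "dd (S 0 z) z = (\<lambda>_. 0)" using sol(2,3) by (auto simp: dd_def P_def fun_eq_iff)
    ultimately show "D2 (S 0 z) z = 0" using D2_sums[of "S 0 z" z] z sums_unique2 sums_zero by metis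
  qed
  have SH: "S t z \<in> Hsp a b \<mu> 0" if "z \<in> Hsp a b \<mu> 0" "0 \<le> t" for t z
    using traj_Hsp[OF trS[OF that(1)] that(2)] .
  have Lam_cong: "Lam a b \<mu> f \<epsilon> z = Lam a b \<mu> f \<epsilon> w" if "z \<in> Hsp a b \<mu> 0" "w \<in> Hsp a b \<mu> 0" "D2 z w = 0" for z w
  proof -
    have "(\<lambda>j::nat. Lam a b \<mu> f \<epsilon> z) \<longlonglongrightarrow> Lam a b \<mu> f \<epsilon> w"
      by (rule Lam_tendsto[of "\<lambda>_. z" w]) (use that in \<open>auto simp: Hdist_D2\<close>)
    thus ?thesis by (simp add: LIMSEQ_const_iff)
  qed
  have eps': "\<epsilon> < 1 / (2 * sqrt om2)"
  proof -
    have "(1 + lam a b 1) / lam a b 1 = om2" using \<Lambda>_pos[of 0] by (simp add: om2_def add_divide_distrib)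
    thus ?thesis using eps eps0 by simp
  qed
  have inv: "S t z \<in> D" if t: "0 \<le> t" and z: "z \<in> D" for t z
  proof -
    have zH: "z \<in> Hsp a b \<mu> 0" and zL: "Lam a b \<mu> f \<epsilon> z \<le> cstar / \<epsilon>" using z by (auto simp: D_def)
    define B where "B = cstar / \<epsilon>"
    \<comment> \<open>The assumed differential inequality says that the energy functional has
      derivative at most \<open>p\<close> of its value.\<close>
    define p where "p y = c2 * Fn\<^sup>2 + c3 * \<epsilon>\<^sup>2 * y\<^sup>2 - \<epsilon> * c1 * y" for y
    have "Lam a b \<mu> f \<epsilon> (S t z) \<le> B"
    proof (rule barrier_comparison[where p = p and q = "\<lambda>y. c3 * \<epsilon>\<^sup>2 * (y + B) - \<epsilon> * c1" and Y = "\<lambda>t. Lam a b \<mu> f \<epsilon> (S t z)"])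
      fix r :: real assume "0 \<le> r"
      from ineq[rule_format, OF zH conjI[OF eps] this]
      show "\<exists>D. ((\<lambda>t. Lam a b \<mu> f \<epsilon> (S t z)) has_real_derivative D) (at r within {0..}) \<and> D \<le> p (Lam a b \<mu> f \<epsilon> (S r z))"
        unfolding p_def Fn_def by (elim exE) (rule exI, auto simp: algebra_simps)
    next
      fix y
      have s: "0 < sqrt c2" "0 < sqrt c3" "(sqrt c2)\<^sup>2 = c2" "(sqrt c3)\<^sup>2 = c3" using c by auto
      have cs: "sqrt c3 * (sqrt c3 * cstar) = c1 - sqrt c2 * sqrt c3 * Fn"
        using s by (simp add: cstar_def real_sqrt_mult real_sqrt_divide field_simps power2_eq_square)
      have F0: "0 \<le> Fn" by (simp add: Fn_def normF_def set_lebesgue_integral_def)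
      have Fs: "2 * (sqrt c2 * sqrt c3) * Fn \<le> c1"
        using small s unfolding Fn_def real_sqrt_mult by (simp add: field_simps)
      have "p B = c2 * Fn\<^sup>2 + c3 * cstar\<^sup>2 - c1 * cstar"
        using eps by (simp add: p_def B_def power_divide)
      also have "\<dots> = c2 * Fn\<^sup>2 - cstar * (c1 - sqrt c3 * (sqrt c3 * cstar))"
        using s(4) by (simp add: algebra_simps power2_eq_square)
      also have "\<dots> = c2 * Fn\<^sup>2 - cstar * (sqrt c2 * sqrt c3 * Fn)" unfolding cs by simp
      finally have pB: "p B = c2 * Fn\<^sup>2 - cstar * (sqrt c2 * sqrt c3 * Fn)" .
      \<comment> \<open>At the barrier \<open>B = cstar / \<epsilon>\<close> the powers of
        \<open>\<epsilon>\<close> cancel. The resulting factor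
        \<open>2 * (sqrt c2 * sqrt c3) * Fn - c1\<close> is nonpositive precisely by the smallness
        of \<open>f\<close>, so the barrier is not crossed upwards.\<close>
      have "sqrt c3 * p B = sqrt c3 * (c2 * Fn\<^sup>2) - sqrt c2 * Fn * (sqrt c3 * (sqrt c3 * cstar))"
        unfolding pB by (simp only: right_diff_distrib mult_ac)
      also have "\<dots> = sqrt c2 * Fn * (2 * (sqrt c2 * sqrt c3) * Fn - c1)"
        unfolding cs using s(3) by (simp add: algebra_simps power2_eq_square)
      also have "\<dots> \<le> 0" using s F0 Fs by (intro mult_nonneg_nonpos) auto
      finally have "p B \<le> 0" using s(2) by (simp add: mult_le_0_iff)
      \<comment> \<open>A quadratic difference contains the factor \<open>y - B\<close>, which gives
        the form required by the barrier comparison.\<close>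
      moreover have "p y - p B = (y - B) * (c3 * \<epsilon>\<^sup>2 * (y + B) - \<epsilon> * c1)"
        by (simp add: p_def power2_eq_square algebra_simps)
      ultimately show "p y \<le> (y - B) * (c3 * \<epsilon>\<^sup>2 * (y + B) - \<epsilon> * c1)" by linarith
    next
      show "continuous_on UNIV (\<lambda>y. c3 * \<epsilon>\<^sup>2 * (y + B) - \<epsilon> * c1)" by (intro continuous_intros)
      show "Lam a b \<mu> f \<epsilon> (S 0 z) \<le> B" using zL Lam_cong[OF SH[OF zH] zH S0[OF zH]] by (simp add: B_def)
    qed (rule t)
    thus ?thesis using SH[OF zH t] by (simp add: D_def B_def)
  qed
  \<comment> \<open>Coercivity turns the sublevel bound into this bound on the squared norm, valid
    along whole orbits because the sublevel set is invariant.\<close>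
  define R where "R = 2 * (cstar / \<epsilon>) + 8 * cf / mass"
  have DR: "Hnorm2 a b \<mu> 0 z \<le> R" if "z \<in> D" for z
    using Lam_coercive[OF _ eps(1) eps', of z] that by (auto simp: D_def R_def)
  have closed: "y \<in> D" if "\<And>j::nat. z j \<in> D" "y \<in> Hsp a b \<mu> 0" "(\<lambda>j. Hdist a b \<mu> (z j) y) \<longlonglongrightarrow> 0" for z y
  proof -
    have "(\<lambda>j. Lam a b \<mu> f \<epsilon> (z j)) \<longlonglongrightarrow> Lam a b \<mu> f \<epsilon> y"
      by (rule Lam_tendsto[OF _ that(2,3)]) (use that(1) in \<open>auto simp: D_def\<close>)
    hence "Lam a b \<mu> f \<epsilon> y \<le> cstar / \<epsilon>" by (rule LIMSEQ_le_const2) (use that(1) in \<open>auto simp: D_def\<close>)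
    thus ?thesis using that(2) by (simp add: D_def)
  qed
  have "integrable lborel (\<lambda>s. s * ker \<mu> s)"
    using mu by (simp add: kernel_ok_def set_integrable_def ker_def mult.left_commute)
  note i2 = second_moment_integrable[OF this]
  show ?thesis
  proof (rule asymptotic_compactness[OF i2, where R = R])
    fix K1 assume K1: "\<And>U t. (\<And>j. traj (U j)) \<Longrightarrow> (\<And>j r. 0 \<le> r \<Longrightarrow> Hnorm2 a b \<mu> 0 (U j r) \<le> R) \<Longrightarrow>
        (\<And>j. 0 \<le> t j) \<Longrightarrow> filterlim t at_top sequentially \<Longrightarrow>
        \<exists>g y. strict_mono (g :: nat \<Rightarrow> nat) \<and> y \<in> Hsp a b \<mu> 1 \<and> Hnorm2 a b \<mu> 1 y \<le> K1 \<and>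
          (\<lambda>j. Hdist a b \<mu> (U (g j) (t (g j))) y) \<longlonglongrightarrow> 0"
    define N where "N = {y \<in> Hsp a b \<mu> 1. Hnorm2 a b \<mu> 1 y \<le> K1}"
    have trD: "traj (\<lambda>t. S t z)" and RD: "\<And>t. 0 \<le> t \<Longrightarrow> Hnorm2 a b \<mu> 0 (S t z) \<le> R" if "z \<in> D" for z
      using trS[OF DH[OF that]] DR[OF inv[OF _ that]] by simp_all
    \<comment> \<open>A point of the sublevel set is required only to know that \<open>R\<close> is
      nonnegative; the constant does not depend on it.\<close>
    have dep: "\<exists>K. 0 < K \<and> (\<forall>U V T. traj U \<and> traj V \<and> (\<forall>t\<ge>0. Hnorm2 a b \<mu> 0 (U t) \<le> R) \<and> (\<forall>t\<ge>0. Hnorm2 a b \<mu> 0 (V t) \<le> R) \<and> 0 \<le> T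
        \<longrightarrow> D2 (U T) (V T) \<le> K * D2 (U 0) (V 0) * exp (K * T))" if "z0 \<in> D" for z0
    proof -
      have "0 \<le> R" using DR[OF that] Hnorm2_nonneg[OF DH[OF that]] by simp
      from continuous_dependence[OF this] show ?thesis by metis
    qed
    show ?thesis
    proof (rule pseudo_metric_attractor[where d = "Hdist a b \<mu>" and S = S and X = "Hsp a b \<mu> 0" and D = D and N = N])
      fix s t :: real and z assume st: "0 \<le> s" "0 \<le> t" and z: "z \<in> D"
      obtain K where K: "\<forall>U V T. traj U \<and> traj V \<and> (\<forall>t\<ge>0. Hnorm2 a b \<mu> 0 (U t) \<le> R) \<and> (\<forall>t\<ge>0. Hnorm2 a b \<mu> 0 (V t) \<le> R) \<and> 0 \<le> T
        \<longrightarrow> D2 (U T) (V T) \<le> K * D2 (U 0) (V 0) * exp (K * T)" using dep[OF z] by blast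
      have zs: "S s z \<in> D" by (rule inv[OF st(1) z])
      \<comment> \<open>Both sides are trajectories issuing, up to distance zero, from
        \<open>S s z\<close>: one is a time shift of the orbit of \<open>z\<close>, the other a new
        orbit. Continuous dependence keeps them at distance zero.\<close>
      have "D2 (S (t + s) z) (S t (S s z)) \<le> K * D2 (S (0 + s) z) (S 0 (S s z)) * exp (K * t)"
        using K[rule_format, of "\<lambda>r. S (r + s) z" "\<lambda>r. S r (S s z)" t] traj_shift[OF trD[OF z] st(1)] trD[OF zs] RD[OF z] RD[OF zs] st by simp
      also have "D2 (S (0 + s) z) (S 0 (S s z)) = D2 (S 0 (S s z)) (S s z)"
        using D2_sym[OF DH[OF zs] DH[OF inv[OF _ zs, of 0]]] by simp
      also have "\<dots> = 0" by (rule S0[OF DH[OF zs]])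
      finally have "D2 (S (t + s) z) (S t (S s z)) = 0"
        using D2_nonneg[OF DH[OF inv[OF _ z, of "t + s"]] DH[OF inv[OF st(2) zs]]] st by simp
      thus "Hdist a b \<mu> (S (t + s) z) (S t (S s z)) = 0" by (simp add: Hdist_D2)
    next
      fix t :: real and z :: "nat \<Rightarrow> state" and w
      assume t: "0 \<le> t" and z: "\<And>n. z n \<in> D" and w: "w \<in> D" and lim: "(\<lambda>n. Hdist a b \<mu> (z n) w) \<longlonglongrightarrow> 0"
      have zH: "z n \<in> Hsp a b \<mu> 0" and wH: "w \<in> Hsp a b \<mu> 0" for n using DH[OF z] DH[OF w] .
      obtain K where K: "\<forall>U V T. traj U \<and> traj V \<and> (\<forall>t\<ge>0. Hnorm2 a b \<mu> 0 (U t) \<le> R) \<and> (\<forall>t\<ge>0. Hnorm2 a b \<mu> 0 (V t) \<le> R) \<and> 0 \<le> T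
        \<longrightarrow> D2 (U T) (V T) \<le> K * D2 (U 0) (V 0) * exp (K * T)" "0 < K" using dep[OF w] by blast
      have le: "D2 (S t (z n)) (S t w) \<le> K * exp (K * t) * D2 (z n) w" for n
      proof -
        have "D2 (S t (z n)) (S t w) \<le> K * D2 (S 0 (z n)) (S 0 w) * exp (K * t)"
          using K(1)[rule_format, of "\<lambda>r. S r (z n)" "\<lambda>r. S r w" t] trD[OF z] trD[OF w] RD[OF z] RD[OF w] t by simp
        also have "D2 (S 0 (z n)) (S 0 w) = D2 (z n) w"
        proof -
          have h: "S 0 (z n) \<in> Hsp a b \<mu> 0" "S 0 w \<in> Hsp a b \<mu> 0" by (intro SH zH wH order_refl)+
          note s = is_sol_traj(2,3)[OF S[rule_format, OF zH[of n]]] is_sol_traj(2,3)[OF S[rule_format, OF wH]]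
          have "dd (S 0 (z n)) (S 0 w) = dd (z n) w" by (simp add: dd_def fun_eq_iff s)
          thus ?thesis using D2_sums[OF h] D2_sums[OF zH wH, of n] sums_unique2 by metis
        qed
        finally show ?thesis by (simp add: mult_ac)
      qed
      have "(\<lambda>n. K * exp (K * t) * D2 (z n) w) \<longlonglongrightarrow> K * exp (K * t) * 0"
        by (intro tendsto_intros D2_tendsto[OF zH wH lim])
      hence lim0: "(\<lambda>n. K * exp (K * t) * D2 (z n) w) \<longlonglongrightarrow> 0" by simp
      have "(\<lambda>n. D2 (S t (z n)) (S t w)) \<longlonglongrightarrow> 0"
      proof (rule Lim_null_comparison[OF _ lim0], intro always_eventually allI)
        show "norm (D2 (S t (z n)) (S t w)) \<le> K * exp (K * t) * D2 (z n) w" for n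
          using le[of n] D2_nonneg[OF SH[OF zH t] SH[OF wH t], of n] by simp
      qed
      from tendsto_real_sqrt[OF this] show "(\<lambda>n. Hdist a b \<mu> (S t (z n)) (S t w)) \<longlonglongrightarrow> 0" by (simp add: Hdist_D2)
    next
      fix z :: "nat \<Rightarrow> state" and t :: "nat \<Rightarrow> real"
      assume z: "\<And>n. z n \<in> D" and t: "\<And>n. 0 \<le> t n" "filterlim t at_top sequentially"
      obtain g y where g: "strict_mono g" "y \<in> Hsp a b \<mu> 1" "Hnorm2 a b \<mu> 1 y \<le> K1" "(\<lambda>j. Hdist a b \<mu> (S (t (g j)) (z (g j))) y) \<longlonglongrightarrow> 0"
        using K1[of "\<lambda>j r. S r (z j)" t, OF trD[OF z] RD[OF z] t] by blast
      have "y \<in> D" by (rule closed[OF _ Hsp_1_subset[OF g(2)] g(4)]) (intro inv t z)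
      thus "\<exists>g y. strict_mono (g :: nat \<Rightarrow> nat) \<and> y \<in> D \<inter> N \<and> (\<lambda>n. Hdist a b \<mu> (S (t (g n)) (z (g n))) y) \<longlonglongrightarrow> 0"
        using g by (intro exI[of _ g] exI[of _ y]) (auto simp: N_def)
    next
      fix x y assume "x \<in> Hsp a b \<mu> 0" "y \<in> Hsp a b \<mu> 0"
      thus "0 \<le> Hdist a b \<mu> x y" "Hdist a b \<mu> x y = Hdist a b \<mu> y x" by (rule Hdist_nonneg Hdist_sym; assumption)+
    next
      fix x y z assume "x \<in> Hsp a b \<mu> 0" "y \<in> Hsp a b \<mu> 0" "z \<in> Hsp a b \<mu> 0"
      thus "Hdist a b \<mu> x z \<le> Hdist a b \<mu> x y + Hdist a b \<mu> y z" by (rule Hdist_triangle)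
    next
      show "D \<subseteq> Hsp a b \<mu> 0" using DH by blast
    next
      fix t :: real and z assume "0 \<le> t" "z \<in> D"
      thus "S t z \<in> D" by (rule inv)
    next
      fix A assume A: "A \<subseteq> D \<inter> N"
        "\<And>x. (\<And>n. x n \<in> A) \<Longrightarrow> \<exists>g y. strict_mono (g :: nat \<Rightarrow> nat) \<and> y \<in> A \<and> (\<lambda>n. Hdist a b \<mu> (x (g n)) y) \<longlonglongrightarrow> 0"
        "\<And>t y. 0 \<le> t \<Longrightarrow> y \<in> A \<Longrightarrow> \<exists>w\<in>A. Hdist a b \<mu> (S t y) w = 0"
        "\<And>t w. 0 \<le> t \<Longrightarrow> w \<in> A \<Longrightarrow> \<exists>y\<in>A. Hdist a b \<mu> (S t y) w = 0"
        "\<And>e. 0 < e \<Longrightarrow> \<exists>T. \<forall>t\<ge>T. \<forall>z\<in>D. \<exists>y\<in>A. Hdist a b \<mu> (S t z) y < e"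
      have AD: "A \<subseteq> D" using A(1) by blast
      have comp: "Hcompact a b \<mu> A"
        unfolding Hcompact_def
      proof (intro conjI allI impI)
        show "A \<subseteq> Hsp a b \<mu> 0" using AD DH by blast
        fix x :: "nat \<Rightarrow> state" assume "\<forall>n. x n \<in> A"
        thus "\<exists>g y. strict_mono g \<and> y \<in> A \<and> (\<lambda>n. Hdist a b \<mu> (x (g n)) y) \<longlonglongrightarrow> 0" by (intro A(2)) simp
      qed
      \<comment> \<open>Since \<open>A\<close> lies in the ball \<open>N\<close> of the smoother
        space by construction, it also serves as the compact set \<open>K\<close>.\<close>
      moreover have "Hbounded a b \<mu> 1 A" unfolding Hbounded_def using A(1) by (auto simp: N_def)
      moreover have "global_attractor a b \<mu> S D A"
        unfolding global_attractor_def
      proof (intro conjI allI impI ballI AD comp)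
        fix B and e :: real assume B: "B \<subseteq> D \<and> Hbounded a b \<mu> 0 B" and e: "0 < e"
        obtain T where T: "\<forall>t\<ge>T. \<forall>z\<in>D. \<exists>y\<in>A. Hdist a b \<mu> (S t z) y < e" using A(5)[OF e] by blast
        \<comment> \<open>Attraction is uniform on the whole sublevel set, so one time works for
          every bounded subset.\<close>
        show "\<exists>T. \<forall>t\<ge>T. \<forall>z\<in>B. \<exists>y\<in>A. Hdist a b \<mu> (S t z) y < e"
          using T B by (intro exI[of _ T]) blast
      qed (rule A(3,4); assumption)+
      ultimately have "\<exists>A K. global_attractor a b \<mu> S D A \<and> Hcompact a b \<mu> K \<and> Hbounded a b \<mu> 1 K \<and> A \<subseteq> K"
        by blast
      thus ?thesis unfolding Let_def D_def cstar_def Fn_def .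
    qed
  qed
qed

end
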